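(* Let $\mathfrak g$ be of type $A_N$ or $B_N$ and let $(i_t,k_t)\in\mathcal X$, $1\le t\le T$, be a snake of length $T\in\mathbb Z_{\ge1}$. Then $$\chi_q\Big(L\Big(\prod_{t=1}^TY_{i_t,k_t}\Big)\Big)=\sum_{(p_1,\dots,p_T)\in\overline{\mathfrak P}_{(i_t,k_t)_{1\le t\le T}}}\ \prod_{t=1}^T\mathsf m(p_t).$$ The module $L(\prod_{t=1}^TY_{i_t,k_t})$ is thin, special and anti-special.
   Context: **Quantum affine algebras.** $\mathfrak g$ is of type $A_N$ or $B_N$ ($N\ge2$ in type $B$, node $N$ being the short root), $I=\{1,\dots,N\}$, simple roots $\alpha_i$, $C$ the Cartan matrix; $r_i=1$ for all $i$ in type A; in type B, $r_i=2$ for $i<N$ and $r_N=1$; $B_{ij}=r_iC_{ij}$. Fix $q\in\mathbb C^*$ not a root of unity; $[n]_q=\frac{q^n-q^{-n}}{q-q^{-1}}$. $U_q(\widehat{\mathfrak g})$ is the untwisted quantum affine algebra in Drinfeld's new realization, with generators $x^\pm_{i,n}$, $k_i^{\pm1}$, $h_{i,n}$ ($n\neq0$), central $c^{\pm1/2}$, normalized so that $k_ix^\pm_{j,n}k_i^{-1}=q^{\pm B_{ij}}x^\pm_{j,n}$, $[h_{i,n},x^\pm_{j,m}]=\pm\frac1n[nB_{ij}]_qc^{\mp|n|/2}x^\pm_{j,n+m}$, and with $\phi_i^\pm(u)=\sum_{n\ge0}\phi^\pm_{i,\pm n}u^{\pm n}=k_i^{\pm1}\exp(\pm(q-q^{-1})\sum_{m\ge1}h_{i,\pm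 m}u^{\pm m})$. Modules are finite-dimensional of type 1 ($c^{\pm1/2}$ acts as the identity, and the $k_i$ act diagonalizably by powers of $q$ given by integral weights). Monomials $m=\prod Y_{i,b}^{w_{i,b}-x_{i,b}}$ ($w_{i,b},x_{i,b}\ge0$) in formal variables $(Y_{i,b})_{i\in I,b\in\mathbb C^*}$ are identified with $l$-weights: $\gamma(m)_i^\pm(u)=q^{r_i(\deg Q_i-\deg R_i)}\frac{Q_i(uq^{-r_i})R_i(uq^{r_i})}{Q_i(uq^{r_i})R_i(uq^{-r_i})}$ (expanded in powers of $u^{\pm1}$), with $Q_i(u)=\prod_b(1-ub)^{w_{i,b}}$, $R_i(u)=\prod_b(1-ub)^{x_{i,b}}$. $V_m$ is the corresponding generalized simultaneous eigenspace of the $\phi^\pm_{i,\pm r}$ in $V$, and $\chi_q(V)=\sum_m\dim(V_m)m$. A monomial is dominant (anti-dominant) if all its exponents are $\ge0$ ($\le0$). For $m$ dominant, $L(m)$ is the unique finite-dimensional irreducible module with highest $l$-weight $\boldsymbol\gamma(m)$. A module is thin if all its $l$-weight spaces have dimension at most $1$; special (anti-special) if its $q$-character has exactly one dominant (anti-dominant) monomial. Fix $a\in\mathbb C^*$ once and for all and write $Y_{i,k}:=Y_{i,aq^k}$ for $(i,k)\in I\times\mathbb Z$. **Index set.** Type A: $\mathcal X=\{(i,k)\in I\times\mathbb Z:i-k\equiv1\bmod2\}$. Type B: $\mathcal X=\{(N,2k+1):k\in\mathbb Z\}\sqcup\{(i,k)\in I\times\mathbb Z:i<N,\ k\equiv0\bmod2\}$.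 Define an injective map $\iota:\mathcal X\to\mathbb Z^2$. Type A: $\iota(i,k)=(i,k)$. Type B: $\iota(i,k)=(2i,k)$ if $i<N$ and $2N+k-2i\equiv2\bmod4$; $\iota(i,k)=(4N-2-2i,k)$ if $i<N$ and $2N+k-2i\equiv0\bmod4$; $\iota(N,k)=(2N-1,k)$. **Snakes.** $(i',k')\in\mathcal X$ is in snake position with respect to $(i,k)\in\mathcal X$ iff — Type A: $k'-k\ge|i'-i|+2$. Type B: if $i=i'=N$: $k'-k\ge2$ and $k'-k\equiv2\bmod4$; if exactly one of $i,i'$ equals $N$: $k'-k\ge2|i'-i|+3$ and $k'-k\equiv2|i'-i|-1\bmod4$; if $i,i'<N$: $k'-k\ge2|i'-i|+4$ and $k'-k\equiv2|i'-i|\bmod4$. A finite sequence $(i_t,k_t)_{1\le t\le T}$ in $\mathcal X$ is a snake iff for all $2\le t\le T$, $(i_t,k_t)$ is in snake position with respect to $(i_{t-1},k_{t-1})$. **Paths.** A path is a finite sequence of points of $\mathbb R^2$; $(x,y)\in p$ means that $(x,y)$ is a point of $p$. For $(i,k)\in\mathcal X$ define a set of paths $\mathfrak P_{i,k}$. Type A: $\mathfrak P_{i,k}$ consists of all $((0,y_0),(1,y_1),\dots,(N+1,y_{N+1}))$ with $y_0=i+k$, $y_{N+1}=N+1-i+k$, $y_{r+1}-y_r\in\{1,-1\}$ for $0\le r\le N$. Type B: fix $\epsilon$ with $0<\epsilon<1/2$. For odd $\ell$, $\mathfrak P_{N,\ell}$ consists of all $((x_0,y_0),\dots,(x_N,y_N))$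 with $x_N=2N-1$, and for $r<N$: $x_r=2r$ if $\ell\equiv3\bmod4$, $x_r=4N-2-2r$ if $\ell\equiv1\bmod4$; $y_0=\ell+2N-1$, $y_{r+1}-y_r\in\{2,-2\}$ for $0\le r\le N-2$, $y_N-y_{N-1}\in\{1+\epsilon,-1-\epsilon\}$. For $i<N$, $\mathfrak P_{i,k}$ consists of all $(a_0,\dots,a_N,\bar a_N,\dots,\bar a_0)$ with $(a_0,\dots,a_N)\in\mathfrak P_{N,k-(2N-2i-1)}$, $(\bar a_0,\dots,\bar a_N)\in\mathfrak P_{N,k+(2N-2i-1)}$ and $a_N-\bar a_N=(0,y)$ with $y>0$. **Corners.** Each path $p$ has sets $C_{p,+}$ (upper corners) and $C_{p,-}$ (lower corners), subsets of $\mathcal X$. Type A: $C_{p,\pm}=\{(r,y_r)\in p:r\in I,\ y_{r-1}=y_{r+1}=y_r\pm1\}$. Type B, for $p=((j_r,\ell_r))_r$: $C_{p,+}=\iota^{-1}\{(j_r,\ell_r)\in p:j_r\notin\{0,2N-1,4N-2\},\ \ell_{r-1}>\ell_r,\ \ell_{r+1}>\ell_r\}\sqcup\{(N,\ell)\in\mathcal X:(2N-1,\ell-\epsilon)\in p,\ (2N-1,\ell+\epsilon)\notin p\}$ and $C_{p,-}=\iota^{-1}\{(j_r,\ell_r)\in p:j_r\notin\{0,2N-1,4N-2\},\ \ell_{r-1}<\ell_r,\ \ell_{r+1}<\ell_r\}\sqcup\{(N,\ell)\in\mathcal X:(2N-1,\ell+\epsilon)\in p,\ (2N-1,\ell-\epsilon)\notin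 p\}$. Set $\mathsf m(p)=\prod_{(j,\ell)\in C_{p,+}}Y_{j,\ell}\prod_{(j,\ell)\in C_{p,-}}Y_{j,\ell}^{-1}$. **Non-overlapping tuples.** $p$ is strictly above $p'$ iff $(x,y)\in p$ and $(x,z)\in p'$ imply $y<z$. A tuple $(p_1,\dots,p_T)$ is non-overlapping iff $p_s$ is strictly above $p_t$ for all $s<t$. $\overline{\mathfrak P}_{(i_t,k_t)_{1\le t\le T}}$ is the set of non-overlapping tuples $(p_1,\dots,p_T)$ with $p_t\in\mathfrak P_{i_t,k_t}$ for all $t$. *)

theory Defs
  imports
    Complex_Main
    "HOL-Algebra.QuotRing"
    "HOL-Library.Poly_Mapping"
    "HOL-Combinatorics.Permutations"
    "HOL-Computational_Algebra.Polynomial_FPS"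
begin

section \<open>Cartan data\<close>

datatype cartan_type = TypeA | TypeB

fun valid_rank :: "cartan_type \<Rightarrow> nat \<Rightarrow> bool" where
  "valid_rank TypeA N \<longleftrightarrow> 1 \<le> N"
| "valid_rank TypeB N \<longleftrightarrow> 2 \<le> N"

definition nodes :: "nat \<Rightarrow> nat set" where
  "nodes N = {1..N}"

text \<open>In type B the node \<open>N\<close> is the short root, so \<open>C N (N - 1) = -2\<close> and \<open>C (N - 1) N = -1\<close>.\<close>

definition cartan :: "cartan_type \<Rightarrow> nat \<Rightarrow> nat \<Rightarrow> nat \<Rightarrow> int" where
  "cartan ty N i j =
     (if i = j then 2
      else if i = Suc j \<or> j = Suc i then (if ty = TypeB \<and> i = N then -2 else -1)
      else 0)"

definition rlen :: "cartan_type \<Rightarrow> nat \<Rightarrow> nat \<Rightarrow> int" where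
  "rlen ty N i = (if ty = TypeB \<and> i < N then 2 else 1)"

definition symcartan :: "cartan_type \<Rightarrow> nat \<Rightarrow> nat \<Rightarrow> nat \<Rightarrow> int" where
  "symcartan ty N i j = rlen ty N i * cartan ty N i j"

definition qint :: "complex \<Rightarrow> int \<Rightarrow> complex" where
  "qint q n = (q powi n - q powi (- n)) / (q - inverse q)"

definition qfact :: "complex \<Rightarrow> nat \<Rightarrow> complex" where
  "qfact q n = (\<Prod>l=1..n. qint q (int l))"

definition qbinom :: "complex \<Rightarrow> nat \<Rightarrow> nat \<Rightarrow> complex" where
  "qbinom q n k = qfact q n / (qfact q k * qfact q (n - k))"

section \<open>The quantum affine algebra in Drinfeld's new realization\<close>

datatype pm = Plus | Minus

fun sg :: "pm \<Rightarrow> int" where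
  "sg Plus = 1"
| "sg Minus = -1"

text \<open>\<open>GenK Plus i\<close> and \<open>GenK Minus i\<close> are \<open>k\<^sub>i\<close> and its inverse; \<open>GenC Plus\<close> and \<open>GenC Minus\<close>
  are the square root of \<open>c\<close> and its inverse.\<close>

datatype generator =
    GenX pm nat int
  | GenK pm nat
  | GenH nat int
  | GenC pm

definition generators :: "nat \<Rightarrow> generator set" where
  "generators N =
     {GenX e i n | e i n. i \<in> nodes N} \<union> {GenK e i | e i. i \<in> nodes N}
     \<union> {GenH i n | i n. i \<in> nodes N \<and> n \<noteq> 0} \<union> {GenC e | e. True}"

datatype word = Word (letters: "generator list")

instantiation word :: monoid_add
begin

definition zero_word :: word where
  "0 = Word []"

definition plus_word :: "word \<Rightarrow> word \<Rightarrow> word" where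
  "v + w = Word (letters v @ letters w)"

instance
  by standard (auto simp: zero_word_def plus_word_def)

end

text \<open>Noncommutative polynomials: with concatenation as the addition of words, the convolution
  product of \<^typ>\<open>word \<Rightarrow>\<^sub>0 complex\<close> is the product of the free algebra.\<close>

type_synonym ncpoly = "word \<Rightarrow>\<^sub>0 complex"

definition const :: "complex \<Rightarrow> ncpoly" where
  "const z = Poly_Mapping.single 0 z"

definition gen :: "generator \<Rightarrow> ncpoly" where
  "gen g = Poly_Mapping.single (Word [g]) 1"

definition free_algebra :: "nat \<Rightarrow> ncpoly ring" where
  "free_algebra N =
     \<lparr> carrier = {f. \<forall>w \<in> Poly_Mapping.keys f. set (letters w) \<subseteq> generators N},
       monoid.mult = (*), one = 1, zero = 0, add = (+) \<rparr>"

abbreviation genX :: "pm \<Rightarrow> nat \<Rightarrow> int \<Rightarrow> ncpoly" where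
  "genX e i n \<equiv> gen (GenX e i n)"

abbreviation genK :: "pm \<Rightarrow> nat \<Rightarrow> ncpoly" where
  "genK e i \<equiv> gen (GenK e i)"

abbreviation genH :: "nat \<Rightarrow> int \<Rightarrow> ncpoly" where
  "genH i n \<equiv> gen (GenH i n)"

text \<open>\<open>chalf n\<close> is \<open>c\<close> to the power \<open>n / 2\<close>.\<close>

definition chalf :: "int \<Rightarrow> ncpoly" where
  "chalf n = (if 0 \<le> n then gen (GenC Plus) ^ nat n else gen (GenC Minus) ^ nat (- n))"

text \<open>\<open>phi q e i n\<close> is the coefficient of the \<open>n\<close>-th power of \<open>u\<close> (for \<open>e = Plus\<close>) or of the inverse
  of \<open>u\<close> (for \<open>e = Minus\<close>) in \<open>k\<^sub>i\<close> or its inverse times the exponential series. The series in the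
  exponent has no constant term, so its \<open>j\<close>-th power contributes only for \<open>j \<le> n\<close>.\<close>

definition phi :: "complex \<Rightarrow> pm \<Rightarrow> nat \<Rightarrow> nat \<Rightarrow> ncpoly" where
  "phi q e i n =
     genK e i * (\<Sum>j\<le>n. const ((of_int (sg e) * (q - inverse q)) ^ j / fact j) *
       fps_nth (Abs_fps (\<lambda>m. if m = 0 then 0 else genH i (sg e * int m)) ^ j) n)"

definition phi_int :: "complex \<Rightarrow> pm \<Rightarrow> nat \<Rightarrow> int \<Rightarrow> ncpoly" where
  "phi_int q e i n = (if 0 \<le> sg e * n then phi q e i (nat (sg e * n)) else 0)"

definition qserre :: "complex \<Rightarrow> pm \<Rightarrow> nat \<Rightarrow> nat \<Rightarrow> (nat \<Rightarrow> int) \<Rightarrow> int \<Rightarrow> nat \<Rightarrow> ncpoly" where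
  "qserre q' e i j n m s =
     (\<Sum>\<pi> | \<pi> permutes {..<s}. \<Sum>k\<le>s. const ((-1) ^ k * qbinom q' s k) *
        (\<Prod>l\<leftarrow>[0..<k]. genX e i (n (\<pi> l))) * genX e j m * (\<Prod>l\<leftarrow>[k..<s]. genX e i (n (\<pi> l))))"

text \<open>Each element is a relator, i.e. the difference of the two sides of a defining relation.\<close>

inductive_set relators :: "cartan_type \<Rightarrow> nat \<Rightarrow> complex \<Rightarrow> ncpoly set"
  for ty :: cartan_type and N :: nat and q :: complex
where
  c_inverse: "gen (GenC Plus) * gen (GenC Minus) - 1 \<in> relators ty N q"
| c_inverse': "gen (GenC Minus) * gen (GenC Plus) - 1 \<in> relators ty N q"
| c_central: "g \<in> generators N \<Longrightarrow> gen (GenC e) * gen g - gen g * gen (GenC e) \<in> relators ty N q"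
| k_inverse: "i \<in> nodes N \<Longrightarrow> genK Plus i * genK Minus i - 1 \<in> relators ty N q"
| k_inverse': "i \<in> nodes N \<Longrightarrow> genK Minus i * genK Plus i - 1 \<in> relators ty N q"
| k_k: "\<lbrakk>i \<in> nodes N; j \<in> nodes N\<rbrakk> \<Longrightarrow>
    genK Plus i * genK Plus j - genK Plus j * genK Plus i \<in> relators ty N q"
| k_h: "\<lbrakk>i \<in> nodes N; j \<in> nodes N; n \<noteq> 0\<rbrakk> \<Longrightarrow>
    genK Plus i * genH j n - genH j n * genK Plus i \<in> relators ty N q"
| k_x: "\<lbrakk>i \<in> nodes N; j \<in> nodes N\<rbrakk> \<Longrightarrow>
    genK Plus i * genX e j n * genK Minus i
      - const (q powi (sg e * symcartan ty N i j)) * genX e j n \<in> relators ty N q"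
| h_x: "\<lbrakk>i \<in> nodes N; j \<in> nodes N; n \<noteq> 0\<rbrakk> \<Longrightarrow>
    genH i n * genX e j m - genX e j m * genH i n
      - const (of_int (sg e) * (1 / of_int n) * qint q (n * symcartan ty N i j))
          * chalf (- sg e * \<bar>n\<bar>) * genX e j (n + m) \<in> relators ty N q"
| x_x: "\<lbrakk>i \<in> nodes N; j \<in> nodes N\<rbrakk> \<Longrightarrow>
    genX e i (n + 1) * genX e j m
      - const (q powi (sg e * symcartan ty N i j)) * genX e j m * genX e i (n + 1)
      - (const (q powi (sg e * symcartan ty N i j)) * genX e i n * genX e j (m + 1)
          - genX e j (m + 1) * genX e i n) \<in> relators ty N q"
| h_h: "\<lbrakk>i \<in> nodes N; j \<in> nodes N; n \<noteq> 0; m \<noteq> 0\<rbrakk> \<Longrightarrow>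
    genH i n * genH j m - genH j m * genH i n
      - (if n = - m
         then const ((1 / of_int n) * qint q (n * symcartan ty N i j) / (q - inverse q))
                * (chalf (2 * n) - chalf (- 2 * n))
         else 0) \<in> relators ty N q"
| xp_xm: "\<lbrakk>i \<in> nodes N; j \<in> nodes N\<rbrakk> \<Longrightarrow>
    genX Plus i n * genX Minus j m - genX Minus j m * genX Plus i n
      - (if i = j
         then const (1 / (q powi rlen ty N i - q powi (- rlen ty N i)))
                * (chalf (n - m) * phi_int q Plus i (n + m)
                    - chalf (m - n) * phi_int q Minus i (n + m))
         else 0) \<in> relators ty N q"
| serre: "\<lbrakk>i \<in> nodes N; j \<in> nodes N; i \<noteq> j\<rbrakk> \<Longrightarrow>
    qserre (q powi rlen ty N i) e i j n m (nat (1 - cartan ty N i j)) \<in> relators ty N q"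

definition uq_ideal :: "cartan_type \<Rightarrow> nat \<Rightarrow> complex \<Rightarrow> ncpoly set" where
  "uq_ideal ty N q = Idl\<^bsub>free_algebra N\<^esub> (relators ty N q)"

definition uq :: "cartan_type \<Rightarrow> nat \<Rightarrow> complex \<Rightarrow> ncpoly set ring" where
  "uq ty N q = free_algebra N Quot uq_ideal ty N q"

definition uq_class :: "cartan_type \<Rightarrow> nat \<Rightarrow> complex \<Rightarrow> ncpoly \<Rightarrow> ncpoly set" where
  "uq_class ty N q f = uq_ideal ty N q +>\<^bsub>free_algebra N\<^esub> f"

section \<open>Modules\<close>

text \<open>HOL-Algebra has modules over commutative rings only. The module is the whole type \<open>'v\<close>.\<close>

definition left_module :: "('r, 'b) ring_scheme \<Rightarrow> ('r \<Rightarrow> 'v::ab_group_add \<Rightarrow> 'v) \<Rightarrow> bool" where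
  "left_module R act \<longleftrightarrow>
     (\<forall>a \<in> carrier R. \<forall>v w. act a (v + w) = act a v + act a w) \<and>
     (\<forall>a \<in> carrier R. \<forall>b \<in> carrier R. \<forall>v. act (a \<oplus>\<^bsub>R\<^esub> b) v = act a v + act b v) \<and>
     (\<forall>a \<in> carrier R. \<forall>b \<in> carrier R. \<forall>v. act (a \<otimes>\<^bsub>R\<^esub> b) v = act a (act b v)) \<and>
     (\<forall>v. act \<one>\<^bsub>R\<^esub> v = v)"

definition submodule_of :: "('r, 'b) ring_scheme \<Rightarrow> ('r \<Rightarrow> 'v::ab_group_add \<Rightarrow> 'v) \<Rightarrow> 'v set \<Rightarrow> bool"
where
  "submodule_of R act W \<longleftrightarrow>
     0 \<in> W \<and> (\<forall>v \<in> W. \<forall>w \<in> W. v + w \<in> W) \<and> (\<forall>a \<in> carrier R. \<forall>v \<in> W. act a v \<in> W)"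

definition irreducible_module :: "('r, 'b) ring_scheme \<Rightarrow> ('r \<Rightarrow> 'v::ab_group_add \<Rightarrow> 'v) \<Rightarrow> bool" where
  "irreducible_module R act \<longleftrightarrow>
     (UNIV :: 'v set) \<noteq> {0} \<and> (\<forall>W. submodule_of R act W \<longrightarrow> W = {0} \<or> W = UNIV)"

type_synonym 'v uq_action = "ncpoly set \<Rightarrow> 'v \<Rightarrow> 'v"

text \<open>The underlying complex vector space structure of a module.\<close>

definition scal ::
  "cartan_type \<Rightarrow> nat \<Rightarrow> complex \<Rightarrow> 'v uq_action \<Rightarrow> complex \<Rightarrow> 'v \<Rightarrow> 'v" where
  "scal ty N q act z = act (uq_class ty N q (const z))"

definition weight_space ::
  "cartan_type \<Rightarrow> nat \<Rightarrow> complex \<Rightarrow> 'v uq_action \<Rightarrow> (nat \<Rightarrow> int) \<Rightarrow> 'v::ab_group_add set" where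
  "weight_space ty N q act wt =
     {v. \<forall>i \<in> nodes N. act (uq_class ty N q (genK Plus i)) v
            = scal ty N q act (q powi (rlen ty N i * wt i)) v}"

text \<open>The integral weight with fundamental coordinates \<open>wt i\<close> pairs with the simple root \<open>i\<close> to
  \<open>rlen ty N i * wt i\<close>.\<close>

definition type1 :: "cartan_type \<Rightarrow> nat \<Rightarrow> complex \<Rightarrow> 'v::ab_group_add uq_action \<Rightarrow> bool" where
  "type1 ty N q act \<longleftrightarrow>
     (\<forall>e v. act (uq_class ty N q (gen (GenC e))) v = v) \<and>
     module.span (scal ty N q act) (\<Union>wt. weight_space ty N q act wt) = UNIV"

definition uq_module :: "cartan_type \<Rightarrow> nat \<Rightarrow> complex \<Rightarrow> 'v::ab_group_add uq_action \<Rightarrow> bool" where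
  "uq_module ty N q act \<longleftrightarrow>
     left_module (uq ty N q) act \<and>
     (\<exists>S. finite S \<and> module.span (scal ty N q act) S = UNIV) \<and>
     type1 ty N q act"

section \<open>\<open>l\<close>-weights and \<open>q\<close>-characters\<close>

text \<open>\<open>\<gamma> e i r\<close> is the coefficient of \<open>\<gamma>\<^sub>i\<close> (sign \<open>e\<close>) at the \<open>r\<close>-th power of \<open>u\<close> or of its inverse.\<close>

type_synonym lweight = "pm \<Rightarrow> nat \<Rightarrow> nat \<Rightarrow> complex"

definition lweight_space ::
  "cartan_type \<Rightarrow> nat \<Rightarrow> complex \<Rightarrow> 'v uq_action \<Rightarrow> lweight \<Rightarrow> 'v::ab_group_add set" where
  "lweight_space ty N q act \<gamma> =
     {v. \<exists>p. \<forall>e. \<forall>i \<in> nodes N. \<forall>r.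
        ((\<lambda>w. act (uq_class ty N q (phi q e i r)) w - scal ty N q act (\<gamma> e i r) w) ^^ p) v = 0}"

text \<open>The group of monomials in the \<open>Y\<^sub>i\<^sub>,\<^sub>b\<close>, written additively (an element is its function of
  exponents), and its integral group ring.\<close>

type_synonym monomial = "nat \<times> complex \<Rightarrow>\<^sub>0 int"
type_synonym yring = "monomial \<Rightarrow>\<^sub>0 int"

definition monomials :: "nat \<Rightarrow> monomial set" where
  "monomials N = {m. Poly_Mapping.keys m \<subseteq> nodes N \<times> (UNIV - {0})}"

definition ymono :: "monomial \<Rightarrow> yring" where
  "ymono m = Poly_Mapping.single m 1"

definition Qpoly :: "monomial \<Rightarrow> nat \<Rightarrow> complex poly" where
  "Qpoly m i = (\<Prod>b | Poly_Mapping.lookup m (i, b) > 0. [:1, - b:] ^ nat (Poly_Mapping.lookup m (i, b)))"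

definition Rpoly :: "monomial \<Rightarrow> nat \<Rightarrow> complex poly" where
  "Rpoly m i = (\<Prod>b | Poly_Mapping.lookup m (i, b) < 0. [:1, - b:] ^ nat (- Poly_Mapping.lookup m (i, b)))"

definition gamma_num :: "cartan_type \<Rightarrow> nat \<Rightarrow> complex \<Rightarrow> monomial \<Rightarrow> nat \<Rightarrow> complex poly" where
  "gamma_num ty N q m i =
     pcompose (Qpoly m i) [:0, q powi (- rlen ty N i):] * pcompose (Rpoly m i) [:0, q powi rlen ty N i:]"

definition gamma_den :: "cartan_type \<Rightarrow> nat \<Rightarrow> complex \<Rightarrow> monomial \<Rightarrow> nat \<Rightarrow> complex poly" where
  "gamma_den ty N q m i =
     pcompose (Qpoly m i) [:0, q powi rlen ty N i:] * pcompose (Rpoly m i) [:0, q powi (- rlen ty N i):]"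

text \<open>Numerator and denominator have the same degree, so the expansion in the inverse of \<open>u\<close> is the
  quotient of the reflected polynomials.\<close>

definition gamma :: "cartan_type \<Rightarrow> nat \<Rightarrow> complex \<Rightarrow> monomial \<Rightarrow> lweight" where
  "gamma ty N q m e i r =
     q powi (rlen ty N i * (int (degree (Qpoly m i)) - int (degree (Rpoly m i)))) *
     (case e of
        Plus \<Rightarrow> fps_nth (fps_of_poly (gamma_num ty N q m i) / fps_of_poly (gamma_den ty N q m i)) r
      | Minus \<Rightarrow> fps_nth (fps_of_poly (reflect_poly (gamma_num ty N q m i))
                         / fps_of_poly (reflect_poly (gamma_den ty N q m i))) r)"

abbreviation mspace ::
  "cartan_type \<Rightarrow> nat \<Rightarrow> complex \<Rightarrow> 'v uq_action \<Rightarrow> monomial \<Rightarrow> 'v::ab_group_add set" where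
  "mspace ty N q act m \<equiv> lweight_space ty N q act (gamma ty N q m)"

definition qchar :: "cartan_type \<Rightarrow> nat \<Rightarrow> complex \<Rightarrow> 'v::ab_group_add uq_action \<Rightarrow> yring" where
  "qchar ty N q act =
     (\<Sum>m | m \<in> monomials N \<and> mspace ty N q act m \<noteq> {0}.
        of_nat (vector_space.dim (scal ty N q act) (mspace ty N q act m)) * ymono m)"

definition dominant :: "monomial \<Rightarrow> bool" where
  "dominant m \<longleftrightarrow> (\<forall>z. Poly_Mapping.lookup m z \<ge> 0)"

definition antidominant :: "monomial \<Rightarrow> bool" where
  "antidominant m \<longleftrightarrow> (\<forall>z. Poly_Mapping.lookup m z \<le> 0)"

definition thin :: "cartan_type \<Rightarrow> nat \<Rightarrow> complex \<Rightarrow> 'v::ab_group_add uq_action \<Rightarrow> bool" where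
  "thin ty N q act \<longleftrightarrow>
     (\<forall>\<gamma>. vector_space.dim (scal ty N q act) (lweight_space ty N q act \<gamma>) \<le> 1)"

definition special :: "cartan_type \<Rightarrow> nat \<Rightarrow> complex \<Rightarrow> 'v::ab_group_add uq_action \<Rightarrow> bool" where
  "special ty N q act \<longleftrightarrow> (\<exists>!m. m \<in> Poly_Mapping.keys (qchar ty N q act) \<and> dominant m)"

definition antispecial :: "cartan_type \<Rightarrow> nat \<Rightarrow> complex \<Rightarrow> 'v::ab_group_add uq_action \<Rightarrow> bool" where
  "antispecial ty N q act \<longleftrightarrow> (\<exists>!m. m \<in> Poly_Mapping.keys (qchar ty N q act) \<and> antidominant m)"

definition highest_lweight ::
  "cartan_type \<Rightarrow> nat \<Rightarrow> complex \<Rightarrow> 'v::ab_group_add uq_action \<Rightarrow> lweight \<Rightarrow> bool" where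
  "highest_lweight ty N q act \<gamma> \<longleftrightarrow>
     (\<exists>v. v \<noteq> 0 \<and> (\<lambda>a. act a v) ` carrier (uq ty N q) = UNIV \<and>
        (\<forall>i \<in> nodes N. \<forall>n. act (uq_class ty N q (genX Plus i n)) v = 0) \<and>
        (\<forall>e. \<forall>i \<in> nodes N. \<forall>r.
           act (uq_class ty N q (phi q e i r)) v = scal ty N q act (\<gamma> e i r) v))"

text \<open>The action \<open>act\<close> is a model of \<open>L(m)\<close>, which is determined by \<open>m\<close> up to isomorphism.\<close>

definition is_L :: "cartan_type \<Rightarrow> nat \<Rightarrow> complex \<Rightarrow> monomial \<Rightarrow> 'v::ab_group_add uq_action \<Rightarrow> bool" where
  "is_L ty N q m act \<longleftrightarrow>
     uq_module ty N q act \<and> irreducible_module (uq ty N q) act \<and>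
     highest_lweight ty N q act (gamma ty N q m)"

section \<open>Snakes, paths and corners\<close>

definition Yvar :: "complex \<Rightarrow> complex \<Rightarrow> nat \<times> int \<Rightarrow> monomial" where
  "Yvar q a = (\<lambda>(i, k). Poly_Mapping.single (i, a * q powi k) 1)"

fun index_set :: "cartan_type \<Rightarrow> nat \<Rightarrow> (nat \<times> int) set" where
  "index_set TypeA N = {(i, k). i \<in> nodes N \<and> (int i - k) mod 2 = 1}"
| "index_set TypeB N = {(i, k). i = N \<and> odd k} \<union> {(i, k). i \<in> nodes N \<and> i < N \<and> even k}"

definition iotaB :: "nat \<Rightarrow> nat \<times> int \<Rightarrow> int \<times> int" where
  "iotaB N = (\<lambda>(i, k).
     if i = N then (2 * int N - 1, k)
     else if (2 * int N + k - 2 * int i) mod 4 = 2 then (2 * int i, k)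
     else (4 * int N - 2 - 2 * int i, k))"

text \<open>\<open>snake_position ty N z' z\<close>: \<open>z'\<close> is in snake position with respect to \<open>z\<close>.\<close>

fun snake_position :: "cartan_type \<Rightarrow> nat \<Rightarrow> nat \<times> int \<Rightarrow> nat \<times> int \<Rightarrow> bool" where
  "snake_position TypeA N (i', k') (i, k) \<longleftrightarrow> k' - k \<ge> \<bar>int i' - int i\<bar> + 2"
| "snake_position TypeB N (i', k') (i, k) \<longleftrightarrow>
     (if i = N \<and> i' = N then k' - k \<ge> 2 \<and> (k' - k) mod 4 = 2
      else if i = N \<or> i' = N then
        k' - k \<ge> 2 * \<bar>int i' - int i\<bar> + 3 \<and> (k' - k) mod 4 = (2 * \<bar>int i' - int i\<bar> - 1) mod 4
      else
        k' - k \<ge> 2 * \<bar>int i' - int i\<bar> + 4 \<and> (k' - k) mod 4 = (2 * \<bar>int i' - int i\<bar>) mod 4)"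

definition snake :: "cartan_type \<Rightarrow> nat \<Rightarrow> (nat \<times> int) list \<Rightarrow> bool" where
  "snake ty N s \<longleftrightarrow> set s \<subseteq> index_set ty N \<and>
     (\<forall>t. Suc t < length s \<longrightarrow> snake_position ty N (s ! Suc t) (s ! t))"

type_synonym path = "(real \<times> real) list"

definition pathsA :: "nat \<Rightarrow> nat \<times> int \<Rightarrow> path set" where
  "pathsA N = (\<lambda>(i, k). {p. length p = N + 2 \<and>
     (\<forall>r \<le> N + 1. fst (p ! r) = real r) \<and>
     snd (p ! 0) = real i + of_int k \<and>
     snd (p ! (N + 1)) = real N + 1 - real i + of_int k \<and>
     (\<forall>r \<le> N. snd (p ! Suc r) - snd (p ! r) \<in> {1, -1})})"

definition half_pathsB :: "nat \<Rightarrow> real \<Rightarrow> int \<Rightarrow> path set" where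
  "half_pathsB N \<epsilon> l = {p. length p = N + 1 \<and>
     fst (p ! N) = 2 * real N - 1 \<and>
     (\<forall>r < N. fst (p ! r) = (if l mod 4 = 3 then 2 * real r else 4 * real N - 2 - 2 * real r)) \<and>
     snd (p ! 0) = of_int l + 2 * real N - 1 \<and>
     (\<forall>r. r + 2 \<le> N \<longrightarrow> snd (p ! Suc r) - snd (p ! r) \<in> {2, -2}) \<and>
     snd (p ! N) - snd (p ! (N - 1)) \<in> {1 + \<epsilon>, - 1 - \<epsilon>}}"

definition pathsB :: "nat \<Rightarrow> real \<Rightarrow> nat \<times> int \<Rightarrow> path set" where
  "pathsB N \<epsilon> = (\<lambda>(i, k).
     if i = N then half_pathsB N \<epsilon> k
     else {a @ rev b | a b.
        a \<in> half_pathsB N \<epsilon> (k - (2 * int N - 2 * int i - 1)) \<and>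
        b \<in> half_pathsB N \<epsilon> (k + (2 * int N - 2 * int i - 1)) \<and>
        fst (a ! N) = fst (b ! N) \<and> snd (a ! N) - snd (b ! N) > 0})"

fun paths :: "cartan_type \<Rightarrow> nat \<Rightarrow> real \<Rightarrow> nat \<times> int \<Rightarrow> path set" where
  "paths TypeA N \<epsilon> z = pathsA N z"
| "paths TypeB N \<epsilon> z = pathsB N \<epsilon> z"

text \<open>For \<open>e = Plus\<close> these are the upper corners (local minima of the second coordinate, which is
  drawn downwards), for \<open>e = Minus\<close> the lower corners.\<close>

definition cornersA :: "nat \<Rightarrow> pm \<Rightarrow> path \<Rightarrow> (nat \<times> int) set" where
  "cornersA N e p = {(r, k) \<in> index_set TypeA N.
     p ! r = (real r, of_int k) \<and>
     snd (p ! (r - 1)) = of_int (k + sg e) \<and> snd (p ! (r + 1)) = of_int (k + sg e)}"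

definition turnsB :: "nat \<Rightarrow> pm \<Rightarrow> path \<Rightarrow> (real \<times> real) set" where
  "turnsB N e p = {p ! r | r. 0 < r \<and> Suc r < length p \<and>
     fst (p ! r) \<notin> {0, 2 * real N - 1, 4 * real N - 2} \<and>
     of_int (sg e) * snd (p ! (r - 1)) > of_int (sg e) * snd (p ! r) \<and>
     of_int (sg e) * snd (p ! Suc r) > of_int (sg e) * snd (p ! r)}"

definition cornersB :: "nat \<Rightarrow> real \<Rightarrow> pm \<Rightarrow> path \<Rightarrow> (nat \<times> int) set" where
  "cornersB N \<epsilon> e p =
     {z \<in> index_set TypeB N. map_prod of_int of_int (iotaB N z) \<in> turnsB N e p} \<union>
     {(i, l) \<in> index_set TypeB N. i = N \<and>
        (2 * real N - 1, of_int l - of_int (sg e) * \<epsilon>) \<in> set p \<and>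
        (2 * real N - 1, of_int l + of_int (sg e) * \<epsilon>) \<notin> set p}"

fun corners :: "cartan_type \<Rightarrow> nat \<Rightarrow> real \<Rightarrow> pm \<Rightarrow> path \<Rightarrow> (nat \<times> int) set" where
  "corners TypeA N \<epsilon> e p = cornersA N e p"
| "corners TypeB N \<epsilon> e p = cornersB N \<epsilon> e p"

definition path_monomial ::
  "cartan_type \<Rightarrow> nat \<Rightarrow> real \<Rightarrow> complex \<Rightarrow> complex \<Rightarrow> path \<Rightarrow> monomial" where
  "path_monomial ty N \<epsilon> q a p =
     (\<Sum>z \<in> corners ty N \<epsilon> Plus p. Yvar q a z) - (\<Sum>z \<in> corners ty N \<epsilon> Minus p. Yvar q a z)"

definition strictly_above :: "path \<Rightarrow> path \<Rightarrow> bool" where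
  "strictly_above p p' \<longleftrightarrow> (\<forall>x y z. (x, y) \<in> set p \<longrightarrow> (x, z) \<in> set p' \<longrightarrow> y < z)"

definition nonoverlapping_paths ::
  "cartan_type \<Rightarrow> nat \<Rightarrow> real \<Rightarrow> (nat \<times> int) list \<Rightarrow> path list set" where
  "nonoverlapping_paths ty N \<epsilon> s = {ps. length ps = length s \<and>
     (\<forall>t < length s. ps ! t \<in> paths ty N \<epsilon> (s ! t)) \<and>
     (\<forall>t < length s. \<forall>r < t. strictly_above (ps ! r) (ps ! t))}"

end

(*
  The states of the sum are encoded as systems of integer height functions ("strands"), one for each
  path in type A and for each half path in type B. Replacing an upper corner of a state by a lower one
  multiplies its monomial by the inverse of a simple root monomial. The l-weight of a state has only
  simple poles, and these are exactly the positions where a corner can be moved down or up; moves at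
  different positions commute.

  By induction on the number of moves from the top state one constructs a nonzero vector of L(m) for
  every state, on which the Cartan currents act by the l-weight of the state and the raising and lowering
  currents act by sums of exponentials, one for each possible move; Lagrange interpolation separates the
  terms. That two ways of reaching a state give proportional vectors follows from irreducibility: a vector
  of lower weight killed by all raising operators vanishes. Hence these vectors span a submodule, which is
  all of L(m). Different states have different l-weights, which gives thinness and the q-character, and
  only the top (bottom) state admits no move up (down), so that L(m) is special (anti-special).
*)
theory Submission
  imports Defs
begin

section \<open>Separating the terms of an exponential sum\<close>

text \<open>The module is given abstractly, as an irreducible one with a prescribed highest
  l-weight, so both bounds for its character are obtained inside it: the constructed vectors are
  nonzero with distinct l-weights, and their span is stable under the algebra. The obstacle is that
  a lowering operator could send a vector to zero, or produce something unforeseen. Lowering and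
  raising at the same label compose to a residue of the l-weight. At a pole it is nonzero and keeps
  the vector alive; elsewhere it is zero and the lowered vector vanishes. Everything therefore
  depends on an exact match between poles and moves, which an arbitrary family of paths need not
  have: a corner could be blocked without its pole being cancelled. In type A all paths have the
  same parity and a blocking path always cancels the pole. In type B half paths of both parities
  share the middle column, and the match holds because consecutive half paths of a snake alternate
  in parity; this is what the congruences modulo 4 in the snake condition provide. The algebraic
  half of the argument knows only states, labels, moves and residues and is the same for both
  types.\<close>

definition lagrange :: "complex set \<Rightarrow> complex \<Rightarrow> complex poly" where
  "lagrange Z c = (\<Prod>z\<in>Z - {c}. smult (1 / (c - z)) [:- z, 1:])"

lemma poly_lagrange:
  assumes "finite Z" "c \<in> Z" "z \<in> Z"
  shows "poly (lagrange Z c) z = (if z = c then 1 else 0)"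
proof (cases "z = c")
  case True
  have "(\<Prod>x\<in>Z - {c}. poly (smult (1 / (c - x)) [:- x, 1:]) c) = 1"
    by (rule prod.neutral) (auto simp: divide_simps)
  with True show ?thesis by (simp add: lagrange_def poly_prod)
next
  case False
  with assms have "z \<in> Z - {c}" by auto
  with assms False show ?thesis
    by (auto simp add: lagrange_def poly_prod intro!: prod_zero bexI[of _ z])
qed

locale complex_space = vector_space scale for scale :: "complex \<Rightarrow> 'v::ab_group_add \<Rightarrow> 'v"
begin

abbreviation lin :: "('v \<Rightarrow> 'v) \<Rightarrow> bool" where
  "lin f \<equiv> module_hom scale scale f"

lemma lin_iff: "lin f \<longleftrightarrow> (\<forall>v w. f (v + w) = f v + f w) \<and> (\<forall>z v. f (scale z v) = scale z (f v))"
  using module_axioms by (auto simp: module_hom_def module_hom_axioms_def)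

lemma lin_lincomb:
  assumes "\<And>k. k \<in> A \<Longrightarrow> lin (f k)"
  shows "lin (\<lambda>v. \<Sum>k\<in>A. scale (a k) (f k v))"
  using assms
  by (auto simp: lin_iff scale_right_distrib sum.distrib scale_sum_right scale_left_commute
      intro!: sum.cong)

lemma lin_span_closed:
  assumes "lin f" "f ` S \<subseteq> span S" "u \<in> span S"
  shows "f u \<in> span S"
proof -
  have "f u \<in> span (f ` S)" using assms by (simp add: module_hom.span_image)
  then show ?thesis using span_minimal[OF assms(2) subspace_span] by blast
qed

lemma lin_cong_sum:
  assumes "lin f" shows "f (\<Sum>k\<in>A. scale (a k) (g k)) = (\<Sum>k\<in>A. scale (a k) (f (g k)))"
  by (simp add: module_hom.sum[OF assms] module_hom.scale[OF assms])

end

text \<open>The Lagrange polynomial of \<open>c\<close> applied to the index shift and read off at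
  index 0. Only the modes from 0 up to its degree enter, so this is defined and linear for every
  family \<open>f\<close>, even before \<open>f\<close> is known to be an exponential sum.\<close>

definition pick :: "(complex \<Rightarrow> 'v \<Rightarrow> 'v::ab_group_add) \<Rightarrow> complex set \<Rightarrow> complex \<Rightarrow> (int \<Rightarrow> 'v) \<Rightarrow> 'v" where
  "pick scale Z c f = (\<Sum>k\<le>degree (lagrange Z c). scale (coeff (lagrange Z c) k) (f (int k)))"

text \<open>On the term \<open>d powi m\<close> the shift multiplies by \<open>d\<close>, so a
  polynomial in the shift multiplies by its value at \<open>d\<close>, which is 1 for
  \<open>d = c\<close> and 0 at the other nodes.\<close>

lemma pick_exp_sum:
  fixes scale :: "complex \<Rightarrow> 'v \<Rightarrow> 'v::ab_group_add"
  assumes "vector_space scale" "finite Z" "C \<subseteq> Z" "c \<in> Z"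
    and f: "\<And>m. f m = (\<Sum>d\<in>C. scale (d powi m) (u d))"
  shows "pick scale Z c f = (if c \<in> C then u c else 0)"
proof -
  interpret vector_space scale by fact
  let ?l = "lagrange Z c"
  have fin: "finite C" using assms finite_subset by blast
  have "pick scale Z c f = (\<Sum>k\<le>degree ?l. \<Sum>d\<in>C. scale (coeff ?l k * d ^ k) (u d))"
    by (simp add: pick_def f scale_sum_right)
  also have "\<dots> = (\<Sum>d\<in>C. scale (poly ?l d) (u d))"
    by (subst sum.swap) (simp add: poly_altdef scale_sum_left)
  also have "\<dots> = (\<Sum>d\<in>C. if d = c then u c else 0)"
    using assms by (intro sum.cong) (auto simp: poly_lagrange)
  finally show ?thesis using fin by (simp add: sum.delta)
qed

lemma vector_space_complex: "vector_space ((*) :: complex \<Rightarrow> complex \<Rightarrow> complex)"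
  by standard (auto simp: algebra_simps)

text \<open>Linear independence of geometric sequences: \<open>pick\<close> recovers each
  coefficient from the values of the sum.\<close>

lemma exp_sum_eq_imp_coeff_eq:
  fixes u w :: "complex \<Rightarrow> complex"
  assumes "finite C" "\<And>m. (\<Sum>d\<in>C. u d * d powi m) = (\<Sum>d\<in>C. w d * d powi m)" "c \<in> C"
  shows "u c = w c"
proof -
  have "pick (*) C c (\<lambda>m. \<Sum>d\<in>C. u d * d powi m) = u c"
    using pick_exp_sum[OF vector_space_complex assms(1) order.refl assms(3),
        of "\<lambda>m. \<Sum>d\<in>C. u d * d powi m" u] assms(3) by (simp add: mult.commute)
  moreover have "pick (*) C c (\<lambda>m. \<Sum>d\<in>C. u d * d powi m) = w c"
    using pick_exp_sum[OF vector_space_complex assms(1) order.refl assms(3),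
        of "\<lambda>m. \<Sum>d\<in>C. u d * d powi m" w] assms(2,3) by (simp add: mult.commute)
  ultimately show ?thesis by simp
qed

section \<open>Irreducible modules over the loop generators\<close>

text \<open>\<open>F e i n\<close> is the mode \<open>\<phi>\<^sub>i\<^sub>,\<^sub>n\<close> of sign \<open>e\<close>, extended by zero to all integers \<open>n\<close>. The operator \<open>D\<close>
  is a product of the \<open>K Plus i\<close> which provides a grading: every lowering operator rescales its
  eigenvalues by the same factor \<open>\<theta>\<close>.\<close>

locale loop_module = complex_space scale
  for scale :: "complex \<Rightarrow> 'v::ab_group_add \<Rightarrow> 'v" +
  fixes I :: "nat set" and B :: "nat \<Rightarrow> nat \<Rightarrow> int" and q :: complex and kap :: "nat \<Rightarrow> complex"
    and X :: "pm \<Rightarrow> nat \<Rightarrow> int \<Rightarrow> 'v \<Rightarrow> 'v" and K :: "pm \<Rightarrow> nat \<Rightarrow> 'v \<Rightarrow> 'v"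
    and H :: "nat \<Rightarrow> int \<Rightarrow> 'v \<Rightarrow> 'v" and F :: "pm \<Rightarrow> nat \<Rightarrow> int \<Rightarrow> 'v \<Rightarrow> 'v"
    and D :: "'v \<Rightarrow> 'v" and \<theta> :: complex
  assumes q0: "q \<noteq> 0" and kap0: "i \<in> I \<Longrightarrow> kap i \<noteq> 0"
    and linX: "i \<in> I \<Longrightarrow> lin (X e i n)" and linK: "i \<in> I \<Longrightarrow> lin (K e i)"
    and linH: "i \<in> I \<Longrightarrow> n \<noteq> 0 \<Longrightarrow> lin (H i n)" and linF: "i \<in> I \<Longrightarrow> lin (F e i n)"
    and linD: "lin D"
    and KK: "i \<in> I \<Longrightarrow> K Minus i (K Plus i v) = v" "i \<in> I \<Longrightarrow> K Plus i (K Minus i v) = v"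
    and KX: "i \<in> I \<Longrightarrow> j \<in> I \<Longrightarrow>
      K Plus i (X e j n v) = scale (q powi (sg e * B i j)) (X e j n (K Plus i v))"
    and HX: "i \<in> I \<Longrightarrow> j \<in> I \<Longrightarrow> n \<noteq> 0 \<Longrightarrow> H i n (X e j m v) =
      X e j m (H i n v) + scale (of_int (sg e) * (1 / of_int n) * qint q (n * B i j)) (X e j (n + m) v)"
    and XX: "i \<in> I \<Longrightarrow> j \<in> I \<Longrightarrow>
      X e i (n + 1) (X e j m v) - scale (q powi (sg e * B i j)) (X e j m (X e i (n + 1) v)) =
      scale (q powi (sg e * B i j)) (X e i n (X e j (m + 1) v)) - X e j (m + 1) (X e i n v)"
    and XpXm: "i \<in> I \<Longrightarrow> j \<in> I \<Longrightarrow> X Plus i n (X Minus j m v) = X Minus j m (X Plus i n v) +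
      (if i = j then scale (kap i) (F Plus i (n + m) v - F Minus i (n + m) v) else 0)"
    and XX_commute: "i \<in> I \<Longrightarrow> j \<in> I \<Longrightarrow> i \<noteq> j \<Longrightarrow> B i j = 0 \<Longrightarrow> X e i n (X e j m v) = X e j m (X e i n v)"
    and FX: "i \<in> I \<Longrightarrow> j \<in> I \<Longrightarrow>
      F e i n (X Minus j m v) - scale (q powi - B i j) (F e i (n - 1) (X Minus j (m + 1) v)) =
      scale (q powi - B i j) (X Minus j m (F e i n v)) - X Minus j (m + 1) (F e i (n - 1) v)"
    and F_outside: "i \<in> I \<Longrightarrow> sg e * n < 0 \<Longrightarrow> F e i n v = 0"
    and F_mem: "i \<in> I \<Longrightarrow> subspace W \<Longrightarrow> (\<And>e i v. i \<in> I \<Longrightarrow> v \<in> W \<Longrightarrow> K e i v \<in> W) \<Longrightarrow>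
      (\<And>i n v. i \<in> I \<Longrightarrow> n \<noteq> 0 \<Longrightarrow> v \<in> W \<Longrightarrow> H i n v \<in> W) \<Longrightarrow> v \<in> W \<Longrightarrow> F e i n v \<in> W"
    and irred: "subspace W \<Longrightarrow> (\<And>e i v. i \<in> I \<Longrightarrow> v \<in> W \<Longrightarrow> K e i v \<in> W) \<Longrightarrow>
      (\<And>i n v. i \<in> I \<Longrightarrow> n \<noteq> 0 \<Longrightarrow> v \<in> W \<Longrightarrow> H i n v \<in> W) \<Longrightarrow>
      (\<And>e i n v. i \<in> I \<Longrightarrow> v \<in> W \<Longrightarrow> X e i n v \<in> W) \<Longrightarrow> W = {0} \<or> W = UNIV"
    and DK: "i \<in> I \<Longrightarrow> D (K e i v) = K e i (D v)"
    and DH: "i \<in> I \<Longrightarrow> n \<noteq> 0 \<Longrightarrow> D (H i n v) = H i n (D v)"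
    and DX: "i \<in> I \<Longrightarrow> D (X Minus i n v) = scale \<theta> (X Minus i n (D v))"
    and \<theta>: "r > 0 \<Longrightarrow> \<theta> ^ r \<noteq> 1"
begin

lemma X_Kp:
  assumes "i \<in> I" "j \<in> I"
  shows "X e j n (K Plus i v) = scale (q powi - (sg e * B i j)) (K Plus i (X e j n v))"
  using assms q0 by (simp add: KX power_int_minus)

lemma X_Km:
  assumes "i \<in> I" "j \<in> I"
  shows "X e j n (K Minus i v) = scale (q powi (sg e * B i j)) (K Minus i (X e j n v))"
proof -
  have "X e j n (K Minus i v) = K Minus i (K Plus i (X e j n (K Minus i v)))"
    using KK assms by simp
  also have "\<dots> = scale (q powi (sg e * B i j)) (K Minus i (X e j n (K Plus i (K Minus i v))))"
    using assms by (simp add: KX module_hom.scale[OF linK])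
  finally show ?thesis using KK assms by simp
qed

text \<open>If \<open>w\<close> is annihilated by all raising operators, then the commutation relations make
  \<open>below w\<close> closed under them, so that it is a submodule.\<close>

inductive_set below :: "'v \<Rightarrow> 'v set" for w where
  base: "w \<in> below w"
| zero: "0 \<in> below w"
| add: "u \<in> below w \<Longrightarrow> v \<in> below w \<Longrightarrow> u + v \<in> below w"
| scale: "u \<in> below w \<Longrightarrow> scale z u \<in> below w"
| K: "i \<in> I \<Longrightarrow> u \<in> below w \<Longrightarrow> K e i u \<in> below w"
| H: "i \<in> I \<Longrightarrow> n \<noteq> 0 \<Longrightarrow> u \<in> below w \<Longrightarrow> H i n u \<in> below w"
| X: "i \<in> I \<Longrightarrow> u \<in> below w \<Longrightarrow> X Minus i n u \<in> below w"

lemma subspace_below: "subspace (below w)"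
  by (auto simp: subspace_def intro: below.intros)

lemma below_F: "i \<in> I \<Longrightarrow> u \<in> below w \<Longrightarrow> F e i n u \<in> below w"
  by (rule F_mem) (auto intro: subspace_below below.intros)

text \<open>Each rule of \<open>below\<close> passes through a raising mode up to a commutator. For
  \<open>H\<close> this is another raising mode on the same vector, hence the induction with
  arbitrary \<open>i\<close> and \<open>n\<close>; for \<open>X Minus\<close> it is a combination of
  modes \<open>F\<close>, which \<open>F_mem\<close> reduces to \<open>K\<close> and
  \<open>H\<close>.\<close>

lemma below_Xp:
  assumes "\<And>i n. i \<in> I \<Longrightarrow> X Plus i n w = 0" and "u \<in> below w"
  shows "i \<in> I \<Longrightarrow> X Plus i n u \<in> below w"
  using assms(2)
proof (induction arbitrary: i n)
  case base
  then show ?case using assms(1) below.zero by simp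
next
  case zero
  then show ?case by (simp add: module_hom.zero[OF linX] below.zero)
next
  case (add u v)
  then show ?case by (simp add: module_hom.add[OF linX] below.add)
next
  case (scale u z)
  then show ?case by (simp add: module_hom.scale[OF linX] below.scale)
next
  case (K j u e)
  then show ?case by (cases e) (auto simp: X_Kp X_Km intro: below.scale below.K)
next
  case (H j m u)
  have "X Plus i n (H j m u) = H j m (X Plus i n u)
     + scale (- (1 / of_int m * qint q (m * B j i))) (X Plus i (m + n) u)"
    using H.hyps H.prems by (simp add: HX)
  then show ?case using below.H[OF H.hyps(1,2) H.IH[OF H.prems]] H.IH[OF H.prems]
    by (metis below.add below.scale)
next
  case (X j u m)
  have "scale (kap i) (F Plus i (n + m) u - F Minus i (n + m) u) \<in> below w"
    using X subspace_below[of w] by (auto intro!: subspace_scale subspace_diff below_F)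
  then show ?case using X by (auto simp: XpXm intro: below.intros)
qed

section \<open>The grading by powers of \<open>\<theta>\<close> and vectors killed by all raising
  modes\<close>

definition grade :: "complex \<Rightarrow> nat \<Rightarrow> 'v set" where
  "grade d n = {u. D u = scale (d * \<theta> ^ n) u}"

text \<open>The product of \<open>D - d * \<theta> ^ l\<close> over l from 1 to k. It annihilates
  the grades 1 to k and, for \<open>d \<noteq> 0\<close>, acts on grade 0 by a nonzero scalar, since
  no positive power of \<open>\<theta>\<close> is 1. So grade 0 is separated from the positive
  grades without decomposing the module.\<close>

definition Dprod :: "complex \<Rightarrow> nat \<Rightarrow> 'v \<Rightarrow> 'v" where
  "Dprod d = rec_nat (\<lambda>v. v) (\<lambda>k f v. D (f v) - scale (d * \<theta> ^ Suc k) (f v))"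

lemma Dprod_simps [simp]:
  "Dprod d 0 v = v"
  "Dprod d (Suc k) v = D (Dprod d k v) - scale (d * \<theta> ^ Suc k) (Dprod d k v)"
  by (simp_all add: Dprod_def)

lemma lin_Dprod: "lin (Dprod d k)"
proof (induction k)
  case 0
  then show ?case by (simp add: lin_iff)
next
  case (Suc k)
  then show ?case using linD
    by (auto simp: lin_iff algebra_simps)
qed

lemma Dprod_eigen:
  assumes "D u = scale c u"
  shows "Dprod d k u = scale (\<Prod>l=1..k. c - d * \<theta> ^ l) u"
proof (induction k)
  case (Suc k)
  then show ?case using assms
    by (simp add: module_hom.scale[OF linD] algebra_simps)
qed simp

lemma Dprod_mono: "Dprod d k u = 0 \<Longrightarrow> k \<le> l \<Longrightarrow> Dprod d l u = 0"
  by (induction l) (auto simp: le_Suc_eq module_hom.zero[OF linD])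

text \<open>\<open>K\<close> and \<open>H\<close> commute with \<open>D\<close>, and each lowering
  mode raises the grade by one, so nothing in \<open>below w\<close> falls back to grade 0.\<close>

lemma below_graded:
  assumes "w \<in> grade d (Suc n)" "u \<in> below w"
  shows "u \<in> span (\<Union>k. grade d (Suc k))"
  using assms(2)
proof induction
  case base
  then show ?case using assms by (auto intro: span_base)
next
  case zero
  then show ?case by (rule span_zero)
next
  case (add u v)
  then show ?case by (blast intro: span_add)
next
  case (scale u z)
  then show ?case by (blast intro: span_scale)
next
  case (K i u e)
  have "K e i v \<in> grade d m" if "v \<in> grade d m" for v m
    using that K by (simp add: grade_def DK module_hom.scale[OF linK])
  then have "K e i ` (\<Union>k. grade d (Suc k)) \<subseteq> span (\<Union>k. grade d (Suc k))"
    by (auto intro!: span_base)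
  then show ?case using lin_span_closed[OF linK] K by simp
next
  case (H i n u)
  have "H i n v \<in> grade d m" if "v \<in> grade d m" for v m
    using that H by (simp add: grade_def DH module_hom.scale[OF linH])
  then have "H i n ` (\<Union>k. grade d (Suc k)) \<subseteq> span (\<Union>k. grade d (Suc k))"
    by (auto intro!: span_base)
  then show ?case using lin_span_closed[OF linH] H by simp
next
  case (X i u n)
  have "X Minus i n v \<in> grade d (Suc m)" if "v \<in> grade d m" for v m
    using that X by (simp add: grade_def DX module_hom.scale[OF linX] algebra_simps)
  then have "X Minus i n ` (\<Union>k. grade d (Suc k)) \<subseteq> span (\<Union>k. grade d (Suc k))"
    by (blast intro!: span_base)
  then show ?case using lin_span_closed[OF linX] X by simp
qed

lemma graded_Dprod:
  assumes "u \<in> span (\<Union>k. grade d (Suc k))"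
  shows "\<exists>M. Dprod d M u = 0"
  using assms
proof (induction rule: span_induct_alt)
  case base
  then show ?case by (intro exI[of _ 0]) simp
next
  case (step c x y)
  then obtain M k where "Dprod d M y = 0" "x \<in> grade d (Suc k)" by auto
  moreover have "Dprod d (Suc k) x = 0"
  proof -
    have "(\<Prod>l=1..Suc k. d * \<theta> ^ Suc k - d * \<theta> ^ l) = 0"
      by (rule prod_zero) (auto intro: bexI[of _ "Suc k"])
    then show ?thesis using Dprod_eigen[of x "d * \<theta> ^ Suc k" d "Suc k"] \<open>x \<in> grade d (Suc k)\<close>
      by (simp only: grade_def mem_Collect_eq scale_zero_left)
  qed
  ultimately have "Dprod d (max M (Suc k)) x = 0" "Dprod d (max M (Suc k)) y = 0"
    by (metis Dprod_mono max.cobounded1 max.cobounded2)+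
  then have "Dprod d (max M (Suc k)) (scale c x + y) = 0"
    by (simp only: module_hom.add[OF lin_Dprod] module_hom.scale[OF lin_Dprod] scale_zero_right add_0)
  then show ?case by blast
qed

text \<open>Were \<open>w\<close> nonzero, irreducibility would make \<open>below w\<close> the
  whole module and put \<open>v0\<close> into the span of the positive grades. Each vector of that
  span is annihilated by some \<open>Dprod\<close>, which only rescales \<open>v0\<close>.\<close>

lemma killed_imp_zero:
  assumes v0: "v0 \<noteq> 0" "D v0 = scale d v0" "d \<noteq> 0"
    and w: "D w = scale (d * \<theta> ^ Suc n) w" "\<And>i n. i \<in> I \<Longrightarrow> X Plus i n w = 0"
  shows "w = 0"
proof -
  have "X e i n v \<in> below w" if "i \<in> I" "v \<in> below w" for e i n v
    using that below_Xp[OF w(2)] below.X by (cases e) auto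
  then have "below w = {0} \<or> below w = UNIV"
    using subspace_below below.K below.H by (intro irred) auto
  moreover have "v0 \<notin> below w"
  proof
    assume "v0 \<in> below w"
    then have "v0 \<in> span (\<Union>k. grade d (Suc k))"
      using below_graded[of w d n] w(1) unfolding grade_def by blast
    then obtain M where "Dprod d M v0 = 0" using graded_Dprod by blast
    moreover have "d - d * \<theta> ^ l \<noteq> 0" if "l \<ge> 1" for l
      using v0(3) \<theta>[of l] that by (simp add: algebra_simps)
    ultimately show False using v0(1) Dprod_eigen[OF v0(2), of d M]
      by (auto simp: scale_eq_0_iff)
  qed
  ultimately show ?thesis using below.base[of w] by auto
qed

end

section \<open>Modules with a multiplicity-free crystal of moves\<close>

text \<open>A label \<open>(i, c)\<close> in \<open>L p\<close> (in \<open>R p\<close>) stands for a move from the state \<open>p\<close> by the lowering (raising)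
  current of node \<open>i\<close>, which acts through the mode of frequency \<open>c\<close>. The labels of the possible
  moves are the poles of the \<open>l\<close>-weight \<open>gam p\<close>, all of them simple, and \<open>rho p\<close> gives the residues.\<close>

locale crystal_module = loop_module scale I B q kap X K H F D \<theta>
  for scale :: "complex \<Rightarrow> 'v::ab_group_add \<Rightarrow> 'v" and I B q kap X K H F D \<theta> +
  fixes P :: "'s set" and p0 :: 's and deg :: "'s \<Rightarrow> nat"
    and L R :: "'s \<Rightarrow> (nat \<times> complex) set"
    and lower raise :: "'s \<Rightarrow> nat \<times> complex \<Rightarrow> 's"
    and gam :: "'s \<Rightarrow> pm \<Rightarrow> nat \<Rightarrow> int \<Rightarrow> complex"
    and rho :: "'s \<Rightarrow> nat \<times> complex \<Rightarrow> complex"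
    and v0 :: 'v and d0 :: complex
  assumes finP: "finite P" and p0: "p0 \<in> P" "deg p0 = 0"
    and finLR: "p \<in> P \<Longrightarrow> finite (L p)" "p \<in> P \<Longrightarrow> finite (R p)"
    and LR_labels: "p \<in> P \<Longrightarrow> L p \<union> R p \<subseteq> I \<times> (UNIV - {0})"
    and lower: "p \<in> P \<Longrightarrow> x \<in> L p \<Longrightarrow>
      lower p x \<in> P \<and> x \<in> R (lower p x) \<and> raise (lower p x) x = p \<and> deg (lower p x) = Suc (deg p)"
    and raise: "p \<in> P \<Longrightarrow> x \<in> R p \<Longrightarrow>
      raise p x \<in> P \<and> x \<in> L (raise p x) \<and> lower (raise p x) x = p"
    and diamond_lower: "p \<in> P \<Longrightarrow> x \<in> L p \<Longrightarrow> y \<in> L p \<Longrightarrow> x \<noteq> y \<Longrightarrow>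
      y \<in> L (lower p x) \<and> lower (lower p x) y = lower (lower p y) x"
    and diamond_raise: "p \<in> P \<Longrightarrow> x \<in> R p \<Longrightarrow> y \<in> R p \<Longrightarrow> x \<noteq> y \<Longrightarrow>
      y \<in> R (raise p x) \<and> raise (raise p x) y = raise (raise p y) x"
    and LR_disjoint: "p \<in> P \<Longrightarrow> L p \<inter> R p = {}"
    and top_unique: "p \<in> P \<Longrightarrow> R p = {} \<Longrightarrow> p = p0"
    and gam_outside: "p \<in> P \<Longrightarrow> i \<in> I \<Longrightarrow> sg e * n < 0 \<Longrightarrow> gam p e i n = 0"
    and gam_poles: "p \<in> P \<Longrightarrow> i \<in> I \<Longrightarrow> kap i * (gam p Plus i n - gam p Minus i n) =
      (\<Sum>c | (i, c) \<in> L p \<union> R p. rho p (i, c) * c powi n)"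
    and rho0: "p \<in> P \<Longrightarrow> x \<in> L p \<union> R p \<Longrightarrow> rho p x \<noteq> 0"
    and gam_lower: "p \<in> P \<Longrightarrow> (j, c) \<in> L p \<Longrightarrow> i \<in> I \<Longrightarrow>
      gam (lower p (j, c)) e i n - q powi - B i j * c * gam (lower p (j, c)) e i (n - 1) =
      q powi - B i j * gam p e i n - c * gam p e i (n - 1)"
    and q_generic: "l \<noteq> 0 \<Longrightarrow> q powi l \<noteq> 1" and B_diag: "i \<in> I \<Longrightarrow> B i i \<noteq> 0"
    and v0: "v0 \<noteq> 0" "i \<in> I \<Longrightarrow> X Plus i n v0 = 0" "i \<in> I \<Longrightarrow> F e i n v0 = scale (gam p0 e i n) v0"
      "i \<in> I \<Longrightarrow> n \<noteq> 0 \<Longrightarrow> \<exists>\<eta>. H i n v0 = scale \<eta> v0" "i \<in> I \<Longrightarrow> \<exists>\<eta>. K Plus i v0 = scale \<eta> v0"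
    and d0: "d0 \<noteq> 0" "D v0 = scale d0 v0"
begin

section \<open>Projections of the currents to single frequencies\<close>

definition Z :: "complex set" where
  "Z = snd ` (\<Union>p\<in>P. L p \<union> R p)"

definition pk :: "complex \<Rightarrow> (int \<Rightarrow> 'v) \<Rightarrow> 'v" where
  "pk c f = pick scale Z c f"

text \<open>The component of frequency \<open>snd x\<close> of the current of node
  \<open>fst x\<close>. All states share the interpolation nodes \<open>Z\<close>, so this is one
  fixed linear combination of modes, and identities for modes carry over to it by linearity. Only on
  vectors satisfying \<open>diag\<close> do the components add up to the current.\<close>

definition U :: "pm \<Rightarrow> nat \<times> complex \<Rightarrow> 'v \<Rightarrow> 'v" where
  "U e x v = pk (snd x) (\<lambda>m. X e (fst x) m v)"

lemma finZ: "finite Z"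
  unfolding Z_def using finP finLR by auto

lemma mem_Z: "p \<in> P \<Longrightarrow> (i, c) \<in> L p \<union> R p \<Longrightarrow> c \<in> Z"
  unfolding Z_def by force

lemma nz_Z: "c \<in> Z \<Longrightarrow> c \<noteq> 0"
  unfolding Z_def using LR_labels by force

lemma labels: "p \<in> P \<Longrightarrow> (i, c) \<in> L p \<union> R p \<Longrightarrow> i \<in> I \<and> c \<noteq> 0 \<and> c \<in> Z"
  using LR_labels mem_Z by blast

lemma pk_add: "pk c (\<lambda>m. f m + g m) = pk c f + pk c g"
  by (simp add: pk_def pick_def scale_right_distrib sum.distrib)

lemma pk_diff: "pk c (\<lambda>m. f m - g m) = pk c f - pk c g"
  by (simp add: pk_def pick_def scale_right_diff_distrib sum_subtractf)

lemma pk_lin: "lin T \<Longrightarrow> pk c (\<lambda>m. T (f m)) = T (pk c f)"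
  unfolding pk_def pick_def by (rule lin_cong_sum[symmetric])

lemma pk_scale: "pk c (\<lambda>m. scale a (f m)) = scale a (pk c f)"
  by (simp add: pk_def pick_def scale_sum_right mult.commute)

lemma pk_zero [simp]: "pk c (\<lambda>m. 0) = 0"
  by (simp add: pk_def pick_def)

lemma pk_sum:
  assumes "\<And>m. f m = (\<Sum>d\<in>C. scale (d powi m) (u d))" "C \<subseteq> Z" "c \<in> Z"
  shows "pk c f = (if c \<in> C then u c else 0)"
  unfolding pk_def by (rule pick_exp_sum[OF vector_space_axioms finZ]) (use assms in auto)

lemma pk_exp: "c \<in> Z \<Longrightarrow> pk c (\<lambda>m. scale (a * c powi m) w) = scale a w"
  by (subst pk_sum[where C = "{c}" and u = "\<lambda>_. scale a w"]) (auto simp: mult.commute)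

lemma linU: "fst x \<in> I \<Longrightarrow> lin (U e x)"
  unfolding U_def pk_def pick_def by (rule lin_lincomb) (simp add: linX)

definition diag :: "pm \<Rightarrow> 'v \<Rightarrow> bool" where
  "diag e w \<longleftrightarrow> (\<forall>i\<in>I. \<forall>m. X e i m w = (\<Sum>c\<in>Z. scale (c powi m) (U e (i, c) w)))"

lemma diagD: "diag e w \<Longrightarrow> i \<in> I \<Longrightarrow> X e i m w = (\<Sum>c\<in>Z. scale (c powi m) (U e (i, c) w))"
  by (simp add: diag_def)

lemma diag_add: "diag e w \<Longrightarrow> diag e w' \<Longrightarrow> diag e (w + w')"
  unfolding diag_def
  by (auto simp: module_hom.add[OF linX] module_hom.add[OF linU] scale_right_distrib sum.distrib)

lemma diag_scale: "diag e w \<Longrightarrow> diag e (scale a w)"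
  unfolding diag_def
  by (auto simp: module_hom.scale[OF linX] module_hom.scale[OF linU] scale_sum_right mult.commute)

lemma diag_zero: "diag e 0"
  unfolding diag_def by (auto simp: module_hom.zero[OF linX] module_hom.zero[OF linU])

lemma diag_sum: "(\<And>y. y \<in> A \<Longrightarrow> diag e (f y)) \<Longrightarrow> diag e (sum f A)"
  by (induction A rule: infinite_finite_induct) (auto intro: diag_add diag_zero)

lemma pk_shift: "diag e w \<Longrightarrow> i \<in> I \<Longrightarrow> c \<in> Z \<Longrightarrow>
    pk c (\<lambda>m. X e i (m + k) w) = scale (c powi k) (U e (i, c) w)"
  by (subst pk_sum[where C = Z and u = "\<lambda>c. scale (c powi k) (U e (i, c) w)"])
     (auto simp: diagD power_int_add nz_Z intro!: sum.cong)

definition expands ::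
  "pm \<Rightarrow> (nat \<times> complex) set \<Rightarrow> (nat \<times> complex \<Rightarrow> complex) \<Rightarrow> 'v \<Rightarrow> (nat \<times> complex \<Rightarrow> 'v) \<Rightarrow> bool" where
  "expands e S a w V \<longleftrightarrow>
     (\<forall>i\<in>I. \<forall>m. X e i m w = (\<Sum>c | (i, c) \<in> S. scale (c powi m) (scale (a (i, c)) (V (i, c)))))"

lemma expands_U:
  assumes "expands e S a w V" "snd ` S \<subseteq> Z" "i \<in> I" "c \<in> Z"
  shows "U e (i, c) w = (if (i, c) \<in> S then scale (a (i, c)) (V (i, c)) else 0)"
  unfolding U_def
  by (subst pk_sum[where C = "{c. (i, c) \<in> S}" and u = "\<lambda>c. scale (a (i, c)) (V (i, c))"])
     (use assms in \<open>force simp: expands_def\<close>)+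

lemma expands_diag:
  assumes "expands e S a w V" "snd ` S \<subseteq> Z"
  shows "diag e w"
  unfolding diag_def
proof (intro ballI allI)
  fix i m assume i: "i \<in> I"
  have "{c. (i, c) \<in> S} \<subseteq> Z" using assms by force
  then have "(\<Sum>c | (i, c) \<in> S. scale (c powi m) (scale (a (i, c)) (V (i, c))))
      = (\<Sum>c\<in>Z. scale (c powi m) (U e (i, c) w))"
    by (intro sum.mono_neutral_cong_left) (auto simp: finZ expands_U[OF assms i])
  then show "X e i m w = (\<Sum>c\<in>Z. scale (c powi m) (U e (i, c) w))"
    using assms(1) i by (simp add: expands_def)
qed

lemma snd_LR: "p \<in> P \<Longrightarrow> snd ` L p \<subseteq> Z" "p \<in> P \<Longrightarrow> snd ` R p \<subseteq> Z"
  unfolding Z_def by blast+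

section \<open>Residues of the l-weights along moves\<close>

definition rhz :: "'s \<Rightarrow> nat \<times> complex \<Rightarrow> complex" where
  "rhz p x = (if x \<in> L p \<union> R p then rho p x else 0)"

lemma gam_rhz:
  assumes "p \<in> P" "i \<in> I"
  shows "kap i * (gam p Plus i n - gam p Minus i n) = (\<Sum>c\<in>Z. rhz p (i, c) * c powi n)"
  unfolding gam_poles[OF assms]
  by (intro sum.mono_neutral_cong_left finZ) (use assms mem_Z in \<open>auto simp: rhz_def\<close>)

text \<open>Inserting the pole expansions into the difference of \<open>gam_lower\<close> for the
  two signs gives two exponential sums over \<open>Z\<close>, whose coefficients at \<open>c\<close>
  are compared. Because \<open>rhz\<close> is extended by zero, this makes sense at every node, also
  where a pole appears or disappears.\<close>

lemma rhz_lower: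
  assumes p: "p \<in> P" "(j, d) \<in> L p" and i: "i \<in> I" "c \<in> Z"
  shows "rhz (lower p (j, d)) (i, c) * (c - q powi - B i j * d) = rhz p (i, c) * (q powi - B i j * c - d)"
proof -
  let ?p = "lower p (j, d)" and ?Q = "q powi - B i j"
  have P: "?p \<in> P" using lower p by blast
  define G where "G p n = kap i * (gam p Plus i n - gam p Minus i n)" for p n
  have "(\<Sum>c\<in>Z. (rhz ?p (i, c) * (c - ?Q * d)) * c powi n) =
        (\<Sum>c\<in>Z. (rhz p (i, c) * (?Q * c - d)) * c powi n)" for n
  proof -
    have "G ?p (n + 1) - ?Q * d * G ?p n = ?Q * G p (n + 1) - d * G p n"
      using arg_cong2[OF gam_lower[OF p i(1), of Plus "n + 1"] gam_lower[OF p i(1), of Minus "n + 1"],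
          of "\<lambda>a b. kap i * (a - b)"]
      unfolding G_def by (simp add: algebra_simps)
    moreover have s: "G p (n + 1) = (\<Sum>c\<in>Z. rhz p (i, c) * c * c powi n)"
      "G p n = (\<Sum>c\<in>Z. rhz p (i, c) * c powi n)" if "p \<in> P" for p
      unfolding G_def gam_rhz[OF that i(1)]
      by (auto intro!: sum.cong simp: power_int_add nz_Z)
    ultimately show ?thesis
      unfolding s[OF P] s[OF p(1)] sum_distrib_left sum_subtractf[symmetric]
      by (simp add: algebra_simps)
  qed
  then show ?thesis
    by (rule exp_sum_eq_imp_coeff_eq[OF finZ _ i(2), of "\<lambda>c. rhz ?p (i, c) * (c - ?Q * d)"])
qed

section \<open>The vectors attached to the states\<close>

definition parent :: "'s \<Rightarrow> nat \<times> complex" where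
  "parent p = (SOME x. x \<in> R p)"

text \<open>A state is reached through one arbitrarily chosen parent in each degree. The choice
  fixes only the scale: \<open>good_unique\<close> shows that any other parent leads to a
  multiple.\<close>

definition vecn :: "nat \<Rightarrow> 's \<Rightarrow> 'v" where
  "vecn = rec_nat (\<lambda>p. v0) (\<lambda>n f p. U Minus (parent p) (f (raise p (parent p))))"

definition vec :: "'s \<Rightarrow> 'v" where
  "vec p = vecn (deg p) p"

lemma parent: "R p \<noteq> {} \<Longrightarrow> parent p \<in> R p"
  unfolding parent_def by (meson ex_in_conv someI)

lemma deg_raise: "p \<in> P \<Longrightarrow> x \<in> R p \<Longrightarrow> deg p = Suc (deg (raise p x))"
  using lower raise by metis

lemma deg_0: "p \<in> P \<Longrightarrow> deg p = 0 \<longleftrightarrow> p = p0"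
  using deg_raise top_unique p0 by (metis ex_in_conv nat.distinct(1))

lemma vec_p0: "vec p0 = v0"
  by (simp add: vec_def vecn_def p0)

lemma vec_parent: "p \<in> P \<Longrightarrow> p \<noteq> p0 \<Longrightarrow>
    parent p \<in> R p \<and> vec p = U Minus (parent p) (vec (raise p (parent p)))"
  using parent[of p] top_unique[of p] deg_raise[of p "parent p"]
  by (cases "R p = {}") (simp_all add: vec_def vecn_def)

text \<open>Stated for an arbitrary \<open>w\<close>, because the vectors
  \<open>U Minus x (vec p)\<close> that come from different parents must be compared before they are
  known to be proportional. It describes only the raising side; the lowering side,
  \<open>good_lower\<close>, becomes available one degree later.\<close>

definition good :: "'s \<Rightarrow> 'v \<Rightarrow> bool" where
  "good p w \<longleftrightarrow>
     (\<forall>e. \<forall>i\<in>I. \<forall>n. F e i n w = scale (gam p e i n) w) \<and>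
     (\<forall>i\<in>I. \<exists>\<eta>. K Plus i w = scale \<eta> w) \<and>
     (\<forall>i\<in>I. \<forall>n. n \<noteq> 0 \<longrightarrow> (\<exists>\<eta>. H i n w = scale \<eta> w)) \<and>
     D w = scale (d0 * \<theta> ^ deg p) w \<and>
     (\<exists>a. (\<forall>x\<in>R p. a x \<noteq> 0) \<and> expands Plus (R p) a w (\<lambda>x. vec (raise p x)))"

definition good_lower :: "'s \<Rightarrow> bool" where
  "good_lower p \<longleftrightarrow> (\<exists>b. (\<forall>x\<in>L p. b x \<noteq> 0) \<and> expands Minus (L p) b (vec p) (\<lambda>x. vec (lower p x)))"

lemma goodF: "good p w \<Longrightarrow> i \<in> I \<Longrightarrow> F e i n w = scale (gam p e i n) w"
  and goodK: "good p w \<Longrightarrow> i \<in> I \<Longrightarrow> \<exists>\<eta>. K Plus i w = scale \<eta> w"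
  and goodH: "good p w \<Longrightarrow> i \<in> I \<Longrightarrow> n \<noteq> 0 \<Longrightarrow> \<exists>\<eta>. H i n w = scale \<eta> w"
  and goodD: "good p w \<Longrightarrow> D w = scale (d0 * \<theta> ^ deg p) w"
  and goodX: "good p w \<Longrightarrow> \<exists>a. (\<forall>x\<in>R p. a x \<noteq> 0) \<and> expands Plus (R p) a w (\<lambda>x. vec (raise p x))"
  unfolding good_def by blast+

lemma good_p0: "good p0 (vec p0)"
proof -
  have "R p0 = {}" using p0 deg_raise by (metis ex_in_conv nat.distinct(1))
  then show ?thesis using v0 d0 p0 by (auto simp: good_def vec_p0 expands_def)
qed

lemma killed:
  assumes "D w = scale (d0 * \<theta> ^ Suc n) w" "\<And>i m. i \<in> I \<Longrightarrow> X Plus i m w = 0"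
  shows "w = 0"
  using killed_imp_zero[OF v0(1) d0(2) d0(1) assms] .

text \<open>The commutator of the two currents is the difference of the two expansions of the
  l-weight, an exponential sum over the poles; projecting to \<open>c\<close> leaves the residue
  there.\<close>

lemma Xp_U:
  assumes p: "p \<in> P" "\<And>e i n. i \<in> I \<Longrightarrow> F e i n w = scale (gam p e i n) w"
    and i: "i \<in> I" "j \<in> I" "c \<in> Z"
  shows "X Plus j k (U Minus (i, c) w) = U Minus (i, c) (X Plus j k w)
    + (if i = j then scale (rhz p (i, c) * c powi k) w else 0)"
proof -
  have "X Plus j k (U Minus (i, c) w) = pk c (\<lambda>m. X Plus j k (X Minus i m w))"
    using i pk_lin[OF linX, where f = "\<lambda>m. X Minus i m w"] by (simp add: U_def)
  also have "\<dots> = pk c (\<lambda>m. X Minus i m (X Plus j k w)) + pk c (\<lambda>m. if j = i then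
      scale (kap j) (F Plus j (k + m) w - F Minus j (k + m) w) else 0)"
    using i by (simp add: XpXm pk_add)
  also have "pk c (\<lambda>m. if j = i then scale (kap j) (F Plus j (k + m) w - F Minus j (k + m) w) else 0)
      = (if i = j then scale (rhz p (i, c) * c powi k) w else 0)"
  proof (cases "i = j")
    case True
    have "scale (kap i) (F Plus i (k + m) w - F Minus i (k + m) w)
        = (\<Sum>d\<in>Z. scale (d powi m) (scale (rhz p (i, d) * d powi k) w))" for m
    proof -
      have "scale (kap i) (F Plus i (k + m) w - F Minus i (k + m) w)
        = scale (kap i * (gam p Plus i (k + m) - gam p Minus i (k + m))) w"
        using i p by (simp add: algebra_simps)
      then show ?thesis unfolding gam_rhz[OF p(1) i(1)]
        by (auto simp: scale_sum_left power_int_add nz_Z algebra_simps intro!: sum.cong)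
    qed
    then show ?thesis using True i
      by (subst pk_sum[where C = Z and u = "\<lambda>c. scale (rhz p (i, c) * c powi k) w"]) auto
  qed auto
  finally show ?thesis by (simp add: U_def)
qed

text \<open>Each relation is applied to the modes and then projected to \<open>c\<close>, where a
  shift of the mode becomes multiplication by \<open>c\<close>. For \<open>F\<close> this gives a
  two-term recursion, and \<open>gam p'\<close> satisfies the same one by
  \<open>gam_lower\<close>.\<close>

lemma U_eigen:
  assumes p: "p \<in> P" "(j, c) \<in> L p" and w: "good p w" "diag Minus w"
  defines "W \<equiv> U Minus (j, c) w" and "p' \<equiv> lower p (j, c)"
  shows "i \<in> I \<Longrightarrow> F e i n W = scale (gam p' e i n) W"
    and "i \<in> I \<Longrightarrow> \<exists>\<eta>. K Plus i W = scale \<eta> W"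
    and "i \<in> I \<Longrightarrow> n \<noteq> 0 \<Longrightarrow> \<exists>\<eta>. H i n W = scale \<eta> W"
    and "D W = scale (d0 * \<theta> ^ deg p') W"
proof -
  have jc: "j \<in> I" "c \<noteq> 0" "c \<in> Z" using p labels by auto
  have p': "p' \<in> P" "deg p' = Suc (deg p)" using lower p by (auto simp: p'_def)
  have WU: "W = pk c (\<lambda>m. X Minus j m w)" by (simp add: W_def U_def)
  have sh: "pk c (\<lambda>m. X Minus j (m + k) w) = scale (c powi k) W" for k
    using pk_shift[OF w(2) jc(1,3)] by (simp add: W_def)
  show "F e i n W = scale (gam p' e i n) W" if i: "i \<in> I" for e i n
  proof -
    let ?Q = "q powi - B i j"
    define E where "E n = F e i n W - scale (gam p' e i n) W" for n
    have Fw: "F e i n w = scale (gam p e i n) w" for n using goodF w i by blast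
    have pkF: "pk c (\<lambda>m. F e i n (X Minus j (m + k) w)) = F e i n (scale (c powi k) W)" for n k
      using pk_lin[OF linF[OF i], where f = "\<lambda>m. X Minus j (m + k) w"] by (simp add: sh)
    have h1: "F e i n W - scale (?Q * c) (F e i (n - 1) W)
        = scale (?Q * gam p e i n - c * gam p e i (n - 1)) W" for n
    proof -
      have "pk c (\<lambda>m. F e i n (X Minus j m w) - scale ?Q (F e i (n - 1) (X Minus j (m + 1) w)))
        = pk c (\<lambda>m. scale (?Q * gam p e i n) (X Minus j m w) - scale (gam p e i (n - 1)) (X Minus j (m + 1) w))"
        using i jc FX by (simp add: Fw module_hom.scale[OF linX])
      then show ?thesis
        using pkF[of n 0] pkF[of "n - 1" 1] sh[of 0] sh[of 1]
        by (simp add: pk_diff pk_scale module_hom.scale[OF linF] i mult.commute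
            flip: scale_left_diff_distrib)
    qed
    have h2: "gam p' e i n - ?Q * c * gam p' e i (n - 1) = ?Q * gam p e i n - c * gam p e i (n - 1)"
      for n unfolding p'_def using gam_lower p i by blast
    have E: "E n = scale (?Q * c) (E (n - 1))" for n
    proof -
      have "F e i n W = scale (?Q * c) (F e i (n - 1) W)
          + scale (gam p' e i n - ?Q * c * gam p' e i (n - 1)) W"
        using h1[of n] h2[of n] by (simp add: diff_eq_eq add.commute)
      then show ?thesis unfolding E_def by (simp add: algebra_simps)
    qed
    have E0: "E n = 0" if "sg e * n < 0" for n
      using that gam_outside[OF p'(1) i] F_outside[OF i] by (simp add: E_def)
    have Qc: "?Q * c \<noteq> 0" using jc q0 by simp
    \<comment> \<open>The defect \<open>E\<close> is a geometric sequence vanishing on a half line.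
      For \<open>Plus\<close> zero propagates upwards from the negative indices, for
      \<open>Minus\<close> downwards from the positive ones, which requires division by
      \<open>?Q * c\<close>.\<close>
    have "E n = 0"
    proof (cases e)
      case Plus
      have "E (int k - 1) = 0" for k
      proof (induction k)
        case (Suc k)
        have "E (int (Suc k) - 1) = scale (?Q * c) (E (int k - 1))" by (subst E) simp
        then show ?case using Suc by simp
      qed (use E0 Plus in auto)
      from this[of "nat (n + 1)"] show ?thesis using E0[of n] Plus by (cases "n < 0") auto
    next
      case Minus
      have "E (1 - int k) = 0" for k
      proof (induction k)
        case (Suc k)
        have "E (1 - int k) = scale (?Q * c) (E (1 - int (Suc k)))" by (subst E) (simp add: algebra_simps)
        then show ?case using Suc Qc q0 by (simp add: scale_eq_0_iff)
      qed (use E0 Minus in auto)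
      from this[of "nat (1 - n)"] show ?thesis using E0[of n] Minus by (cases "n > 0") auto
    qed
    then show ?thesis by (simp add: E_def)
  qed
  show "\<exists>\<eta>. K Plus i W = scale \<eta> W" if i: "i \<in> I" for i
  proof -
    obtain \<eta> where \<eta>: "K Plus i w = scale \<eta> w" using goodK w i by blast
    have "K Plus i W = pk c (\<lambda>m. K Plus i (X Minus j m w))"
      using pk_lin[OF linK[OF i]] WU by simp
    also have "\<dots> = pk c (\<lambda>m. scale (q powi (- B i j) * \<eta>) (X Minus j m w))"
      using i jc by (simp add: KX \<eta> module_hom.scale[OF linX])
    finally show ?thesis by (auto simp: pk_scale WU)
  qed
  show "\<exists>\<eta>. H i n W = scale \<eta> W" if i: "i \<in> I" "n \<noteq> 0" for i n
  proof -
    obtain \<eta> where \<eta>: "H i n w = scale \<eta> w" using goodH w i by blast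
    have "H i n W = pk c (\<lambda>m. H i n (X Minus j m w))"
      using pk_lin[OF linH[OF i]] WU by simp
    also have "\<dots> = pk c (\<lambda>m. scale \<eta> (X Minus j m w) +
        scale (- (1 / of_int n) * qint q (n * B i j)) (X Minus j (m + n) w))"
      using i jc by (simp add: HX \<eta> module_hom.scale[OF linX] add.commute)
    also have "\<dots> = scale \<eta> W + scale (- (1 / of_int n) * qint q (n * B i j) * c powi n) W"
      by (simp only: pk_add pk_scale sh scale_scale flip: WU)
    finally show ?thesis by (metis scale_left_distrib)
  qed
  have "D W = pk c (\<lambda>m. D (X Minus j m w))"
    using pk_lin[OF linD] WU by simp
  also have "\<dots> = pk c (\<lambda>m. scale (\<theta> * (d0 * \<theta> ^ deg p)) (X Minus j m w))"
    using w(1) jc by (simp add: DX good_def module_hom.scale[OF linX])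
  finally show "D W = scale (d0 * \<theta> ^ deg p') W"
    using p' by (simp add: pk_scale algebra_simps flip: WU)
qed

text \<open>A raising label other than \<open>x\<close> of the lowered state is a label of
  \<open>p\<close> by \<open>diamond_raise\<close>; conversely \<open>diamond_lower\<close> at
  \<open>raise p y\<close> closes the square formed by \<open>x\<close> and
  \<open>y\<close>.\<close>

lemma R_lower:
  assumes "p \<in> P" "x \<in> L p"
  shows "R (lower p x) = insert x {y \<in> R p. x \<in> L (raise p y)}"
    and "\<And>y. y \<in> R p \<Longrightarrow> x \<in> L (raise p y) \<Longrightarrow> raise (lower p x) y = lower (raise p y) x"
proof -
  let ?p = "lower p x"
  have p': "?p \<in> P" "x \<in> R ?p" "raise ?p x = p" using lower assms by auto
  have 1: "y \<in> R ?p \<and> raise ?p y = lower (raise p y) x" if y: "y \<in> R p" "x \<in> L (raise p y)" for y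
  proof -
    have "x \<noteq> y" using LR_disjoint assms y by blast
    then have "y \<in> L (lower (raise p y) x) \<and> lower (lower (raise p y) x) y = lower (lower (raise p y) y) x"
      using diamond_lower[of "raise p y" x y] raise y assms by blast
    moreover have "lower (raise p y) y = p" "lower (raise p y) x \<in> P" using raise lower y assms by auto
    ultimately show ?thesis using lower by metis
  qed
  have 2: "y \<in> R p \<and> x \<in> L (raise p y)" if y: "y \<in> R ?p" "y \<noteq> x" for y
    using diamond_raise[OF p'(1,2) y(1)] diamond_raise[OF p'(1) y(1) p'(2)] y p' raise[OF p'(1) y(1)]
      raise by metis
  show "R ?p = insert x {y \<in> R p. x \<in> L (raise p y)}" using 1 2 p'(2) by blast
  show "\<And>y. y \<in> R p \<Longrightarrow> x \<in> L (raise p y) \<Longrightarrow> raise ?p y = lower (raise p y) x" using 1 by blast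
qed

lemma rhz_nz: "p \<in> P \<Longrightarrow> x \<in> L p \<union> R p \<Longrightarrow> rhz p x \<noteq> 0"
  using rho0 by (auto simp: rhz_def)

text \<open>\<open>rhz_lower\<close> at the label of the move itself: the two factors there are
  \<open>c - q powi - B i i * c\<close> and its negative, and they are nonzero.\<close>

lemma rhz_raise:
  assumes "p \<in> P" "x \<in> R p"
  shows "rhz (raise p x) x = - rhz p x"
proof -
  obtain i c where x: "x = (i, c)" by (cases x)
  have i: "i \<in> I" "c \<noteq> 0" "c \<in> Z" using assms labels x by auto
  have r: "raise p x \<in> P" "x \<in> L (raise p x)" "lower (raise p x) x = p" using raise assms by auto
  have "q powi - B i i \<noteq> 1" using q_generic B_diag i by simp
  moreover have "(c - q powi - B i i * c) * (rhz p x + rhz (raise p x) x) = 0"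
    using rhz_lower[of "raise p x" i c i c] r i by (simp add: x algebra_simps)
  ultimately show ?thesis using i
    by (auto simp: eq_neg_iff_add_eq_0 add.commute)
qed

lemma vec_diag_Minus: "p \<in> P \<Longrightarrow> good_lower p \<Longrightarrow> diag Minus (vec p)"
  unfolding good_lower_def using expands_diag snd_LR(1) by blast

lemma good_diag_Plus: "p \<in> P \<Longrightarrow> good p w \<Longrightarrow> diag Plus w"
  unfolding good_def using expands_diag snd_LR(2) by blast

text \<open>Evaluates \<open>U Plus x (U Minus x v)\<close> in two ways, for the vector
  \<open>v\<close> of the raised state. Along the expansions it is \<open>a x * b x\<close>; by the
  commutator it is the residue at the raised state, since \<open>U Plus x\<close> annihilates
  \<open>v\<close>. Going back to \<open>p\<close> changes the sign of the residue.\<close>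

lemma raise_lower_product:
  assumes p: "p \<in> P" "x \<in> R p" "vec p \<noteq> 0" "vec (raise p x) \<noteq> 0"
    and a: "expands Plus (R p) a (vec p) (\<lambda>x. vec (raise p x))"
    and g: "good (raise p x) (vec (raise p x))"
    and b: "expands Minus (L (raise p x)) b (vec (raise p x)) (\<lambda>y. vec (lower (raise p x) y))"
  shows "a x * b x = - rhz p x"
proof -
  obtain i c where x: "x = (i, c)" by (cases x)
  let ?r = "raise p x"
  have i: "i \<in> I" "c \<noteq> 0" "c \<in> Z" using p labels x by auto
  have r: "?r \<in> P" "x \<in> L ?r" "lower ?r x = p" using raise p by auto
  have Um: "U Minus x (vec ?r) = scale (b x) (vec p)"
    using expands_U[OF b snd_LR(1)[OF r(1)] i(1,3)] r x by simp
  have "x \<notin> R ?r" using LR_disjoint r by blast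
  then have Up0: "U Plus x (vec ?r) = 0"
    using g expands_U[OF _ snd_LR(2)[OF r(1)] i(1,3)] x by (auto simp: good_def)
  have Up: "U Plus x (vec p) = scale (a x) (vec ?r)"
    using expands_U[OF a snd_LR(2)[OF p(1)] i(1,3)] p x by simp
  have "U Plus x (U Minus x (vec ?r)) =
      pk c (\<lambda>k. U Minus x (X Plus i k (vec ?r)) + scale (rhz ?r x * c powi k) (vec ?r))"
    using Xp_U[OF r(1) _ i(1,1,3), of "vec ?r"] g by (simp add: U_def[of Plus] x good_def)
  also have "\<dots> = U Minus x (U Plus x (vec ?r)) + scale (rhz ?r x) (vec ?r)"
    using pk_lin[OF linU, where f = "\<lambda>k. X Plus i k (vec ?r)"] i
    by (simp add: pk_add pk_exp U_def[of Plus] x)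
  finally have "scale (a x * b x) (vec ?r) = scale (rhz ?r x) (vec ?r)"
    using Um Up Up0 i x by (simp add: module_hom.scale[OF linU] module_hom.zero[OF linU] mult.commute)
  then have "a x * b x = rhz ?r x" using p(4) unfolding scale_cancel_right by simp
  then show ?thesis using rhz_raise[OF p(1,2)] by simp
qed

section \<open>The induction step from one degree to the next\<close>

definition ready :: "'s \<Rightarrow> bool" where
  "ready p \<longleftrightarrow> p \<in> P \<and> vec p \<noteq> 0 \<and> good p (vec p) \<and>
     (\<forall>y\<in>R p. vec (raise p y) \<noteq> 0 \<and> good (raise p y) (vec (raise p y)) \<and> good_lower (raise p y))"

lemma D_U: "i \<in> I \<Longrightarrow> D (U Minus (i, c) v) = scale \<theta> (U Minus (i, c) (D v))"
  using pk_lin[OF linD, where f = "\<lambda>m. X Minus i m v"] by (simp add: U_def DX pk_scale)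

text \<open>Coordinates for raising \<open>vec p\<close> and then lowering: \<open>a\<close> holds
  the coefficients of the raising, \<open>b y\<close> those of the lowering from
  \<open>raise p y\<close>, and the last clause ties the two together through the residue.\<close>

definition expansion ::
  "'s \<Rightarrow> (nat \<times> complex \<Rightarrow> complex) \<Rightarrow> (nat \<times> complex \<Rightarrow> nat \<times> complex \<Rightarrow> complex) \<Rightarrow> bool" where
  "expansion p a b \<longleftrightarrow> (\<forall>x\<in>R p. a x \<noteq> 0) \<and> expands Plus (R p) a (vec p) (\<lambda>x. vec (raise p x)) \<and>
    (\<forall>y\<in>R p. \<forall>x\<in>L (raise p y). b y x \<noteq> 0) \<and>
    (\<forall>j\<in>I. \<forall>k. diag Minus (X Plus j k (vec p))) \<and>
    (\<forall>i\<in>I. \<forall>c\<in>Z. \<forall>j\<in>I. \<forall>k. U Minus (i, c) (X Plus j k (vec p)) =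
       (\<Sum>d | (j, d) \<in> R p. scale (d powi k * a (j, d)) (if (i, c) \<in> L (raise p (j, d))
          then scale (b (j, d) (i, c)) (vec (lower (raise p (j, d)) (i, c))) else 0))) \<and>
    (\<forall>x\<in>R p. a x * b x x = - rhz p x)"

lemma ready_expand:
  assumes "ready p"
  obtains a b where "expansion p a b"
proof -
  have p: "p \<in> P" using assms by (simp add: ready_def)
  have R: "raise p y \<in> P" if "y \<in> R p" for y using raise[OF p that] by simp
  obtain a where a: "\<And>x. x \<in> R p \<Longrightarrow> a x \<noteq> 0" "expands Plus (R p) a (vec p) (\<lambda>x. vec (raise p x))"
    using goodX[of p "vec p"] assms unfolding ready_def by blast
  have "\<forall>y\<in>R p. \<exists>b. (\<forall>x\<in>L (raise p y). b x \<noteq> 0) \<and>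
      expands Minus (L (raise p y)) b (vec (raise p y)) (\<lambda>x. vec (lower (raise p y) x))"
    using assms by (auto simp: ready_def good_lower_def)
  from bchoice[OF this] obtain b where b': "\<forall>y\<in>R p. (\<forall>x\<in>L (raise p y). b y x \<noteq> 0) \<and>
      expands Minus (L (raise p y)) (b y) (vec (raise p y)) (\<lambda>x. vec (lower (raise p y) x))" ..
  have b: "\<And>x y. y \<in> R p \<Longrightarrow> x \<in> L (raise p y) \<Longrightarrow> b y x \<noteq> 0"
    "\<And>y. y \<in> R p \<Longrightarrow> expands Minus (L (raise p y)) (b y) (vec (raise p y)) (\<lambda>x. vec (lower (raise p y) x))"
    using b' by simp_all
  have u: "X Plus j k (vec p) = (\<Sum>d | (j, d) \<in> R p. scale (d powi k * a (j, d)) (vec (raise p (j, d))))"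
    if "j \<in> I" for j k using a(2) that by (simp add: expands_def)
  have "diag Minus (X Plus j k (vec p))" if "j \<in> I" for j k
    unfolding u[OF that] using assms R
    by (intro diag_sum diag_scale vec_diag_Minus) (auto simp: ready_def)
  moreover have "U Minus (i, c) (X Plus j k (vec p)) =
       (\<Sum>d | (j, d) \<in> R p. scale (d powi k * a (j, d)) (if (i, c) \<in> L (raise p (j, d))
          then scale (b (j, d) (i, c)) (vec (lower (raise p (j, d)) (i, c))) else 0))"
    if i: "i \<in> I" "c \<in> Z" "j \<in> I" for i c j k
  proof -
    have lU: "lin (U Minus (i, c))" using i by (simp add: linU)
    show ?thesis unfolding u[OF i(3)] lin_cong_sum[OF lU]
      by (intro sum.cong refl arg_cong[of _ _ "scale _"], subst expands_U[OF b(2)])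
        (use i R snd_LR(1) in auto)
  qed
  moreover have "a x * b x x = - rhz p x" if "x \<in> R p" for x
    using raise_lower_product[OF p that _ _ a(2) _ b(2)[OF that]] assms that unfolding ready_def by blast+
  ultimately have "expansion p a b" unfolding expansion_def using a b(1) by blast
  then show thesis using that by blast
qed

text \<open>Both claims say that a vector of lower weight is zero, so by \<open>killed\<close> it
  suffices to apply the raising modes. They lead to lowered vectors of the states
  \<open>raise p y\<close>, where the expansion is already known. In the second claim the only term
  that can survive is the one returning to \<open>p\<close>; its coefficient
  \<open>a x * b x x = - rhz p x\<close> cancels the residue from the commutator.\<close>

lemma ready_diag:
  assumes "ready p"
  shows "diag Minus (vec p)"
    and "i \<in> I \<Longrightarrow> c \<in> Z \<Longrightarrow> (i, c) \<notin> L p \<Longrightarrow> U Minus (i, c) (vec p) = 0"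
proof -
  have p: "p \<in> P" and g: "good p (vec p)" using assms unfolding ready_def by blast+
  obtain a b where E: "expansion p a b" using ready_expand[OF assms] .
  have ab: "\<And>x. x \<in> R p \<Longrightarrow> a x \<noteq> 0" "expands Plus (R p) a (vec p) (\<lambda>x. vec (raise p x))"
    "\<And>x y. y \<in> R p \<Longrightarrow> x \<in> L (raise p y) \<Longrightarrow> b y x \<noteq> 0"
    "\<And>j k. j \<in> I \<Longrightarrow> diag Minus (X Plus j k (vec p))"
    "\<And>i c j k. i \<in> I \<Longrightarrow> c \<in> Z \<Longrightarrow> j \<in> I \<Longrightarrow> U Minus (i, c) (X Plus j k (vec p)) =
       (\<Sum>d | (j, d) \<in> R p. scale (d powi k * a (j, d)) (if (i, c) \<in> L (raise p (j, d))
          then scale (b (j, d) (i, c)) (vec (lower (raise p (j, d)) (i, c))) else 0))"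
    "\<And>x. x \<in> R p \<Longrightarrow> a x * b x x = - rhz p x"
    using E unfolding expansion_def by blast+
  have Fv: "F e i n (vec p) = scale (gam p e i n) (vec p)" if "i \<in> I" for e i n
    using goodF g that by blast
  have Dv: "D (vec p) = scale (d0 * \<theta> ^ deg p) (vec p)" using goodD g by blast
  have XU: "X Plus j k (U Minus (i, c) (vec p)) = U Minus (i, c) (X Plus j k (vec p))
    + (if i = j then scale (rhz p (i, c) * c powi k) (vec p) else 0)"
    if "i \<in> I" "j \<in> I" "c \<in> Z" for i j c k
    using Xp_U[OF p _ that] Fv by blast
  have DU: "D (U Minus (i, c) (vec p)) = scale (d0 * \<theta> ^ Suc (deg p)) (U Minus (i, c) (vec p))"
    if "i \<in> I" for i c
    using that by (simp add: D_U Dv module_hom.scale[OF linU] mult.left_commute)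
  show "diag Minus (vec p)"
    unfolding diag_def
  proof (intro ballI allI)
    fix i m assume i: "i \<in> I"
    let ?S = "\<Sum>c\<in>Z. scale (c powi m) (U Minus (i, c) (vec p))"
    have "X Minus i m (vec p) - ?S = 0"
    proof (rule killed)
      show "D (X Minus i m (vec p) - ?S) = scale (d0 * \<theta> ^ Suc (deg p)) (X Minus i m (vec p) - ?S)"
        using i by (simp add: module_hom.diff[OF linD] lin_cong_sum[OF linD] DU DX Dv
            module_hom.scale[OF linX] scale_right_diff_distrib scale_sum_right mult_ac)
      fix j k assume j: "j \<in> I"
      have 1: "(if j = i then scale (kap j) (F Plus j (k + m) (vec p) - F Minus j (k + m) (vec p)) else 0)
          = (\<Sum>c\<in>Z. scale (c powi m) (if i = j then scale (rhz p (i, c) * c powi k) (vec p) else 0))"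
      proof (cases "i = j")
        case True
        have "scale (kap i) (F Plus i (k + m) (vec p) - F Minus i (k + m) (vec p))
          = scale (kap i * (gam p Plus i (k + m) - gam p Minus i (k + m))) (vec p)"
          using i by (simp add: Fv algebra_simps)
        then show ?thesis using True unfolding gam_rhz[OF p i]
          by (auto simp: scale_sum_left power_int_add nz_Z algebra_simps intro!: sum.cong)
      qed auto
      have 2: "X Minus i m (X Plus j k (vec p)) = (\<Sum>c\<in>Z. scale (c powi m) (U Minus (i, c) (X Plus j k (vec p))))"
        using diagD[OF ab(4)[OF j] i] .
      have "X Plus j k (X Minus i m (vec p)) =
        (\<Sum>c\<in>Z. scale (c powi m) (U Minus (i, c) (X Plus j k (vec p)))) +
        (\<Sum>c\<in>Z. scale (c powi m) (if i = j then scale (rhz p (i, c) * c powi k) (vec p) else 0))"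
        using XpXm[OF j i] 1 2 by simp
      also have "\<dots> = X Plus j k ?S"
        unfolding lin_cong_sum[OF linX[OF j]] using i j
        by (simp only: XU scale_right_distrib sum.distrib cong: sum.cong)
      finally show "X Plus j k (X Minus i m (vec p) - ?S) = 0"
        by (simp add: module_hom.diff[OF linX[OF j]])
    qed
    then show "X Minus i m (vec p) = ?S" by simp
  qed
  show "U Minus (i, c) (vec p) = 0" if i: "i \<in> I" "c \<in> Z" "(i, c) \<notin> L p" for i c
  proof (rule killed[OF DU[OF i(1)]])
    fix j k assume j: "j \<in> I"
    let ?t = "\<lambda>d. scale (d powi k * a (j, d)) (if (i, c) \<in> L (raise p (j, d))
          then scale (b (j, d) (i, c)) (vec (lower (raise p (j, d)) (i, c))) else 0)"
    \<comment> \<open>Otherwise the diamond of \<open>y\<close> and \<open>(i, c)\<close> at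
      \<open>raise p y\<close> would make \<open>(i, c)\<close> a lowering label of
      \<open>p\<close>.\<close>
    have 1: "(i, c) \<notin> L (raise p y)" if "y \<in> R p" "y \<noteq> (i, c)" for y
      using diamond_lower[of "raise p y" y "(i, c)"] raise[OF p that(1)] that i by auto
    have 2: "(i, c) \<in> L (raise p (i, c))" "lower (raise p (i, c)) (i, c) = p" if "(i, c) \<in> R p"
      using raise[OF p that] by auto
    have "finite {d. (j, d) \<in> R p}"
      using finLR(2)[OF p] finite_vimageI[of "R p" "Pair j"] by (auto simp: vimage_def inj_on_def)
    then have "(\<Sum>d | (j, d) \<in> R p. ?t d) = (\<Sum>d | (j, d) \<in> R p \<and> d = c \<and> i = j. ?t d)"
      using 1 by (intro sum.mono_neutral_right) auto
    also have "\<dots> = (if i = j \<and> (i, c) \<in> R p then scale (- rhz p (i, c) * c powi k) (vec p) else 0)"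
    proof (cases "i = j \<and> (i, c) \<in> R p")
      case True
      then have t: "j = i" "(i, c) \<in> R p" and e: "{d. (j, d) \<in> R p \<and> d = c \<and> i = j} = {c}" by auto
      have "scale (c powi k * a (i, c)) (scale (b (i, c) (i, c)) (vec p)) = scale (- rhz p (i, c) * c powi k) (vec p)"
        using ab(6)[OF t(2)] by (simp add: mult_ac)
      then show ?thesis unfolding e using 2[OF t(2)] t by simp
    next
      case False
      then have e: "{d. (j, d) \<in> R p \<and> d = c \<and> i = j} = {}" by auto
      show ?thesis unfolding e using False by auto
    qed
    finally show "X Plus j k (U Minus (i, c) (vec p)) = 0"
      unfolding XU[OF i(1) j i(2)] ab(5)[OF i(1,2) j] using i(3) by (auto simp: rhz_def)
  qed
qed

text \<open>Raising \<open>U Minus x (vec p)\<close> at \<open>x\<close> returns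
  \<open>vec p\<close> with the residue as coefficient, and the other raising moves pass through the
  lowering with coefficient \<open>a y * b y x\<close>. All of these are nonzero, and the one at
  \<open>x\<close> shows that the vector does not vanish.\<close>

lemma ready_lower:
  assumes "ready p" "x \<in> L p"
  shows "good (lower p x) (U Minus x (vec p))" "U Minus x (vec p) \<noteq> 0"
proof -
  obtain i c where x: "x = (i, c)" by (cases x)
  let ?p = "lower p x" and ?w = "U Minus x (vec p)"
  have p: "p \<in> P" and g: "good p (vec p)" and v: "vec p \<noteq> 0" using assms unfolding ready_def by blast+
  have i: "i \<in> I" "c \<in> Z" "c \<noteq> 0" using labels p assms x by auto
  have P: "?p \<in> P" "x \<in> R ?p" "raise ?p x = p" using lower p assms by auto
  obtain a b where E: "expansion p a b" using ready_expand[OF assms(1)] .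
  have ab: "\<And>x. x \<in> R p \<Longrightarrow> a x \<noteq> 0" "expands Plus (R p) a (vec p) (\<lambda>x. vec (raise p x))"
    "\<And>x y. y \<in> R p \<Longrightarrow> x \<in> L (raise p y) \<Longrightarrow> b y x \<noteq> 0"
    "\<And>j k. j \<in> I \<Longrightarrow> diag Minus (X Plus j k (vec p))"
    "\<And>i c j k. i \<in> I \<Longrightarrow> c \<in> Z \<Longrightarrow> j \<in> I \<Longrightarrow> U Minus (i, c) (X Plus j k (vec p)) =
       (\<Sum>d | (j, d) \<in> R p. scale (d powi k * a (j, d)) (if (i, c) \<in> L (raise p (j, d))
          then scale (b (j, d) (i, c)) (vec (lower (raise p (j, d)) (i, c))) else 0))"
    "\<And>x. x \<in> R p \<Longrightarrow> a x * b x x = - rhz p x"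
    using E unfolding expansion_def by blast+
  define h where "h y = (if y = x then rhz p x else a y * b y x)" for y
  have h0: "h y \<noteq> 0" if y: "y \<in> R ?p" for y
  proof (cases "y = x")
    case True
    then show ?thesis using rhz_nz[OF p, of x] assms(2) rho0[OF p, of x] by (simp add: h_def)
  next
    case False
    with y have "y \<in> R p" "x \<in> L (raise p y)" unfolding R_lower(1)[OF p assms(2)] by simp_all
    then show ?thesis using ab(1)[of y] ab(3)[of y x] False by (simp add: h_def)
  qed
  have ex: "expands Plus (R ?p) h ?w (\<lambda>y. vec (raise ?p y))"
    unfolding expands_def
  proof (intro ballI allI)
    fix j k assume j: "j \<in> I"
    let ?A = "{d. (j, d) \<in> R p \<and> x \<in> L (raise p (j, d))}"
    have fin: "finite {d. (j, d) \<in> R p}"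
      using finLR(2)[OF p] finite_vimageI[of "R p" "Pair j"] by (auto simp: vimage_def inj_on_def)
    have xR: "x \<notin> R p" using LR_disjoint p assms(2) by blast
    have "U Minus x (X Plus j k (vec p)) =
        (\<Sum>d\<in>?A. scale (d powi k) (scale (h (j, d)) (vec (raise ?p (j, d)))))"
      unfolding x ab(5)[OF i(1,2) j]
      by (rule sum.mono_neutral_cong_right)
        (use fin xR R_lower(2)[OF p assms(2)] in \<open>auto simp: h_def x\<close>)
    moreover have "{d. (j, d) \<in> R ?p} = (if i = j then insert c ?A else ?A)"
      unfolding R_lower(1)[OF p assms(2)] using x by auto
    moreover have "finite ?A" "c \<notin> ?A \<or> i \<noteq> j" using fin xR x by auto
    moreover have "X Plus j k ?w = U Minus x (X Plus j k (vec p))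
      + (if i = j then scale (rhz p x * c powi k) (vec p) else 0)"
      using Xp_U[OF p _ i(1) j i(2), of "vec p"] goodF[OF g] x by auto
    ultimately show "X Plus j k ?w =
       (\<Sum>d | (j, d) \<in> R ?p. scale (d powi k) (scale (h (j, d)) (vec (raise ?p (j, d)))))"
      using P(3) x by (auto simp: h_def mult.commute add.commute)
  qed
  show "good ?p ?w"
    using U_eigen[of p i c "vec p"] ex h0 p assms(2) g ready_diag(1)[OF assms(1)] unfolding good_def x
    by blast
  have "U Plus x ?w = scale (h x) (vec p)"
    using expands_U[OF ex snd_LR(2)[OF P(1)] i(1,2)] P x by simp
  then show "?w \<noteq> 0" using h0[OF P(2)] v linU[of x Plus] x i
    by (auto simp: module_hom.zero[OF linU])
qed

text \<open>For such a pair the factor \<open>q powi - B i j * c - d\<close> in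
  \<open>rhz_lower\<close> is zero, which would force the residue at the pole \<open>(i, c)\<close>
  to vanish. The inequality permits a division in \<open>good_unique\<close>.\<close>

lemma q_shift_neq:
  assumes p: "p \<in> P" "(i, c) \<in> R p" "(j, d) \<in> R p" "(i, c) \<noteq> (j, d)" and B: "B i j \<noteq> 0"
  shows "c \<noteq> q powi B i j * d"
proof
  assume c: "c = q powi B i j * d"
  have i: "i \<in> I" "c \<in> Z" "d \<noteq> 0" using labels p by blast+
  let ?r = "raise p (j, d)"
  have r: "?r \<in> P" "(j, d) \<in> L ?r" "lower ?r (j, d) = p" using raise p by auto
  have "rhz p (i, c) * (c - q powi - B i j * d) = rhz ?r (i, c) * (q powi - B i j * c - d)"
    using rhz_lower[OF r(1,2) i(1,2)] r(3) by simp
  also have "q powi - B i j * c - d = 0"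
    using q0 by (simp add: c power_int_minus)
  finally have "rhz p (i, c) = 0 \<or> q powi B i j = q powi - B i j" using i by (auto simp: c)
  moreover have "q powi B i j \<noteq> q powi - B i j"
  proof
    assume e: "q powi B i j = q powi - B i j"
    have "q powi (B i j + B i j) = q powi B i j * q powi B i j" using q0 by (intro power_int_add) simp
    also have "\<dots> = q powi B i j * q powi - B i j" using e by simp
    also have "\<dots> = 1" using q0 by (simp add: power_int_minus)
    finally show False using q_generic[of "B i j + B i j"] B by simp
  qed
  ultimately show False using rhz_nz p by blast
qed

text \<open>The scalar \<open>\<kappa>\<close> is chosen so that \<open>u = w' - \<kappa> w\<close>
  has no component at \<open>x\<close>. For any other label \<open>y\<close> the quadratic relation
  of the raising currents yields \<open>U Plus x (U Plus y u) = 0\<close>. But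
  \<open>U Plus x\<close> does not annihilate \<open>vec (raise p y)\<close>, as the diamond keeps
  \<open>x\<close> available there, so the component at \<open>y\<close> is zero as well. Hence all
  raising modes kill \<open>u\<close>.\<close>

lemma good_unique:
  assumes p: "p \<in> P" "x \<in> R p" and r: "\<And>y. y \<in> R p \<Longrightarrow> ready (raise p y)"
    and w: "good p w" "good p w'" "w' \<noteq> 0" and d: "deg p = Suc n"
  shows "\<exists>\<kappa>. \<kappa> \<noteq> 0 \<and> w' = scale \<kappa> w"
proof -
  obtain g where g: "\<And>y. y \<in> R p \<Longrightarrow> g y \<noteq> 0" "expands Plus (R p) g w (\<lambda>y. vec (raise p y))"
    using w goodX by blast
  obtain g' where g': "expands Plus (R p) g' w' (\<lambda>y. vec (raise p y))"
    using w goodX by blast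
  define \<kappa> where "\<kappa> = g' x / g x"
  define h where "h y = g' y - \<kappa> * g y" for y
  define u where "u = w' - scale \<kappa> w"
  have hx: "h x = 0" using g p by (simp add: h_def \<kappa>_def)
  have ex: "expands Plus (R p) h u (\<lambda>y. vec (raise p y))"
    unfolding expands_def
  proof (intro ballI allI)
    fix i m assume i: "i \<in> I"
    have "X Plus i m u = X Plus i m w' - scale \<kappa> (X Plus i m w)"
      using i by (simp add: u_def module_hom.diff[OF linX] module_hom.scale[OF linX])
    then show "X Plus i m u = (\<Sum>c | (i, c) \<in> R p. scale (c powi m) (scale (h (i, c)) (vec (raise p (i, c)))))"
      using g(2) g' i unfolding expands_def
      by (simp add: h_def scale_sum_right algebra_simps flip: sum_subtractf)
  qed
  obtain i c where x: "x = (i, c)" by (cases x)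
  have i: "i \<in> I" "c \<in> Z" "c \<noteq> 0" using labels p x by auto
  have lUx: "lin (U Plus x)" using linU x i by simp
  have Uy: "U Plus y u = scale (h y) (vec (raise p y))" if "y \<in> R p" for y
  proof -
    obtain j d where y: "y = (j, d)" by (cases y)
    then show ?thesis using expands_U[OF ex snd_LR(2)[OF p(1)], of j d] labels[of p j d] that p by auto
  qed
  have Ux: "U Plus x u = 0" using Uy p hx by simp
  have du: "diag Plus u" by (rule expands_diag[OF ex snd_LR(2)[OF p(1)]])
  have h0: "h y = 0" if y: "y \<in> R p" "y \<noteq> x" for y
  proof -
    obtain j d where yy: "y = (j, d)" by (cases y)
    have j: "j \<in> I" "d \<in> Z" "d \<noteq> 0" using labels[of p j d] y yy p by auto
    have dXu: "diag Plus (X Plus j m u)" for m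
    proof -
      have "diag Plus (vec (raise p (j, d)))" if "(j, d) \<in> R p" for d
        using r[OF that] good_diag_Plus unfolding ready_def by blast+
      then show ?thesis using ex j unfolding expands_def
        by (auto intro!: diag_sum diag_scale)
    qed
    have UU: "U Plus x (U Plus y u) = pk d (\<lambda>m. U Plus x (X Plus j m u))"
    proof -
      have "U Plus y u = pk d (\<lambda>m. X Plus j m u)" by (simp add: U_def yy)
      then show ?thesis using pk_lin[OF lUx, where f = "\<lambda>m. X Plus j m u"] by simp
    qed
    have "U Plus x (U Plus y u) = 0"
    proof (cases "B i j = 0")
      case True
      then have ne: "i \<noteq> j" using B_diag i by auto
      have "U Plus x (X Plus j m u) = X Plus j m (U Plus x u)" for m
        using pk_lin[OF linX[OF j(1)], where f = "\<lambda>n. X Plus i n u"] XX_commute[OF i(1) j(1) ne True]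
        by (simp add: U_def x)
      then show ?thesis using Ux j by (simp add: UU module_hom.zero[OF linX])
    next
      case False
      let ?Q = "q powi B i j"
      \<comment> \<open>Of the four terms of the quadratic relation, projected to \<open>c\<close>
        in the first current, the two containing \<open>U Plus x u\<close> vanish. Projecting the
        other two to \<open>d\<close> produces the factor \<open>c - ?Q * d\<close>.\<close>
      have "scale c (U Plus x (X Plus j m u)) = scale ?Q (U Plus x (X Plus j (m + 1) u))" for m
      proof -
        have "pk c (\<lambda>n. X Plus i (n + 1) (X Plus j m u) - scale ?Q (X Plus j m (X Plus i (n + 1) u)))
          = pk c (\<lambda>n. scale ?Q (X Plus i n (X Plus j (m + 1) u)) - X Plus j (m + 1) (X Plus i n u))"
          using XX[OF i(1) j(1), of Plus] by simp
        moreover have "pk c (\<lambda>n. X Plus j m (X Plus i (n + 1) u)) = 0"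
          using pk_lin[OF linX[OF j(1)], where f = "\<lambda>n. X Plus i (n + 1) u"] pk_shift[OF du i(1,2), of 1] Ux x
          by (simp add: module_hom.zero[OF linX[OF j(1)]])
        moreover have "pk c (\<lambda>n. X Plus j (m + 1) (X Plus i n u)) = 0"
          using pk_lin[OF linX[OF j(1)], where f = "\<lambda>n. X Plus i n u"] pk_shift[OF du i(1,2), of 0] Ux x
          by (simp add: module_hom.zero[OF linX[OF j(1)]])
        ultimately show ?thesis
          using pk_shift[OF dXu[of m] i(1,2), of 1] pk_shift[OF dXu[of "m + 1"] i(1,2), of 0]
          by (simp add: pk_diff pk_scale x)
      qed
      then have "pk d (\<lambda>m. scale c (U Plus x (X Plus j m u))) = pk d (\<lambda>m. scale ?Q (U Plus x (X Plus j (m + 1) u)))"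
        by simp
      also have "\<dots> = scale ?Q (scale d (U Plus x (U Plus y u)))"
        using pk_shift[OF du j(1,2), of 1] pk_lin[OF lUx, where f = "\<lambda>m. X Plus j (m + 1) u"]
        by (simp add: pk_scale module_hom.scale[OF lUx] yy)
      finally have "scale (c - ?Q * d) (U Plus x (U Plus y u)) = 0"
        by (simp add: pk_scale UU algebra_simps)
      moreover have "(i, c) \<noteq> (j, d)" using y(2) x yy by auto
      then have "c \<noteq> ?Q * d" by (rule q_shift_neq[OF p(1) p(2)[unfolded x] y(1)[unfolded yy] _ False])
      ultimately show ?thesis by (simp add: scale_eq_0_iff)
    qed
    moreover have "U Plus x (U Plus y u) = scale (h y) (U Plus x (vec (raise p y)))"
      using Uy[OF y(1)] by (simp add: module_hom.scale[OF lUx])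
    moreover have "U Plus x (vec (raise p y)) \<noteq> 0"
    proof -
      have xr: "x \<in> R (raise p y)" using diamond_raise[OF p(1) y(1) p(2) y(2)] by blast
      have P: "raise p y \<in> P" and g: "good (raise p y) (vec (raise p y))"
        and nz: "vec (raise (raise p y) x) \<noteq> 0"
        using r[OF y(1)] xr unfolding ready_def by blast+
      obtain a where a: "\<And>z. z \<in> R (raise p y) \<Longrightarrow> a z \<noteq> 0"
        "expands Plus (R (raise p y)) a (vec (raise p y)) (\<lambda>z. vec (raise (raise p y) z))"
        using g goodX by blast
      show ?thesis using expands_U[OF a(2) snd_LR(2)[OF P] i(1,2)] a(1)[OF xr] xr nz x
        by (auto simp: scale_eq_0_iff)
    qed
    ultimately show ?thesis by (simp add: scale_eq_0_iff)
  qed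
  have "u = 0"
  proof (rule killed)
    show "D u = scale (d0 * \<theta> ^ Suc n) u"
      using w d by (simp add: u_def good_def module_hom.diff[OF linD] module_hom.scale[OF linD]
          scale_right_diff_distrib mult_ac)
    show "X Plus i m u = 0" if "i \<in> I" for i m
    proof -
      have "h y = 0" if "y \<in> R p" for y using hx h0 that by blast
      then have "(\<Sum>c | (i, c) \<in> R p. scale (c powi m) (scale (h (i, c)) (vec (raise p (i, c))))) = 0"
        by (intro sum.neutral) simp
      then show ?thesis using ex that unfolding expands_def by simp
    qed
  qed
  then have "w' = scale \<kappa> w" by (simp add: u_def)
  then show ?thesis using w(3) by (intro exI[of _ \<kappa>]) auto
qed

text \<open>A lowering expansion in degree \<open>n\<close> compares two vectors of degree
  \<open>n + 1\<close>, which must already be known to be good; so \<open>good\<close> is carried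
  one degree ahead of \<open>good_lower\<close>.\<close>

lemma vec_good:
  "\<forall>p\<in>P. deg p \<le> n \<longrightarrow> vec p \<noteq> 0 \<and> good p (vec p) \<and> (deg p < n \<longrightarrow> good_lower p)"
proof (induction n)
  case 0
  then show ?case using deg_0 good_p0 vec_p0 v0(1) by auto
next
  case (Suc n)
  have ready: "ready p" if "p \<in> P" "deg p = n" for p
    using Suc that deg_raise[OF that(1)] raise[OF that(1)] unfolding ready_def
    by (metis le_eq_less_or_eq lessI less_imp_le)
  have new: "vec p \<noteq> 0 \<and> good p (vec p)" if p: "p \<in> P" "deg p = Suc n" for p
  proof -
    have q: "parent p \<in> R p" "vec p = U Minus (parent p) (vec (raise p (parent p)))"
      using vec_parent[OF p(1)] p p0 by (metis nat.distinct(1))+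
    then have "raise p (parent p) \<in> P" "parent p \<in> L (raise p (parent p))"
      "lower (raise p (parent p)) (parent p) = p" "deg (raise p (parent p)) = n"
      using raise deg_raise p by auto
    then show ?thesis using ready_lower[OF ready] q by metis
  qed
  have low: "good_lower p" if p: "p \<in> P" "deg p = n" for p
  proof -
    have "\<exists>\<kappa>. \<kappa> \<noteq> 0 \<and> U Minus x (vec p) = scale \<kappa> (vec (lower p x))" if x: "x \<in> L p" for x
    proof (rule good_unique)
      show "lower p x \<in> P" "x \<in> R (lower p x)" "deg (lower p x) = Suc n" using lower x p by auto
      then show "good (lower p x) (vec (lower p x))" using new by blast
      show "good (lower p x) (U Minus x (vec p))" "U Minus x (vec p) \<noteq> 0"
        using ready_lower[OF ready[OF p] x] by auto
      show "ready (raise (lower p x) y)" if "y \<in> R (lower p x)" for y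
        using that lower[OF p(1) x] deg_raise[of "lower p x" y] raise[of "lower p x" y] p
        by (intro ready) auto
    qed
    then obtain b where b: "\<And>x. x \<in> L p \<Longrightarrow> b x \<noteq> 0"
      "\<And>x. x \<in> L p \<Longrightarrow> U Minus x (vec p) = scale (b x) (vec (lower p x))" by metis
    have "expands Minus (L p) b (vec p) (\<lambda>x. vec (lower p x))"
      unfolding expands_def
    proof (intro ballI allI)
      fix i m assume i: "i \<in> I"
      have "X Minus i m (vec p) = (\<Sum>c\<in>Z. scale (c powi m) (U Minus (i, c) (vec p)))"
        by (rule diagD[OF ready_diag(1)[OF ready[OF p]] i])
      also have "\<dots> = (\<Sum>c | (i, c) \<in> L p. scale (c powi m) (scale (b (i, c)) (vec (lower p (i, c)))))"
        using ready_diag(2)[OF ready[OF p] i] b(2) snd_LR(1)[OF p(1)] finZ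
        by (intro sum.mono_neutral_cong_right) force+
      finally show "X Minus i m (vec p) = \<dots>" .
    qed
    then show ?thesis using b(1) unfolding good_lower_def by blast
  qed
  show ?case using Suc new low by (metis le_SucE less_Suc_eq_le order_le_less)
qed

theorem vec_nz: "p \<in> P \<Longrightarrow> vec p \<noteq> 0"
  and vec_F: "p \<in> P \<Longrightarrow> i \<in> I \<Longrightarrow> F e i n (vec p) = scale (gam p e i n) (vec p)"
  using vec_good[of "deg p"] by (auto simp: good_def)

text \<open>Each generator sends the vector of a state to a combination of vectors of states, so the
  span is a submodule, and it is nonzero.\<close>

theorem span_vec: "span (vec ` P) = UNIV"
proof -
  have g: "good p (vec p)" "good_lower p" if "p \<in> P" for p
    using vec_good[of "Suc (deg p)"] that by auto
  have "K e i v \<in> span (vec ` P)" if i: "i \<in> I" "v \<in> span (vec ` P)" for e i v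
  proof (rule lin_span_closed[OF linK[OF i(1)] _ i(2)])
    have "K e i (vec p) \<in> span (vec ` P)" if p: "p \<in> P" for p
    proof -
      obtain \<eta> where \<eta>: "K Plus i (vec p) = scale \<eta> (vec p)" using goodK[OF g(1)[OF p] i(1)] by blast
      then have v: "vec p = scale \<eta> (K Minus i (vec p))"
        using KK(1)[OF i(1), of "vec p"] by (simp add: module_hom.scale[OF linK[OF i(1)]])
      then have "\<eta> \<noteq> 0" using vec_nz[OF p] by auto
      then have "K Minus i (vec p) = scale (1 / \<eta>) (vec p)" by (subst v) simp
      then show ?thesis using \<eta> p by (cases e) (simp_all add: span_scale span_base)
    qed
    then show "K e i ` vec ` P \<subseteq> span (vec ` P)" by auto
  qed
  moreover have "H i n v \<in> span (vec ` P)" if i: "i \<in> I" "n \<noteq> 0" "v \<in> span (vec ` P)" for i n v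
  proof (rule lin_span_closed[OF linH[OF i(1,2)] _ i(3)])
    have "H i n (vec p) \<in> span (vec ` P)" if p: "p \<in> P" for p
    proof -
      obtain \<eta> where "H i n (vec p) = scale \<eta> (vec p)" using goodH[OF g(1)[OF p] i(1,2)] by blast
      then show ?thesis using p by (simp add: span_scale span_base)
    qed
    then show "H i n ` vec ` P \<subseteq> span (vec ` P)" by auto
  qed
  moreover have "X e i n v \<in> span (vec ` P)" if i: "i \<in> I" "v \<in> span (vec ` P)" for e i n v
  proof (rule lin_span_closed[OF linX[OF i(1)] _ i(2)])
    have "X e i n (vec p) \<in> span (vec ` P)" if p: "p \<in> P" for p
    proof (cases e)
      case Plus
      obtain a where "expands Plus (R p) a (vec p) (\<lambda>x. vec (raise p x))" using goodX[OF g(1)[OF p]] by blast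
      then have "X Plus i n (vec p)
          = (\<Sum>c | (i, c) \<in> R p. scale (c powi n) (scale (a (i, c)) (vec (raise p (i, c)))))"
        using i by (simp add: expands_def)
      then show ?thesis using raise[OF p] unfolding Plus
        by (simp only:) (intro span_sum span_scale span_base imageI, blast)
    next
      case Minus
      obtain b where "expands Minus (L p) b (vec p) (\<lambda>x. vec (lower p x))"
        using g(2)[OF p] unfolding good_lower_def by blast
      then have "X Minus i n (vec p)
          = (\<Sum>c | (i, c) \<in> L p. scale (c powi n) (scale (b (i, c)) (vec (lower p (i, c)))))"
        using i by (simp add: expands_def)
      then show ?thesis using lower[OF p] unfolding Minus
        by (simp only:) (intro span_sum span_scale span_base imageI, blast)
    qed
    then show "X e i n ` vec ` P \<subseteq> span (vec ` P)" by auto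
  qed
  ultimately have "span (vec ` P) = {0} \<or> span (vec ` P) = UNIV" by (intro irred subspace_span)
  moreover have "vec p0 \<in> span (vec ` P)" "vec p0 \<noteq> 0" using p0 vec_nz by (auto intro: span_base)
  ultimately show ?thesis by blast
qed

end

section \<open>Bi-infinite sequences under the shift\<close>

text \<open>Multiplication of the bilateral formal series with coefficients \<open>f n\<close> by
  the polynomial \<open>p\<close>. Two such series have no product in general, so a rational
  function enters only through the equation denominator times series = numerator, which its
  expansions at 0 and at infinity both satisfy.\<close>

definition cact :: "complex poly \<Rightarrow> (int \<Rightarrow> complex) \<Rightarrow> int \<Rightarrow> complex" where
  "cact p f n = (\<Sum>k\<le>degree p. coeff p k * f (n - int k))"

definition pcoeff :: "complex poly \<Rightarrow> int \<Rightarrow> complex" where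
  "pcoeff p n = (if 0 \<le> n then coeff p (nat n) else 0)"

lemma cact_eq: "degree p \<le> M \<Longrightarrow> cact p f n = (\<Sum>k\<le>M. coeff p k * f (n - int k))"
  unfolding cact_def by (rule sum.mono_neutral_left) (auto simp: coeff_eq_0)

lemma cact_0 [simp]: "cact 0 f n = 0"
  by (simp add: cact_def)

lemma cact_pCons: "cact (pCons a p) f n = a * f n + cact p f (n - 1)"
proof -
  have "cact (pCons a p) f n = (\<Sum>k\<le>Suc (degree p). coeff (pCons a p) k * f (n - int k))"
    by (rule cact_eq) (simp add: degree_pCons_le)
  then show ?thesis by (simp add: cact_def sum.atMost_Suc_shift algebra_simps del: sum.atMost_Suc)
qed

lemma cact_add: "cact (p + r) f n = cact p f n + cact r f n"
  using cact_eq[of p "max (degree p) (degree r)"] cact_eq[of r "max (degree p) (degree r)"]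
    cact_eq[of "p + r" "max (degree p) (degree r)"]
  by (simp add: degree_add_le_max algebra_simps sum.distrib)

lemma cact_smult: "cact (smult a p) f n = a * cact p f n"
  using cact_eq[of "smult a p" "degree p" f n] by (simp add: cact_def sum_distrib_left algebra_simps)

lemma cact_mult: "cact (p * r) f = cact p (cact r f)"
proof (induction p)
  case (pCons a p)
  then show ?case by (auto simp: fun_eq_iff cact_add cact_smult cact_pCons)
qed (simp add: fun_eq_iff)

lemma cact_scale: "cact p (\<lambda>n. a * f n) n = a * cact p f n"
  by (simp add: cact_def sum_distrib_left algebra_simps)

lemma cact_diff: "cact p (\<lambda>n. f n - g n) n = cact p f n - cact p g n"
  by (simp add: cact_def sum_subtractf algebra_simps)

lemma cact_pcoeff: "cact p (pcoeff r) = pcoeff (p * r)"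
proof (induction p)
  case 0
  then show ?case by (simp add: fun_eq_iff pcoeff_def)
next
  case (pCons a p)
  have "pcoeff (pCons 0 s) n = pcoeff s (n - 1)" for s n
    by (auto simp: pcoeff_def coeff_pCons nat_diff_distrib split: nat.splits)
  moreover have "pcoeff (u + v) n = pcoeff u n + pcoeff v n" "pcoeff (smult a u) n = a * pcoeff u n" for u v n
    by (auto simp: pcoeff_def)
  ultimately show ?case using pCons by (auto simp: fun_eq_iff cact_pCons)
qed

text \<open>On series with a lowest exponent, multiplication by a nonzero polynomial is injective:
  the lowest term meets the lowest coefficient of \<open>p\<close>. The companion
  \<open>cact_eq_0_above\<close> uses the leading coefficient instead.\<close>

lemma cact_eq_0_below:
  assumes "p \<noteq> 0" "\<And>n. cact p f n = 0" "\<And>n. n < m \<Longrightarrow> f n = 0"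
  shows "f n = 0"
proof -
  define d where "d = (LEAST k. coeff p k \<noteq> 0)"
  have ex: "\<exists>k. coeff p k \<noteq> 0" using assms(1) leading_coeff_neq_0 by blast
  have d: "coeff p d \<noteq> 0" "\<And>k. k < d \<Longrightarrow> coeff p k = 0"
    unfolding d_def using LeastI_ex[OF ex] not_less_Least by blast+
  then have dd: "d \<le> degree p" by (simp add: le_degree)
  have "f (m + int l - 1) = 0" for l
  proof (induction l rule: less_induct)
    case (less l)
    have low: "f n = 0" if "n < m + int l - 1" for n
    proof (cases "n < m")
      case False
      then have "f (m + int (nat (n - m + 1)) - 1) = 0" using that by (intro less) auto
      then show ?thesis using False by simp
    qed (use assms(3) in auto)
    have "0 = cact p f (m + int l - 1 + int d)" by (simp add: assms(2))
    also have "\<dots> = (\<Sum>k\<le>degree p. if k = d then coeff p d * f (m + int l - 1) else 0)"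
      unfolding cact_def
    proof (rule sum.cong)
      fix k show "coeff p k * f (m + int l - 1 + int d - int k) = (if k = d then coeff p d * f (m + int l - 1) else 0)"
        using d low[of "m + int l - 1 + int d - int k"] by (cases k d rule: linorder_cases) auto
    qed auto
    finally show ?case using d dd by (simp add: sum.delta)
  qed
  from this[of "nat (n - m + 1)"] assms(3)[of n] show ?thesis by (cases "n < m") auto
qed

lemma cact_eq_0_above:
  assumes "p \<noteq> 0" "\<And>n. cact p f n = 0" "\<And>n. n > m \<Longrightarrow> f n = 0"
  shows "f n = 0"
proof -
  let ?d = "degree p"
  have d: "coeff p ?d \<noteq> 0" using assms(1) by simp
  have "f (m - int l + 1) = 0" for l
  proof (induction l rule: less_induct)
    case (less l)
    have low: "f n = 0" if "n > m - int l + 1" for n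
    proof (cases "n > m")
      case False
      then have "f (m - int (nat (m - n + 1)) + 1) = 0" using that by (intro less) auto
      then show ?thesis using False by simp
    qed (use assms(3) in auto)
    have "0 = cact p f (m - int l + 1 + int ?d)" by (simp add: assms(2))
    also have "\<dots> = (\<Sum>k\<le>degree p. if k = ?d then coeff p ?d * f (m - int l + 1) else 0)"
      unfolding cact_def
    proof (rule sum.cong)
      fix k assume "k \<in> {..degree p}"
      then show "coeff p k * f (m - int l + 1 + int ?d - int k) = (if k = ?d then coeff p ?d * f (m - int l + 1) else 0)"
        using low[of "m - int l + 1 + int ?d - int k"] by (cases "k = ?d") auto
    qed auto
    finally show ?case using d by (simp add: sum.delta)
  qed
  from this[of "nat (m - n + 1)"] assms(3)[of n] show ?thesis by (cases "n > m") auto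
qed

lemma cact_linear: "cact [:1, - c:] f n = f n - c * f (n - 1)"
  by (simp add: cact_pCons)

text \<open>A linear recurrence with distinct nonzero characteristic roots. By induction the image
  \<open>g\<close> under one factor is an exponential sum; dividing its coefficients by
  \<open>1 - c / d\<close> gives a particular solution, and the remainder is geometric with ratio
  \<open>c\<close>.\<close>

lemma cact_prod_eq_0:
  assumes "finite C" "0 \<notin> C" "\<And>n. cact (\<Prod>c\<in>C. [:1, - c:]) f n = 0"
  shows "\<exists>\<rho>. \<forall>n. f n = (\<Sum>c\<in>C. \<rho> c * c powi n)"
  using assms
proof (induction C arbitrary: f rule: finite_induct)
  case empty
  then show ?case by (simp add: cact_pCons one_pCons)
next
  case (insert c C)
  define g where "g = cact [:1, - c:] f"
  have "cact (\<Prod>c\<in>C. [:1, - c:]) g n = 0" for n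
    using insert.prems(2)[of n] insert.hyps by (simp add: g_def mult.commute flip: cact_mult)
  then have "\<exists>\<rho>. \<forall>n. g n = (\<Sum>d\<in>C. \<rho> d * d powi n)" using insert.prems(1) by (intro insert.IH) auto
  then obtain \<rho> where \<rho>: "\<And>n. g n = (\<Sum>d\<in>C. \<rho> d * d powi n)" by blast
  define \<sigma> where "\<sigma> d = \<rho> d / (1 - c / d)" for d
  define h where "h n = f n - (\<Sum>d\<in>C. \<sigma> d * d powi n)" for n
  have h1: "h n = c * h (n - 1)" for n
  proof -
    have "\<sigma> d * d powi n - c * (\<sigma> d * d powi (n - 1)) = \<rho> d * d powi n" if "d \<in> C" for d
    proof -
      have "d \<noteq> 0" "d \<noteq> c" using that insert by auto
      then have d: "d powi (n - 1) = d powi n / d" "1 - c / d \<noteq> 0" by (auto simp: power_int_diff)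
      have "\<sigma> d * d powi n - c * (\<sigma> d * d powi (n - 1)) = (\<sigma> d * (1 - c / d)) * d powi n"
        unfolding d(1) by (simp add: algebra_simps)
      also have "\<sigma> d * (1 - c / d) = \<rho> d" using d(2) by (simp add: \<sigma>_def)
      finally show ?thesis .
    qed
    then have "(\<Sum>d\<in>C. \<sigma> d * d powi n) - c * (\<Sum>d\<in>C. \<sigma> d * d powi (n - 1)) = g n"
      unfolding \<rho> sum_distrib_left sum_subtractf[symmetric] by (intro sum.cong) auto
    then show ?thesis unfolding h_def g_def cact_linear by (simp add: algebra_simps)
  qed
  have c: "c \<noteq> 0" using insert by auto
  have h2: "h n = h 0 * c powi n" for n
  proof (induction n rule: int_induct[where k = 0])
    case (step1 i)
    then show ?case using h1[of "i + 1"] c by (simp add: power_int_add)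
  next
    case (step2 i)
    then show ?case using h1[of i] c by (simp add: power_int_diff field_simps)
  qed simp
  have h3: "(\<Sum>d\<in>insert c C. (if d = c then h 0 else \<sigma> d) * d powi n)
      = h 0 * c powi n + (\<Sum>d\<in>C. \<sigma> d * d powi n)" for n
  proof -
    have "(\<Sum>d\<in>C. (if d = c then h 0 else \<sigma> d) * d powi n) = (\<Sum>d\<in>C. \<sigma> d * d powi n)"
      using insert.hyps by (intro sum.cong) auto
    then show ?thesis using insert.hyps by simp
  qed
  have "f n = h n + (\<Sum>d\<in>C. \<sigma> d * d powi n)" for n
    by (simp add: h_def)
  then have "f n = (\<Sum>d\<in>insert c C. (if d = c then h 0 else \<sigma> d) * d powi n)" for n
    using h2[of n] h3[of n] by simp
  then have "\<forall>n. f n = (\<Sum>d\<in>insert c C. (if d = c then h 0 else \<sigma> d) * d powi n)" ..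
  then show ?case by (rule exI[where x = "\<lambda>d. if d = c then h 0 else \<sigma> d"])
qed

lemma fps_mult_divide:
  fixes f g :: "complex fps"
  assumes "fps_nth g 0 \<noteq> 0" shows "g * (f / g) = f"
proof -
  have "g dvd f" by (rule unit_imp_dvd) (simp add: fps_is_unit_iff assms)
  then show ?thesis by (rule dvd_mult_div_cancel)
qed

lemma fps_quotient_cact:
  assumes "coeff den 0 \<noteq> 0" and "\<And>n. f n = (if 0 \<le> n then w * fps_nth (fps_of_poly num / fps_of_poly den) (nat n) else 0)"
  shows "cact den f n = w * pcoeff num n"
proof (cases "0 \<le> n")
  case False
  then show ?thesis by (simp add: cact_def pcoeff_def assms(2))
next
  case True
  define m where "m = nat n"
  have m: "n = int m" unfolding m_def using True by (rule nat_0_le[symmetric])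
  let ?g = "fps_of_poly num / fps_of_poly den"
  have "fps_of_poly den * ?g = fps_of_poly num"
    using assms(1) by (intro fps_mult_divide) simp
  then have "coeff num m = (\<Sum>k=0..m. coeff den k * fps_nth ?g (m - k))"
    using fps_mult_nth[of "fps_of_poly den" ?g m] by simp
  moreover have "cact den f n = (\<Sum>k\<le>max m (degree den). coeff den k * f (n - int k))"
    by (rule cact_eq) simp
  moreover have "\<dots> = (\<Sum>k=0..m. coeff den k * f (n - int k))"
    by (rule sum.mono_neutral_right) (auto simp: assms(2) m)
  moreover have "\<dots> = w * (\<Sum>k=0..m. coeff den k * fps_nth ?g (m - k))"
    by (auto simp: sum_distrib_left assms(2) m nat_diff_distrib intro!: sum.cong)
  ultimately show ?thesis by (simp add: pcoeff_def m)
qed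

text \<open>The expansion at infinity solves the same equation as the one at 0, with the same
  constant \<open>w\<close>, because numerator and denominator have equal degree. Exponent
  \<open>n\<close> of the product is coefficient \<open>degree den - n\<close> of the product of the
  reflected series.\<close>

lemma fps_quotient_reflect_cact:
  assumes den: "den \<noteq> 0" "degree num = degree den"
    and f: "\<And>n. f n = (if n \<le> 0 then
      w * fps_nth (fps_of_poly (reflect_poly num) / fps_of_poly (reflect_poly den)) (nat (- n)) else 0)"
  shows "cact den f n = w * pcoeff num n"
proof (cases "n \<le> int (degree den)")
  case False
  then show ?thesis by (auto simp: cact_def pcoeff_def f den coeff_eq_0 nat_less_iff)
next
  case True
  let ?d = "degree den" and ?g = "fps_of_poly (reflect_poly num) / fps_of_poly (reflect_poly den)"
  define r where "r = nat (int ?d - n)"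
  have r: "n = int ?d - int r" using True by (simp add: r_def)
  have "fps_of_poly (reflect_poly den) * ?g = fps_of_poly (reflect_poly num)"
    using den(1) by (intro fps_mult_divide) simp
  then have "coeff (reflect_poly num) r = (\<Sum>k=0..r. coeff (reflect_poly den) k * fps_nth ?g (r - k))"
    using fps_mult_nth[of "fps_of_poly (reflect_poly den)" ?g r] by simp
  moreover have "cact den f n = (\<Sum>k\<le>?d. coeff den (?d - k) * f (n - int (?d - k)))"
    unfolding cact_def by (rule sum.reindex_bij_witness[of _ "\<lambda>k. ?d - k" "\<lambda>k. ?d - k"]) auto
  moreover have "\<dots> = (\<Sum>k\<le>max ?d r. coeff (reflect_poly den) k * f (int k - int r))"
    by (rule sum.mono_neutral_cong_left) (auto simp: coeff_reflect_poly r of_nat_diff)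
  moreover have "\<dots> = (\<Sum>k=0..r. coeff (reflect_poly den) k * f (int k - int r))"
    by (rule sum.mono_neutral_right) (auto simp: f)
  moreover have "\<dots> = w * (\<Sum>k=0..r. coeff (reflect_poly den) k * fps_nth ?g (r - k))"
    by (auto simp: sum_distrib_left f nat_diff_distrib intro!: sum.cong)
  moreover have "coeff (reflect_poly num) r = pcoeff num n"
    by (auto simp: coeff_reflect_poly pcoeff_def den(2) r nat_diff_distrib)
  ultimately show ?thesis by simp
qed

section \<open>The \<open>l\<close>-weight of a monomial\<close>

definition linprod :: "complex set \<Rightarrow> (complex \<Rightarrow> nat) \<Rightarrow> complex poly" where
  "linprod S e = (\<Prod>c\<in>S. [:1, - c:] ^ e c)"

lemma linprod_mult: "linprod S e * linprod S e' = linprod S (\<lambda>c. e c + e' c)"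
  by (simp add: linprod_def prod.distrib power_add)

lemma linprod_nz: "linprod S e \<noteq> 0"
  by (cases "finite S") (auto simp: linprod_def)

lemma linprod_coeff_0: "coeff (linprod S e) 0 = 1"
  by (simp add: linprod_def flip: poly_0_coeff_0) (simp add: poly_prod)

text \<open>The exponent is read off as a root multiplicity at \<open>1 / c\<close>;
  \<open>c = 0\<close> is excluded because its factor is the constant 1.\<close>

lemma order_linprod:
  assumes "finite S" "0 \<notin> S" "c \<in> S"
  shows "order (1 / c) (linprod S e) = e c"
proof -
  have c0: "c \<noteq> 0" using assms by auto
  have 1: "order (1 / c) ([:1, - d:] ^ k) = (if d = c then k else 0)" if "d \<noteq> 0" "c \<noteq> 0" for d k
  proof (cases "d = c")
    case True
    have "[:1, - c:] = smult (- c) [:- (1 / c), 1:]" using that by simp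
    then have "[:1, - c:] ^ k = smult ((- c) ^ k) ([:- (1 / c), 1:] ^ k)"
      by (simp only: smult_power)
    then show ?thesis using True that by (simp add: order_smult order_power_n_n del: power_minus)
  next
    case False
    have "poly ([:1, - d:] ^ k) (1 / c) \<noteq> 0" using False that by (auto simp: field_simps)
    then show ?thesis using False by (simp add: order_0I)
  qed
  have "order (1 / c) (linprod T e) = (if c \<in> T then e c else 0)" if "finite T" "0 \<notin> T" for T
    using that
  proof (induction T rule: finite_induct)
    case (insert d T)
    have "linprod (insert d T) e = [:1, - d:] ^ e d * linprod T e"
      using insert by (simp add: linprod_def)
    moreover have "[:1, - d:] ^ e d * linprod T e \<noteq> 0" using linprod_nz by auto
    ultimately show ?case using insert c0 1[of d "e d"] by (auto simp: order_mult)
  qed (simp add: linprod_def order_0I)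
  then show ?thesis using assms by simp
qed

text \<open>The order of the pole at \<open>u = 1 / c\<close>. With \<open>r = rlen ty N i\<close>,
  a variable of node \<open>i\<close> with parameter \<open>b\<close> has a pole for
  \<open>c = b * q powi r\<close> and a zero for \<open>c = b * q powi - r\<close>.\<close>

definition ordm :: "cartan_type \<Rightarrow> nat \<Rightarrow> complex \<Rightarrow> monomial \<Rightarrow> nat \<Rightarrow> complex \<Rightarrow> int" where
  "ordm ty N q m i c = Poly_Mapping.lookup m (i, c * q powi - rlen ty N i)
     - Poly_Mapping.lookup m (i, c * q powi rlen ty N i)"

definition wtm :: "monomial \<Rightarrow> nat \<Rightarrow> int" where
  "wtm m i = int (degree (Qpoly m i)) - int (degree (Rpoly m i))"

text \<open>Indexed by the exponent of \<open>u\<close> for both signs, so that \<open>Minus\<close>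
  lives on \<open>n \<le> 0\<close>. Extended by zero, the two expansions become bilateral sequences
  that can be subtracted.\<close>

definition gext :: "cartan_type \<Rightarrow> nat \<Rightarrow> complex \<Rightarrow> monomial \<Rightarrow> pm \<Rightarrow> nat \<Rightarrow> int \<Rightarrow> complex" where
  "gext ty N q m e i n = (if 0 \<le> sg e * n then gamma ty N q m e i (nat (sg e * n)) else 0)"

lemma pcompose_linprod:
  assumes "finite T" "s \<noteq> 0" "finite S" "(\<lambda>b. b * s) ` T \<subseteq> S" "\<And>b. b \<notin> T \<Longrightarrow> e b = 0"
  shows "pcompose (\<Prod>b\<in>T. [:1, - b:] ^ e b) [:0, s:] = linprod S (\<lambda>c. e (c / s))"
proof -
  have "pcompose (\<Prod>b\<in>T. [:1, - b:] ^ e b) [:0, s:] = (\<Prod>b\<in>T. [:1, - (b * s):] ^ e b)"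
  proof -
    have "pcompose (p ^ k) r = pcompose p r ^ k" for p r :: "complex poly" and k
      by (induction k) (auto simp: pcompose_mult pcompose_1)
    then show ?thesis
      by (simp add: pcompose_prod pcompose_pCons mult.commute)
  qed
  also have "\<dots> = (\<Prod>c\<in>(\<lambda>b. b * s) ` T. [:1, - c:] ^ e (c / s))"
    using assms(2) by (subst prod.reindex) (auto simp: inj_on_def)
  also have "\<dots> = (\<Prod>c\<in>S. [:1, - c:] ^ e (c / s))"
  proof (rule prod.mono_neutral_left)
    show "\<forall>c\<in>S - (\<lambda>b. b * s) ` T. [:1, - c:] ^ e (c / s) = 1"
    proof
      fix c assume c: "c \<in> S - (\<lambda>b. b * s) ` T"
      have "c / s \<notin> T"
      proof
        assume "c / s \<in> T"
        then have "c / s * s \<in> (\<lambda>b. b * s) ` T" by (rule imageI)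
        then show False using c assms(2) by simp
      qed
      then show "[:1, - c:] ^ e (c / s) = 1" using assms(5) by simp
    qed
  qed (use assms in auto)
  finally show ?thesis by (simp add: linprod_def)
qed

context
  fixes ty :: cartan_type and N :: nat and q :: complex
  assumes q0: "q \<noteq> 0" and qroot: "\<And>n::nat. n > 0 \<Longrightarrow> q ^ n \<noteq> 1"
begin

abbreviation (input) "rl i \<equiv> rlen ty N i"

lemma finite_keys: "finite {b. Poly_Mapping.lookup m (i, b) \<noteq> 0}"
proof -
  have "finite (Pair i -` Poly_Mapping.keys m)" by (intro finite_vimageI) (auto simp: inj_on_def)
  then show ?thesis by (simp add: vimage_def in_keys_iff)
qed

text \<open>All \<open>c\<close> for which \<open>1 / c\<close> can be a root of the numerator or of
  the denominator, before cancellation.\<close>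

definition suppS :: "monomial \<Rightarrow> nat \<Rightarrow> complex set" where
  "suppS m i = (\<lambda>b. b * q powi rl i) ` {b. Poly_Mapping.lookup m (i, b) \<noteq> 0} \<union>
     (\<lambda>b. b * q powi - rl i) ` {b. Poly_Mapping.lookup m (i, b) \<noteq> 0}"

lemma finite_suppS: "finite (suppS m i)"
  by (simp add: suppS_def finite_keys)

lemma lookup_0: "m \<in> monomials N \<Longrightarrow> Poly_Mapping.lookup m (i, 0) = 0"
  by (auto simp: monomials_def in_keys_iff)

lemma suppS_0: "m \<in> monomials N \<Longrightarrow> 0 \<notin> suppS m i"
  using q0 lookup_0[of m i] by (auto simp: suppS_def)

definition numexp :: "monomial \<Rightarrow> nat \<Rightarrow> complex \<Rightarrow> nat" where
  "numexp m i c = nat (Poly_Mapping.lookup m (i, c * q powi rl i)) + nat (- Poly_Mapping.lookup m (i, c * q powi - rl i))"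

definition denexp :: "monomial \<Rightarrow> nat \<Rightarrow> complex \<Rightarrow> nat" where
  "denexp m i c = nat (Poly_Mapping.lookup m (i, c * q powi - rl i)) + nat (- Poly_Mapping.lookup m (i, c * q powi rl i))"

lemma num_den_ord: "int (denexp m i c) - int (numexp m i c) = ordm ty N q m i c"
  by (simp add: numexp_def denexp_def ordm_def)

lemma powi_inv: "c / q powi k = c * q powi - k"
  using q0 by (simp add: power_int_minus divide_inverse)

lemma gamma_num_den:
  assumes "finite S" "suppS m i \<subseteq> S"
  shows "gamma_num ty N q m i = linprod S (numexp m i)"
    and "gamma_den ty N q m i = linprod S (denexp m i)"
proof -
  have f: "finite {b. Poly_Mapping.lookup m (i, b) > 0}" "finite {b. Poly_Mapping.lookup m (i, b) < 0}"
    using finite_keys[of m i] by (auto elim: rev_finite_subset)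
  have Q: "pcompose (Qpoly m i) [:0, s:] = linprod S (\<lambda>c. nat (Poly_Mapping.lookup m (i, c / s)))"
    and R: "pcompose (Rpoly m i) [:0, s:] = linprod S (\<lambda>c. nat (- Poly_Mapping.lookup m (i, c / s)))"
    if "s = q powi rl i \<or> s = q powi - rl i" for s
  proof -
    have s: "s \<noteq> 0" using that q0 by auto
    have sub: "b * s \<in> S" if "Poly_Mapping.lookup m (i, b) \<noteq> 0" for b
      using that assms(2) \<open>s = _ \<or> s = _\<close> unfolding suppS_def by blast
    show "pcompose (Qpoly m i) [:0, s:] = linprod S (\<lambda>c. nat (Poly_Mapping.lookup m (i, c / s)))"
      unfolding Qpoly_def by (rule pcompose_linprod[OF f(1) s assms(1)]) (auto intro: sub)
    show "pcompose (Rpoly m i) [:0, s:] = linprod S (\<lambda>c. nat (- Poly_Mapping.lookup m (i, c / s)))"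
      unfolding Rpoly_def by (rule pcompose_linprod[OF f(2) s assms(1)]) (auto intro: sub)
  qed
  show "gamma_num ty N q m i = linprod S (numexp m i)"
    unfolding gamma_num_def by (simp add: Q R linprod_mult powi_inv numexp_def[abs_def])
  show "gamma_den ty N q m i = linprod S (denexp m i)"
    unfolding gamma_den_def by (simp add: Q R linprod_mult powi_inv denexp_def[abs_def])
qed

lemma degree_num_den: "degree (gamma_num ty N q m i) = degree (gamma_den ty N q m i)"
proof -
  have nz: "gamma_num ty N q m i \<noteq> 0" "gamma_den ty N q m i \<noteq> 0"
    using gamma_num_den[OF finite_suppS order.refl] linprod_nz by simp_all
  then show ?thesis using q0
    by (simp add: gamma_num_def gamma_den_def degree_mult_eq degree_pcompose)
qed

definition qwt :: "monomial \<Rightarrow> nat \<Rightarrow> complex" where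
  "qwt m i = q powi (rl i * wtm m i)"

text \<open>The equation is the same for both signs; the later identities between l-weights are
  derived from it by cancelling polynomials.\<close>

lemma cact_gext: "cact (gamma_den ty N q m i) (gext ty N q m e i) n = qwt m i * pcoeff (gamma_num ty N q m i) n"
proof (cases e)
  case Plus
  have "coeff (gamma_den ty N q m i) 0 \<noteq> 0"
    using gamma_num_den[OF finite_suppS order.refl] linprod_coeff_0 by simp
  then show ?thesis
    by (rule fps_quotient_cact) (simp add: gext_def gamma_def Plus qwt_def wtm_def)
next
  case Minus
  have "gamma_den ty N q m i \<noteq> 0"
    using gamma_num_den[OF finite_suppS order.refl] linprod_nz by simp
  then show ?thesis using degree_num_den
    by (rule fps_quotient_reflect_cact) (simp add: gext_def gamma_def Minus qwt_def wtm_def)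
qed

text \<open>Bilateral series can be annihilated by polynomials, but for a fixed sign the combination
  is supported on a half line, so \<open>p\<close> can be cancelled: bounded below for
  \<open>Plus\<close>, and for \<open>Minus\<close> bounded above by the sum of the degrees
  involved.\<close>

lemma gext_sided:
  assumes "p \<noteq> 0" "\<And>n. cact p (\<lambda>n. a * cact r (gext ty N q m e i) n
      + a' * cact r' (gext ty N q m' e i) n + b * pcoeff A n) n = 0"
  shows "a * cact r (gext ty N q m e i) n + a' * cact r' (gext ty N q m' e i) n + b * pcoeff A n = 0"
proof (cases e)
  case Plus
  show ?thesis
    by (rule cact_eq_0_below[OF assms, where m = 0])
       (auto simp: Plus cact_def gext_def pcoeff_def)
next
  case Minus
  show ?thesis
  proof (rule cact_eq_0_above[OF assms(1)])
    show "cact p (\<lambda>n. a * cact r (gext ty N q m e i) n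
      + a' * cact r' (gext ty N q m' e i) n + b * pcoeff A n) n = 0" for n by (rule assms(2))
    fix n assume "n > int (degree r) + int (degree r') + int (degree A)"
    then show "a * cact r (gext ty N q m e i) n + a' * cact r' (gext ty N q m' e i) n + b * pcoeff A n = 0"
      by (auto simp: Minus cact_def gext_def pcoeff_def coeff_eq_0)
  qed
qed

lemma pcoeff_smult: "pcoeff (smult a p) n = a * pcoeff p n"
  by (simp add: pcoeff_def)

lemma pcoeff_inj: "(\<And>n. pcoeff p n = pcoeff r n) \<Longrightarrow> p = r"
  by (rule poly_eqI) (metis nat_int of_nat_0_le_iff pcoeff_def)

lemma cact_comb: "cact p (\<lambda>n. a * f n + a' * g n + b * h n) n
    = a * cact p f n + a' * cact p g n + b * cact p h n"
  by (simp add: cact_def sum_distrib_left sum.distrib algebra_simps)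

lemma cact_lift:
  assumes "\<And>n. cact p f n = a * pcoeff r n"
  shows "cact (s * p) f n = a * pcoeff (s * r) n"
proof -
  have "cact p f = (\<lambda>n. a * pcoeff r n)" using assms by blast
  then show ?thesis by (simp add: cact_mult cact_scale cact_pcoeff)
qed

lemma cact_gext_linprod:
  assumes "finite S" "suppS m i \<subseteq> S"
  shows "cact (linprod S (denexp m i)) (gext ty N q m e i) n = qwt m i * pcoeff (linprod S (numexp m i)) n"
  using cact_gext[of m i e n] gamma_num_den[OF assms] by simp

text \<open>Passes from the defining fraction, which may have common factors, to any fraction with
  the same pole orders, in particular to the reduced one.\<close>

lemma gext_num_den:
  assumes S: "finite S" "suppS m i \<subseteq> S" and e: "\<And>c. int (f c) - int (g c) = ordm ty N q m i c"
  shows "cact (linprod S f) (gext ty N q m e i) n = qwt m i * pcoeff (linprod S g) n"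
proof -
  let ?den = "linprod S (denexp m i)" and ?num = "linprod S (numexp m i)" and ?f = "linprod S f"
  have eq: "?f * ?num = ?den * linprod S g"
  proof -
    have "f c + numexp m i c = denexp m i c + g c" for c using e[of c] num_den_ord[of m i c] by linarith
    then show ?thesis by (simp add: linprod_mult)
  qed
  have "1 * cact ?f (gext ty N q m e i) n + 0 * cact 0 (gext ty N q m e i) n
    + (- qwt m i) * pcoeff (linprod S g) n = 0"
  proof (rule gext_sided[where p = ?den])
    fix n
    show "cact ?den (\<lambda>n. 1 * cact ?f (gext ty N q m e i) n + 0 * cact 0 (gext ty N q m e i) n
        + (- qwt m i) * pcoeff (linprod S g) n) n = 0"
      unfolding cact_comb cact_mult[symmetric] cact_pcoeff
      using cact_lift[OF cact_gext_linprod[OF S], of ?f e n] eq by (simp add: mult.commute)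
  qed (simp add: linprod_nz)
  then show ?thesis by simp
qed

lemma poly_linprod: "poly (linprod S e) x = (\<Prod>c\<in>S. (1 - c * x) ^ e c)"
  by (simp add: linprod_def poly_prod algebra_simps)

lemma cact_geometric: "c \<noteq> 0 \<Longrightarrow> cact p (\<lambda>n. c powi n) n = poly p (1 / c) * c powi n"
  by (induction p arbitrary: n) (auto simp: cact_pCons power_int_diff algebra_simps)

lemma cact_sum: "cact p (\<lambda>n. \<Sum>d\<in>C. a d * f d n) n = (\<Sum>d\<in>C. a d * cact p (f d) n)"
  unfolding cact_def sum_distrib_left by (subst sum.swap) (simp add: algebra_simps)

text \<open>The difference of the two expansions is annihilated by the reduced denominator, whose
  roots are simple, so it is an exponential sum. If the coefficient at \<open>c\<close> were zero,
  multiplying by the remaining factors would already make the two expansions agree. Their common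
  value is supported on a bounded interval and is a polynomial, so \<open>1 - c u\<close> would
  divide the reduced numerator, contrary to \<open>c\<close> being a pole.\<close>

lemma gext_poles:
  assumes m: "m \<in> monomials N" and le: "\<And>c. ordm ty N q m i c \<le> 1"
  defines "C \<equiv> {c. ordm ty N q m i c = 1}"
  shows "finite C" "0 \<notin> C"
    and "\<exists>\<rho>. (\<forall>c\<in>C. \<rho> c \<noteq> 0) \<and>
      (\<forall>n. gext ty N q m Plus i n - gext ty N q m Minus i n = (\<Sum>c\<in>C. \<rho> c * c powi n))"
proof -
  let ?S = "suppS m i" and ?o = "ordm ty N q m i"
  have CS: "C \<subseteq> ?S"
  proof
    fix c assume "c \<in> C"
    then consider "Poly_Mapping.lookup m (i, c * q powi - rl i) \<noteq> 0" | "Poly_Mapping.lookup m (i, c * q powi rl i) \<noteq> 0"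
      by (auto simp: C_def ordm_def) fastforce
    then show "c \<in> ?S"
    proof cases
      case 1
      have "c = c * q powi - rl i * q powi rl i" using q0 by (simp add: power_int_minus)
      then show ?thesis using 1 unfolding suppS_def by blast
    next
      case 2
      have "c = c * q powi rl i * q powi - rl i" using q0 by (simp add: power_int_minus)
      then show ?thesis using 2 unfolding suppS_def by blast
    qed
  qed
  then show fin: "finite C" and C0: "0 \<notin> C" using finite_suppS finite_subset suppS_0[OF m] by blast+
  define A where "A = linprod ?S (\<lambda>c. nat (- ?o c))"
  have D: "linprod ?S (\<lambda>c. nat (?o c)) = (\<Prod>c\<in>C. [:1, - c:])"
  proof -
    have "linprod ?S (\<lambda>c. nat (?o c)) = (\<Prod>c\<in>C. [:1, - c:] ^ nat (?o c))"
      unfolding linprod_def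
    proof (rule prod.mono_neutral_right[OF finite_suppS CS], rule ballI)
      fix c assume "c \<in> ?S - C"
      then have "nat (?o c) = 0" using le[of c] by (auto simp: C_def)
      then show "[:1, - c:] ^ nat (?o c) = 1" by simp
    qed
    also have "\<dots> = (\<Prod>c\<in>C. [:1, - c:])" by (rule prod.cong) (auto simp: C_def)
    finally show ?thesis .
  qed
  have act: "cact (\<Prod>c\<in>C. [:1, - c:]) (gext ty N q m e i) n = qwt m i * pcoeff A n" for e n
    using gext_num_den[OF finite_suppS order.refl, of "\<lambda>c. nat (?o c)" "\<lambda>c. nat (- ?o c)" m i e n]
    by (simp add: D A_def)
  define \<delta> where "\<delta> n = gext ty N q m Plus i n - gext ty N q m Minus i n" for n
  have "cact (\<Prod>c\<in>C. [:1, - c:]) \<delta> n = 0" for n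
    unfolding \<delta>_def cact_diff act by simp
  then obtain \<rho> where \<rho>: "\<And>n. \<delta> n = (\<Sum>c\<in>C. \<rho> c * c powi n)"
    using cact_prod_eq_0[OF fin C0] by blast
  have "\<rho> c \<noteq> 0" if c: "c \<in> C" for c
  proof
    assume z: "\<rho> c = 0"
    have c0: "c \<noteq> 0" using c C0 by blast
    let ?P = "\<Prod>d\<in>C - {c}. [:1, - d:]"
    have P: "(\<Prod>c\<in>C. [:1, - c:]) = [:1, - c:] * ?P" using fin c by (subst prod.remove) auto
    have "\<rho> d * cact ?P (\<lambda>n. d powi n) n = 0" if "d \<in> C" for d n
    proof (cases "d = c")
      case False
      then have "poly ?P (1 / d) = 0" using that fin C0
        by (auto simp: poly_prod intro!: prod_zero bexI[of _ d])
      moreover have "d \<noteq> 0" using that C0 by blast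
      ultimately show ?thesis by (simp add: cact_geometric)
    qed (simp add: z)
    then have "cact ?P \<delta> n = 0" for n
      unfolding \<rho>[abs_def] cact_sum by (intro sum.neutral) blast
    then have PM: "cact ?P (gext ty N q m Plus i) n = cact ?P (gext ty N q m Minus i) n" for n
      unfolding \<delta>_def cact_diff by simp
    define h where "h = cact ?P (gext ty N q m Plus i)"
    have h0: "h n = 0" if "n < 0" for n
      using that unfolding h_def cact_def by (intro sum.neutral) (simp add: gext_def)
    have h1: "h n = 0" if "n > int (degree ?P)" for n
      using that unfolding h_def PM unfolding cact_def by (intro sum.neutral) (simp add: gext_def)
    define A' where "A' = (\<Sum>k\<le>degree ?P. monom (h (int k)) k)"
    have "h = pcoeff A'"
      using h0 h1 by (auto simp: fun_eq_iff pcoeff_def A'_def coeff_sum)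
    then have "pcoeff ([:1, - c:] * A') = (\<lambda>n. qwt m i * pcoeff A n)"
      using act[of Plus] unfolding P cact_mult h_def[symmetric] by (auto simp: cact_pcoeff simp flip: )
    then have "[:1, - c:] * A' = smult (qwt m i) A"
      by (intro pcoeff_inj) (simp only: pcoeff_smult)
    then have "poly (smult (qwt m i) A) (1 / c) = poly ([:1, - c:] * A') (1 / c)" by simp
    then have "poly (smult (qwt m i) A) (1 / c) = 0" using c0 by (simp only: poly_mult) simp
    moreover have "qwt m i \<noteq> 0" using q0 by (simp add: qwt_def)
    ultimately have "poly A (1 / c) = 0" by simp
    then obtain d where "d \<in> ?S" "(1 - d * (1 / c)) ^ nat (- ?o d) = 0"
      unfolding A_def poly_linprod using finite_suppS by auto
    then have "d = c" "nat (- ?o d) > 0" using c0 by auto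
    then show False using c by (simp add: C_def)
  qed
  then show "\<exists>\<rho>. (\<forall>c\<in>C. \<rho> c \<noteq> 0) \<and>
      (\<forall>n. gext ty N q m Plus i n - gext ty N q m Minus i n = (\<Sum>c\<in>C. \<rho> c * c powi n))"
    using \<rho> unfolding \<delta>_def by blast
qed

text \<open>Multiplication of the l-weight by \<open>Q * (1 - u * d / Q) / (1 - u * Q * d)\<close>,
  cleared of denominators. For \<open>Q = q powi - B i j\<close> this is the \<open>i\<close>-th
  component of the l-weight of the inverse simple root monomial belonging to node \<open>j\<close>
  and parameter \<open>d\<close>.\<close>

lemma gext_shift:
  assumes w: "qwt m' i = Q * qwt m i" and Q: "Q \<noteq> 0" "d \<noteq> 0"
    and o: "\<And>c. ordm ty N q m' i c = ordm ty N q m i c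
      + (if c = Q * d then 1 else 0) - (if c = d / Q then 1 else 0)"
  shows "gext ty N q m' e i n - Q * d * gext ty N q m' e i (n - 1)
    = Q * gext ty N q m e i n - d * gext ty N q m e i (n - 1)"
proof -
  define S where "S = suppS m i \<union> suppS m' i \<union> {Q * d, d / Q}"
  have S: "finite S" "suppS m i \<subseteq> S" "suppS m' i \<subseteq> S" "Q * d \<in> S" "d / Q \<in> S"
    by (auto simp: S_def finite_suppS)
  let ?g = "gext ty N q m e i" and ?g' = "gext ty N q m' e i"
  let ?d = "linprod S (denexp m i)" and ?d' = "linprod S (denexp m' i)"
    and ?n = "linprod S (numexp m i)" and ?n' = "linprod S (numexp m' i)"
  have lin: "[:1, - c:] = linprod S (\<lambda>d. if d = c then 1 else 0)" if "c \<in> S" for c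
  proof -
    have "linprod S (\<lambda>d. if d = c then 1 else 0) = (\<Prod>d\<in>S. if d = c then [:1, - d:] else 1)"
      unfolding linprod_def by (rule prod.cong) auto
    then show ?thesis using that S(1) by (simp add: prod.delta)
  qed
  have eq: "?d * ([:1, - (Q * d):] * ?n') = ?d' * ([:1, - (d / Q):] * ?n)"
    unfolding lin[OF S(4)] lin[OF S(5)] linprod_mult
    by (rule arg_cong[where f = "linprod S"], rule ext)
       (use o num_den_ord in \<open>smt (verit) of_nat_eq_iff of_nat_add of_nat_0 of_nat_1\<close>)
  have "1 * cact [:1, - (Q * d):] ?g' n + (- Q) * cact [:1, - (d / Q):] ?g n + 0 * pcoeff 0 n = 0"
  proof (rule gext_sided[where p = "?d * ?d'"])
    show "?d * ?d' \<noteq> 0" by (simp add: linprod_nz)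
    fix n
    have "cact (?d * ?d') (cact [:1, - (Q * d):] ?g') n = qwt m' i * pcoeff (?d * ([:1, - (Q * d):] * ?n')) n"
      using cact_lift[OF cact_gext_linprod[OF S(1,3)], of "?d * [:1, - (Q * d):]" e n]
      by (simp only: mult_ac flip: cact_mult)
    moreover have "cact (?d * ?d') (cact [:1, - (d / Q):] ?g) n = qwt m i * pcoeff (?d' * ([:1, - (d / Q):] * ?n)) n"
      using cact_lift[OF cact_gext_linprod[OF S(1,2)], of "?d' * [:1, - (d / Q):]" e n]
      by (simp only: mult_ac flip: cact_mult)
    ultimately show "cact (?d * ?d') (\<lambda>n. 1 * cact [:1, - (Q * d):] ?g' n
        + (- Q) * cact [:1, - (d / Q):] ?g n + 0 * pcoeff 0 n) n = 0"
      unfolding cact_comb eq w by simp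
  qed
  then show ?thesis using Q by (simp add: cact_linear algebra_simps)
qed

lemma qpow_inf: "l \<noteq> 0 \<Longrightarrow> q powi l \<noteq> 1"
  using qroot[of "nat \<bar>l\<bar>"] q0 by (auto simp: power_int_def power_inverse split: if_splits)

text \<open>Equal l-weights have equal pole orders. So, with \<open>r = rl i\<close>, the difference
  \<open>D\<close> of the exponents of node \<open>i\<close> takes the same value at
  \<open>c * q powi - r\<close> and \<open>c * q powi r\<close>, and is constant along
  multiplication by \<open>q powi (2 * r)\<close>. These orbits are infinite, since \<open>q\<close>
  is not a root of unity, whereas \<open>D\<close> has finite support.\<close>

lemma gamma_inj:
  assumes m: "m \<in> monomials N" "m' \<in> monomials N"
    and eq: "\<And>i n. i \<in> nodes N \<Longrightarrow> gext ty N q m Plus i n = gext ty N q m' Plus i n"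
  shows "m = m'"
proof (rule poly_mapping_eqI)
  fix x :: "nat \<times> complex"
  obtain i b where x: "x = (i, b)" by (cases x)
  show "Poly_Mapping.lookup m x = Poly_Mapping.lookup m' x"
  proof (cases "i \<in> nodes N \<and> b \<noteq> 0")
    case False
    have "Poly_Mapping.lookup m x = 0" if "m \<in> monomials N" for m
    proof (rule ccontr)
      assume "Poly_Mapping.lookup m x \<noteq> 0"
      then have "x \<in> Poly_Mapping.keys m" by (simp add: in_keys_iff)
      then show False using that False x unfolding monomials_def by blast
    qed
    then show ?thesis using m by simp
  next
    case True
    then have i: "i \<in> nodes N" and b: "b \<noteq> 0" by auto
    define S where "S = suppS m i \<union> suppS m' i"
    have S: "finite S" "suppS m i \<subseteq> S" "suppS m' i \<subseteq> S" "0 \<notin> S"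
      using finite_suppS suppS_0 m by (auto simp: S_def)
    let ?d = "linprod S (denexp m i)" and ?d' = "linprod S (denexp m' i)"
      and ?n = "linprod S (numexp m i)" and ?n' = "linprod S (numexp m' i)"
    have gg: "gext ty N q m' Plus i = gext ty N q m Plus i" using eq[OF i] by auto
    have w: "qwt m i * pcoeff (?d' * ?n) n = qwt m' i * pcoeff (?d * ?n') n" for n
      using cact_lift[OF cact_gext_linprod[OF S(1,2)], of ?d' Plus n]
        cact_lift[OF cact_gext_linprod[OF S(1,3)], of ?d Plus n] by (simp add: gg mult.commute)
    have "qwt m i = qwt m' i" using w[of 0] by (simp add: pcoeff_def linprod_mult linprod_coeff_0)
    moreover have "qwt m i \<noteq> 0" using q0 by (simp add: qwt_def)
    ultimately have "?d' * ?n = ?d * ?n'" using w by (intro pcoeff_inj) simp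
    then have "denexp m' i c + numexp m i c = denexp m i c + numexp m' i c" if "c \<in> S" for c
      using order_linprod[OF S(1,4) that] unfolding linprod_mult by metis
    then have ord1: "ordm ty N q m i c = ordm ty N q m' i c" if "c \<in> S" for c
      using that num_den_ord[of m i c] num_den_ord[of m' i c] by fastforce
    have ord0: "ordm ty N q m i c = 0" if "c \<notin> suppS m i" for m c
    proof -
      have "c = c * q powi - rl i * q powi rl i" "c = c * q powi rl i * q powi - rl i"
        using q0 by (simp_all add: power_int_minus)
      then have "Poly_Mapping.lookup m (i, c * q powi - rl i) = 0" "Poly_Mapping.lookup m (i, c * q powi rl i) = 0"
        using that unfolding suppS_def by blast+
      then show ?thesis by (simp add: ordm_def)
    qed
    define D where "D b = Poly_Mapping.lookup m (i, b) - Poly_Mapping.lookup m' (i, b)" for b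
    have DD: "D (c * q powi - rl i) = D (c * q powi rl i)" for c
      using ord1[of c] ord0[of c m] ord0[of c m'] by (cases "c \<in> S") (auto simp: D_def ordm_def S_def)
    have step: "D (c * q powi (2 * rl i)) = D c" for c
    proof -
      have "c * q powi rl i * q powi - rl i = c" "c * q powi rl i * q powi rl i = c * q powi (2 * rl i)"
        using q0 power_int_add[of q "rl i" "rl i"] by (simp_all add: power_int_minus mult.assoc)
      then show ?thesis using DD[of "c * q powi rl i"] by metis
    qed
    have "D (b * (q powi (2 * rl i)) ^ k) = D b" for k :: nat
    proof (induction k)
      case (Suc k)
      have "b * (q powi (2 * rl i)) ^ Suc k = (b * (q powi (2 * rl i)) ^ k) * q powi (2 * rl i)" by simp
      then show ?case using step Suc by presburger
    qed simp
    moreover have "inj (\<lambda>k::nat. b * (q powi (2 * rl i)) ^ k)"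
    proof (rule injI)
      fix k l :: nat assume "b * (q powi (2 * rl i)) ^ k = b * (q powi (2 * rl i)) ^ l"
      then have e: "q powi (2 * rl i * int k) = q powi (2 * rl i * int l)"
        using b by (simp add: power_int_mult)
      have "q powi (2 * rl i * int k - 2 * rl i * int l) = 1" using e q0 by (simp add: power_int_diff)
      then have "2 * rl i * int k - 2 * rl i * int l = 0" using qpow_inf by blast
      then show "k = l" by (simp add: rlen_def split: if_splits)
    qed
    moreover have "finite {b. D b \<noteq> 0}"
      by (rule finite_subset[OF _ finite_UnI[OF finite_keys[of m i] finite_keys[of m' i]]]) (auto simp: D_def)
    ultimately have "\<not> range (\<lambda>k::nat. b * (q powi (2 * rl i)) ^ k) \<subseteq> {b. D b \<noteq> 0}"
      using finite_imageD[of "\<lambda>k::nat. b * (q powi (2 * rl i)) ^ k" UNIV] finite_subset by blast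
    then have "D b = 0" using \<open>\<And>k. D (b * _ ^ k) = D b\<close> unfolding image_subset_iff by auto
    then show ?thesis by (simp add: D_def x)
  qed
qed

end

section \<open>Systems of strands\<close>

text \<open>A state assigns to every strand \<open>\<sigma> \<in> J\<close> its heights in the columns \<open>0, \<dots>, M\<close>. The left ends are
  fixed; the right ends are fixed in type A and free in type B, where a path of a node other than the
  short one consists of two strands. Strands whose left ends have different parity have only the last
  column in common.\<close>

locale strands =
  fixes J :: "nat set" and M :: nat and s r :: "nat \<Rightarrow> int" and free :: bool
  assumes finJ: "finite J" and M: "M \<ge> 1"
    and alternate: "free \<Longrightarrow> \<sigma> \<in> J \<Longrightarrow> \<tau> \<in> J \<Longrightarrow> \<sigma> < \<tau> \<Longrightarrow> even (s \<sigma> - s \<tau>) \<Longrightarrow>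
      \<exists>\<upsilon>\<in>J. \<sigma> < \<upsilon> \<and> \<upsilon> < \<tau> \<and> odd (s \<sigma> - s \<upsilon>)"
begin

section \<open>States, moves and their labels\<close>

definition nd :: "nat set" where
  "nd = {1..(if free then M else M - 1)}"

definition ordered :: "(nat \<Rightarrow> nat \<Rightarrow> int) \<Rightarrow> bool" where
  "ordered y \<longleftrightarrow> (\<forall>\<sigma>\<in>J. \<forall>\<tau>\<in>J. \<sigma> < \<tau> \<longrightarrow> (\<forall>c\<le>M. even (s \<sigma> - s \<tau>) \<or> c = M \<longrightarrow> y \<sigma> c < y \<tau> c))"

definition strand :: "nat \<Rightarrow> (nat \<Rightarrow> int) \<Rightarrow> bool" where
  "strand \<sigma> z \<longleftrightarrow> z 0 = s \<sigma> \<and> (\<forall>c<M. \<bar>z (Suc c) - z c\<bar> = 1) \<and> (free \<or> z M = r \<sigma>)"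

definition valid :: "(nat \<Rightarrow> nat \<Rightarrow> int) \<Rightarrow> bool" where
  "valid y \<longleftrightarrow> (\<forall>\<sigma>\<in>J. strand \<sigma> (y \<sigma>)) \<and> ordered y \<and> (\<forall>\<sigma> c. \<sigma> \<notin> J \<or> c > M \<longrightarrow> y \<sigma> c = 0)"

text \<open>A label records the height \<open>e\<close> of the neighbours of column
  \<open>j\<close>, not the height of the strand there. A move replaces \<open>e - \<delta>\<close>
  by \<open>e + \<delta>\<close>, so it has the same label as its inverse. At a free end there is
  only the left neighbour.\<close>

definition site :: "(nat \<Rightarrow> int) \<Rightarrow> nat \<Rightarrow> int \<Rightarrow> bool" where
  "site z j e \<longleftrightarrow> z (j - 1) = e \<and> (j < M \<longrightarrow> z (Suc j) = e)"

text \<open>Formulated for all strands at once, so that it depends on the label alone; in a valid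
  state at most one strand has this site, and \<open>Mv_upd\<close> reduces the move to an update of
  that strand. For \<open>\<delta> = 1\<close> an upper corner becomes a lower one.\<close>

definition Mv :: "int \<Rightarrow> (nat \<Rightarrow> nat \<Rightarrow> int) \<Rightarrow> nat \<times> int \<Rightarrow> nat \<Rightarrow> nat \<Rightarrow> int" where
  "Mv \<delta> y = (\<lambda>(j, e) \<sigma> c. if \<sigma> \<in> J \<and> c = j \<and> site (y \<sigma>) j e \<and> y \<sigma> j = e - \<delta> then e + \<delta> else y \<sigma> c)"

definition mov :: "int \<Rightarrow> (nat \<Rightarrow> nat \<Rightarrow> int) \<Rightarrow> nat \<times> int \<Rightarrow> bool" where
  "mov \<delta> y = (\<lambda>(j, e). j \<in> nd \<and> (\<exists>\<sigma>\<in>J. site (y \<sigma>) j e \<and> y \<sigma> j = e - \<delta>) \<and> valid (Mv \<delta> y (j, e)))"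

abbreviation upd :: "(nat \<Rightarrow> nat \<Rightarrow> int) \<Rightarrow> nat \<Rightarrow> nat \<Rightarrow> int \<Rightarrow> nat \<Rightarrow> nat \<Rightarrow> int" where
  "upd y \<sigma> j h \<equiv> y(\<sigma> := (y \<sigma>)(j := h))"

lemma nd: "j \<in> nd \<longleftrightarrow> 1 \<le> j \<and> j \<le> M \<and> (free \<or> j < M)"
  using M by (auto simp: nd_def)

lemma strandD: "valid y \<Longrightarrow> \<sigma> \<in> J \<Longrightarrow> strand \<sigma> (y \<sigma>)"
  by (simp add: valid_def)

lemma orderedD: "valid y \<Longrightarrow> \<sigma> \<in> J \<Longrightarrow> \<tau> \<in> J \<Longrightarrow> \<sigma> < \<tau> \<Longrightarrow> c \<le> M \<Longrightarrow>
    even (s \<sigma> - s \<tau>) \<or> c = M \<Longrightarrow> y \<sigma> c < y \<tau> c"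
  by (auto simp: valid_def ordered_def)

lemma step: "strand \<sigma> z \<Longrightarrow> c < M \<Longrightarrow> z (Suc c) = z c + 1 \<or> z (Suc c) = z c - 1"
  by (auto simp: strand_def abs_if split: if_splits)

lemma step_left:
  assumes "strand \<sigma> z" "1 \<le> c" "c \<le> M"
  shows "z (c - 1) = z c + 1 \<or> z (c - 1) = z c - 1"
  using step[of \<sigma> z "c - 1"] assms by auto

lemma parity: "strand \<sigma> z \<Longrightarrow> c \<le> M \<Longrightarrow> even (z c - s \<sigma> - int c)"
proof (induction c)
  case 0
  then show ?case by (simp add: strand_def)
next
  case (Suc c)
  then show ?case using step[of \<sigma> z c] by auto
qed

lemma parity_same:
  assumes "valid y" "valid y'" "\<sigma> \<in> J" "\<tau> \<in> J" "c \<le> M"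
  shows "even (y \<sigma> c - y' \<tau> c) \<longleftrightarrow> even (s \<sigma> - s \<tau>)"
proof -
  have "y \<sigma> c - y' \<tau> c = (y \<sigma> c - s \<sigma> - int c) - (y' \<tau> c - s \<tau> - int c) + (s \<sigma> - s \<tau>)" by simp
  then show ?thesis using parity strandD assms by (metis even_add even_diff)
qed

text \<open>Strands of different parity never have equal heights in a column, and strands of equal
  parity are strictly ordered in every column.\<close>

lemma strands_inj:
  assumes "valid y" "\<sigma> \<in> J" "\<tau> \<in> J" "c \<le> M" "y \<sigma> c = y \<tau> c"
  shows "\<sigma> = \<tau>"
proof -
  have "even (s \<sigma> - s \<tau>)" "even (s \<tau> - s \<sigma>)" using parity_same[of y y] assms by (metis diff_self even_zero)+
  then show ?thesis using orderedD[of y \<sigma> \<tau> c] orderedD[of y \<tau> \<sigma> c] assms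
    by (cases \<sigma> \<tau> rule: linorder_cases) auto
qed

lemma site_unique:
  assumes "valid y" "j \<in> nd" "\<sigma> \<in> J" "\<tau> \<in> J" "site (y \<sigma>) j e" "site (y \<tau>) j e"
  shows "\<sigma> = \<tau>"
proof (rule strands_inj[OF assms(1,3,4)])
  show "j - 1 \<le> M" "y \<sigma> (j - 1) = y \<tau> (j - 1)" using assms by (auto simp: site_def nd)
qed

section \<open>Inverse and commuting moves\<close>

lemma Mv_upd:
  assumes "valid y" "j \<in> nd" "\<sigma> \<in> J" "site (y \<sigma>) j e" "y \<sigma> j = e - \<delta>"
  shows "Mv \<delta> y (j, e) = upd y \<sigma> j (e + \<delta>)"
proof (intro ext)
  fix \<tau> c
  have "\<tau> = \<sigma>" if "\<tau> \<in> J" "site (y \<tau>) j e"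
    using site_unique[OF assms(1,2) that(1) assms(3) that(2) assms(4)] .
  then show "Mv \<delta> y (j, e) \<tau> c = upd y \<sigma> j (e + \<delta>) \<tau> c"
    using assms(3-5) unfolding Mv_def by (cases "\<tau> = \<sigma>") auto
qed

lemma movE:
  assumes "valid y" "mov \<delta> y (j, e)"
  obtains \<sigma> where "\<sigma> \<in> J" "j \<in> nd" "site (y \<sigma>) j e" "y \<sigma> j = e - \<delta>" "Mv \<delta> y (j, e) = upd y \<sigma> j (e + \<delta>)"
    "valid (upd y \<sigma> j (e + \<delta>))"
proof -
  obtain \<sigma> where \<sigma>: "\<sigma> \<in> J" "j \<in> nd" "site (y \<sigma>) j e" "y \<sigma> j = e - \<delta>" and v: "valid (Mv \<delta> y (j, e))"
    using assms(2) unfolding mov_def by auto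
  then show thesis using that[OF \<sigma> Mv_upd[OF assms(1) \<sigma>(2,1,3,4)]] Mv_upd[OF assms(1) \<sigma>(2,1,3,4)] by simp
qed

lemma movI:
  assumes "valid y" "\<sigma> \<in> J" "j \<in> nd" "site (y \<sigma>) j e" "y \<sigma> j = e - \<delta>" "valid (upd y \<sigma> j (e + \<delta>))"
  shows "mov \<delta> y (j, e)"
  using assms Mv_upd[OF assms(1,3,2,4,5)] by (auto simp: mov_def)

lemma strand_upd:
  assumes "strand \<sigma> z" "j \<in> nd" "site z j e" "h = e + 1 \<or> h = e - 1"
  shows "strand \<sigma> (z(j := h))"
proof -
  have "\<bar>(z(j := h)) (Suc c) - (z(j := h)) c\<bar> = 1" if "c < M" for c
    using assms that unfolding strand_def site_def nd by (cases "c = j"; cases "Suc c = j") auto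
  then show ?thesis using assms by (auto simp: strand_def nd)
qed

lemma valid_updI:
  assumes y: "valid y" and \<sigma>: "\<sigma> \<in> J" "j \<in> nd" "site (y \<sigma>) j e" "h = e + 1 \<or> h = e - 1"
    and o: "\<And>\<tau>. \<tau> \<in> J \<Longrightarrow> even (s \<sigma> - s \<tau>) \<or> j = M \<Longrightarrow> \<sigma> < \<tau> \<Longrightarrow> h < y \<tau> j"
      "\<And>\<tau>. \<tau> \<in> J \<Longrightarrow> even (s \<sigma> - s \<tau>) \<or> j = M \<Longrightarrow> \<tau> < \<sigma> \<Longrightarrow> y \<tau> j < h"
  shows "valid (upd y \<sigma> j h)"
proof -
  have "strand \<tau> (upd y \<sigma> j h \<tau>)" if "\<tau> \<in> J" for \<tau>
    using strandD[OF y that] strand_upd \<sigma> by auto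
  moreover have "ordered (upd y \<sigma> j h)"
    unfolding ordered_def
  proof (intro ballI allI impI)
    fix \<rho> \<tau> c assume *: "\<rho> \<in> J" "\<tau> \<in> J" "\<rho> < \<tau>" "c \<le> M" "even (s \<rho> - s \<tau>) \<or> c = M"
    then have "even (s \<tau> - s \<rho>) \<or> c = M" by (metis even_diff_iff even_minus minus_diff_eq)
    then show "upd y \<sigma> j h \<rho> c < upd y \<sigma> j h \<tau> c"
      using o[of \<rho>] o[of \<tau>] orderedD[OF y *] * by (auto simp: fun_upd_def)
  qed
  moreover have "\<forall>\<tau> c. \<tau> \<notin> J \<or> c > M \<longrightarrow> upd y \<sigma> j h \<tau> c = 0"
    using y \<sigma> by (auto simp: valid_def nd)
  ultimately show ?thesis by (simp add: valid_def)
qed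

lemma Mv_inverse:
  assumes y: "valid y" and m: "mov \<delta> y x" and \<delta>: "\<delta> = 1 \<or> \<delta> = -1"
  shows "mov (- \<delta>) (Mv \<delta> y x) x" "Mv (- \<delta>) (Mv \<delta> y x) x = y"
proof -
  obtain j e where x: "x = (j, e)" by (cases x)
  obtain \<sigma> where \<sigma>: "\<sigma> \<in> J" "j \<in> nd" "site (y \<sigma>) j e" "y \<sigma> j = e - \<delta>"
    "Mv \<delta> y (j, e) = upd y \<sigma> j (e + \<delta>)" "valid (upd y \<sigma> j (e + \<delta>))"
    using movE[OF y m[unfolded x]] .
  let ?y = "upd y \<sigma> j (e + \<delta>)"
  have st: "site (?y \<sigma>) j e" using \<sigma> by (auto simp: site_def nd)
  have b: "upd ?y \<sigma> j (e + - \<delta>) = y" using \<sigma>(4) by (auto simp: fun_eq_iff)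
  have h: "?y \<sigma> j = e - (- \<delta>)" by simp
  show "mov (- \<delta>) (Mv \<delta> y x) x" unfolding x \<sigma>(5)
    by (rule movI[OF \<sigma>(6,1,2) st h]) (simp only: b y)
  show "Mv (- \<delta>) (Mv \<delta> y x) x = y" unfolding x \<sigma>(5)
    by (rule trans[OF Mv_upd[OF \<sigma>(6,2,1) st h] b])
qed

lemma valid_Mv: "mov \<delta> y x \<Longrightarrow> valid (Mv \<delta> y x)"
  by (auto simp: mov_def split: prod.splits)

text \<open>Different labels belong to different strands or to different columns, and two sites of
  one strand with the same \<open>\<delta>\<close> are never adjacent, as neighbouring columns
  cannot both carry a minimum or both a maximum. The order survives the two moves because it
  survives each of them, and two moves in one column shift both strands by the same amount.\<close>

lemma diamond:
  assumes y: "valid y" and m: "mov \<delta> y x" "mov \<delta> y x'" "x \<noteq> x'" and \<delta>: "\<delta> = 1 \<or> \<delta> = -1"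
  shows "mov \<delta> (Mv \<delta> y x) x' \<and> Mv \<delta> (Mv \<delta> y x) x' = Mv \<delta> (Mv \<delta> y x') x"
proof -
  obtain j e where x: "x = (j, e)" by (cases x)
  obtain j' e' where x': "x' = (j', e')" by (cases x')
  obtain \<sigma> where \<sigma>: "\<sigma> \<in> J" "j \<in> nd" "site (y \<sigma>) j e" "y \<sigma> j = e - \<delta>"
    "Mv \<delta> y (j, e) = upd y \<sigma> j (e + \<delta>)" "valid (upd y \<sigma> j (e + \<delta>))"
    using movE[OF y m(1)[unfolded x]] .
  obtain \<tau> where \<tau>: "\<tau> \<in> J" "j' \<in> nd" "site (y \<tau>) j' e'" "y \<tau> j' = e' - \<delta>"
    "Mv \<delta> y (j', e') = upd y \<tau> j' (e' + \<delta>)" "valid (upd y \<tau> j' (e' + \<delta>))"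
    using movE[OF y m(2)[unfolded x']] .
  let ?y1 = "upd y \<sigma> j (e + \<delta>)" and ?y2 = "upd y \<tau> j' (e' + \<delta>)"
  let ?y12 = "upd ?y1 \<tau> j' (e' + \<delta>)" and ?y21 = "upd ?y2 \<sigma> j (e + \<delta>)"
  have ne: "\<sigma> \<noteq> \<tau> \<or> j \<noteq> j'" using m(3) \<sigma>(3) \<tau>(3) unfolding x x' site_def by auto
  have na: "\<sigma> \<noteq> \<tau> \<or> (j' \<noteq> Suc j \<and> j \<noteq> Suc j')"
    using \<sigma>(2-4) \<tau>(2-4) \<delta> unfolding site_def nd by auto
  have st: "site (?y1 \<tau>) j' e'" "?y1 \<tau> j' = e' - \<delta>"
    using \<tau>(2-4) \<sigma>(2) ne na by (auto simp: site_def nd)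
  have st': "site (?y2 \<sigma>) j e" "?y2 \<sigma> j = e - \<delta>"
    using \<sigma>(2-4) \<tau>(2) ne na by (auto simp: site_def nd)
  have v: "valid ?y12"
  proof (rule valid_updI[OF \<sigma>(6) \<tau>(1,2) st(1)])
    show "e' + \<delta> = e' + 1 \<or> e' + \<delta> = e' - 1" using \<delta> by auto
    fix \<rho> assume \<rho>: "\<rho> \<in> J" "even (s \<tau> - s \<rho>) \<or> j' = M"
    have jM: "j' \<le> M" using \<tau> by (simp add: nd)
    have \<rho>': "even (s \<rho> - s \<tau>) \<or> j' = M" using \<rho>(2) by (metis even_minus minus_diff_eq)
    show "e' + \<delta> < ?y1 \<rho> j'" if "\<tau> < \<rho>"
      using orderedD[OF \<tau>(6,1) \<rho>(1) that jM \<rho>(2)] orderedD[OF y \<tau>(1) \<rho>(1) that jM \<rho>(2)] that \<tau>(4) \<sigma>(4)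
      by (auto split: if_splits)
    show "?y1 \<rho> j' < e' + \<delta>" if "\<rho> < \<tau>"
      using orderedD[OF \<tau>(6) \<rho>(1) \<tau>(1) that jM \<rho>'] orderedD[OF y \<rho>(1) \<tau>(1) that jM \<rho>'] that \<tau>(4) \<sigma>(4)
      by (auto split: if_splits)
  qed
  have eq: "?y21 = ?y12" using ne by (auto simp: fun_eq_iff)
  have "mov \<delta> ?y1 x'" unfolding x' by (rule movI[OF \<sigma>(6) \<tau>(1,2) st v])
  moreover have "Mv \<delta> ?y1 x' = ?y12" unfolding x' by (rule Mv_upd[OF \<sigma>(6) \<tau>(2,1) st])
  moreover have "Mv \<delta> ?y2 x = ?y21" unfolding x by (rule Mv_upd[OF \<tau>(6) \<sigma>(2,1) st'])
  ultimately show ?thesis using \<sigma>(5) \<tau>(5) x x' eq by simp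
qed

section \<open>Pole orders and available moves\<close>

definition occ :: "(nat \<Rightarrow> nat \<Rightarrow> int) \<Rightarrow> nat \<Rightarrow> int \<Rightarrow> int" where
  "occ y c h = (\<Sum>\<sigma>\<in>J. if y \<sigma> c = h then 1 else 0)"

text \<open>The order of the pole of the \<open>j\<close>-th component of the \<open>l\<close>-weight at level \<open>e\<close>.\<close>

definition ordc :: "(nat \<Rightarrow> nat \<Rightarrow> int) \<Rightarrow> nat \<Rightarrow> int \<Rightarrow> int" where
  "ordc y j e = occ y (j - 1) e
     + (if j < M then occ y (Suc j) e - occ y j (e - 1) - occ y j (e + 1) else - occ y M e)"

text \<open>The strands that contribute a zero: in an inner column those with an extremum at
  distance 1 from \<open>e\<close> that opens away from \<open>e\<close>, at a free end those ending
  at height \<open>e\<close>.\<close>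

definition neg :: "(nat \<Rightarrow> int) \<Rightarrow> nat \<Rightarrow> int \<Rightarrow> bool" where
  "neg z j e \<longleftrightarrow> (if j < M then (z j = e - 1 \<or> z j = e + 1) \<and> z (j - 1) \<noteq> e \<and> z (Suc j) \<noteq> e else z M = e)"

text \<open>Counted strand by strand: a site gives 1, \<open>neg\<close> gives -1, and the
  contributions of a monotone passage cancel.\<close>

lemma ordc_sum:
  assumes "valid y" "j \<in> nd"
  shows "ordc y j e = (\<Sum>\<sigma>\<in>J. (if site (y \<sigma>) j e then 1 else 0) - (if neg (y \<sigma>) j e then 1 else 0))"
proof (cases "j < M")
  case True
  have "(if y \<sigma> (j - 1) = e then 1 else 0) + (if y \<sigma> (Suc j) = e then 1 else 0)
      - (if y \<sigma> j = e - 1 then 1 else 0) - (if y \<sigma> j = e + 1 then 1 else 0)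
      = (if site (y \<sigma>) j e then 1 else 0) - (if neg (y \<sigma>) j e then 1 else (0::int))" if "\<sigma> \<in> J" for \<sigma>
    using step[of \<sigma> "y \<sigma>" j] step_left[of \<sigma> "y \<sigma>" j] strandD[OF assms(1) that] True assms(2)
    by (auto simp: site_def neg_def nd)
  then have "(\<Sum>\<sigma>\<in>J. (if y \<sigma> (j - 1) = e then 1 else 0) + (if y \<sigma> (Suc j) = e then 1 else 0)
      - (if y \<sigma> j = e - 1 then 1 else 0) - (if y \<sigma> j = e + 1 then 1 else 0)) =
      (\<Sum>\<sigma>\<in>J. (if site (y \<sigma>) j e then 1 else 0) - (if neg (y \<sigma>) j e then 1 else (0::int)))"
    by (rule sum.cong[OF refl])
  then show ?thesis using True
    by (simp add: ordc_def occ_def sum.distrib sum_subtractf)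
next
  case False
  then have j: "j = M" using assms by (auto simp: nd)
  have "(if y \<sigma> (j - 1) = e then 1 else 0) - (if y \<sigma> M = e then 1 else 0)
      = (if site (y \<sigma>) j e then 1 else 0) - (if neg (y \<sigma>) j e then 1 else (0::int))" if "\<sigma> \<in> J" for \<sigma>
    by (auto simp: site_def neg_def j)
  then have "(\<Sum>\<sigma>\<in>J. (if y \<sigma> (j - 1) = e then 1 else 0) - (if y \<sigma> M = e then 1 else 0)) =
      (\<Sum>\<sigma>\<in>J. (if site (y \<sigma>) j e then 1 else 0) - (if neg (y \<sigma>) j e then 1 else (0::int)))"
    by (rule sum.cong[OF refl])
  then show ?thesis using False
    by (simp add: ordc_def occ_def sum_subtractf)
qed

lemma sum_ind: "finite A \<Longrightarrow> (\<Sum>\<sigma>\<in>A. if P \<sigma> then 1 else (0::int)) = int (card {\<sigma>\<in>A. P \<sigma>})"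
  by (simp add: sum.If_cases Int_def)

text \<open>All strands with a site at this label pass through height \<open>e\<close> in column
  \<open>j - 1\<close>, so there is at most one.\<close>

lemma ordc_le_1_iff:
  assumes "valid y" "j \<in> nd"
  shows "ordc y j e \<le> 1"
    and "ordc y j e = 1 \<longleftrightarrow> (\<exists>\<sigma>\<in>J. site (y \<sigma>) j e) \<and> (\<forall>\<sigma>\<in>J. \<not> neg (y \<sigma>) j e)"
proof -
  let ?p = "{\<sigma>\<in>J. site (y \<sigma>) j e}" and ?n = "{\<sigma>\<in>J. neg (y \<sigma>) j e}"
  have o: "ordc y j e = int (card ?p) - int (card ?n)"
    unfolding ordc_sum[OF assms] by (simp add: sum_subtractf sum_ind finJ)
  have p: "card ?p \<le> 1" using site_unique[OF assms] by (subst One_nat_def, subst card_le_Suc0_iff_eq) (auto simp: finJ)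
  then show "ordc y j e \<le> 1" using o by simp
  have "ordc y j e = 1 \<longleftrightarrow> card ?p \<noteq> 0 \<and> card ?n = 0" using o p by auto
  then show "ordc y j e = 1 \<longleftrightarrow> (\<exists>\<sigma>\<in>J. site (y \<sigma>) j e) \<and> (\<forall>\<sigma>\<in>J. \<not> neg (y \<sigma>) j e)"
    using finJ by auto
qed

lemma site_height: "strand \<sigma> z \<Longrightarrow> j \<in> nd \<Longrightarrow> site z j e \<Longrightarrow> z j = e - 1 \<or> z j = e + 1"
  using step_left[of \<sigma> z j] by (auto simp: site_def nd)

lemma even_comm: "even (a - b) \<longleftrightarrow> even (b - a)" for a b :: int
  by presburger

text \<open>Being in the way of the move is the same as cancelling the pole. In an inner column an
  obstructing strand of equal parity sits at \<open>e + \<delta>\<close>; its neighbours cannot be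
  at \<open>e\<close>, where those of \<open>\<sigma>\<close> are, so it is \<open>neg\<close>. At a
  free end a strand of equal parity may also end at \<open>e + \<delta>\<close>; by
  \<open>alternate\<close> there is then a strand between the two, necessarily ending at
  \<open>e\<close>, and that one is \<open>neg\<close>.\<close>

lemma valid_upd_iff:
  assumes y: "valid y" and \<sigma>: "\<sigma> \<in> J" "j \<in> nd" "site (y \<sigma>) j e" "y \<sigma> j = e - \<delta>" and \<delta>: "\<delta> = 1 \<or> \<delta> = -1"
  shows "valid (upd y \<sigma> j (e + \<delta>)) \<longleftrightarrow> (\<forall>\<tau>\<in>J. \<not> neg (y \<tau>) j e)"
proof
  assume v: "valid (upd y \<sigma> j (e + \<delta>))"
  show "\<forall>\<tau>\<in>J. \<not> neg (y \<tau>) j e"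
  proof (intro ballI notI)
    fix \<tau> assume \<tau>: "\<tau> \<in> J" "neg (y \<tau>) j e"
    have jM: "j \<le> M" using \<sigma>(2) by (simp add: nd)
    have ne: "\<sigma> \<noteq> \<tau>" using \<sigma>(3,4) \<tau>(2) \<delta> jM by (auto simp: neg_def site_def split: if_splits)
    have a: "y \<sigma> j \<noteq> y \<tau> j" using strands_inj[OF y \<sigma>(1) \<tau>(1) jM] ne by blast
    have b: "e + \<delta> \<noteq> y \<tau> j" using strands_inj[OF v \<sigma>(1) \<tau>(1) jM] ne by auto
    show False
    proof (cases "j < M")
      case True
      then show False using a b \<tau>(2) \<sigma>(4) \<delta> by (auto simp: neg_def)
    next
      case False
      then have j: "j = M" using jM by simp
      then have h: "y \<tau> M = e" using \<tau>(2) by (simp add: neg_def)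
      then show False
        using orderedD[OF y \<sigma>(1) \<tau>(1), of M] orderedD[OF y \<tau>(1) \<sigma>(1), of M]
          orderedD[OF v \<sigma>(1) \<tau>(1), of M] orderedD[OF v \<tau>(1) \<sigma>(1), of M] ne j \<sigma>(4) \<delta>
        by (cases \<sigma> \<tau> rule: linorder_cases) auto
    qed
  qed
next
  assume n: "\<forall>\<tau>\<in>J. \<not> neg (y \<tau>) j e"
  have jM: "1 \<le> j" "j \<le> M" using \<sigma>(2) by (simp_all add: nd)
  have key: "y \<tau> j \<noteq> e" "y \<tau> j \<noteq> e + \<delta>" if \<tau>: "\<tau> \<in> J" "even (s \<sigma> - s \<tau>) \<or> j = M" "\<sigma> \<noteq> \<tau>" for \<tau>
  proof -
    have par: "even (y \<sigma> j - y \<tau> j) \<longleftrightarrow> even (s \<sigma> - s \<tau>)"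
      by (rule parity_same[OF y y \<sigma>(1) \<tau>(1) jM(2)])
    show 1: "y \<tau> j \<noteq> e"
    proof
      assume h: "y \<tau> j = e"
      then have "j \<noteq> M" using n \<tau>(1) by (auto simp: neg_def)
      then have "even (y \<sigma> j - y \<tau> j)" using par \<tau> by simp
      then show False using h \<sigma>(4) \<delta> by auto
    qed
    show "y \<tau> j \<noteq> e + \<delta>"
    proof
      assume h: "y \<tau> j = e + \<delta>"
      have ev: "even (s \<sigma> - s \<tau>)" using par h \<sigma>(4) by simp
      then have ev': "even (s \<tau> - s \<sigma>)" by (simp only: even_comm)
      show False
      proof (cases "j < M")
        case True
        have "y \<sigma> (j - 1) \<noteq> y \<tau> (j - 1)" "y \<sigma> (Suc j) \<noteq> y \<tau> (Suc j)"
          using strands_inj[OF y \<sigma>(1) \<tau>(1), of "j - 1"] strands_inj[OF y \<sigma>(1) \<tau>(1), of "Suc j"]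
            \<tau>(3) True by linarith+
        then have "y \<tau> (j - 1) \<noteq> e" "y \<tau> (Suc j) \<noteq> e" using \<sigma>(3) True unfolding site_def by auto
        then have "neg (y \<tau>) j e" using h \<delta> True by (auto simp: neg_def)
        then show False using n \<tau> by blast
      next
        case False
        then have j: "j = M" and fr: "free" using jM \<sigma>(2) by (auto simp: nd)
        have "\<exists>\<upsilon>\<in>J. y \<upsilon> M = e"
        proof (cases "\<sigma> < \<tau>")
          case True
          then obtain \<upsilon> where u: "\<upsilon> \<in> J" "\<sigma> < \<upsilon>" "\<upsilon> < \<tau>"
            using alternate[OF fr \<sigma>(1) \<tau>(1) True ev] by blast
          have "y \<sigma> M < y \<upsilon> M" "y \<upsilon> M < y \<tau> M"
            using orderedD[OF y \<sigma>(1) u(1,2), of M] orderedD[OF y u(1) \<tau>(1) u(3), of M] by simp_all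
          then show ?thesis using u(1) h j \<sigma>(4) \<delta> by (intro bexI[of _ \<upsilon>]) auto
        next
          case False
          then have lt: "\<tau> < \<sigma>" using \<tau>(3) by simp
          then obtain \<upsilon> where u: "\<upsilon> \<in> J" "\<tau> < \<upsilon>" "\<upsilon> < \<sigma>"
            using alternate[OF fr \<tau>(1) \<sigma>(1) lt ev'] by blast
          have "y \<tau> M < y \<upsilon> M" "y \<upsilon> M < y \<sigma> M"
            using orderedD[OF y \<tau>(1) u(1,2), of M] orderedD[OF y u(1) \<sigma>(1) u(3), of M] by simp_all
          then show ?thesis using u(1) h j \<sigma>(4) \<delta> by (intro bexI[of _ \<upsilon>]) auto
        qed
        then show False using n j by (auto simp: neg_def)
      qed
    qed
  qed
  show "valid (upd y \<sigma> j (e + \<delta>))"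
  proof (rule valid_updI[OF y \<sigma>(1-3)])
    show "e + \<delta> = e + 1 \<or> e + \<delta> = e - 1" using \<delta> by auto
    fix \<tau> assume \<tau>: "\<tau> \<in> J" "even (s \<sigma> - s \<tau>) \<or> j = M"
    have \<tau>': "even (s \<tau> - s \<sigma>) \<or> j = M" using \<tau>(2) by (simp only: even_comm)
    show "e + \<delta> < y \<tau> j" if lt: "\<sigma> < \<tau>"
    proof -
      have "y \<sigma> j < y \<tau> j" by (rule orderedD[OF y \<sigma>(1) \<tau>(1) lt jM(2) \<tau>(2)])
      moreover have "y \<tau> j \<noteq> e" "y \<tau> j \<noteq> e + \<delta>" using key[OF \<tau>] lt by simp_all
      ultimately show ?thesis using \<sigma>(4) \<delta> by auto
    qed
    show "y \<tau> j < e + \<delta>" if lt: "\<tau> < \<sigma>"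
    proof -
      have "y \<tau> j < y \<sigma> j" by (rule orderedD[OF y \<tau>(1) \<sigma>(1) lt jM(2) \<tau>'])
      moreover have "y \<tau> j \<noteq> e" "y \<tau> j \<noteq> e + \<delta>" using key[OF \<tau>] lt by simp_all
      ultimately show ?thesis using \<sigma>(4) \<delta> by auto
    qed
  qed
qed

lemma ordc_moves:
  assumes y: "valid y" "j \<in> nd"
  shows "ordc y j e = 1 \<longleftrightarrow> mov 1 y (j, e) \<or> mov (-1) y (j, e)"
proof
  assume "ordc y j e = 1"
  then obtain \<sigma> where \<sigma>: "\<sigma> \<in> J" "site (y \<sigma>) j e" and n: "\<forall>\<tau>\<in>J. \<not> neg (y \<tau>) j e"
    using ordc_le_1_iff(2)[OF y] by blast
  have *: "mov \<delta> y (j, e)" if "y \<sigma> j = e - \<delta>" "\<delta> = 1 \<or> \<delta> = -1" for \<delta>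
    using movI[OF y(1) \<sigma>(1) y(2) \<sigma>(2) that(1)] valid_upd_iff[OF y(1) \<sigma>(1) y(2) \<sigma>(2) that] n by blast
  have "y \<sigma> j = e - 1 \<or> y \<sigma> j = e - -1"
    using site_height[OF strandD[OF y(1) \<sigma>(1)] y(2) \<sigma>(2)] by auto
  then show "mov 1 y (j, e) \<or> mov (-1) y (j, e)" using * by blast
next
  assume "mov 1 y (j, e) \<or> mov (-1) y (j, e)"
  then obtain \<delta> :: int where \<delta>: "\<delta> = 1 \<or> \<delta> = -1" "mov \<delta> y (j, e)" by blast
  obtain \<sigma> where \<sigma>: "\<sigma> \<in> J" "j \<in> nd" "site (y \<sigma>) j e" "y \<sigma> j = e - \<delta>" "valid (upd y \<sigma> j (e + \<delta>))"
    using movE[OF y(1) \<delta>(2)] .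
  then show "ordc y j e = 1"
    using valid_upd_iff[OF y(1) \<sigma>(1-4) \<delta>(1)] ordc_le_1_iff(2)[OF y] by blast
qed

lemma mov_disjoint:
  assumes y: "valid y" and "mov 1 y (j, e)" shows "\<not> mov (-1) y (j, e)"
proof
  assume m: "mov (-1) y (j, e)"
  obtain \<sigma> where \<sigma>: "\<sigma> \<in> J" "j \<in> nd" "site (y \<sigma>) j e" "y \<sigma> j = e - 1" using movE[OF assms] .
  obtain \<tau> where \<tau>: "\<tau> \<in> J" "site (y \<tau>) j e" "y \<tau> j = e - -1" using movE[OF y m] .
  show False using site_unique[OF y \<sigma>(2,1) \<tau>(1) \<sigma>(3) \<tau>(2)] \<sigma> \<tau> by simp
qed

text \<open>The symmetrized Cartan matrix divided by 1 in type A and by 2 in type B, the number of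
  powers of \<open>q\<close> per unit of height. The diagonal entry 1 is that of the short
  root.\<close>

definition bet :: "nat \<Rightarrow> nat \<Rightarrow> int" where
  "bet i j = (if i = j then (if j < M then 2 else 1) else if i = Suc j \<or> j = Suc i then -1 else 0)"

lemma occ_upd:
  assumes "\<sigma> \<in> J"
  shows "occ (upd y \<sigma> j h) c g = occ y c g
    + (if c = j then (if h = g then 1 else 0) - (if y \<sigma> j = g then 1 else 0) else 0)"
proof -
  have "(\<Sum>\<tau>\<in>J. if upd y \<sigma> j h \<tau> c = g then 1 else 0)
      = (if (if c = j then h else y \<sigma> c) = g then 1 else 0) + (\<Sum>\<tau>\<in>J - {\<sigma>}. if y \<tau> c = g then 1 else (0::int))"
    using assms finJ by (subst sum.remove[of _ \<sigma>]) (auto intro!: sum.cong)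
  moreover have "(\<Sum>\<tau>\<in>J. if y \<tau> c = g then 1 else 0)
      = (if y \<sigma> c = g then 1 else 0) + (\<Sum>\<tau>\<in>J - {\<sigma>}. if y \<tau> c = g then 1 else (0::int))"
    using assms finJ by (subst sum.remove[of _ \<sigma>]) auto
  ultimately show ?thesis by (simp add: occ_def)
qed

text \<open>The combinatorial counterpart of the hypothesis on pole orders in
  \<open>gext_shift\<close>: the move multiplies by an inverse simple root monomial.\<close>

lemma ordc_Mv:
  assumes y: "valid y" and m: "mov 1 y (j, e)" and i: "i \<in> nd"
  shows "ordc (Mv 1 y (j, e)) i h = ordc y i h
    + (if h = e - bet i j then 1 else 0) - (if h = e + bet i j then 1 else 0)"
proof -
  obtain \<sigma> where \<sigma>: "\<sigma> \<in> J" "j \<in> nd" "site (y \<sigma>) j e" "y \<sigma> j = e - 1" "Mv 1 y (j, e) = upd y \<sigma> j (e + 1)"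
    using movE[OF y m] .
  show ?thesis
  proof -
    have i1: "1 \<le> i" "i \<le> M" and j1: "1 \<le> j" "j \<le> M" using i \<sigma>(2) by (simp_all add: nd)
    note u = \<sigma>(5) ordc_def occ_upd[OF \<sigma>(1)] \<sigma>(4)
    consider "i = j" "j < M" | "i = j" "j = M" | "i = Suc j" "i < M" | "i = Suc j" "i = M"
      | "j = Suc i" | "i \<noteq> j" "i \<noteq> Suc j" "j \<noteq> Suc i"
      using j1 i1 by linarith
    then show ?thesis
    proof cases
      case 1
      then show ?thesis unfolding u using j1 by (simp add: bet_def)
    next
      case 2
      then show ?thesis unfolding u using j1 M by (simp add: bet_def)
    next
      case 3
      then show ?thesis unfolding u using j1 by (simp add: bet_def)
    next
      case 4
      have b: "bet i j = -1" using 4(1) by (simp add: bet_def)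
      show ?thesis unfolding u b using j1 4 by simp
    next
      case 5
      then show ?thesis unfolding u using j1 i1 by (simp add: bet_def)
    next
      case 6
      then have "i - 1 \<noteq> j" "Suc i \<noteq> j" "M \<noteq> j \<or> i < M" using i1 j1 by auto
      then show ?thesis unfolding u using 6 by (auto simp: bet_def)
    qed
  qed
qed

section \<open>Extremal states and the lattice structure\<close>

lemma valid_outside: "valid y \<Longrightarrow> \<sigma> \<notin> J \<or> c > M \<Longrightarrow> y \<sigma> c = 0"
  unfolding valid_def by blast

text \<open>Among the strands where \<open>y\<close> and \<open>z\<close> differ take the last one
  in direction \<open>\<delta>\<close>, and on it a differing column \<open>c\<close> with
  \<open>\<delta> * y \<sigma> c\<close> least. By parity \<open>z\<close> is at least 2 further
  along at \<open>c\<close>. A neighbour at \<open>y \<sigma> c - \<delta>\<close> would agree with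
  \<open>z\<close> by minimality and be too far from \<open>z \<sigma> c\<close>; so
  \<open>c\<close> is a site. The strands beyond \<open>\<sigma>\<close> agree with those of
  \<open>z\<close> and therefore leave room for the move.\<close>

lemma improvable:
  assumes y: "valid y" and z: "valid z" and \<delta>: "\<delta> = 1 \<or> \<delta> = -1"
    and le: "\<And>\<sigma> c. \<delta> * y \<sigma> c \<le> \<delta> * z \<sigma> c" and ne: "y \<noteq> z"
  shows "\<exists>x. mov \<delta> y x"
proof -
  define A where "A = {\<sigma>. \<exists>c. y \<sigma> c \<noteq> z \<sigma> c}"
  have AJ: "A \<subseteq> J"
  proof
    fix \<sigma> assume "\<sigma> \<in> A"
    then obtain c where "y \<sigma> c \<noteq> z \<sigma> c" by (auto simp: A_def)
    then show "\<sigma> \<in> J" using valid_outside[OF y, of \<sigma> c] valid_outside[OF z, of \<sigma> c] by argo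
  qed
  have A0: "A \<noteq> {}" using ne by (auto simp: A_def fun_eq_iff)
  have fA: "finite A" using AJ finJ finite_subset by blast
  define m where "m = Max ((\<lambda>\<sigma>. \<delta> * int \<sigma>) ` A)"
  have "m \<in> (\<lambda>\<sigma>. \<delta> * int \<sigma>) ` A" unfolding m_def using A0 fA by (intro Max_in) auto
  then obtain \<sigma> where \<sigma>A: "\<sigma> \<in> A" "m = \<delta> * int \<sigma>" by auto
  have \<sigma>max: "\<delta> * int \<tau> \<le> \<delta> * int \<sigma>" if "\<tau> \<in> A" for \<tau>
    unfolding \<sigma>A(2)[symmetric] m_def using that fA by (intro Max_ge) auto
  have \<sigma>J: "\<sigma> \<in> J" using \<sigma>A AJ by blast
  define C where "C = {c. y \<sigma> c \<noteq> z \<sigma> c}"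
  have CM: "C \<subseteq> {..M}"
  proof
    fix c assume "c \<in> C"
    then have "y \<sigma> c \<noteq> z \<sigma> c" by (simp add: C_def)
    then show "c \<in> {..M}"
      using valid_outside[OF y, of \<sigma> c] valid_outside[OF z, of \<sigma> c] by (cases "c \<le> M") auto
  qed
  have C0: "C \<noteq> {}" using \<sigma>A by (auto simp: A_def C_def)
  have fC: "finite C" using CM finite_subset by blast
  define n where "n = Min ((\<lambda>c. \<delta> * y \<sigma> c) ` C)"
  have "n \<in> (\<lambda>c. \<delta> * y \<sigma> c) ` C" unfolding n_def using C0 fC by (intro Min_in) auto
  then obtain c where cC: "c \<in> C" "n = \<delta> * y \<sigma> c" by auto
  have cmin: "\<delta> * y \<sigma> c \<le> \<delta> * y \<sigma> d" if "d \<in> C" for d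
    unfolding cC(2)[symmetric] n_def using that fC by (intro Min_le) auto
  have sy: "strand \<sigma> (y \<sigma>)" and sz: "strand \<sigma> (z \<sigma>)" using strandD y z \<sigma>J by auto
  have cne: "y \<sigma> c \<noteq> z \<sigma> c" using cC by (simp add: C_def)
  have cM: "c \<le> M" using cC CM by auto
  have c0: "1 \<le> c" using cne sy sz by (cases c) (auto simp: strand_def)
  have cn: "c \<in> nd" using c0 cM cne sy sz unfolding nd by (cases "c = M") (auto simp: strand_def)
  have diff: "\<delta> * y \<sigma> c + 2 \<le> \<delta> * z \<sigma> c"
  proof -
    have "even (y \<sigma> c - z \<sigma> c)" using parity_same[OF y z \<sigma>J \<sigma>J cM] by simp
    then have "even (\<delta> * z \<sigma> c - \<delta> * y \<sigma> c)" using \<delta> by auto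
    moreover have "\<delta> * y \<sigma> c \<noteq> \<delta> * z \<sigma> c" using cne \<delta> by auto
    ultimately show ?thesis using le[of \<sigma> c] by presburger
  qed
  have nb: "y \<sigma> d = y \<sigma> c + \<delta>" if d: "d = c - 1 \<or> (d = Suc c \<and> c < M)" for d
  proof (rule ccontr)
    assume n: "y \<sigma> d \<noteq> y \<sigma> c + \<delta>"
    have 1: "y \<sigma> d = y \<sigma> c - \<delta>"
      using n d step_left[OF sy c0 cM] step[OF sy, of c] \<delta> by auto
    then have "\<delta> * y \<sigma> d < \<delta> * y \<sigma> c" using \<delta> by auto
    then have "d \<notin> C" using cmin[of d] by auto
    then have "z \<sigma> d = y \<sigma> c - \<delta>" using 1 by (simp add: C_def)
    moreover have "z \<sigma> d = z \<sigma> c + 1 \<or> z \<sigma> d = z \<sigma> c - 1"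
      using d step_left[OF sz c0 cM] step[OF sz, of c] by auto
    ultimately show False using diff \<delta> by auto
  qed
  let ?e = "y \<sigma> c + \<delta>"
  have st: "site (y \<sigma>) c ?e" using nb by (simp add: site_def)
  have h: "y \<sigma> c = ?e - \<delta>" by simp
  have "valid (upd y \<sigma> c (?e + \<delta>))"
  proof (rule valid_updI[OF y \<sigma>J cn st])
    show "?e + \<delta> = ?e + 1 \<or> ?e + \<delta> = ?e - 1" using \<delta> by auto
    fix \<tau> assume \<tau>: "\<tau> \<in> J" "even (s \<sigma> - s \<tau>) \<or> c = M"
    have \<tau>': "even (s \<tau> - s \<sigma>) \<or> c = M" using \<tau>(2) by (simp only: even_comm)
    have same: "y \<tau> c = z \<tau> c" if "\<delta> * int \<sigma> < \<delta> * int \<tau>"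
    proof -
      have "\<tau> \<notin> A" using \<sigma>max[of \<tau>] that by linarith
      then show ?thesis by (simp add: A_def)
    qed
    show "?e + \<delta> < y \<tau> c" if lt: "\<sigma> < \<tau>"
    proof -
      have a: "y \<sigma> c < y \<tau> c" "z \<sigma> c < z \<tau> c"
        using orderedD[OF y \<sigma>J \<tau>(1) lt cM \<tau>(2)] orderedD[OF z \<sigma>J \<tau>(1) lt cM \<tau>(2)] by auto
      show ?thesis
      proof (cases "\<delta> = 1")
        case True
        then show ?thesis using same lt a diff by simp
      next
        case False
        then show ?thesis using \<delta> a by simp
      qed
    qed
    show "y \<tau> c < ?e + \<delta>" if lt: "\<tau> < \<sigma>"
    proof -
      have a: "y \<tau> c < y \<sigma> c" "z \<tau> c < z \<sigma> c"
        using orderedD[OF y \<tau>(1) \<sigma>J lt cM \<tau>'] orderedD[OF z \<tau>(1) \<sigma>J lt cM \<tau>'] by auto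
      show ?thesis
      proof (cases "\<delta> = 1")
        case True
        then show ?thesis using a by simp
      next
        case False
        then show ?thesis using same lt a diff \<delta> by simp
      qed
    qed
  qed
  then have "mov \<delta> y (c, ?e)" by (rule movI[OF y \<sigma>J cn st h])
  then show ?thesis by blast
qed

text \<open>Both strands have the same parity, so where they differ they differ by at least 2 and
  cannot cross between two columns.\<close>

lemma strand_min_max:
  assumes "strand \<sigma> z" "strand \<sigma> z'"
  shows "strand \<sigma> (\<lambda>c. min (z c) (z' c))" "strand \<sigma> (\<lambda>c. max (z c) (z' c))"
proof -
  have "\<bar>min (z (Suc c)) (z' (Suc c)) - min (z c) (z' c)\<bar> = 1 \<and>
    \<bar>max (z (Suc c)) (z' (Suc c)) - max (z c) (z' c)\<bar> = 1" if "c < M" for c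
  proof -
    have "even (z c - s \<sigma> - int c)" "even (z' c - s \<sigma> - int c)"
      using parity[OF assms(1), of c] parity[OF assms(2), of c] that by auto
    then have "z' c = z c \<or> z' c \<ge> z c + 2 \<or> z c \<ge> z' c + 2" by presburger
    then show ?thesis
      using step[OF assms(1) that] step[OF assms(2) that] by (auto simp: min_def max_def)
  qed
  then show "strand \<sigma> (\<lambda>c. min (z c) (z' c))" "strand \<sigma> (\<lambda>c. max (z c) (z' c))"
    using assms by (auto simp: strand_def)
qed

lemma valid_min_max:
  assumes "valid y" "valid y'"
  shows "valid (\<lambda>\<sigma> c. min (y \<sigma> c) (y' \<sigma> c))" "valid (\<lambda>\<sigma> c. max (y \<sigma> c) (y' \<sigma> c))"
proof -
  have "ordered (\<lambda>\<sigma> c. min (y \<sigma> c) (y' \<sigma> c))" "ordered (\<lambda>\<sigma> c. max (y \<sigma> c) (y' \<sigma> c))"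
    unfolding ordered_def
  proof (safe del: disjE)
    fix \<sigma> \<tau> c assume *: "\<sigma> \<in> J" "\<tau> \<in> J" "\<sigma> < \<tau>" "c \<le> M" "even (s \<sigma> - s \<tau>) \<or> c = M"
    have "y \<sigma> c < y \<tau> c" "y' \<sigma> c < y' \<tau> c"
      using orderedD[OF assms(1) *] orderedD[OF assms(2) *] by auto
    then show "min (y \<sigma> c) (y' \<sigma> c) < min (y \<tau> c) (y' \<tau> c)" "max (y \<sigma> c) (y' \<sigma> c) < max (y \<tau> c) (y' \<tau> c)"
      by (simp_all add: min_def max_def)
  qed
  then show "valid (\<lambda>\<sigma> c. min (y \<sigma> c) (y' \<sigma> c))" "valid (\<lambda>\<sigma> c. max (y \<sigma> c) (y' \<sigma> c))"
    using assms strand_min_max unfolding valid_def by simp_all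
qed

text \<open>Valid states form a lattice; \<open>improvable\<close> is applied to \<open>y\<close>
  and its meet, or its join, with \<open>z\<close>.\<close>

lemma extremal:
  assumes "valid y" "valid z"
  shows "(\<And>x. \<not> mov (-1) y x) \<Longrightarrow> y \<sigma> c \<le> z \<sigma> c"
    and "(\<And>x. \<not> mov 1 y x) \<Longrightarrow> z \<sigma> c \<le> y \<sigma> c"
proof -
  show "y \<sigma> c \<le> z \<sigma> c" if n: "\<And>x. \<not> mov (-1) y x"
  proof -
    have "y = (\<lambda>\<sigma> c. min (y \<sigma> c) (z \<sigma> c))"
      using improvable[OF assms(1) valid_min_max(1)[OF assms], of "-1"] n by (rule_tac ccontr) auto
    then have "y \<sigma> c = min (y \<sigma> c) (z \<sigma> c)" by (metis (full_types))
    then show ?thesis by simp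
  qed
  show "z \<sigma> c \<le> y \<sigma> c" if n: "\<And>x. \<not> mov 1 y x"
  proof -
    have "y = (\<lambda>\<sigma> c. max (y \<sigma> c) (z \<sigma> c))"
      using improvable[OF assms(1) valid_min_max(2)[OF assms], of 1] n by (rule_tac ccontr) auto
    then have "y \<sigma> c = max (y \<sigma> c) (z \<sigma> c)" by (metis (full_types))
    then show ?thesis by simp
  qed
qed

lemma extremal_unique:
  assumes "valid y" "valid z" "\<delta> = 1 \<or> \<delta> = -1" "\<And>x. \<not> mov \<delta> y x" "\<And>x. \<not> mov \<delta> z x"
  shows "y = z"
proof (intro ext)
  fix \<sigma> c
  show "y \<sigma> c = z \<sigma> c"
    using assms(3)
  proof
    assume "\<delta> = 1"
    then show ?thesis using extremal(2)[OF assms(1,2)] extremal(2)[OF assms(2,1)] assms(4,5)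
      by (simp add: order.antisym)
  next
    assume "\<delta> = -1"
    then show ?thesis using extremal(1)[OF assms(1,2)] extremal(1)[OF assms(2,1)] assms(4,5)
      by (simp add: order.antisym)
  qed
qed

section \<open>Pole orders determine the state\<close>

lemma occ_eq_0:
  assumes "valid y" "\<bar>e\<bar> > (\<Sum>\<sigma>\<in>J. \<Sum>c\<le>M. \<bar>y \<sigma> c\<bar>)" "c \<le> M"
  shows "occ y c e = 0"
  unfolding occ_def
proof (rule sum.neutral, rule ballI)
  fix \<sigma> assume \<sigma>: "\<sigma> \<in> J"
  have "\<bar>y \<sigma> c\<bar> \<le> (\<Sum>c\<le>M. \<bar>y \<sigma> c\<bar>)" using assms(3) by (intro member_le_sum) auto
  also have "\<dots> \<le> (\<Sum>\<sigma>\<in>J. \<Sum>c\<le>M. \<bar>y \<sigma> c\<bar>)" using \<sigma> finJ by (intro member_le_sum) (auto intro: sum_nonneg)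
  finally have "y \<sigma> c \<noteq> e" using assms(2) by auto
  then show "(if y \<sigma> c = e then 1 else 0) = (0::int)" by simp
qed

text \<open>The difference \<open>d\<close> of the occupation numbers satisfies a discrete wave
  equation in column and height, with zero data in column 0. On the extreme diagonal
  \<open>e - j = v\<close> of its support the equation merely transports the value to the last
  column. There it is excluded: with fixed ends \<open>d\<close> vanishes in that column, and with
  free ends it equals the value in the column before, which lies beyond the extreme diagonal. Equal
  occupation numbers then give equal strands.\<close>

lemma ordc_inj:
  assumes y: "valid y" and y': "valid y'" and eq: "\<And>j e. j \<in> nd \<Longrightarrow> ordc y j e = ordc y' j e"
  shows "y = y'"
proof -
  define d where "d j e = occ y j e - occ y' j e" for j e
  define T where "T = {(j, e). j \<le> M \<and> d j e \<noteq> 0}"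
  have r1: "d (Suc j) e = d j (e - 1) + d j (e + 1) - d (j - 1) e" if "1 \<le> j" "j < M" for j e
    using eq[of j e] that by (auto simp: ordc_def d_def nd)
  have r2: "d (M - 1) e = d M e" if free for e
  proof -
    have "M \<in> nd" unfolding nd using that M by simp
    from eq[OF this, of e] show ?thesis by (simp add: ordc_def d_def)
  qed
  have d0: "d 0 e = 0" for e
    unfolding d_def occ_def using strandD[OF y] strandD[OF y'] by (simp add: strand_def)
  have dM: "d M e = 0" if "\<not> free" for e
  proof -
    have "y \<sigma> M = y' \<sigma> M" if "\<sigma> \<in> J" for \<sigma>
      using strandD[OF y that] strandD[OF y' that] \<open>\<not> free\<close> unfolding strand_def by simp
    then show ?thesis unfolding d_def occ_def by simp
  qed
  have finT: "finite T"
  proof -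
    define K where "K = (\<Sum>\<sigma>\<in>J. \<Sum>c\<le>M. \<bar>y \<sigma> c\<bar>) + (\<Sum>\<sigma>\<in>J. \<Sum>c\<le>M. \<bar>y' \<sigma> c\<bar>)"
    have pos: "(\<Sum>\<sigma>\<in>J. \<Sum>c\<le>M. \<bar>z \<sigma> c\<bar>) \<ge> 0" for z :: "nat \<Rightarrow> nat \<Rightarrow> int"
      by (intro sum_nonneg) auto
    have "d j e = 0" if "j \<le> M" "\<bar>e\<bar> > K" for j e
      using occ_eq_0[OF y, of e j] occ_eq_0[OF y', of e j] that pos[of y] pos[of y']
      unfolding K_def d_def by auto
    then have "T \<subseteq> {..M} \<times> {-K..K}" unfolding T_def by (force simp: abs_le_iff not_less)
    then show ?thesis by (rule finite_subset) auto
  qed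
  have T0: "T = {}"
  proof (rule ccontr)
    assume ne: "T \<noteq> {}"
    define v where "v = Max ((\<lambda>(j, e). e - int j) ` T)"
    have "v \<in> (\<lambda>(j, e). e - int j) ` T" unfolding v_def using ne finT by (intro Max_in) auto
    then obtain j where j: "j \<le> M" "d j (v + int j) \<noteq> 0" by (force simp: T_def)
    have z: "d k e = 0" if "k \<le> M" "e - int k > v" for k e
    proof (rule ccontr)
      assume "d k e \<noteq> 0"
      then have "e - int k \<in> (\<lambda>(j, e). e - int j) ` T" using that by (force simp: T_def)
      then have "e - int k \<le> v" unfolding v_def using finT by (intro Max_ge) auto
      then show False using that by simp
    qed
    have up: "j \<le> k \<Longrightarrow> k \<le> M \<Longrightarrow> d k (v + int k) \<noteq> 0" for k
    proof (induction k rule: dec_induct)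
      case base
      then show ?case using j by simp
    next
      case (step k)
      have k: "1 \<le> k" using step d0 by (cases k) auto
      have "d (Suc k) (v + int (Suc k)) = d k (v + int k) + d k (v + int k + 2) - d (k - 1) (v + int k + 1)"
        using r1[of k "v + int (Suc k)"] k step.prems by (simp add: algebra_simps)
      then show ?case using step z[of k "v + int k + 2"] z[of "k - 1" "v + int k + 1"] k by auto
    qed
    have dd: "d M (v + int M) \<noteq> 0" using up j by blast
    show False
    proof (cases free)
      case True
      then show False using r2[OF True, of "v + int M"] z[of "M - 1" "v + int M"] dd M by auto
    next
      case False
      then show False using dM dd by blast
    qed
  qed
  have occ: "occ y c e = occ y' c e" if "c \<le> M" for c e
    using T0 that unfolding T_def d_def by auto
  have attained: "\<exists>\<tau>\<in>J. z' \<tau> c = z \<sigma> c"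
    if "c \<le> M" "\<sigma> \<in> J" "\<And>e. occ z c e = occ z' c e" for \<sigma> c and z z' :: "nat \<Rightarrow> nat \<Rightarrow> int"
  proof (rule ccontr)
    assume "\<not> ?thesis"
    then have "occ z' c (z \<sigma> c) = 0" unfolding occ_def by (intro sum.neutral) auto
    moreover have "occ z c (z \<sigma> c) \<ge> 1"
      unfolding occ_def using finJ that(2)
      by (intro order.trans[OF _ member_le_sum[of \<sigma>]]) auto
    ultimately show False using that(3)[of "z \<sigma> c"] by simp
  qed
  \<comment> \<open>Strands are compared in increasing order. The height \<open>z \<sigma> c\<close>
    is taken in \<open>z'\<close> by a strand of equal parity; an earlier one is excluded by
    \<open>strands_inj\<close>, a later one by the order.\<close>
  have le: "\<not> z \<sigma> c < z' \<sigma> c"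
    if z: "valid z" "valid z'" "\<And>e. occ z c e = occ z' c e" and c: "c \<le> M" "\<sigma> \<in> J"
      and low: "\<And>\<tau>. \<tau> \<in> J \<Longrightarrow> \<tau> < \<sigma> \<Longrightarrow> z \<tau> c = z' \<tau> c" for z z' \<sigma> c
  proof
    assume lt: "z \<sigma> c < z' \<sigma> c"
    obtain \<tau> where \<tau>: "\<tau> \<in> J" "z' \<tau> c = z \<sigma> c" using attained[OF c z(3)] by blast
    have ev: "even (s \<sigma> - s \<tau>)" using parity_same[OF z(1,2) c(2) \<tau>(1) c(1)] \<tau>(2) by simp
    consider "\<tau> < \<sigma>" | "\<tau> = \<sigma>" | "\<sigma> < \<tau>" by linarith
    then show False
    proof cases
      case 1
      then have "z \<tau> c = z \<sigma> c" using low \<tau> by simp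
      then show False using strands_inj[OF z(1) \<tau>(1) c(2,1)] 1 by simp
    next
      case 2
      then show False using lt \<tau> by simp
    next
      case 3
      then have "z' \<sigma> c < z' \<tau> c" using orderedD[OF z(2) c(2) \<tau>(1) 3 c(1)] ev by blast
      then show False using lt \<tau> by simp
    qed
  qed
  have J: "y \<sigma> c = y' \<sigma> c" if "\<sigma> \<in> J" "c \<le> M" for \<sigma> c
    using that(1)
  proof (induction \<sigma> rule: less_induct)
    case (less \<sigma>)
    have "y \<tau> c = y' \<tau> c" if "\<tau> \<in> J" "\<tau> < \<sigma>" for \<tau> using less that by blast
    then show ?case
      using le[OF y y' occ[OF that(2)] that(2) less.prems] le[OF y' y occ[OF that(2), symmetric] that(2) less.prems]
      by force
  qed
  show ?thesis
  proof (intro ext)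
    fix \<sigma> c
    show "y \<sigma> c = y' \<sigma> c"
      using J[of \<sigma> c] valid_outside[OF y, of \<sigma> c] valid_outside[OF y', of \<sigma> c]
      by (cases "\<sigma> \<in> J \<and> c \<le> M") auto
  qed
qed

section \<open>Finiteness and a bottom state\<close>

lemma strand_bound: "strand \<sigma> z \<Longrightarrow> c \<le> M \<Longrightarrow> \<bar>z c - s \<sigma>\<bar> \<le> int c"
proof (induction c)
  case 0
  then show ?case by (simp add: strand_def)
next
  case (Suc c)
  then show ?case using step[of \<sigma> z c] by auto
qed

lemma finite_valid: "finite {y. valid y}"
proof -
  define K where "K = (\<Sum>\<sigma>\<in>J. \<bar>s \<sigma>\<bar>) + int M"
  have b: "y \<sigma> c \<in> {-K..K}" if "valid y" "\<sigma> \<in> J" "c \<le> M" for y \<sigma> c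
  proof -
    have "\<bar>s \<sigma>\<bar> \<le> (\<Sum>\<sigma>\<in>J. \<bar>s \<sigma>\<bar>)" using that finJ by (intro member_le_sum) auto
    then show ?thesis using strand_bound[OF strandD[OF that(1,2)] that(3)] that(3) unfolding K_def by auto
  qed
  let ?F = "{f. \<forall>x. (x \<in> J \<times> {..M} \<longrightarrow> f x \<in> {-K..K}) \<and> (x \<notin> J \<times> {..M} \<longrightarrow> f x = 0)}"
  have "finite ?F" by (rule finite_set_of_finite_funs) (auto simp: finJ)
  moreover have "{y. valid y} \<subseteq> curry ` ?F"
  proof
    fix y assume "y \<in> {y. valid y}"
    then have "case_prod y \<in> ?F" using b by (auto simp: valid_def not_le)
    then have "curry (case_prod y) \<in> curry ` ?F" by (rule imageI)
    then show "y \<in> curry ` ?F" by simp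
  qed
  ultimately show ?thesis using finite_surj by blast
qed

text \<open>Every move changes it by \<open>2 * \<delta>\<close>, so half its difference from the
  top state counts moves.\<close>

definition total :: "(nat \<Rightarrow> nat \<Rightarrow> int) \<Rightarrow> int" where
  "total y = (\<Sum>\<sigma>\<in>J. \<Sum>c\<le>M. y \<sigma> c)"

lemma total_Mv:
  assumes "valid y" "mov \<delta> y x"
  shows "total (Mv \<delta> y x) = total y + 2 * \<delta>"
proof -
  obtain j e where x: "x = (j, e)" by (cases x)
  obtain \<sigma> where \<sigma>: "\<sigma> \<in> J" "j \<in> nd" "y \<sigma> j = e - \<delta>" "Mv \<delta> y (j, e) = upd y \<sigma> j (e + \<delta>)"
    using movE[OF assms(1) assms(2)[unfolded x]] .
  have j: "j \<in> {..M}" using \<sigma> by (simp add: nd)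
  have "(\<Sum>c\<le>M. upd y \<sigma> j (e + \<delta>) \<tau> c) = (\<Sum>c\<le>M. y \<tau> c) + (if \<tau> = \<sigma> then 2 * \<delta> else 0)" for \<tau>
  proof (cases "\<tau> = \<sigma>")
    case True
    have "(\<Sum>c\<le>M. upd y \<sigma> j (e + \<delta>) \<sigma> c) = (e + \<delta>) + (\<Sum>c\<in>{..M} - {j}. y \<sigma> c)"
      using j by (subst sum.remove[of _ j]) (auto intro!: sum.cong)
    moreover have "(\<Sum>c\<le>M. y \<sigma> c) = (e - \<delta>) + (\<Sum>c\<in>{..M} - {j}. y \<sigma> c)"
      using j \<sigma>(3) by (subst sum.remove[of _ j]) auto
    ultimately show ?thesis using True by simp
  qed simp
  then show ?thesis unfolding x \<sigma>(4) total_def using \<sigma>(1) finJ by (simp add: sum.distrib)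
qed

lemma bottom_exists:
  assumes "valid y" shows "\<exists>z. valid z \<and> (\<forall>x. \<not> mov 1 z x)"
proof -
  define t where "t = Max (total ` {y. valid y})"
  have "t \<in> total ` {y. valid y}" unfolding t_def using assms finite_valid by (intro Max_in) auto
  then obtain z where z: "valid z" "t = total z" by auto
  have "\<not> mov 1 z x" for x
  proof
    assume m: "mov 1 z x"
    have "total (Mv 1 z x) \<le> total z"
      unfolding z(2)[symmetric] t_def using valid_Mv[OF m] finite_valid by (intro Max_ge) auto
    then show False using total_Mv[OF z(1) m] by simp
  qed
  then show ?thesis using z by blast
qed

end

section \<open>The operators of the quantum affine algebra on a module\<close>

definition alg :: "nat \<Rightarrow> ncpoly set" where
  "alg N = {f. \<forall>w \<in> Poly_Mapping.keys f. set (letters w) \<subseteq> generators N}"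

lemma alg_add: "f \<in> alg N \<Longrightarrow> g \<in> alg N \<Longrightarrow> f + g \<in> alg N"
  unfolding alg_def using keys_add[of f g] by blast

lemma alg_mult:
  assumes "f \<in> alg N" "g \<in> alg N" shows "f * g \<in> alg N"
  unfolding alg_def
proof (rule CollectI, rule ballI)
  fix w assume "w \<in> Poly_Mapping.keys (f * g)"
  then obtain a b where "w = a + b" "a \<in> Poly_Mapping.keys f" "b \<in> Poly_Mapping.keys g"
    using keys_mult[of f g] by blast
  then show "set (letters w) \<subseteq> generators N"
    using assms by (auto simp: alg_def plus_word_def)
qed

lemma alg_const: "const z \<in> alg N"
  by (simp add: alg_def const_def zero_word_def)

lemma alg_gen: "g \<in> generators N \<Longrightarrow> gen g \<in> alg N"
  by (simp add: alg_def gen_def)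

lemma const_0: "const 0 = 0" and const_1: "const 1 = 1"
  by (simp_all add: const_def)

lemma const_add: "const (z + w) = const z + const w"
  by (simp add: const_def single_add)

lemma const_mult: "const (z * w) = const z * const w"
  by (simp add: const_def mult_single)

lemma const_uminus: "const (- z) = - const z"
  by (simp add: const_def single_uminus)

lemma const_comm: "const z * f = f * const z"
proof (induction f rule: update_induct)
  case const
  then show ?case by simp
next
  case (update f k v)
  have "Poly_Mapping.update k v f = f + Poly_Mapping.single k v"
    using update(1) by (intro poly_mapping_eqI) (auto simp: lookup_update lookup_add lookup_single in_keys_iff when_def)
  moreover have "const z * Poly_Mapping.single k v = Poly_Mapping.single k v * const z"
    by (simp add: const_def mult_single mult.commute)
  ultimately show ?case using update by (simp add: algebra_simps)
qed

lemma alg_0: "0 \<in> alg N" and alg_1: "1 \<in> alg N"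
  using alg_const[of 0 N] alg_const[of 1 N] by (simp_all add: const_0 const_1)

lemma alg_uminus: "f \<in> alg N \<Longrightarrow> - f \<in> alg N"
  by (simp add: alg_def)

lemma alg_diff: "f \<in> alg N \<Longrightarrow> g \<in> alg N \<Longrightarrow> f - g \<in> alg N"
  using alg_add[of f N "- g"] alg_uminus by simp

lemma alg_sum: "(\<And>x. x \<in> A \<Longrightarrow> f x \<in> alg N) \<Longrightarrow> sum f A \<in> alg N"
  by (induction A rule: infinite_finite_induct) (auto intro: alg_add alg_0)

lemma alg_power: "f \<in> alg N \<Longrightarrow> f ^ n \<in> alg N"
  by (induction n) (auto intro: alg_mult alg_1)

lemma alg_prod_list: "(\<And>f. f \<in> set fs \<Longrightarrow> f \<in> alg N) \<Longrightarrow> prod_list fs \<in> alg N"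
  by (induction fs) (auto intro: alg_mult alg_1)

lemma alg_fps_power: "(\<And>m. fps_nth F m \<in> alg N) \<Longrightarrow> fps_nth (F ^ j) n \<in> alg N"
proof (induction j arbitrary: n)
  case 0
  then show ?case by (auto simp: alg_0 alg_1)
next
  case (Suc j)
  then show ?case by (auto simp: fps_mult_nth intro!: alg_sum alg_mult)
qed

lemma generators_mem:
  "i \<in> nodes N \<Longrightarrow> GenX e i n \<in> generators N" "i \<in> nodes N \<Longrightarrow> GenK e i \<in> generators N"
  "i \<in> nodes N \<Longrightarrow> n \<noteq> 0 \<Longrightarrow> GenH i n \<in> generators N" "GenC e \<in> generators N"
  by (auto simp: generators_def)

lemmas alg_intros = alg_diff alg_add alg_mult alg_const alg_gen alg_0 alg_1 alg_sum alg_power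
  generators_mem

lemma alg_chalf: "chalf n \<in> alg N"
  by (auto simp: chalf_def intro!: alg_intros)

definition hser :: "pm \<Rightarrow> nat \<Rightarrow> ncpoly fps" where
  "hser e i = Abs_fps (\<lambda>m. if m = 0 then 0 else genH i (sg e * int m))"

lemma sg_nz: "sg e \<noteq> 0" by (cases e) auto

lemma alg_hser: "i \<in> nodes N \<Longrightarrow> fps_nth (hser e i) m \<in> alg N"
  by (auto simp: hser_def sg_nz intro!: alg_intros)

lemma alg_phi: "i \<in> nodes N \<Longrightarrow> phi q e i n \<in> alg N"
  unfolding phi_def hser_def[symmetric]
  by (intro alg_intros alg_fps_power alg_hser)

lemma alg_phi_int: "i \<in> nodes N \<Longrightarrow> phi_int q e i n \<in> alg N"
  by (auto simp: phi_int_def alg_0 alg_phi)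

lemma alg_qserre: "i \<in> nodes N \<Longrightarrow> j \<in> nodes N \<Longrightarrow> qserre q' e i j n m s \<in> alg N"
  unfolding qserre_def by (intro alg_intros alg_prod_list) (auto intro!: alg_intros)

lemma relators_alg: "relators ty N q \<subseteq> alg N"
proof
  fix f assume "f \<in> relators ty N q"
  then show "f \<in> alg N"
    by induction (auto intro!: alg_diff alg_add alg_mult alg_const alg_gen alg_0 alg_1
        generators_mem alg_chalf alg_phi_int alg_qserre)
qed

lemma carrier_free: "carrier (free_algebra N) = alg N"
  by (simp add: free_algebra_def alg_def)

lemma ring_free: "ring (free_algebra N)"
proof (rule ringI)
  show "abelian_group (free_algebra N)"
  proof (rule abelian_groupI)
    fix x assume "x \<in> carrier (free_algebra N)"
    then show "\<exists>y\<in>carrier (free_algebra N). y \<oplus>\<^bsub>free_algebra N\<^esub> x = \<zero>\<^bsub>free_algebra N\<^esub>"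
      unfolding carrier_free by (intro bexI[of _ "- x"] alg_uminus) (auto simp: free_algebra_def)
  qed (unfold carrier_free, auto simp: free_algebra_def add.assoc add.commute alg_add alg_0)
  show "Group.monoid (free_algebra N)"
    by (rule monoidI; unfold carrier_free) (auto simp: free_algebra_def mult.assoc alg_mult alg_1)
qed (auto simp: free_algebra_def algebra_simps)

lemma ideal_uq: "ideal (uq_ideal ty N q) (free_algebra N)"
  unfolding uq_ideal_def using ring.genideal_ideal[OF ring_free] relators_alg carrier_free by metis

lemma uq_hom: "uq_class ty N q \<in> ring_hom (free_algebra N) (uq ty N q)"
  using ideal.rcos_ring_hom[OF ideal_uq] unfolding uq_class_def[abs_def] uq_def .

lemma carrier_uq: "carrier (uq ty N q) = uq_class ty N q ` alg N"
  unfolding uq_def FactRing_def A_RCOSETS_def' uq_class_def carrier_free by auto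

lemma uq_class_relator: "f \<in> relators ty N q \<Longrightarrow> uq_class ty N q f = uq_class ty N q 0"
proof -
  interpret ideal "uq_ideal ty N q" "free_algebra N" by (rule ideal_uq)
  assume f: "f \<in> relators ty N q"
  have "relators ty N q \<subseteq> uq_ideal ty N q"
    unfolding uq_ideal_def by (rule genideal_self) (simp add: carrier_free relators_alg)
  moreover have "\<zero>\<^bsub>free_algebra N\<^esub> = 0" by (simp add: free_algebra_def)
  then have "0 \<in> uq_ideal ty N q" using additive_subgroup.zero_closed[OF is_additive_subgroup] by simp
  ultimately have "f \<in> uq_ideal ty N q" "0 \<in> uq_ideal ty N q" using f by auto
  then show ?thesis unfolding uq_class_def using a_rcos_const by simp
qed

section \<open>Defining relations as identities of operators\<close>

locale uq_mod =
  fixes ty :: cartan_type and N :: nat and q :: complex and act :: "'v::ab_group_add uq_action"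
  assumes rank: "valid_rank ty N" and q0: "q \<noteq> 0" and qroot: "\<And>n::nat. n > 0 \<Longrightarrow> q ^ n \<noteq> 1"
    and left: "left_module (uq ty N q) act"
    and C_act: "\<And>e v. act (uq_class ty N q (gen (GenC e))) v = v"
    and irreducible: "irreducible_module (uq ty N q) act"
begin

text \<open>The action pulled back to the free algebra: a relator acts as zero there, so relations
  can be used without handling cosets.\<close>

definition T :: "ncpoly \<Rightarrow> 'v \<Rightarrow> 'v" where
  "T f = act (uq_class ty N q f)"

definition scl :: "complex \<Rightarrow> 'v \<Rightarrow> 'v" where
  "scl z = T (const z)"

lemma scl_scal: "scl = scal ty N q act"
  by (auto simp: fun_eq_iff scl_def scal_def T_def)

lemma class_mem: "f \<in> alg N \<Longrightarrow> uq_class ty N q f \<in> carrier (uq ty N q)"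
  by (simp add: carrier_uq)

lemma T_add: "f \<in> alg N \<Longrightarrow> g \<in> alg N \<Longrightarrow> T (f + g) v = T f v + T g v"
  using left ring_hom_memE(3)[OF uq_hom[of ty N q], of f g] class_mem
  unfolding left_module_def T_def carrier_free by (simp add: free_algebra_def)

lemma T_mult: "f \<in> alg N \<Longrightarrow> g \<in> alg N \<Longrightarrow> T (f * g) v = T f (T g v)"
  using left ring_hom_memE(2)[OF uq_hom[of ty N q], of f g] class_mem
  unfolding left_module_def T_def carrier_free by (simp add: free_algebra_def)

lemma T_1: "T 1 v = v"
  using left ring_hom_memE(4)[OF uq_hom[of ty N q]]
  unfolding left_module_def T_def by (simp add: free_algebra_def)

lemma T_addv: "f \<in> alg N \<Longrightarrow> T f (v + w) = T f v + T f w"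
  using left class_mem unfolding left_module_def T_def by simp

lemma T_0: "T 0 v = 0"
  using T_add[OF alg_0 alg_0, of v] by simp

lemma T_0v: "f \<in> alg N \<Longrightarrow> T f 0 = 0"
  using T_addv[of f 0 0] by simp

lemma T_diff: "f \<in> alg N \<Longrightarrow> g \<in> alg N \<Longrightarrow> T (f - g) v = T f v - T g v"
  using T_add[of "f - g" g v] by (simp add: alg_diff)

lemma T_sum: "(\<And>x. x \<in> A \<Longrightarrow> f x \<in> alg N) \<Longrightarrow> T (sum f A) v = (\<Sum>x\<in>A. T (f x) v)"
  by (induction A rule: infinite_finite_induct) (auto simp: T_0 T_add alg_sum)

lemma T_scl: "f \<in> alg N \<Longrightarrow> T f (scl z v) = scl z (T f v)"
  unfolding scl_def using T_mult[OF _ alg_const, of f z v] T_mult[OF alg_const, of f z v] const_comm[of z f] by simp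

lemma T_const_mult: "f \<in> alg N \<Longrightarrow> T (const z * f) v = scl z (T f v)"
  by (simp add: T_mult alg_const scl_def)

lemma T_relator: "f - g \<in> relators ty N q \<Longrightarrow> f \<in> alg N \<Longrightarrow> g \<in> alg N \<Longrightarrow> T f v = T g v"
  using T_diff[of f g v] uq_class_relator[of "f - g" ty N q] T_0 unfolding T_def by simp

sublocale complex_space scl
proof -
  have "vector_space scl"
  proof
    fix a b :: complex and v w :: 'v
    show "scl a (v + w) = scl a v + scl a w" by (simp add: scl_def T_addv alg_const)
    show "scl (a + b) v = scl a v + scl b v" by (simp add: scl_def const_add T_add alg_const)
    show "scl a (scl b v) = scl (a * b) v" by (simp add: scl_def const_mult T_mult alg_const)
    show "scl 1 v = v" by (simp add: scl_def const_1 T_1)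
  qed
  then show "complex_space scl" by (simp add: complex_space_def)
qed

lemma lin_T: "f \<in> alg N \<Longrightarrow> lin (T f)"
  by (simp add: lin_iff T_addv T_scl)

lemma T_chalf: "T (chalf n) v = v"
proof -
  have "T (gen (GenC e) ^ k) v = v" for e k
    by (induction k) (simp_all add: T_1 T_mult alg_intros C_act[folded T_def])
  then show ?thesis by (simp add: chalf_def)
qed

definition X :: "pm \<Rightarrow> nat \<Rightarrow> int \<Rightarrow> 'v \<Rightarrow> 'v" where "X e i n = T (genX e i n)"
definition K :: "pm \<Rightarrow> nat \<Rightarrow> 'v \<Rightarrow> 'v" where "K e i = T (genK e i)"
definition H :: "nat \<Rightarrow> int \<Rightarrow> 'v \<Rightarrow> 'v" where "H i n = T (genH i n)"
definition F :: "pm \<Rightarrow> nat \<Rightarrow> int \<Rightarrow> 'v \<Rightarrow> 'v" where "F e i n = T (phi_int q e i n)"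

abbreviation (input) "Bm i j \<equiv> symcartan ty N i j"

lemma lin_X: "i \<in> nodes N \<Longrightarrow> lin (X e i n)" and lin_K: "i \<in> nodes N \<Longrightarrow> lin (K e i)"
  and lin_H: "i \<in> nodes N \<Longrightarrow> n \<noteq> 0 \<Longrightarrow> lin (H i n)" and lin_F: "i \<in> nodes N \<Longrightarrow> lin (F e i n)"
  unfolding X_def K_def H_def F_def by (intro lin_T alg_intros alg_phi_int; simp)+

lemma KK: "i \<in> nodes N \<Longrightarrow> K Minus i (K Plus i v) = v" "i \<in> nodes N \<Longrightarrow> K Plus i (K Minus i v) = v"
  using T_relator[OF relators.k_inverse, of i v] T_relator[OF relators.k_inverse', of i v]
  by (simp_all add: alg_intros T_mult T_1 K_def)

lemma K_comm: "i \<in> nodes N \<Longrightarrow> j \<in> nodes N \<Longrightarrow> K Plus i (K Plus j v) = K Plus j (K Plus i v)"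
  using T_relator[OF relators.k_k, of i j v] by (simp add: alg_intros T_mult K_def)

lemma KH: "i \<in> nodes N \<Longrightarrow> j \<in> nodes N \<Longrightarrow> n \<noteq> 0 \<Longrightarrow> K Plus i (H j n v) = H j n (K Plus i v)"
  using T_relator[OF relators.k_h, of i j n v] by (simp add: alg_intros T_mult K_def H_def)

lemma KX: "i \<in> nodes N \<Longrightarrow> j \<in> nodes N \<Longrightarrow>
    K Plus i (X e j n v) = scl (q powi (sg e * Bm i j)) (X e j n (K Plus i v))"
  using T_relator[OF relators.k_x, of i j e n "K Plus i v"] KK[of i v]
  by (simp add: alg_intros T_mult K_def X_def scl_def)

lemma HX: "i \<in> nodes N \<Longrightarrow> j \<in> nodes N \<Longrightarrow> n \<noteq> 0 \<Longrightarrow> H i n (X e j m v) = X e j m (H i n v)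
    + scl (of_int (sg e) * (1 / of_int n) * qint q (n * Bm i j)) (X e j (n + m) v)"
  using T_relator[OF relators.h_x, of i j n e m v]
  by (simp add: alg_intros alg_chalf T_mult T_diff H_def X_def T_chalf scl_def diff_eq_eq add.commute
      del: T_const_mult)

lemma XX: "i \<in> nodes N \<Longrightarrow> j \<in> nodes N \<Longrightarrow>
    X e i (n + 1) (X e j m v) - scl (q powi (sg e * Bm i j)) (X e j m (X e i (n + 1) v)) =
    scl (q powi (sg e * Bm i j)) (X e i n (X e j (m + 1) v)) - X e j (m + 1) (X e i n v)"
  using T_relator[OF relators.x_x, of i j e n m v]
  by (simp add: alg_intros T_mult T_diff X_def scl_def)

lemma HH: "i \<in> nodes N \<Longrightarrow> j \<in> nodes N \<Longrightarrow> n \<noteq> 0 \<Longrightarrow> m \<noteq> 0 \<Longrightarrow> H i n (H j m v) = H j m (H i n v)"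
proof -
  assume a: "i \<in> nodes N" "j \<in> nodes N" "n \<noteq> 0" "m \<noteq> 0"
  let ?c = "if n = - m then const ((1 / of_int n) * qint q (n * Bm i j) / (q - inverse q))
                * (chalf (2 * n) - chalf (- 2 * n)) else 0"
  have c: "?c \<in> alg N" "T ?c v = 0"
    using T_0v[OF alg_const] by (auto simp: alg_intros alg_chalf T_mult T_diff T_chalf T_0)
  show ?thesis
    using T_relator[OF relators.h_h, of i j n m v] a c
    by (simp only: alg_intros T_mult T_diff H_def) simp
qed

definition kap :: "nat \<Rightarrow> complex" where
  "kap i = 1 / (q powi rlen ty N i - q powi - rlen ty N i)"

lemma XpXm: "i \<in> nodes N \<Longrightarrow> j \<in> nodes N \<Longrightarrow> X Plus i n (X Minus j m v) = X Minus j m (X Plus i n v) +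
    (if i = j then scl (kap i) (F Plus i (n + m) v - F Minus i (n + m) v) else 0)"
proof -
  assume a: "i \<in> nodes N" "j \<in> nodes N"
  let ?c = "if i = j then const (1 / (q powi rlen ty N i - q powi (- rlen ty N i)))
                * (chalf (n - m) * phi_int q Plus i (n + m) - chalf (m - n) * phi_int q Minus i (n + m)) else 0"
  have c: "?c \<in> alg N" "T ?c v = (if i = j then scl (kap i) (F Plus i (n + m) v - F Minus i (n + m) v) else 0)"
    using a by (auto simp: alg_intros alg_chalf alg_phi_int T_mult T_diff T_chalf T_0 F_def scl_def kap_def)
  have "T (genX Plus i n * genX Minus j m - genX Minus j m * genX Plus i n) v = T ?c v"
    using relators.xp_xm[OF a, where n = n and m = m and ty = ty and q = q] a c by (intro T_relator) (auto intro!: alg_intros)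
  then show ?thesis unfolding c(2) using a by (simp add: T_diff T_mult alg_intros X_def diff_eq_eq add.commute)
qed

text \<open>For a vanishing Cartan entry the Serre relation has two terms only and is a
  commutator.\<close>

lemma XX_commute: "i \<in> nodes N \<Longrightarrow> j \<in> nodes N \<Longrightarrow> i \<noteq> j \<Longrightarrow> Bm i j = 0 \<Longrightarrow> X e i n (X e j m v) = X e j m (X e i n v)"
proof -
  assume a: "i \<in> nodes N" "j \<in> nodes N" "i \<noteq> j" "Bm i j = 0"
  then have C: "cartan ty N i j = 0" by (auto simp: symcartan_def rlen_def split: if_splits)
  have p: "{\<pi>. \<pi> permutes {..<Suc 0}} = {id}" by (simp add: lessThan_Suc permutes_sing)
  have qi: "qint (q powi rlen ty N i) 1 \<noteq> 0 \<or> qint (q powi rlen ty N i) 1 = 0" by simp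
  let ?Q = "q powi rlen ty N i"
  have b: "qbinom ?Q 1 0 = 1" "qbinom ?Q 1 1 = 1" if "qint ?Q 1 \<noteq> 0"
    using that by (simp_all add: qbinom_def qfact_def)
  \<comment> \<open>The quantum integer 1 is the quotient of \<open>?Q - inverse ?Q\<close> by
    itself; it would be 0, not 1, if that were zero.\<close>
  have "?Q * ?Q \<noteq> 1"
  proof
    assume "?Q * ?Q = 1"
    moreover have "rlen ty N i = 1 \<or> rlen ty N i = 2" by (simp add: rlen_def)
    ultimately have "q ^ 2 = 1 \<or> q ^ 4 = 1" by (auto simp: power2_eq_square power4_eq_xxxx mult.assoc)
    then show False using qroot[of 2] qroot[of 4] by auto
  qed
  then have "?Q - inverse ?Q \<noteq> 0" using q0 by (auto simp: field_simps)
  then have "qint ?Q 1 \<noteq> 0" by (simp add: qint_def power_int_minus)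
  note b = b[OF this]
  have "qserre ?Q e i j (\<lambda>_. n) m 1 = genX e j m * genX e i n - genX e i n * genX e j m"
    unfolding qserre_def One_nat_def p using b by (simp add: const_1 const_uminus)
  moreover have "qserre ?Q e i j (\<lambda>_. n) m 1 \<in> relators ty N q"
    using relators.serre[OF a(1-3), where n = "\<lambda>_. n" and m = m and ty = ty and q = q and e = e] C by simp
  ultimately have "T (genX e j m * genX e i n) v = T (genX e i n * genX e j m) v"
    using a by (intro T_relator) (auto intro!: alg_intros)
  then show ?thesis using a by (simp add: T_mult alg_intros X_def)
qed

end

section \<open>The exponential currents and their commutation with the lowering currents\<close>

lemma triangle_swap:
  fixes f :: "nat \<Rightarrow> nat \<Rightarrow> 'a::comm_monoid_add"
  shows "(\<Sum>k\<le>n. \<Sum>l\<le>n - k. f k l) = (\<Sum>l\<le>n. \<Sum>k\<le>n - l. f k l)"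
  unfolding sum.Sigma[OF finite_atMost ballI[OF finite_atMost]]
  by (rule sum.reindex_bij_witness[where i = prod.swap and j = prod.swap]) auto

lemma triangle_diagonal:
  fixes f :: "nat \<Rightarrow> nat \<Rightarrow> 'a::comm_monoid_add"
  shows "(\<Sum>k\<le>n. \<Sum>l\<le>n - k. f k l) = (\<Sum>p\<le>n. \<Sum>k\<le>p. f k (p - k))"
  unfolding sum.Sigma[OF finite_atMost ballI[OF finite_atMost]]
  by (rule sum.reindex_bij_witness[where i = "\<lambda>(p, k). (k, p - k)" and j = "\<lambda>(k, l). (k + l, k)"]) auto

definition geo :: "complex \<Rightarrow> nat \<Rightarrow> complex" where
  "geo \<beta> p = (if p = 0 then 1 else (\<beta> - inverse \<beta>) * \<beta> ^ (p - 1))"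

lemma geo_Suc: "geo \<beta> (Suc p) - \<beta> * geo \<beta> p = (if p = 0 then - inverse \<beta> else 0)"
  by (cases p) (auto simp: geo_def algebra_simps)

text \<open>The coefficients \<open>geo \<beta>\<close> are those of \<open>(1 - u / \<beta>) / (1 - \<beta> u)\<close>; this is the recursion given
  by its logarithmic derivative.\<close>

lemma geo_rec:
  assumes "\<beta> \<noteq> 0"
  shows "(\<Sum>k\<le>p. geo \<beta> (p - k) * (\<beta> ^ k - inverse \<beta> ^ k)) = of_nat p * geo \<beta> p"
proof (induction p)
  case (Suc p)
  let ?b = "\<lambda>k. \<beta> ^ k - inverse \<beta> ^ k"
  show ?case
  proof (cases "p = 0")
    case True
    then show ?thesis by (simp add: geo_def)
  next
    case False
    have 1: "geo \<beta> (Suc p - k) * ?b k = \<beta> * (geo \<beta> (p - k) * ?b k)" if "k < p" for k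
      using that geo_Suc[of \<beta> "p - k"] by (simp add: Suc_diff_le)
    have "(\<Sum>k\<le>p. geo \<beta> (p - k) * ?b k) = (\<Sum>k<p. geo \<beta> (p - k) * ?b k) + ?b p"
      using sum.lessThan_Suc[of "\<lambda>k. geo \<beta> (p - k) * ?b k" p] by (simp add: lessThan_Suc_atMost geo_def)
    then have 2: "(\<Sum>k<p. geo \<beta> (p - k) * ?b k) = of_nat p * geo \<beta> p - ?b p" using Suc by (simp add: algebra_simps)
    have "(\<Sum>k\<le>Suc p. geo \<beta> (Suc p - k) * ?b k)
        = (\<Sum>k<p. geo \<beta> (Suc p - k) * ?b k) + geo \<beta> 1 * ?b p + ?b (Suc p)"
      by (simp add: lessThan_Suc_atMost[symmetric] geo_def)
    also have "(\<Sum>k<p. geo \<beta> (Suc p - k) * ?b k) = \<beta> * (\<Sum>k<p. geo \<beta> (p - k) * ?b k)"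
      unfolding sum_distrib_left using 1 by (intro sum.cong) auto
    also have "\<dots> = of_nat p * geo \<beta> (Suc p) - \<beta> * ?b p"
      unfolding 2 using geo_Suc[of \<beta> p] False by (simp add: algebra_simps)
    also have "\<dots> + geo \<beta> 1 * ?b p + ?b (Suc p) = of_nat (Suc p) * geo \<beta> (Suc p)"
      using assms False by (cases p) (simp_all add: geo_def field_simps)
    finally show ?thesis .
  qed
qed (simp add: geo_def)

context uq_mod
begin

text \<open>The coefficient of degree \<open>k\<close> in the exponent of the current, up to the
  constant \<open>sq e\<close>; \<open>dhop\<close> is that of its Euler derivative.\<close>

definition hop :: "pm \<Rightarrow> nat \<Rightarrow> nat \<Rightarrow> 'v \<Rightarrow> 'v" where
  "hop e i k v = (if k = 0 then 0 else H i (sg e * int k) v)"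

definition conv :: "(nat \<Rightarrow> 'v \<Rightarrow> 'v) \<Rightarrow> (nat \<Rightarrow> 'v) \<Rightarrow> nat \<Rightarrow> 'v" where
  "conv c f n = (\<Sum>k\<le>n. c k (f (n - k)))"

definition Pw :: "pm \<Rightarrow> nat \<Rightarrow> nat \<Rightarrow> 'v \<Rightarrow> nat \<Rightarrow> 'v" where
  "Pw e i j v n = T (fps_nth (hser e i ^ j) n) v"

definition sq :: "pm \<Rightarrow> complex" where
  "sq e = of_int (sg e) * (q - inverse q)"

definition Ex :: "pm \<Rightarrow> nat \<Rightarrow> 'v \<Rightarrow> nat \<Rightarrow> 'v" where
  "Ex e i v n = (\<Sum>j\<le>n. scl (sq e ^ j / fact j) (Pw e i j v n))"

definition dhop :: "pm \<Rightarrow> nat \<Rightarrow> nat \<Rightarrow> 'v \<Rightarrow> 'v" where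
  "dhop e i k v = scl (of_nat k) (hop e i k v)"

lemma lin_hop: "i \<in> nodes N \<Longrightarrow> lin (hop e i k)"
  using lin_H[of i "sg e * int k"] by (simp add: hop_def[abs_def] lin_iff sg_nz)

lemma lin_dhop: "i \<in> nodes N \<Longrightarrow> lin (dhop e i k)"
  using lin_hop[of i e k] by (simp add: dhop_def[abs_def] lin_iff scale_right_distrib mult.commute)

lemma hop_comm: "i \<in> nodes N \<Longrightarrow> hop e i k (hop e i l v) = hop e i l (hop e i k v)"
  using module_hom.zero[OF lin_hop] by (simp add: hop_def HH sg_nz module_hom.zero[OF lin_H])

lemma conv_comm:
  assumes "\<And>k. lin (c k)" "\<And>k. lin (d k)" "\<And>k l v. c k (d l v) = d l (c k v)"
  shows "conv c (conv d f) n = conv d (conv c f) n"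
proof -
  have "conv c (conv d f) n = (\<Sum>k\<le>n. \<Sum>l\<le>n - k. c k (d l (f (n - k - l))))"
    unfolding conv_def module_hom.sum[OF assms(1)] ..
  also have "\<dots> = (\<Sum>l\<le>n. \<Sum>k\<le>n - l. d l (c k (f (n - l - k))))"
    by (subst triangle_swap) (simp add: assms(3) add.commute)
  also have "\<dots> = conv d (conv c f) n"
    unfolding conv_def module_hom.sum[OF assms(2)] ..
  finally show ?thesis .
qed

lemma Pw_0: "Pw e i 0 v n = (if n = 0 then v else 0)"
  by (simp add: Pw_def T_1 T_0)

lemma Pw_Suc:
  assumes "i \<in> nodes N" shows "Pw e i (Suc j) v = conv (hop e i) (Pw e i j v)"
proof
  fix n
  have a: "fps_nth (hser e i) k \<in> alg N" "fps_nth (hser e i ^ j) k \<in> alg N" for k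
    by (intro alg_hser assms alg_fps_power)+
  have h: "T (fps_nth (hser e i) k) w = hop e i k w" for k w
    by (simp add: hser_def hop_def T_0 H_def)
  have "Pw e i (Suc j) v n = (\<Sum>k=0..n. T (fps_nth (hser e i) k * fps_nth (hser e i ^ j) (n - k)) v)"
    unfolding Pw_def power_Suc fps_mult_nth by (rule T_sum) (intro alg_mult a)
  then show "Pw e i (Suc j) v n = conv (hop e i) (Pw e i j v) n"
    by (simp add: T_mult a h conv_def Pw_def atLeast0AtMost)
qed

lemma Pw_eq_0: "i \<in> nodes N \<Longrightarrow> n < j \<Longrightarrow> Pw e i j v n = 0"
proof (induction j arbitrary: n)
  case (Suc j)
  have "hop e i k (Pw e i j v (n - k)) = 0" if "k \<le> n" for k
    using Suc that by (cases "k = 0") (auto simp: hop_def module_hom.zero[OF lin_H] sg_nz)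
  then show ?case using Suc.prems by (simp add: Pw_Suc conv_def)
qed simp

lemma conv_number:
  assumes "i \<in> nodes N"
  shows "scl (of_nat n) (conv (hop e i) f n) = conv (dhop e i) f n + conv (hop e i) (\<lambda>m. scl (of_nat m) (f m)) n"
proof -
  have "scl (of_nat n) (hop e i k (f (n - k))) = dhop e i k (f (n - k)) + hop e i k (scl (of_nat (n - k)) (f (n - k)))"
    if "k \<le> n" for k
    using that by (simp add: dhop_def module_hom.scale[OF lin_hop[OF assms]] of_nat_diff flip: scale_left_distrib)
  then show ?thesis by (simp add: conv_def scale_sum_right flip: sum.distrib)
qed

text \<open>The Euler derivation of a power of a series; the usual rule applies because the
  operators \<open>hop\<close> commute with one another.\<close>

lemma Pw_number:
  assumes i: "i \<in> nodes N"
  shows "scl (of_nat n) (Pw e i (Suc j) v n) = scl (of_nat (Suc j)) (conv (dhop e i) (Pw e i j v) n)"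
proof (induction j arbitrary: n)
  case 0
  have "conv (hop e i) (\<lambda>m. scl (of_nat m) (Pw e i 0 v m)) n = 0"
    unfolding conv_def by (intro sum.neutral) (auto simp: Pw_0 module_hom.zero[OF lin_hop[OF i]])
  then show ?case using conv_number[OF i, of n e "Pw e i 0 v"] Pw_Suc[OF i, of e 0 v] by simp
next
  case (Suc j)
  have dh: "lin (dhop e i k)" "lin (hop e i k)" "hop e i k (dhop e i l w) = dhop e i l (hop e i k w)" for k l w
    using lin_dhop[OF i] lin_hop[OF i] by (auto simp: dhop_def module_hom.scale[OF lin_hop[OF i]] hop_comm[OF i])
  have "conv (hop e i) (\<lambda>m. scl (of_nat m) (Pw e i (Suc j) v m)) n
      = conv (hop e i) (\<lambda>m. scl (of_nat (Suc j)) (conv (dhop e i) (Pw e i j v) m)) n"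
    using Suc by simp
  also have "\<dots> = scl (of_nat (Suc j)) (conv (hop e i) (conv (dhop e i) (Pw e i j v)) n)"
    unfolding conv_def[of "hop e i"] by (simp only: module_hom.scale[OF dh(2)] scale_sum_right)
  also have "conv (hop e i) (conv (dhop e i) (Pw e i j v)) n = conv (dhop e i) (Pw e i (Suc j) v) n"
    unfolding Pw_Suc[OF i, of e j v] by (rule conv_comm) (use dh in auto)
  finally have "scl (of_nat n) (Pw e i (Suc (Suc j)) v n) = conv (dhop e i) (Pw e i (Suc j) v) n
      + scl (of_nat (Suc j)) (conv (dhop e i) (Pw e i (Suc j) v) n)"
    using conv_number[OF i, of n e "Pw e i (Suc j) v"] Pw_Suc[OF i, of e "Suc j" v] by simp
  also have "\<dots> = scl (1 + of_nat (Suc j)) (conv (dhop e i) (Pw e i (Suc j) v) n)"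
    by (simp only: scale_left_distrib scale_one)
  finally show ?case by simp
qed

lemma Ex_bound:
  assumes "i \<in> nodes N" "n \<le> M"
  shows "Ex e i v n = (\<Sum>j\<le>M. scl (sq e ^ j / fact j) (Pw e i j v n))"
  unfolding Ex_def using assms by (intro sum.mono_neutral_left) (auto simp: Pw_eq_0)

lemma Ex_0: "Ex e i v 0 = v"
  by (simp add: Ex_def Pw_0)

text \<open>The coefficient form of \<open>u E' = (u h') E\<close> for \<open>E = exp h\<close>. It
  determines the coefficients of the exponential from those of the exponent and conversely, and
  replaces explicit manipulation of the exponential series below.\<close>

lemma Ex_rec:
  assumes i: "i \<in> nodes N"
  shows "scl (of_nat n) (Ex e i v n) = scl (sq e) (\<Sum>k\<le>n. dhop e i k (Ex e i v (n - k)))"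
proof -
  have "scl (of_nat n) (Ex e i v n) = (\<Sum>j\<le>Suc n. scl (sq e ^ j / fact j) (scl (of_nat n) (Pw e i j v n)))"
    by (simp only: Ex_bound[OF i le_SucI[OF order.refl], of e v n] scale_sum_right scale_left_commute)
  also have "\<dots> = scl (of_nat n) (Pw e i 0 v n)
      + (\<Sum>j\<le>n. scl (sq e ^ Suc j / fact (Suc j)) (scl (of_nat n) (Pw e i (Suc j) v n)))"
    by (subst sum.atMost_Suc_shift) simp
  also have "scl (of_nat n) (Pw e i 0 v n) = 0" by (simp add: Pw_0)
  also have "(\<Sum>j\<le>n. scl (sq e ^ Suc j / fact (Suc j)) (scl (of_nat n) (Pw e i (Suc j) v n)))
      = (\<Sum>j\<le>n. scl (sq e) (scl (sq e ^ j / fact j) (conv (dhop e i) (Pw e i j v) n)))"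
  proof (intro sum.cong refl)
    fix j
    have "sq e ^ Suc j / fact (Suc j) * of_nat (Suc j) = sq e * (sq e ^ j / fact j)"
      by (simp add: field_simps del: of_nat_Suc)
    then show "scl (sq e ^ Suc j / fact (Suc j)) (scl (of_nat n) (Pw e i (Suc j) v n))
      = scl (sq e) (scl (sq e ^ j / fact j) (conv (dhop e i) (Pw e i j v) n))"
      by (simp only: Pw_number[OF i] scale_scale)
  qed
  also have "\<dots> = scl (sq e) (\<Sum>k\<le>n. \<Sum>j\<le>n. scl (sq e ^ j / fact j) (dhop e i k (Pw e i j v (n - k))))"
    unfolding conv_def scale_sum_right by (rule sum.swap)
  also have "(\<Sum>k\<le>n. \<Sum>j\<le>n. scl (sq e ^ j / fact j) (dhop e i k (Pw e i j v (n - k))))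
      = (\<Sum>k\<le>n. dhop e i k (Ex e i v (n - k)))"
    by (intro sum.cong refl)
       (simp only: Ex_bound[OF i diff_le_self] lin_cong_sum[OF lin_dhop[OF i]])
  finally show ?thesis by simp
qed

lemma T_phi: "i \<in> nodes N \<Longrightarrow> T (phi q e i n) v = K e i (Ex e i v n)"
proof -
  assume i: "i \<in> nodes N"
  have a: "fps_nth (hser e i ^ j) n \<in> alg N" for j by (intro alg_fps_power alg_hser i)
  show ?thesis
    unfolding phi_def hser_def[symmetric] Ex_def Pw_def sq_def K_def
    using i a by (simp add: T_mult T_sum alg_intros scl_def)
qed

lemma F_Ex: "i \<in> nodes N \<Longrightarrow> F e i n v = (if sg e * n \<ge> 0 then K e i (Ex e i v (nat (sg e * n))) else 0)"
  by (simp add: F_def phi_int_def T_phi T_0)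

lemma Ex_mem:
  assumes "i \<in> nodes N" "subspace W" "v \<in> W" "\<And>n v. n \<noteq> 0 \<Longrightarrow> v \<in> W \<Longrightarrow> H i n v \<in> W"
  shows "Ex e i v n \<in> W"
proof (induction n rule: less_induct)
  case (less n)
  show ?case
  proof (cases "n = 0")
    case False
    have "dhop e i k (Ex e i v (n - k)) \<in> W" if "k \<le> n" for k
    proof (cases "k = 0")
      case True
      then show ?thesis using subspace_0[OF assms(2)] by (simp add: dhop_def hop_def)
    next
      case k: False
      then have "Ex e i v (n - k) \<in> W" using less False by simp
      then show ?thesis using k assms(2,4) by (simp add: dhop_def hop_def sg_nz subspace_scale)
    qed
    then have "scl (of_nat n) (Ex e i v n) \<in> W"
      unfolding Ex_rec[OF assms(1)] by (intro subspace_scale subspace_sum assms(2)) auto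
    then have "scl (1 / of_nat n) (scl (of_nat n) (Ex e i v n)) \<in> W" by (rule subspace_scale[OF assms(2)])
    then show ?thesis using False by simp
  qed (simp add: Ex_0 assms(3))
qed

lemma sq_nz: "sq e \<noteq> 0"
proof
  assume "sq e = 0"
  then have "q = inverse q" using sg_nz[of e] by (simp add: sq_def)
  then have "q ^ 2 = 1" using q0 by (simp add: power2_eq_square field_simps)
  then show False using qroot[of 2] by simp
qed

text \<open>\<open>Ex_rec\<close> is solved for its term with \<open>k = n\<close>, which is
  \<open>dhop e i n v\<close> itself because \<open>Ex\<close> in degree 0 is the identity.\<close>

lemma hop_mem_span:
  assumes i: "i \<in> nodes N" and "\<And>n. Ex e i v n \<in> span {v}"
  shows "hop e i n v \<in> span {v}"
proof (induction n rule: less_induct)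
  case (less n)
  show ?case
  proof (cases "n = 0")
    case False
    have "dhop e i k (Ex e i v (n - k)) \<in> span {v}" if k: "k < n" for k
    proof (rule lin_span_closed[OF lin_dhop[OF i]])
      show "dhop e i k ` {v} \<subseteq> span {v}" using less[OF k] by (auto simp: dhop_def intro: span_scale)
      show "Ex e i v (n - k) \<in> span {v}" by (rule assms(2))
    qed
    then have s: "(\<Sum>k<n. dhop e i k (Ex e i v (n - k))) \<in> span {v}" by (intro span_sum) auto
    have "(\<Sum>k\<le>n. dhop e i k (Ex e i v (n - k))) = (\<Sum>k<n. dhop e i k (Ex e i v (n - k))) + dhop e i n v"
      by (simp add: lessThan_Suc_atMost[symmetric] Ex_0)
    then have "dhop e i n v = scl (1 / sq e) (scl (of_nat n) (Ex e i v n)) - (\<Sum>k<n. dhop e i k (Ex e i v (n - k)))"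
      unfolding Ex_rec[OF i] using sq_nz[of e] by simp
    then have "dhop e i n v \<in> span {v}" using s assms(2) by (simp add: span_scale span_diff)
    then have "scl (1 / of_nat n) (dhop e i n v) \<in> span {v}" by (rule span_scale)
    then show ?thesis using False by (simp add: dhop_def)
  qed (simp add: hop_def span_zero)
qed

text \<open>The factor \<open>1 / n\<close> of the relation cancels against the Euler derivative,
  and the denominator of the quantum integer against the factor in \<open>sq\<close>.\<close>

lemma dhop_X:
  fixes e :: pm
  assumes "i \<in> nodes N" "j \<in> nodes N"
  defines "\<beta> \<equiv> q powi (- (sg e * Bm i j))"
  shows "scl (sq e) (dhop e i k (X Minus j m v)) = X Minus j m (scl (sq e) (dhop e i k v))
    + scl (\<beta> ^ k - inverse \<beta> ^ k) (X Minus j (m + sg e * int k) v)"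
proof (cases "k = 0")
  case True
  then show ?thesis using lin_X[OF assms(2), of Minus m] by (simp add: dhop_def hop_def module_hom.zero)
next
  case False
  have s: "of_int (sg e) \<noteq> (0::complex)" using sg_nz by simp
  have d: "q - inverse q \<noteq> 0" using sq_nz[of Plus] by (simp add: sq_def)
  have b: "\<beta> ^ k = q powi - (sg e * int k * Bm i j)" "inverse \<beta> ^ k = q powi (sg e * int k * Bm i j)"
  proof -
    have "\<beta> ^ k = q powi (- (sg e * Bm i j) * int k)"
      unfolding \<beta>_def by (simp only: power_int_mult power_int_of_nat)
    moreover have "inverse \<beta> ^ k = inverse (\<beta> ^ k)" by (simp add: power_inverse)
    moreover have "- (sg e * Bm i j) * int k = - (sg e * int k * Bm i j)" by simp
    ultimately show "\<beta> ^ k = q powi - (sg e * int k * Bm i j)" "inverse \<beta> ^ k = q powi (sg e * int k * Bm i j)"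
      by (simp_all only: power_int_minus inverse_inverse_eq)
  qed
  let ?n = "sg e * int k"
  have c: "sq e * of_nat k * (of_int (sg Minus) * (1 / of_int ?n) * qint q (?n * Bm i j)) = \<beta> ^ k - inverse \<beta> ^ k"
  proof -
    have "S * D * m * (- 1 * (1 / (S * m)) * (Y / D)) = - Y" if "S \<noteq> 0" "D \<noteq> 0" "m \<noteq> 0" for S D m Y :: complex
      using that by simp
    from this[OF s d, of "of_nat k" "q powi (?n * Bm i j) - q powi - (?n * Bm i j)"] False
    show ?thesis unfolding b sq_def qint_def by simp
  qed
  have "scl (sq e) (dhop e i k (X Minus j m v)) = scl (sq e * of_nat k) (H i ?n (X Minus j m v))"
    using False by (simp add: dhop_def hop_def)
  also have "\<dots> = scl (sq e * of_nat k) (X Minus j m (H i ?n v))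
      + scl (sq e * of_nat k) (scl (of_int (sg Minus) * (1 / of_int ?n) * qint q (?n * Bm i j)) (X Minus j (?n + m) v))"
  proof -
    have "H i ?n (X Minus j m v) = X Minus j m (H i ?n v)
        + scl (of_int (sg Minus) * (1 / of_int ?n) * qint q (?n * Bm i j)) (X Minus j (?n + m) v)"
      by (rule HX[OF assms(1,2)]) (use False sg_nz[of e] in simp)
    then show ?thesis by (simp only: scale_right_distrib)
  qed
  also have "\<dots> = X Minus j m (scl (sq e * of_nat k) (H i ?n v)) + scl (\<beta> ^ k - inverse \<beta> ^ k) (X Minus j (m + ?n) v)"
    unfolding scale_scale c by (simp add: module_hom.scale[OF lin_X[OF assms(2)]] add.commute)
  finally show ?thesis using False by (simp add: dhop_def hop_def)
qed

text \<open>Moving the exponential past the lowering current multiplies the current by the scalar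
  series with coefficients \<open>geo \<beta>\<close>. Both sides satisfy the recursion
  \<open>Ex_rec\<close>: moving \<open>dhop\<close> past \<open>X\<close> leaves a sum with the
  factor \<open>n - p\<close> and a commutator term that \<open>geo_rec\<close> turns into one with
  the factor \<open>p\<close>; together they give \<open>n\<close>.\<close>

lemma Ex_X:
  fixes e :: pm
  assumes i: "i \<in> nodes N" "j \<in> nodes N"
  defines "\<beta> \<equiv> q powi (- (sg e * Bm i j))"
  shows "Ex e i (X Minus j m v) n = (\<Sum>p\<le>n. scl (geo \<beta> p) (X Minus j (m + sg e * int p) (Ex e i v (n - p))))"
proof (induction n rule: less_induct)
  case (less n)
  define G where "G n = (\<Sum>p\<le>n. scl (geo \<beta> p) (X Minus j (m + sg e * int p) (Ex e i v (n - p))))" for n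
  have \<beta>: "\<beta> \<noteq> 0" using q0 by (simp add: \<beta>_def)
  have lX: "lin (X Minus j l)" for l by (rule lin_X[OF i(2)])
  show ?case
  proof (cases "n = 0")
    case True
    then show ?thesis by (simp add: Ex_0 geo_def)
  next
    case False
    have "scl (of_nat n) (Ex e i (X Minus j m v) n) = (\<Sum>k\<le>n. scl (sq e) (dhop e i k (Ex e i (X Minus j m v) (n - k))))"
      unfolding Ex_rec[OF i(1)] scale_sum_right ..
    also have "\<dots> = (\<Sum>k\<le>n. scl (sq e) (dhop e i k (G (n - k))))"
    proof (intro sum.cong refl)
      fix k
      show "scl (sq e) (dhop e i k (Ex e i (X Minus j m v) (n - k))) = scl (sq e) (dhop e i k (G (n - k)))"
        using less[of "n - k"] False by (cases "k = 0") (auto simp: dhop_def hop_def G_def)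
    qed
    also have "\<dots> = (\<Sum>k\<le>n. \<Sum>p\<le>n - k. scl (geo \<beta> p) (X Minus j (m + sg e * int p) (scl (sq e) (dhop e i k (Ex e i v (n - k - p)))))
        + scl (geo \<beta> p * (\<beta> ^ k - inverse \<beta> ^ k)) (X Minus j (m + sg e * int (k + p)) (Ex e i v (n - (k + p)))))"
      unfolding G_def lin_cong_sum[OF lin_dhop[OF i(1)]] scale_sum_right
    proof (intro sum.cong refl)
      fix k p
      have "scl (sq e) (scl (geo \<beta> p) (dhop e i k (X Minus j (m + sg e * int p) (Ex e i v (n - k - p)))))
        = scl (geo \<beta> p) (scl (sq e) (dhop e i k (X Minus j (m + sg e * int p) (Ex e i v (n - k - p)))))"
        by (rule scale_left_commute)
      then show "scl (sq e) (scl (geo \<beta> p) (dhop e i k (X Minus j (m + sg e * int p) (Ex e i v (n - k - p)))))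
        = scl (geo \<beta> p) (X Minus j (m + sg e * int p) (scl (sq e) (dhop e i k (Ex e i v (n - k - p)))))
        + scl (geo \<beta> p * (\<beta> ^ k - inverse \<beta> ^ k)) (X Minus j (m + sg e * int (k + p)) (Ex e i v (n - (k + p))))"
        unfolding dhop_X[OF i] \<beta>_def[symmetric]
        by (simp add: scale_right_distrib algebra_simps)
    qed
    also have "\<dots> = (\<Sum>k\<le>n. \<Sum>p\<le>n - k. scl (geo \<beta> p) (X Minus j (m + sg e * int p) (scl (sq e) (dhop e i k (Ex e i v (n - k - p))))))
        + (\<Sum>k\<le>n. \<Sum>p\<le>n - k. scl (geo \<beta> p * (\<beta> ^ k - inverse \<beta> ^ k)) (X Minus j (m + sg e * int (k + p)) (Ex e i v (n - (k + p)))))"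
      by (simp only: sum.distrib)
    also have "(\<Sum>k\<le>n. \<Sum>p\<le>n - k. scl (geo \<beta> p * (\<beta> ^ k - inverse \<beta> ^ k)) (X Minus j (m + sg e * int (k + p)) (Ex e i v (n - (k + p)))))
        = (\<Sum>p\<le>n. scl (of_nat p * geo \<beta> p) (X Minus j (m + sg e * int p) (Ex e i v (n - p))))"
    proof -
      have "(\<Sum>k\<le>n. \<Sum>p\<le>n - k. scl (geo \<beta> p * (\<beta> ^ k - inverse \<beta> ^ k)) (X Minus j (m + sg e * int (k + p)) (Ex e i v (n - (k + p)))))
        = (\<Sum>p\<le>n. \<Sum>k\<le>p. scl (geo \<beta> (p - k) * (\<beta> ^ k - inverse \<beta> ^ k))
            (X Minus j (m + sg e * int (k + (p - k))) (Ex e i v (n - (k + (p - k))))))"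
        by (rule triangle_diagonal)
      also have "\<dots> = (\<Sum>p\<le>n. scl (\<Sum>k\<le>p. geo \<beta> (p - k) * (\<beta> ^ k - inverse \<beta> ^ k))
            (X Minus j (m + sg e * int p) (Ex e i v (n - p))))"
        unfolding scale_sum_left by (intro sum.cong refl) simp
      finally show ?thesis by (simp only: geo_rec[OF \<beta>])
    qed
    also have "(\<Sum>k\<le>n. \<Sum>p\<le>n - k. scl (geo \<beta> p) (X Minus j (m + sg e * int p) (scl (sq e) (dhop e i k (Ex e i v (n - k - p))))))
        = (\<Sum>p\<le>n. scl (geo \<beta> p) (X Minus j (m + sg e * int p) (scl (of_nat (n - p)) (Ex e i v (n - p)))))"
      unfolding Ex_rec[OF i(1)] scale_sum_right module_hom.sum[OF lX]
      by (subst triangle_swap) (intro sum.cong refl, simp add: add.commute)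
    also have "\<dots> + (\<Sum>p\<le>n. scl (of_nat p * geo \<beta> p) (X Minus j (m + sg e * int p) (Ex e i v (n - p))))
        = scl (of_nat n) (G n)"
      unfolding G_def scale_sum_right sum.distrib[symmetric]
    proof (intro sum.cong refl)
      fix p assume "p \<in> {..n}"
      then have "geo \<beta> p * of_nat (n - p) + of_nat p * geo \<beta> p = of_nat n * geo \<beta> p"
        by (simp add: of_nat_diff algebra_simps)
      then show "scl (geo \<beta> p) (X Minus j (m + sg e * int p) (scl (of_nat (n - p)) (Ex e i v (n - p))))
          + scl (of_nat p * geo \<beta> p) (X Minus j (m + sg e * int p) (Ex e i v (n - p)))
          = scl (of_nat n) (scl (geo \<beta> p) (X Minus j (m + sg e * int p) (Ex e i v (n - p))))"
        by (simp only: module_hom.scale[OF lX] scale_scale flip: scale_left_distrib)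
    qed
    finally have "scl (of_nat n) (Ex e i (X Minus j m v) n) = scl (of_nat n) (G n)" .
    then show ?thesis using False by (simp add: scale_cancel_left G_def)
  qed
qed

text \<open>Multiplication by \<open>1 - \<beta> u\<close> reduces the sum in \<open>Ex_X\<close> to
  two terms.\<close>

lemma Ex_X_two_term:
  fixes e :: pm
  assumes i: "i \<in> nodes N" "j \<in> nodes N"
  defines "\<beta> \<equiv> q powi (- (sg e * Bm i j))"
  shows "Ex e i (X Minus j m v) (Suc n) - scl \<beta> (Ex e i (X Minus j (m + sg e) v) n)
    = X Minus j m (Ex e i v (Suc n)) - scl (inverse \<beta>) (X Minus j (m + sg e) (Ex e i v n))"
proof -
  let ?t = "\<lambda>p. X Minus j (m + sg e * int p) (Ex e i v (Suc n - p))"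
  have "Ex e i (X Minus j m v) (Suc n) = scl (geo \<beta> 0) (?t 0) + (\<Sum>p\<le>n. scl (geo \<beta> (Suc p)) (?t (Suc p)))"
    unfolding Ex_X[OF i] \<beta>_def[symmetric] by (subst sum.atMost_Suc_shift) simp
  moreover have "scl \<beta> (Ex e i (X Minus j (m + sg e) v) n) = (\<Sum>p\<le>n. scl (\<beta> * geo \<beta> p) (?t (Suc p)))"
    unfolding Ex_X[OF i] \<beta>_def[symmetric] scale_sum_right by (intro sum.cong refl) (simp add: algebra_simps)
  ultimately have "Ex e i (X Minus j m v) (Suc n) - scl \<beta> (Ex e i (X Minus j (m + sg e) v) n)
      = ?t 0 + (\<Sum>p\<le>n. scl (geo \<beta> (Suc p) - \<beta> * geo \<beta> p) (?t (Suc p)))"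
    by (simp add: geo_def scale_left_diff_distrib sum_subtractf)
  also have "(\<Sum>p\<le>n. scl (geo \<beta> (Suc p) - \<beta> * geo \<beta> p) (?t (Suc p))) = (\<Sum>p\<le>n. if p = 0 then scl (- inverse \<beta>) (?t (Suc 0)) else 0)"
    unfolding geo_Suc by (intro sum.cong) auto
  finally show ?thesis by simp
qed

text \<open>After multiplication by \<open>K\<close> the two-term identities for the two signs
  become one and the same relation, valid for both expansions. For \<open>Minus\<close> the two
  modes exchange their roles and the identity is rescaled by
  \<open>- inverse ?\<beta>\<close>.\<close>

lemma FX:
  assumes i: "i \<in> nodes N" "j \<in> nodes N"
  shows "F e i n (X Minus j m v) - scl (q powi - Bm i j) (F e i (n - 1) (X Minus j (m + 1) v)) =
    scl (q powi - Bm i j) (X Minus j m (F e i n v)) - X Minus j (m + 1) (F e i (n - 1) v)"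
proof (cases e)
  case Plus
  let ?\<beta> = "q powi - Bm i j"
  have KXm: "K Plus i (X Minus j m v) = scl ?\<beta> (X Minus j m (K Plus i v))" for m v
    using KX[OF i, of Minus] by simp
  consider "n < 0" | "n = 0" | k where "n = int (Suc k)"
    by (cases n) (auto, metis not0_implies_Suc of_nat_0 of_nat_Suc)
  then show ?thesis
  proof cases
    case 1
    then show ?thesis using i Plus by (simp add: F_Ex module_hom.zero[OF lin_X])
  next
    case 2
    then show ?thesis using i Plus by (simp add: F_Ex Ex_0 KXm module_hom.zero[OF lin_X])
  next
    case (3 k)
    have "K Plus i (Ex Plus i (X Minus j m v) (Suc k) - scl ?\<beta> (Ex Plus i (X Minus j (m + 1) v) k))
      = K Plus i (X Minus j m (Ex Plus i v (Suc k)) - scl (inverse ?\<beta>) (X Minus j (m + 1) (Ex Plus i v k)))"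
      using Ex_X_two_term[OF i, of Plus m v k] by simp
    then show ?thesis using i Plus 3 q0
      by (simp add: F_Ex module_hom.diff[OF lin_K] module_hom.scale[OF lin_K] KXm nat_add_distrib)
  qed
next
  case Minus
  let ?\<beta> = "q powi Bm i j"
  have KXm: "K Minus i (X Minus j m v) = scl ?\<beta> (X Minus j m (K Minus i v))" for m v
  proof -
    have "X Minus j m v = scl ?\<beta> (K Plus i (X Minus j m (K Minus i v)))"
      using KX[OF i, of Minus m "K Minus i v"] KK(2)[OF i(1), of v] q0 by (simp add: power_int_minus)
    then show ?thesis using KK(1)[OF i(1)] by (simp add: module_hom.scale[OF lin_K[OF i(1)]])
  qed
  have inv: "q powi - Bm i j = inverse ?\<beta>" by (simp add: power_int_minus)
  \<comment> \<open>For \<open>n = 1\<close> the mode \<open>F Minus i n\<close> is zero while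
    \<open>F Minus i (n - 1)\<close> is \<open>K Minus i\<close>.\<close>
  consider "n > 1" | "n = 1" | k where "n = - int k"
    by (metis (no_types, opaque_lifting) int_cases4 less_numeral_extra(3) linorder_neqE_linordered_idom
        neg_0_less_iff_less nonneg_int_cases of_nat_0_le_iff add.inverse_inverse int_one_le_iff_zero_less le_less
        minus_le_iff neg_le_0_iff_le not_le)
  then show ?thesis
  proof cases
    case 1
    then show ?thesis using i Minus by (simp add: F_Ex module_hom.zero[OF lin_X])
  next
    case 2
    then show ?thesis using i Minus q0 by (simp add: F_Ex Ex_0 KXm module_hom.zero[OF lin_X] power_int_minus)
  next
    case (3 k)
    have n: "nat (sg Minus * n) = k" "nat (sg Minus * (n - 1)) = Suc k" using 3 by auto
    have "K Minus i (Ex Minus i (X Minus j (m + 1) v) (Suc k) - scl ?\<beta> (Ex Minus i (X Minus j m v) k))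
      = K Minus i (X Minus j (m + 1) (Ex Minus i v (Suc k)) - scl (inverse ?\<beta>) (X Minus j m (Ex Minus i v k)))"
      using Ex_X_two_term[OF i, of Minus "m + 1" v k] by simp
    then have a: "F Minus i (n - 1) (X Minus j (m + 1) v) - scl ?\<beta> (F Minus i n (X Minus j m v))
      = scl ?\<beta> (X Minus j (m + 1) (F Minus i (n - 1) v)) - X Minus j m (F Minus i n v)"
      using i 3 n q0
      by (simp add: F_Ex module_hom.diff[OF lin_K] module_hom.scale[OF lin_K] KXm)
    have "scl (- inverse ?\<beta>) (F Minus i (n - 1) (X Minus j (m + 1) v) - scl ?\<beta> (F Minus i n (X Minus j m v)))
      = scl (- inverse ?\<beta>) (scl ?\<beta> (X Minus j (m + 1) (F Minus i (n - 1) v)) - X Minus j m (F Minus i n v))"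
      by (simp only: a)
    then show ?thesis unfolding Minus inv using q0
      by (simp add: scale_right_diff_distrib algebra_simps)
  qed
qed

lemma F_mem:
  assumes i: "i \<in> nodes N" and W: "subspace W" "\<And>e i v. i \<in> nodes N \<Longrightarrow> v \<in> W \<Longrightarrow> K e i v \<in> W"
    "\<And>i n v. i \<in> nodes N \<Longrightarrow> n \<noteq> 0 \<Longrightarrow> v \<in> W \<Longrightarrow> H i n v \<in> W" and v: "v \<in> W"
  shows "F e i n v \<in> W"
proof (cases "sg e * n \<ge> 0")
  case True
  have "Ex e i v (nat (sg e * n)) \<in> W" by (rule Ex_mem[OF i W(1) v W(3)[OF i]])
  then show ?thesis using True W(2)[OF i] by (simp add: F_Ex i)
next
  case False
  then show ?thesis using subspace_0[OF W(1)] by (simp add: F_Ex i)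
qed

text \<open>A highest l-weight vector is given by eigenvalues of the currents \<open>phi\<close>
  only. Their zero modes are the \<open>K\<close>; once these are removed, the exponential
  determines its exponent by \<open>hop_mem_span\<close>.\<close>

lemma F_eigen_imp_KH_eigen:
  assumes i: "i \<in> nodes N" and F: "\<And>e n. F e i n v = scl (\<gamma> e n) v"
  shows "\<exists>\<eta>. K e i v = scl \<eta> v" "n \<noteq> 0 \<Longrightarrow> \<exists>\<eta>. H i n v = scl \<eta> v"
proof -
  have K: "K e i v = scl (\<gamma> e 0) v" for e using F[of e 0] by (simp add: F_Ex i Ex_0)
  then show "\<exists>\<eta>. K e i v = scl \<eta> v" by blast
  have Ex: "Ex e i v n \<in> span {v}" for e n
  proof -
    define e' where "e' = (if e = Plus then Minus else Plus)"
    have "K e i (Ex e i v n) = scl (\<gamma> e (sg e * int n)) v"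
      using F[of e "sg e * int n"] by (cases e) (simp_all add: F_Ex i)
    then have "K e' i (K e i (Ex e i v n)) = scl (\<gamma> e (sg e * int n)) (scl (\<gamma> e' 0) v)"
      by (simp add: module_hom.scale[OF lin_K[OF i]] K)
    moreover have "K e' i (K e i w) = w" for w using KK[OF i] by (cases e) (simp_all add: e'_def)
    ultimately show ?thesis by (simp add: span_scale span_base)
  qed
  show "\<exists>\<eta>. H i n v = scl \<eta> v" if n: "n \<noteq> 0"
  proof -
    define e where "e = (if n > 0 then Plus else Minus)"
    have "H i n v = hop e i (nat \<bar>n\<bar>) v" using n by (auto simp: hop_def e_def)
    then have "H i n v \<in> span {v}" using hop_mem_span[OF i Ex] by simp
    then show ?thesis by (auto simp: span_singleton)
  qed
qed

text \<open>The coordinates of a multiple of \<open>\<rho>\<^sup>\<or>\<close> in the basis of simple roots.\<close>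

definition dc :: "nat \<Rightarrow> nat" where
  "dc i = (if ty = TypeA then i * (N + 1 - i) else i * (2 * N + 1 - i))"

definition D :: "'v \<Rightarrow> 'v" where
  "D v = fold (\<lambda>i. K Plus i ^^ dc i) [1..<Suc N] v"

definition dexp :: int where
  "dexp = (if ty = TypeA then 2 else 4)"

lemma set_nodes: "set [1..<Suc N] \<subseteq> nodes N"
  by (auto simp: nodes_def)

text \<open>\<open>dc\<close> is quadratic in \<open>i\<close> with second difference -2. Missing
  neighbours at the ends are made up for by \<open>dc 0 = 0\<close> and, at \<open>N\<close>, by
  \<open>dc (N + 1) = 0\<close> in type A and by the entries of the short root in type B.\<close>

lemma sum_dc:
  assumes "j \<in> nodes N" shows "(\<Sum>i\<leftarrow>[1..<Suc N]. int (dc i) * Bm i j) = dexp"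
proof -
  have j: "1 \<le> j" "j \<le> N" using assms by (auto simp: nodes_def)
  have s: "(\<Sum>i\<leftarrow>[1..<Suc N]. int (dc i) * Bm i j) = (\<Sum>i\<in>{j - 1, j, Suc j} \<inter> {1..N}. int (dc i) * Bm i j)"
    unfolding interv_sum_list_conv_sum_set_nat set_upt
    by (rule sum.mono_neutral_cong_right) (auto simp: symcartan_def cartan_def)
  have j1: "j = 1 \<or> 2 \<le> j" using j by linarith
  define a b c where "a = int (dc (j - 1)) * Bm (j - 1) j" and "b = int (dc j) * Bm j j" and "c = int (dc (Suc j)) * Bm (Suc j) j"
  have z: "(\<Sum>i\<leftarrow>[1..<Suc N]. int (dc i) * Bm i j) = (if j = 1 then 0 else a) + b + (if j = N then 0 else c)"
  proof -
    have "{j - 1, j, Suc j} \<inter> {1..N} = (if j = 1 then {} else {j - 1}) \<union> {j} \<union> (if j = N then {} else {Suc j})"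
      using j by auto
    then show ?thesis unfolding s a_def b_def c_def using j by (auto simp: add.assoc)
  qed
  obtain k where k: "j = Suc k" using j by (cases j) auto
  obtain l where l: "N = j + l" using j by (metis le_Suc_ex)
  show ?thesis
    unfolding z unfolding a_def b_def c_def unfolding dc_def dexp_def symcartan_def cartan_def rlen_def
    using j rank
    by (cases ty; cases k; cases l) (simp_all add: k l algebra_simps of_nat_diff)
qed

lemma K_pow_X: "i \<in> nodes N \<Longrightarrow> j \<in> nodes N \<Longrightarrow>
    (K Plus i ^^ c) (X Minus j n v) = scl (q powi - (int c * Bm i j)) (X Minus j n ((K Plus i ^^ c) v))"
proof (induction c)
  case (Suc c)
  have "(K Plus i ^^ Suc c) (X Minus j n v) = scl (q powi - (int c * Bm i j) * q powi - Bm i j) (X Minus j n ((K Plus i ^^ Suc c) v))"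
    using Suc KX[OF Suc.prems, of Minus] by (simp add: module_hom.scale[OF lin_K])
  also have "q powi - (int c * Bm i j) * q powi - Bm i j = q powi - (int (Suc c) * Bm i j)"
    using q0 by (simp add: algebra_simps flip: power_int_add)
  finally show ?case .
qed simp

lemma lin_fold:
  assumes "\<And>i. i \<in> set xs \<Longrightarrow> lin (f i)" shows "lin (fold f xs)"
  using assms by (induction xs) (auto simp: lin_iff)

lemma lin_pow: "lin f \<Longrightarrow> lin (f ^^ c)"
  by (induction c) (auto simp: lin_iff)

lemma lin_D: "lin D"
  unfolding D_def[abs_def] by (intro lin_fold lin_pow lin_K) (auto simp: nodes_def)

lemma D_X:
  assumes j: "j \<in> nodes N"
  shows "D (X Minus j n v) = scl (q powi - dexp) (X Minus j n (D v))"
proof -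
  have "fold (\<lambda>i. K Plus i ^^ dc i) xs (X Minus j n v)
      = scl (q powi - (\<Sum>i\<leftarrow>xs. int (dc i) * Bm i j)) (X Minus j n (fold (\<lambda>i. K Plus i ^^ dc i) xs v))"
    if "set xs \<subseteq> nodes N" for xs
    using that
  proof (induction xs arbitrary: v)
    case (Cons i xs)
    let ?f = "fold (\<lambda>i. K Plus i ^^ dc i) xs"
    have i: "i \<in> nodes N" and xs: "set xs \<subseteq> nodes N" using Cons.prems by auto
    have l: "lin ?f" using xs by (intro lin_fold lin_pow lin_K) auto
    have "?f ((K Plus i ^^ dc i) (X Minus j n v)) = scl (q powi - (int (dc i) * Bm i j)) (?f (X Minus j n ((K Plus i ^^ dc i) v)))"
      unfolding K_pow_X[OF i j] module_hom.scale[OF l] ..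
    then show ?case using q0
      by (simp add: Cons.IH[OF xs] flip: power_int_add)
  qed simp
  from this[OF set_nodes] show ?thesis unfolding D_def sum_dc[OF j] .
qed

lemma D_commute:
  assumes "\<And>i v. i \<in> nodes N \<Longrightarrow> f (K Plus i v) = K Plus i (f v)"
  shows "f (D v) = D (f v)"
proof -
  have p: "f ((K Plus i ^^ c) v) = (K Plus i ^^ c) (f v)" if "i \<in> nodes N" for i c v
    by (induction c) (simp_all add: assms that)
  have "f (fold (\<lambda>i. K Plus i ^^ dc i) xs v) = fold (\<lambda>i. K Plus i ^^ dc i) xs (f v)" if "set xs \<subseteq> nodes N" for xs
    using that by (induction xs arbitrary: v) (simp_all add: p)
  from this[OF set_nodes] show ?thesis unfolding D_def .
qed

lemma K_Minus_comm:
  assumes "i \<in> nodes N" "j \<in> nodes N" shows "K Minus i (K Plus j v) = K Plus j (K Minus i v)"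
proof -
  have "K Minus i (K Plus j v) = K Minus i (K Plus j (K Plus i (K Minus i v)))" by (simp only: KK(2)[OF assms(1)])
  also have "\<dots> = K Minus i (K Plus i (K Plus j (K Minus i v)))" using K_comm assms by simp
  finally show ?thesis using KK(1)[OF assms(1)] by simp
qed

lemma D_eigen:
  assumes "\<And>i. i \<in> nodes N \<Longrightarrow> \<exists>\<eta>. K Plus i v = scl \<eta> v" "v \<noteq> 0"
  shows "\<exists>d. d \<noteq> 0 \<and> D v = scl d v"
proof -
  have p: "\<exists>d. d \<noteq> 0 \<and> (K Plus i ^^ c) v = scl d v" if i: "i \<in> nodes N" for i c
  proof -
    obtain \<eta> where \<eta>: "K Plus i v = scl \<eta> v" using assms i by blast
    have "\<eta> \<noteq> 0" using \<eta> KK(1)[OF i, of v] module_hom.zero[OF lin_K[OF i]] assms(2) by auto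
    moreover have "(K Plus i ^^ c) v = scl (\<eta> ^ c) v"
      by (induction c) (simp_all add: \<eta> module_hom.scale[OF lin_K[OF i]] mult.commute)
    ultimately show ?thesis by (intro exI[of _ "\<eta> ^ c"]) simp
  qed
  have "\<exists>d. d \<noteq> 0 \<and> fold (\<lambda>i. K Plus i ^^ dc i) xs v = scl d v" if "set xs \<subseteq> nodes N" for xs
    using that
  proof (induction xs rule: rev_induct)
    case Nil
    show ?case by (intro exI[of _ 1]) simp
  next
    case (snoc i xs)
    then obtain d d' where "d \<noteq> 0" "fold (\<lambda>i. K Plus i ^^ dc i) xs v = scl d v"
      "d' \<noteq> 0" "(K Plus i ^^ dc i) v = scl d' v" using p[of i "dc i"] by auto
    moreover have "lin (K Plus i ^^ dc i)" using snoc.prems by (intro lin_pow lin_K) simp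
    ultimately show ?case by (intro exI[of _ "d * d'"]) (simp add: module_hom.scale)
  qed
  from this[OF set_nodes] show ?thesis unfolding D_def .
qed

text \<open>Stability passes from letters to words and by linearity to the free algebra; the central
  generators act as the identity.\<close>

lemma T_gen_mem:
  assumes W: "subspace W" "\<And>e i v. i \<in> nodes N \<Longrightarrow> v \<in> W \<Longrightarrow> K e i v \<in> W"
    "\<And>i n v. i \<in> nodes N \<Longrightarrow> n \<noteq> 0 \<Longrightarrow> v \<in> W \<Longrightarrow> H i n v \<in> W"
    "\<And>e i n v. i \<in> nodes N \<Longrightarrow> v \<in> W \<Longrightarrow> X e i n v \<in> W"
    and f: "f \<in> alg N" and v: "v \<in> W"
  shows "T f v \<in> W"
proof -
  have w: "T (Poly_Mapping.single (Word gs) z) v \<in> W" if "set gs \<subseteq> generators N" for gs z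
    using that
  proof (induction gs arbitrary: z)
    case Nil
    have "Poly_Mapping.single (Word []) z = const z" by (simp add: const_def zero_word_def)
    then show ?case using subspace_scale[OF W(1) v] by (simp add: scl_def[symmetric])
  next
    case (Cons g gs)
    have e: "Poly_Mapping.single (Word (g # gs)) z = gen g * Poly_Mapping.single (Word gs) z"
      by (simp add: gen_def mult_single plus_word_def)
    have a: "gen g \<in> alg N" "Poly_Mapping.single (Word gs) z \<in> alg N"
      using Cons.prems by (auto simp: alg_def gen_def)
    have u: "T (Poly_Mapping.single (Word gs) z) v \<in> W" using Cons by auto
    have "T (gen g) u \<in> W" if "u \<in> W" for u
      using Cons.prems that W(2-4) C_act unfolding generators_def
      by (auto simp: X_def K_def H_def T_def)
    then show ?case unfolding e T_mult[OF a] using u by blast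
  qed
  show ?thesis using f
  proof (induction f rule: update_induct)
    case const
    then show ?case using subspace_0[OF W(1)] by (simp add: T_0)
  next
    case (update f k z)
    have e: "Poly_Mapping.update k z f = f + Poly_Mapping.single k z"
      using update(1) by (intro poly_mapping_eqI) (auto simp: lookup_update lookup_add lookup_single in_keys_iff when_def)
    have keys: "Poly_Mapping.keys (Poly_Mapping.update k z f) = insert k (Poly_Mapping.keys f)"
      using update(2) by (simp add: keys_update)
    then have a: "f \<in> alg N" "set (letters k) \<subseteq> generators N" using update(4) by (auto simp: alg_def)
    moreover have "Poly_Mapping.single k z \<in> alg N" using a(2) by (auto simp: alg_def)
    ultimately show ?case unfolding e using update(3) w[of "letters k" z] subspace_add[OF W(1)]
      by (simp add: T_add)
  qed
qed

lemma irred: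
  assumes W: "subspace W" "\<And>e i v. i \<in> nodes N \<Longrightarrow> v \<in> W \<Longrightarrow> K e i v \<in> W"
    "\<And>i n v. i \<in> nodes N \<Longrightarrow> n \<noteq> 0 \<Longrightarrow> v \<in> W \<Longrightarrow> H i n v \<in> W"
    "\<And>e i n v. i \<in> nodes N \<Longrightarrow> v \<in> W \<Longrightarrow> X e i n v \<in> W"
  shows "W = {0} \<or> W = UNIV"
proof -
  have "submodule_of (uq ty N q) act W"
    unfolding submodule_of_def carrier_uq
    using subspace_0[OF W(1)] subspace_add[OF W(1)] T_gen_mem[OF W] by (auto simp: T_def)
  then show ?thesis using irreducible unfolding irreducible_module_def by blast
qed

lemma qpow_neq_1: "l \<noteq> 0 \<Longrightarrow> q powi l \<noteq> 1"
  using q0 qroot by (rule qpow_inf)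

theorem loop_module: "loop_module scl (nodes N) Bm q kap X K H F D (q powi - dexp)"
proof (intro loop_module.intro loop_module_axioms.intro)
  show "q \<noteq> 0" by (rule q0)
  show "kap i \<noteq> 0" if "i \<in> nodes N" for i
  proof -
    let ?r = "rlen ty N i"
    have "q powi ?r \<noteq> q powi - ?r"
    proof
      assume e: "q powi ?r = q powi - ?r"
      have "q powi ?r * q powi ?r = q powi ?r * q powi - ?r" using e by simp
      then have "q powi ?r * q powi ?r = 1" using q0 by (simp add: power_int_minus)
      then have "q powi (?r + ?r) = 1" using q0 by (subst power_int_add) auto
      then show False using qpow_neq_1[of "?r + ?r"] by (simp add: rlen_def split: if_splits)
    qed
    then show ?thesis by (simp add: kap_def)
  qed
  show "(q powi - dexp) ^ r \<noteq> 1" if "0 < r" for r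
  proof -
    have "(q powi - dexp) ^ r = q powi (- dexp * int r)"
      by (simp only: power_int_mult power_int_of_nat)
    then show ?thesis using qpow_neq_1[of "- dexp * int r"] that by (simp add: dexp_def)
  qed
  show "D (K e i v) = K e i (D v)" if "i \<in> nodes N" for e i v
    using that K_comm K_Minus_comm by (intro D_commute[symmetric]) (cases e; simp)
  show "D (H i n v) = H i n (D v)" if "i \<in> nodes N" "n \<noteq> 0" for i n v
    using that KH by (intro D_commute[symmetric]) simp
  show "F e i n v = 0" if "i \<in> nodes N" "sg e * n < 0" for e i n v
    using that by (simp add: F_Ex)
qed (assumption | rule complex_space_axioms lin_X lin_K lin_H lin_F lin_D KK KX HX XX XpXm XX_commute
    FX F_mem irred D_X)+

end

section \<open>The monomial of a system of strands\<close>

locale strand_module = uq_mod ty N q act + strands J M s r free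
  for ty :: cartan_type and N :: nat and q :: complex and act :: "'v::ab_group_add uq_action"
    and J M s r free +
  fixes a :: complex
  assumes a0: "a \<noteq> 0" and M_eq: "M = (if ty = TypeA then N + 1 else N)" and free_iff: "free \<longleftrightarrow> ty = TypeB"
begin

definition lam :: int where
  "lam = (if ty = TypeA then 1 else 2)"

lemma nodes_nd: "nodes N = nd"
  unfolding set_eq_iff nd nodes_def using M_eq free_iff by (cases ty) auto

definition lev :: "int \<Rightarrow> complex" where
  "lev k = a * q powi k"

lemma lev_inj: "lev k = lev l \<longleftrightarrow> k = l"
proof
  assume "lev k = lev l"
  then have "q powi (k - l) = 1" using a0 q0 by (simp add: lev_def power_int_diff)
  then show "k = l" using qpow_neq_1[of "k - l"] by auto
qed simp

lemma lev_nz: "lev k \<noteq> 0"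
  using a0 q0 by (simp add: lev_def)

lemma lev_mult: "lev k * q powi l = lev (k + l)"
  using q0 by (simp add: lev_def power_int_add)

text \<open>A strand contributes to its monomial the variable of node \<open>i\<close> at level \<open>cpos z i\<close>, to the power
  \<open>csgn z i\<close>. Heights count in units of \<open>q\<^sup>2\<close> in type B, and at a free end the corner sits halfway between
  the heights of the last two columns.\<close>

definition csgn :: "(nat \<Rightarrow> int) \<Rightarrow> nat \<Rightarrow> int" where
  "csgn z i = (if i < M then (z (i - 1) + z (Suc i) - 2 * z i) div 2 else z (i - 1) - z i)"

definition cpos :: "(nat \<Rightarrow> int) \<Rightarrow> nat \<Rightarrow> int" where
  "cpos z i = (if i < M then lam * z i else z (i - 1) + z i)"

definition mon :: "(nat \<Rightarrow> nat \<Rightarrow> int) \<Rightarrow> monomial" where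
  "mon y = (\<Sum>\<sigma>\<in>J. \<Sum>i\<in>nd. Poly_Mapping.single (i, lev (cpos (y \<sigma>) i)) (csgn (y \<sigma>) i))"

definition mex :: "(nat \<Rightarrow> nat \<Rightarrow> int) \<Rightarrow> nat \<Rightarrow> int \<Rightarrow> int" where
  "mex y i k = (\<Sum>\<sigma>\<in>J. if cpos (y \<sigma>) i = k then csgn (y \<sigma>) i else 0)"

lemma fin_nd: "finite nd"
  by (simp add: nd_def)

lemma lookup_mon: "Poly_Mapping.lookup (mon y) (i, b) =
    (if i \<in> nd then \<Sum>\<sigma>\<in>J. if lev (cpos (y \<sigma>) i) = b then csgn (y \<sigma>) i else 0 else 0)"
proof -
  have "(\<Sum>j\<in>nd. Poly_Mapping.lookup (Poly_Mapping.single (j, lev (cpos z j)) (csgn z j)) (i, b))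
      = (\<Sum>j\<in>nd. if j = i then (if lev (cpos z i) = b then csgn z i else 0) else 0)" for z
    by (intro sum.cong refl) (auto simp: lookup_single when_def)
  then show ?thesis by (simp add: mon_def lookup_sum fin_nd sum.delta)
qed

lemma lookup_mon_lev: "i \<in> nd \<Longrightarrow> Poly_Mapping.lookup (mon y) (i, lev k) = mex y i k"
  by (simp add: lookup_mon mex_def lev_inj)

lemma lookup_mon_nz:
  assumes "Poly_Mapping.lookup (mon y) (i, b) \<noteq> 0"
  shows "i \<in> nd \<and> (\<exists>\<sigma>\<in>J. b = lev (cpos (y \<sigma>) i))"
proof (rule ccontr)
  assume "\<not> ?thesis"
  then have "Poly_Mapping.lookup (mon y) (i, b) = 0"
    unfolding lookup_mon by (auto intro!: sum.neutral)
  with assms show False by contradiction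
qed

lemma mon_monomials: "mon y \<in> monomials N"
  unfolding monomials_def
proof (rule CollectI, rule subsetI)
  fix x assume "x \<in> Poly_Mapping.keys (mon y)"
  then have "Poly_Mapping.lookup (mon y) (fst x, snd x) \<noteq> 0" by (simp add: in_keys_iff)
  from lookup_mon_nz[OF this] show "x \<in> nodes N \<times> (UNIV - {0})"
    using lev_nz nodes_nd by (cases x) auto
qed

lemma rlen_nd: "i \<in> nd \<Longrightarrow> rlen ty N i = (if i < M then lam else 1)"
  using M_eq free_iff unfolding nd rlen_def lam_def by (cases ty) auto

lemma Bm_bet: "i \<in> nd \<Longrightarrow> j \<in> nd \<Longrightarrow> symcartan ty N i j = lam * bet i j"
  using M_eq free_iff unfolding nd symcartan_def cartan_def rlen_def lam_def bet_def by (cases ty) auto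

lemma strand_csgn:
  assumes "strand \<sigma> z" "i \<in> nd"
  shows "i < M \<Longrightarrow> 2 * csgn z i = z (i - 1) + z (Suc i) - 2 * z i"
    and "\<not> i < M \<Longrightarrow> csgn z i = z (i - 1) - z i" and "\<not> i < M \<Longrightarrow> z i = z (i - 1) + 1 \<or> z i = z (i - 1) - 1"
    and "i < M \<Longrightarrow> (z (i - 1) = z i + 1 \<or> z (i - 1) = z i - 1) \<and> (z (Suc i) = z i + 1 \<or> z (Suc i) = z i - 1)"
proof -
  have l: "z (i - 1) = z i + 1 \<or> z (i - 1) = z i - 1" using step_left[OF assms(1), of i] assms(2) by (simp add: nd)
  show s: "i < M \<Longrightarrow> (z (i - 1) = z i + 1 \<or> z (i - 1) = z i - 1) \<and> (z (Suc i) = z i + 1 \<or> z (Suc i) = z i - 1)"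
    using l step[OF assms(1), of i] by simp
  show "i < M \<Longrightarrow> 2 * csgn z i = z (i - 1) + z (Suc i) - 2 * z i"
    using s by (auto simp: csgn_def)
  show "\<not> i < M \<Longrightarrow> csgn z i = z (i - 1) - z i" by (simp add: csgn_def)
  show "\<not> i < M \<Longrightarrow> z i = z (i - 1) + 1 \<or> z i = z (i - 1) - 1" using l by auto
qed

lemma lam_pos: "lam > 0"
  by (simp add: lam_def)

lemma M_not_less: "i \<in> nd \<Longrightarrow> \<not> i < M \<Longrightarrow> i = M \<and> lam = 2 \<and> rlen ty N i = 1 \<and> rlen ty N M = 1"
  using free_iff M_eq unfolding nd lam_def rlen_def by auto

text \<open>One inner column: a minimum at \<open>z\<close> (\<open>c = 1\<close>) has its pole at
  \<open>z + 1\<close> and its zero at \<open>z - 1\<close>, a maximum the reverse, and a straight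
  passage has \<open>c = 0\<close>.\<close>

lemma corner_count:
  fixes l z x c e :: int
  assumes "l = z + 1 \<or> l = z - 1" "x = z + 1 \<or> x = z - 1" "2 * c = l + x - 2 * z"
  shows "(if z = e - 1 then c else 0) - (if z = e + 1 then c else 0)
    = (if l = e \<and> x = e then 1 else 0) - (if (z = e - 1 \<or> z = e + 1) \<and> l \<noteq> e \<and> x \<noteq> e then 1 else 0)"
  using assms by (elim disjE) auto

text \<open>Inner columns are \<open>corner_count\<close>. At a free end the variable sits at the
  odd level \<open>y \<sigma> (M - 1) + y \<sigma> M\<close>, and of the two adjacent even levels
  one is its pole and the other its zero.\<close>

lemma mex_ordc:
  assumes y: "valid y" "i \<in> nd"
  shows "mex y i (lam * e - rlen ty N i) - mex y i (lam * e + rlen ty N i) = ordc y i e"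
proof -
  have "(if cpos (y \<sigma>) i = lam * e - rlen ty N i then csgn (y \<sigma>) i else 0)
      - (if cpos (y \<sigma>) i = lam * e + rlen ty N i then csgn (y \<sigma>) i else 0)
      = (if site (y \<sigma>) i e then 1 else 0) - (if neg (y \<sigma>) i e then 1 else 0)" if "\<sigma> \<in> J" for \<sigma>
  proof (cases "i < M")
    case True
    have "lam * e - lam = lam * (e - 1)" "lam * e + lam = lam * (e + 1)" by (simp_all add: algebra_simps)
    then have "cpos (y \<sigma>) i = lam * e - rlen ty N i \<longleftrightarrow> y \<sigma> i = e - 1"
      "cpos (y \<sigma>) i = lam * e + rlen ty N i \<longleftrightarrow> y \<sigma> i = e + 1"
      using lam_pos True by (simp_all add: cpos_def rlen_nd[OF y(2)])
    then have "?thesis \<longleftrightarrow> (if y \<sigma> i = e - 1 then csgn (y \<sigma>) i else 0) - (if y \<sigma> i = e + 1 then csgn (y \<sigma>) i else 0)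
      = (if y \<sigma> (i - 1) = e \<and> y \<sigma> (Suc i) = e then 1 else 0)
        - (if (y \<sigma> i = e - 1 \<or> y \<sigma> i = e + 1) \<and> y \<sigma> (i - 1) \<noteq> e \<and> y \<sigma> (Suc i) \<noteq> e then 1 else 0)"
      unfolding site_def neg_def using True by (simp only: if_True simp_thms)
    then show ?thesis
      using corner_count[of "y \<sigma> (i - 1)" "y \<sigma> i" "y \<sigma> (Suc i)" "csgn (y \<sigma>) i" e]
        strand_csgn(1,4)[OF strandD[OF y(1) that] y(2) True] by blast
  next
    case False
    note M = M_not_less[OF y(2) False]
    have "cpos (y \<sigma>) i = y \<sigma> (M - 1) + y \<sigma> M" "rlen ty N i = 1" using False M by (simp_all add: cpos_def rlen_nd[OF y(2)])
    moreover have "z' + z = 2 * e - 1 \<longleftrightarrow> z' = e \<and> z = e - 1 \<or> z' = e - 1 \<and> z = e"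
      "z' + z = 2 * e + 1 \<longleftrightarrow> z' = e \<and> z = e + 1 \<or> z' = e + 1 \<and> z = e"
      if "z = z' + 1 \<or> z = z' - 1" for z z' :: int using that by auto
    ultimately show ?thesis
      using strand_csgn(2,3)[OF strandD[OF y(1) that] y(2) False] M
      unfolding site_def neg_def by (elim disjE) auto
  qed
  then have "(\<Sum>\<sigma>\<in>J. (if cpos (y \<sigma>) i = lam * e - rlen ty N i then csgn (y \<sigma>) i else 0)
      - (if cpos (y \<sigma>) i = lam * e + rlen ty N i then csgn (y \<sigma>) i else 0))
      = (\<Sum>\<sigma>\<in>J. (if site (y \<sigma>) i e then 1 else 0) - (if neg (y \<sigma>) i e then 1 else 0))"
    by (rule sum.cong[OF refl])
  then show ?thesis unfolding mex_def ordc_sum[OF y] by (simp only: sum_subtractf)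
qed

lemma mex_nz_strand:
  assumes "mex y i k \<noteq> 0" shows "\<exists>\<sigma>\<in>J. cpos (y \<sigma>) i = k"
proof (rule ccontr)
  assume "\<not> ?thesis"
  then have "mex y i k = 0" unfolding mex_def by (intro sum.neutral) auto
  then show False using assms by contradiction
qed

lemma mex_nz:
  assumes y: "valid y" "i \<in> nd" and "mex y i k \<noteq> 0"
  shows "\<exists>e. k = lam * e - rlen ty N i"
proof -
  obtain \<sigma> where \<sigma>: "\<sigma> \<in> J" "cpos (y \<sigma>) i = k"
    using mex_nz_strand[OF assms(3)] by blast
  show ?thesis
  proof (cases "i < M")
    case True
    then have "k = lam * (y \<sigma> i + 1) - rlen ty N i"
      using \<sigma> by (simp add: cpos_def rlen_nd[OF y(2)] algebra_simps)
    then show ?thesis by blast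
  next
    case False
    then have "k = lam * y \<sigma> (M - 1) - rlen ty N i \<or> k = lam * (y \<sigma> (M - 1) + 1) - rlen ty N i"
      using \<sigma> M_not_less[OF y(2) False] strand_csgn(3)[OF strandD[OF y(1) \<sigma>(1)] y(2) False]
      by (auto simp: cpos_def rlen_nd[OF y(2)])
    then show ?thesis by blast
  qed
qed

text \<open>By \<open>mex_nz\<close> the levels of node \<open>i\<close> lie in a single residue
  class, so poles and zeros occur only at levels that are multiples of \<open>lam\<close>.\<close>

lemma ordm_mon:
  assumes y: "valid y" "i \<in> nd"
  shows "ordm ty N q (mon y) i (lev (lam * e)) = ordc y i e"
    and "c \<notin> range (\<lambda>e. lev (lam * e)) \<Longrightarrow> ordm ty N q (mon y) i c = 0"
proof -
  have l: "ordm ty N q (mon y) i (lev k) = mex y i (k - rlen ty N i) - mex y i (k + rlen ty N i)" for k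
    by (simp add: ordm_def lev_mult lookup_mon_lev[OF y(2)])
  then show "ordm ty N q (mon y) i (lev (lam * e)) = ordc y i e" using mex_ordc[OF y] by simp
  show "ordm ty N q (mon y) i c = 0" if c: "c \<notin> range (\<lambda>e. lev (lam * e))"
  proof (cases "\<exists>k. c = lev k")
    case True
    then obtain k where k: "c = lev k" by blast
    have "k \<noteq> lam * e" for e using c k by blast
    moreover have "lam * e - rlen ty N i - rlen ty N i = lam * (e - (if i < M then 2 else 1))" for e
      using M_not_less[OF y(2)] by (auto simp: rlen_nd[OF y(2)] algebra_simps)
    ultimately have "mex y i (k - rlen ty N i) = 0" "mex y i (k + rlen ty N i) = 0"
      using mex_nz[OF y, of "k - rlen ty N i"] mex_nz[OF y, of "k + rlen ty N i"]
      by (metis add_diff_cancel_right' diff_add_cancel)+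
    then show ?thesis using k l by simp
  next
    case False
    have "Poly_Mapping.lookup (mon y) (i, c * q powi x) = 0" for x
    proof (rule ccontr)
      assume "Poly_Mapping.lookup (mon y) (i, c * q powi x) \<noteq> 0"
      then obtain k where "c * q powi x = lev k" using lookup_mon_nz by blast
      then have "c = lev k * q powi - x" using q0 by (simp add: power_int_minus field_simps)
      then show False using False lev_mult by metis
    qed
    then show ?thesis by (simp add: ordm_def)
  qed
qed

lemma wtm_lookup:
  assumes m: "m \<in> monomials N" and S: "finite S" "{b. Poly_Mapping.lookup m (i, b) \<noteq> 0} \<subseteq> S"
  shows "wtm m i = (\<Sum>b\<in>S. Poly_Mapping.lookup m (i, b))"
proof -
  have z: "Poly_Mapping.lookup m (i, 0) = 0" by (rule lookup_0[OF q0 qroot m])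
  have d: "int (degree (\<Prod>b\<in>A. [:1, - b:] ^ f b)) = (\<Sum>b\<in>A. int (f b))" if "0 \<notin> A" for A and f :: "complex \<Rightarrow> nat"
  proof -
    have "degree (\<Prod>b\<in>A. [:1, - b:] ^ f b) = (\<Sum>b\<in>A. degree ([:1, - b:] ^ f b))"
      by (rule degree_prod_sum_eq) auto
    also have "\<dots> = (\<Sum>b\<in>A. f b)"
    proof (rule sum.cong)
      fix b assume "b \<in> A"
      then show "degree ([:1, - b:] ^ f b) = f b" using that by (subst degree_power_eq) auto
    qed simp
    finally show ?thesis by simp
  qed
  have pos: "(\<Sum>b | Poly_Mapping.lookup m (i, b) > 0. int (nat (Poly_Mapping.lookup m (i, b))))
      = (\<Sum>b\<in>S. int (nat (Poly_Mapping.lookup m (i, b))))"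
    using S by (intro sum.mono_neutral_left) auto
  have neg: "(\<Sum>b | Poly_Mapping.lookup m (i, b) < 0. int (nat (- Poly_Mapping.lookup m (i, b))))
      = (\<Sum>b\<in>S. int (nat (- Poly_Mapping.lookup m (i, b))))"
    using S by (intro sum.mono_neutral_left) auto
  have "wtm m i = (\<Sum>b\<in>S. int (nat (Poly_Mapping.lookup m (i, b))) - int (nat (- Poly_Mapping.lookup m (i, b))))"
  proof -
    have 1: "0 \<notin> {b. Poly_Mapping.lookup m (i, b) > 0}" "0 \<notin> {b. Poly_Mapping.lookup m (i, b) < 0}"
      using z by simp_all
    show ?thesis unfolding wtm_def Qpoly_def Rpoly_def sum_subtractf d[OF 1(1)] d[OF 1(2)] pos neg ..
  qed
  also have "\<dots> = (\<Sum>b\<in>S. Poly_Mapping.lookup m (i, b))" by (intro sum.cong refl) simp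
  finally show ?thesis .
qed

lemma wtm_mon:
  assumes "i \<in> nd" shows "wtm (mon y) i = (\<Sum>\<sigma>\<in>J. csgn (y \<sigma>) i)"
proof -
  let ?S = "(\<lambda>\<sigma>. lev (cpos (y \<sigma>) i)) ` J"
  have "{b. Poly_Mapping.lookup (mon y) (i, b) \<noteq> 0} \<subseteq> ?S" using lookup_mon_nz by blast
  then have "wtm (mon y) i = (\<Sum>b\<in>?S. Poly_Mapping.lookup (mon y) (i, b))"
    by (rule wtm_lookup[OF mon_monomials finite_imageI[OF finJ]])
  also have "\<dots> = (\<Sum>b\<in>?S. \<Sum>\<sigma>\<in>J. if lev (cpos (y \<sigma>) i) = b then csgn (y \<sigma>) i else 0)"
    using assms by (simp add: lookup_mon)
  also have "\<dots> = (\<Sum>\<sigma>\<in>J. csgn (y \<sigma>) i)"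
    using finJ by (subst sum.swap) (simp add: sum.delta')
  finally show ?thesis .
qed

text \<open>The weight decreases by a simple root, which produces the constant \<open>Q\<close> of
  \<open>gext_shift\<close>.\<close>

lemma wtm_Mv:
  assumes y: "valid y" and m: "mov 1 y (j, e)" and i: "i \<in> nd"
  shows "rlen ty N i * wtm (mon (Mv 1 y (j, e))) i = rlen ty N i * wtm (mon y) i - symcartan ty N i j"
proof -
  obtain \<sigma> where \<sigma>: "\<sigma> \<in> J" "j \<in> nd" "site (y \<sigma>) j e" "y \<sigma> j = e - 1" "Mv 1 y (j, e) = upd y \<sigma> j (e + 1)"
    "valid (upd y \<sigma> j (e + 1))" using movE[OF y m] .
  let ?z = "y \<sigma>" and ?z' = "(y \<sigma>)(j := e + 1)"
  have "(\<Sum>\<tau>\<in>J. csgn (upd y \<sigma> j (e + 1) \<tau>) i) = csgn ?z' i + (\<Sum>\<tau>\<in>J - {\<sigma>}. csgn (y \<tau>) i)"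
    using \<sigma>(1) finJ by (subst sum.remove[of _ \<sigma>]) (auto intro!: sum.cong)
  moreover have "(\<Sum>\<tau>\<in>J. csgn (y \<tau>) i) = csgn ?z i + (\<Sum>\<tau>\<in>J - {\<sigma>}. csgn (y \<tau>) i)"
    using \<sigma>(1) finJ by (subst sum.remove[of _ \<sigma>]) auto
  ultimately have w: "wtm (mon (Mv 1 y (j, e))) i - wtm (mon y) i = csgn ?z' i - csgn ?z i"
    unfolding \<sigma>(5) wtm_mon[OF i] by simp
  have "rlen ty N i * (csgn ?z' i - csgn ?z i) = - (lam * bet i j)"
  proof (cases "i < M")
    case True
    have "strand \<sigma> ?z'" using strandD[OF \<sigma>(6,1)] by simp
    then have "2 * csgn ?z' i - 2 * csgn ?z i = - 2 * bet i j"
      using strand_csgn(1)[OF _ i True, of \<sigma> ?z'] strand_csgn(1)[OF strandD[OF y \<sigma>(1)] i True] \<sigma>(2,4) i True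
      unfolding bet_def nd by auto
    then have "csgn ?z' i - csgn ?z i = - bet i j" by simp
    then show ?thesis using True by (simp add: rlen_nd[OF i])
  next
    case False
    note M = M_not_less[OF i False]
    have "csgn ?z' i - csgn ?z i = - 2 * bet i j"
      using False M \<sigma>(2,4) i unfolding bet_def nd csgn_def by auto
    then show ?thesis using False M by (simp add: rlen_nd[OF i])
  qed
  then have "rlen ty N i * (wtm (mon (Mv 1 y (j, e))) i - wtm (mon y) i) = - symcartan ty N i j"
    unfolding w Bm_bet[OF i \<sigma>(2)] .
  then show ?thesis by (simp add: right_diff_distrib)
qed

lemma qwt_eq: "qwt ty N q m i = q powi (rlen ty N i * wtm m i)"
  by (rule qwt_def[OF q0 qroot])

lemma gext_Mv:
  assumes y: "valid y" and m: "mov 1 y (j, e)" and i: "i \<in> nd"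
  shows "gext ty N q (mon (Mv 1 y (j, e))) b i n
      - q powi - symcartan ty N i j * lev (lam * e) * gext ty N q (mon (Mv 1 y (j, e))) b i (n - 1)
    = q powi - symcartan ty N i j * gext ty N q (mon y) b i n - lev (lam * e) * gext ty N q (mon y) b i (n - 1)"
proof (rule gext_shift[OF q0 qroot])
  have j: "j \<in> nd" using m by (simp add: mov_def)
  have B: "symcartan ty N i j = lam * bet i j" by (rule Bm_bet[OF i j])
  show "qwt ty N q (mon (Mv 1 y (j, e))) i = q powi - symcartan ty N i j * qwt ty N q (mon y) i"
    unfolding qwt_eq wtm_Mv[OF assms] using q0 by (simp add: algebra_simps flip: power_int_add)
  show "q powi - symcartan ty N i j \<noteq> 0" "lev (lam * e) \<noteq> 0" using q0 lev_nz by simp_all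
  fix c
  have 1: "q powi - symcartan ty N i j * lev (lam * e) = lev (lam * (e - bet i j))"
    "lev (lam * e) / q powi - symcartan ty N i j = lev (lam * (e + bet i j))"
    using q0 lev_mult[of "lam * e" "- (lam * bet i j)"] lev_mult[of "lam * e" "lam * bet i j"]
    unfolding B by (simp_all add: algebra_simps power_int_minus divide_inverse)
  show "ordm ty N q (mon (Mv 1 y (j, e))) i c = ordm ty N q (mon y) i c
      + (if c = q powi - symcartan ty N i j * lev (lam * e) then 1 else 0)
      - (if c = lev (lam * e) / q powi - symcartan ty N i j then 1 else 0)"
  proof (cases "c \<in> range (\<lambda>e. lev (lam * e))")
    case True
    then obtain h where c: "c = lev (lam * h)" by blast
    show ?thesis unfolding 1 c ordm_mon(1)[OF valid_Mv[OF m] i] ordm_mon(1)[OF y i] ordc_Mv[OF assms]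
      using lam_pos by (simp add: lev_inj)
  next
    case False
    then show ?thesis unfolding 1 ordm_mon(2)[OF valid_Mv[OF m] i False] ordm_mon(2)[OF y i False] by auto
  qed
qed

text \<open>The moving strand contributes \<open>\<delta>\<close> to this exponent, and nothing of
  opposite sign cancels it: in an inner column no second strand has the same height, and at a free
  end such a strand would end at \<open>e\<close>, be \<open>neg\<close> and prevent the
  move.\<close>

lemma mov_mex:
  assumes y: "valid y" and m: "mov \<delta> y (i, e)" and \<delta>: "\<delta> = 1 \<or> \<delta> = -1"
  shows "\<delta> * mex y i (lam * e - \<delta> * rlen ty N i) \<ge> 1"
proof -
  obtain \<sigma> where \<sigma>: "\<sigma> \<in> J" "i \<in> nd" "site (y \<sigma>) i e" "y \<sigma> i = e - \<delta>" "valid (upd y \<sigma> i (e + \<delta>))"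
    using movE[OF y m] .
  let ?k = "lam * e - \<delta> * rlen ty N i"
  have n: "\<not> neg (y \<tau>) i e" if "\<tau> \<in> J" for \<tau> using valid_upd_iff[OF y \<sigma>(1-4) \<delta>] \<sigma>(5) that by blast
  have \<sigma>': "cpos (y \<sigma>) i = ?k \<and> csgn (y \<sigma>) i = \<delta>"
  proof (cases "i < M")
    case True
    then show ?thesis using \<sigma>(3,4) strand_csgn(1)[OF strandD[OF y \<sigma>(1)] \<sigma>(2) True] \<delta>
      by (auto simp: cpos_def rlen_nd[OF \<sigma>(2)] site_def algebra_simps)
  next
    case False
    then show ?thesis using \<sigma>(3,4) M_not_less[OF \<sigma>(2) False] \<delta>
      by (auto simp: cpos_def csgn_def rlen_nd[OF \<sigma>(2)] site_def algebra_simps)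
  qed
  have pos: "0 \<le> (if cpos (y \<tau>) i = ?k then \<delta> * csgn (y \<tau>) i else 0)" if \<tau>: "\<tau> \<in> J" for \<tau>
  proof (cases "cpos (y \<tau>) i = ?k")
    case k: True
    show ?thesis
    proof (cases "i < M")
      case True
      then have "lam * y \<tau> i = lam * y \<sigma> i" using k \<sigma>' by (simp add: cpos_def)
      then have "y \<sigma> i = y \<tau> i" using lam_pos by simp
      then have "\<sigma> = \<tau>" by (rule strands_inj[OF y \<sigma>(1) \<tau> less_imp_le[OF True]])
      then show ?thesis using \<sigma>' \<delta> by auto
    next
      case False
      note M = M_not_less[OF \<sigma>(2) False]
      have "y \<tau> i \<noteq> e" using n[OF \<tau>] M by (simp add: neg_def)
      then show ?thesis using k M False strand_csgn(3)[OF strandD[OF y \<tau>] \<sigma>(2) False] \<delta>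
        by (auto simp: cpos_def csgn_def rlen_nd[OF \<sigma>(2)])
    qed
  qed simp
  have "\<delta> * mex y i ?k = (\<Sum>\<tau>\<in>J. if cpos (y \<tau>) i = ?k then \<delta> * csgn (y \<tau>) i else 0)"
    unfolding mex_def sum_distrib_left by (intro sum.cong refl) auto
  also have "\<dots> \<ge> (if cpos (y \<sigma>) i = ?k then \<delta> * csgn (y \<sigma>) i else 0)"
    using \<sigma>(1) finJ pos by (intro member_le_sum) auto
  finally show ?thesis using \<sigma>' \<delta> by auto
qed

lemma dominant_no_raise:
  assumes y: "valid y" and "dominant (mon y)" shows "\<not> mov (-1) y x"
proof
  assume m: "mov (-1) y x"
  obtain i e where x: "x = (i, e)" by (cases x)
  have "mex y i (lam * e + rlen ty N i) \<le> -1" using mov_mex[OF y m[unfolded x]] by simp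
  moreover have i: "i \<in> nd" using m by (simp add: mov_def x)
  moreover have "Poly_Mapping.lookup (mon y) (i, lev (lam * e + rlen ty N i)) \<ge> 0"
    using assms(2) by (simp add: dominant_def)
  ultimately show False unfolding lookup_mon_lev[OF i] by linarith
qed

text \<open>If an exponent is positive, let \<open>k\<close> be the highest such level of its node.
  The pole order at the label next above \<open>k\<close> is then at least 1, hence equal to 1, and
  belongs to a move. A raising move would need a negative exponent at \<open>k + 2 * ?r\<close>,
  making the order at least 2; so the state has a lowering move.\<close>

lemma antidominant_iff:
  assumes y: "valid y"
  shows "antidominant (mon y) \<longleftrightarrow> (\<forall>x. \<not> mov 1 y x)"
proof
  assume ad: "antidominant (mon y)"
  show "\<forall>x. \<not> mov 1 y x"
  proof (intro allI notI)
    fix x assume m: "mov 1 y x"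
    obtain i e where x: "x = (i, e)" by (cases x)
    have "mex y i (lam * e - rlen ty N i) \<ge> 1" using mov_mex[OF y m[unfolded x]] by simp
    moreover have i: "i \<in> nd" using m by (simp add: mov_def x)
    moreover have "Poly_Mapping.lookup (mon y) (i, lev (lam * e - rlen ty N i)) \<le> 0"
      using ad by (simp add: antidominant_def)
    ultimately show False unfolding lookup_mon_lev[OF i] by linarith
  qed
next
  assume n: "\<forall>x. \<not> mov 1 y x"
  show "antidominant (mon y)"
    unfolding antidominant_def
  proof (rule allI, rule ccontr)
    fix z assume z: "\<not> Poly_Mapping.lookup (mon y) z \<le> 0"
    obtain i b where zi: "z = (i, b)" by (cases z)
    have "Poly_Mapping.lookup (mon y) (i, b) \<noteq> 0" using z zi by auto
    then obtain k0 where i: "i \<in> nd" and k0: "b = lev k0" using lookup_mon_nz by blast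
    let ?P = "{k. mex y i k > 0}"
    have "?P \<subseteq> (\<lambda>\<sigma>. cpos (y \<sigma>) i) ` J"
    proof
      fix k assume "k \<in> ?P"
      then have "mex y i k \<noteq> 0" by simp
      then obtain \<sigma> where "\<sigma> \<in> J" "cpos (y \<sigma>) i = k" using mex_nz_strand by blast
      then show "k \<in> (\<lambda>\<sigma>. cpos (y \<sigma>) i) ` J" by blast
    qed
    then have fin: "finite ?P" using finJ finite_surj by blast
    have ne: "k0 \<in> ?P" using z zi k0 lookup_mon_lev[OF i] by simp
    define k where "k = Max ?P"
    have k: "mex y i k > 0" using Max_in[OF fin] ne unfolding k_def by blast
    let ?r = "rlen ty N i"
    have r: "?r > 0" by (simp add: rlen_def)
    have up: "mex y i (k + 2 * ?r) \<le> 0"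
    proof (rule ccontr)
      assume "\<not> ?thesis"
      then have "k + 2 * ?r \<le> k" unfolding k_def by (intro Max_ge fin) (simp add: k_def[symmetric])
      then show False using r by simp
    qed
    have "mex y i k \<noteq> 0" using k by simp
    then obtain e where e: "k = lam * e - ?r" using mex_nz[OF y i] by blast
    have k': "lam * e - ?r = k" "lam * e + ?r = k + 2 * ?r" "lam * e - -1 * ?r = k + 2 * ?r" using e by simp_all
    have o: "mex y i k - mex y i (k + 2 * ?r) = ordc y i e" using mex_ordc[OF y i, of e] unfolding k' .
    then have "ordc y i e = 1" using k up ordc_le_1_iff(1)[OF y i, of e] by linarith
    then have "mov (-1) y (i, e)" using ordc_moves[OF y i] n by blast
    then have "mex y i (k + 2 * ?r) \<le> -1" using mov_mex[OF y, of "-1" i e] unfolding k' by simp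
    then show False using o \<open>ordc y i e = 1\<close> k by linarith
  qed
qed

end

section \<open>The character\<close>

text \<open>An operator that separates \<open>p\<close> from \<open>r\<close>, shifted by the
  eigenvalue of \<open>r\<close>, removes the term of \<open>r\<close> from the relation.\<close>

lemma (in complex_space) eigenvectors_independent:
  assumes "finite Q" "\<And>p. p \<in> Q \<Longrightarrow> vec p \<noteq> 0"
    and "\<And>x. x \<in> A \<Longrightarrow> lin (f x)" "\<And>p x. p \<in> Q \<Longrightarrow> x \<in> A \<Longrightarrow> f x (vec p) = scale (g p x) (vec p)"
    and "\<And>p p'. p \<in> Q \<Longrightarrow> p' \<in> Q \<Longrightarrow> p \<noteq> p' \<Longrightarrow> \<exists>x\<in>A. g p x \<noteq> g p' x"
    and "(\<Sum>p\<in>Q. scale (a p) (vec p)) = 0" "p \<in> Q"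
  shows "a p = 0"
  using assms
proof (induction Q arbitrary: a p rule: finite_induct)
  case (insert r Q)
  have zero: "a p = 0" if p: "p \<in> Q" for p
  proof -
    have "r \<noteq> p" using p insert.hyps by blast
    then obtain x where x: "x \<in> A" "g p x \<noteq> g r x" using insert.prems(4)[of p r] p by blast
    note l = insert.prems(2)[OF x(1)]
    have "f x (\<Sum>p\<in>insert r Q. scale (a p) (vec p)) - scale (g r x) (\<Sum>p\<in>insert r Q. scale (a p) (vec p)) = 0"
      using insert.prems(5) module_hom.zero[OF l] by simp
    then have "(\<Sum>p\<in>insert r Q. scale (a p * (g p x - g r x)) (vec p)) = 0"
      unfolding lin_cong_sum[OF l] scale_sum_right sum_subtractf[symmetric]
      using insert.prems(3)[OF _ x(1)] by (simp add: algebra_simps)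
    then have "(\<Sum>p\<in>Q. scale (a p * (g p x - g r x)) (vec p)) = 0" using insert.hyps by simp
    then have "a p * (g p x - g r x) = 0"
      using insert.prems(1-4) p by (intro insert.IH[of "\<lambda>p. a p * (g p x - g r x)"]) auto
    then show ?thesis using x(2) by simp
  qed
  have "scale (a r) (vec r) = 0"
    using insert.prems(5) insert.hyps zero by simp
  then have "a r = 0" using insert.prems(1)[of r] by (simp add: scale_eq_0_iff)
  then show ?case using insert.prems(6) zero by blast
qed simp

context strand_module
begin

section \<open>Labels as complex frequencies and the crystal of moves\<close>

definition enc :: "nat \<times> int \<Rightarrow> nat \<times> complex" where
  "enc = (\<lambda>(i, e). (i, lev (lam * e)))"

definition dec :: "nat \<times> complex \<Rightarrow> nat \<times> int" where
  "dec = inv_into UNIV enc"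

lemma enc_inj: "inj enc"
  using lam_pos by (auto simp: inj_def enc_def lev_inj)

lemma dec_enc [simp]: "dec (enc x) = x"
  unfolding dec_def by (rule inv_into_f_f[OF enc_inj UNIV_I])

definition labs :: "int \<Rightarrow> (nat \<Rightarrow> nat \<Rightarrow> int) \<Rightarrow> (nat \<times> complex) set" where
  "labs \<delta> y = enc ` {x. mov \<delta> y x}"

definition move :: "int \<Rightarrow> (nat \<Rightarrow> nat \<Rightarrow> int) \<Rightarrow> nat \<times> complex \<Rightarrow> nat \<Rightarrow> nat \<Rightarrow> int" where
  "move \<delta> y x = Mv \<delta> y (dec x)"

lemma labs_poles:
  assumes y: "valid y" and i: "i \<in> nd"
  shows "(i, c) \<in> labs 1 y \<union> labs (-1) y \<longleftrightarrow> ordm ty N q (mon y) i c = 1"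
proof
  assume "(i, c) \<in> labs 1 y \<union> labs (-1) y"
  then obtain e where e: "c = lev (lam * e)" "mov 1 y (i, e) \<or> mov (-1) y (i, e)"
    by (auto simp: labs_def enc_def)
  then show "ordm ty N q (mon y) i c = 1" using ordc_moves[OF y i] ordm_mon(1)[OF y i] by simp
next
  assume o: "ordm ty N q (mon y) i c = 1"
  then obtain e where e: "c = lev (lam * e)" using ordm_mon(2)[OF y i, of c] by force
  then have "mov 1 y (i, e) \<or> mov (-1) y (i, e)" using o ordc_moves[OF y i] ordm_mon(1)[OF y i] by simp
  then show "(i, c) \<in> labs 1 y \<union> labs (-1) y" unfolding e labs_def by (force simp: enc_def)
qed

lemma labs_nd: "(i, c) \<in> labs \<delta> y \<Longrightarrow> i \<in> nd \<and> c \<noteq> 0"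
  using lev_nz by (auto simp: labs_def enc_def mov_def)

lemma ordm_le_1: "valid y \<Longrightarrow> i \<in> nd \<Longrightarrow> ordm ty N q (mon y) i c \<le> 1"
  using ordm_mon[of y i] ordc_le_1_iff(1)[of y i] by (cases "c \<in> range (\<lambda>e. lev (lam * e))") force+

text \<open>Residues at the simple poles; they exist by \<open>gext_poles\<close>, and the choice
  makes them a function of the state.\<close>

definition res :: "(nat \<Rightarrow> nat \<Rightarrow> int) \<Rightarrow> nat \<Rightarrow> complex \<Rightarrow> complex" where
  "res y i = (SOME \<rho>. (\<forall>c\<in>{c. ordm ty N q (mon y) i c = 1}. \<rho> c \<noteq> 0) \<and>
      (\<forall>n. gext ty N q (mon y) Plus i n - gext ty N q (mon y) Minus i n
        = (\<Sum>c\<in>{c. ordm ty N q (mon y) i c = 1}. \<rho> c * c powi n)))"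

lemma res:
  assumes "valid y" "i \<in> nd"
  shows "finite {c. ordm ty N q (mon y) i c = 1}"
    and "ordm ty N q (mon y) i c = 1 \<Longrightarrow> res y i c \<noteq> 0"
    and "gext ty N q (mon y) Plus i n - gext ty N q (mon y) Minus i n
        = (\<Sum>c | ordm ty N q (mon y) i c = 1. res y i c * c powi n)"
proof -
  have ex: "\<exists>\<rho>. (\<forall>c\<in>{c. ordm ty N q (mon y) i c = 1}. \<rho> c \<noteq> 0) \<and>
      (\<forall>n. gext ty N q (mon y) Plus i n - gext ty N q (mon y) Minus i n
        = (\<Sum>c\<in>{c. ordm ty N q (mon y) i c = 1}. \<rho> c * c powi n))"
    by (rule gext_poles(3)[OF q0 qroot mon_monomials ordm_le_1[OF assms]])
  show "finite {c. ordm ty N q (mon y) i c = 1}"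
    by (rule gext_poles(1)[OF q0 qroot mon_monomials ordm_le_1[OF assms]])
  from someI_ex[OF ex] show "ordm ty N q (mon y) i c = 1 \<Longrightarrow> res y i c \<noteq> 0"
    "gext ty N q (mon y) Plus i n - gext ty N q (mon y) Minus i n
        = (\<Sum>c | ordm ty N q (mon y) i c = 1. res y i c * c powi n)"
    unfolding res_def[symmetric] by blast+
qed

lemma finite_labs: "valid y \<Longrightarrow> finite (labs 1 y \<union> labs (-1) y)"
proof (rule finite_subset)
  assume y: "valid y"
  show "labs 1 y \<union> labs (-1) y \<subseteq> (SIGMA i:nd. {c. ordm ty N q (mon y) i c = 1})"
  proof
    fix x assume "x \<in> labs 1 y \<union> labs (-1) y"
    then show "x \<in> (SIGMA i:nd. {c. ordm ty N q (mon y) i c = 1})"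
      using labs_nd labs_poles[OF y] by (cases x) blast
  qed
  show "finite (SIGMA i:nd. {c. ordm ty N q (mon y) i c = 1})"
    using fin_nd res(1)[OF y] by blast
qed

lemma move_inverse:
  assumes y: "valid y" and x: "x \<in> labs \<delta> y" and \<delta>: "\<delta> = 1 \<or> \<delta> = -1"
  shows "valid (move \<delta> y x)" "x \<in> labs (- \<delta>) (move \<delta> y x)" "move (- \<delta>) (move \<delta> y x) x = y"
    "total (move \<delta> y x) = total y + 2 * \<delta>"
proof -
  obtain z where z: "x = enc z" "mov \<delta> y z" using x by (auto simp: labs_def)
  show "valid (move \<delta> y x)" using valid_Mv[OF z(2)] by (simp add: move_def z)
  show "x \<in> labs (- \<delta>) (move \<delta> y x)" using Mv_inverse(1)[OF y z(2) \<delta>] by (simp add: move_def z labs_def)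
  show "move (- \<delta>) (move \<delta> y x) x = y" using Mv_inverse(2)[OF y z(2) \<delta>] by (simp add: move_def z)
  show "total (move \<delta> y x) = total y + 2 * \<delta>" using total_Mv[OF y z(2)] by (simp add: move_def z)
qed

lemma move_diamond:
  assumes y: "valid y" and x: "x \<in> labs \<delta> y" "x' \<in> labs \<delta> y" "x \<noteq> x'" and \<delta>: "\<delta> = 1 \<or> \<delta> = -1"
  shows "x' \<in> labs \<delta> (move \<delta> y x) \<and> move \<delta> (move \<delta> y x) x' = move \<delta> (move \<delta> y x') x"
proof -
  obtain z z' where z: "x = enc z" "mov \<delta> y z" "x' = enc z'" "mov \<delta> y z'" using x by (auto simp: labs_def)
  then have "z \<noteq> z'" using x(3) by blast
  from diamond[OF y z(2,4) this \<delta>] show ?thesis by (simp add: z move_def labs_def)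
qed

text \<open>The degree is the number of moves from \<open>y0\<close>. It is a natural number because
  a dominant state admits no raising move, so its strands have the least possible heights.\<close>

lemma crystal:
  assumes y0: "valid y0" "dominant (mon y0)" and hw: "highest_lweight ty N q act (gamma ty N q (mon y0))"
  shows "\<exists>v0 d0. crystal_module scl (nodes N) (symcartan ty N) q kap X K H F D (q powi - dexp)
    {y. valid y} y0 (\<lambda>y. nat ((total y - total y0) div 2)) (labs 1) (labs (-1)) (move 1) (move (-1))
    (\<lambda>y. gext ty N q (mon y)) (\<lambda>y x. kap (fst x) * res y (fst x) (snd x)) v0 d0"
proof -
  have no: "\<not> mov (-1) y0 x" for x by (rule dominant_no_raise[OF y0])
  obtain v0 where v0: "v0 \<noteq> 0" "\<And>i n. i \<in> nodes N \<Longrightarrow> X Plus i n v0 = 0"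
    "\<And>e i r. i \<in> nodes N \<Longrightarrow> T (phi q e i r) v0 = scl (gamma ty N q (mon y0) e i r) v0"
    using hw unfolding highest_lweight_def scl_scal X_def T_def by blast
  have Fv0: "F e i n v0 = scl (gext ty N q (mon y0) e i n) v0" if "i \<in> nodes N" for e i n
    using v0(3)[OF that] by (simp add: F_def phi_int_def gext_def T_0)
  obtain d0 where d0: "d0 \<noteq> 0" "D v0 = scl d0 v0"
    using D_eigen[of v0] F_eigen_imp_KH_eigen(1)[OF _ Fv0] v0(1) by blast
  have le: "total y0 \<le> total y" if "valid y" for y
    unfolding total_def by (intro sum_mono extremal(1)[OF y0(1) that]) (rule no)
  have lower: "valid (move 1 y x) \<and> x \<in> labs (-1) (move 1 y x) \<and> move (-1) (move 1 y x) x = y \<and>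
      nat ((total (move 1 y x) - total y0) div 2) = Suc (nat ((total y - total y0) div 2))"
    if "valid y" "x \<in> labs 1 y" for y x
    using move_inverse[OF that] le[OF that(1)] by (simp add: algebra_simps)
  have raise: "valid (move (-1) y x) \<and> x \<in> labs 1 (move (-1) y x) \<and> move 1 (move (-1) y x) x = y"
    if "valid y" "x \<in> labs (-1) y" for y x
    using move_inverse[OF that] by simp
  have poles: "kap i * (gext ty N q (mon y) Plus i n - gext ty N q (mon y) Minus i n) =
      (\<Sum>c | (i, c) \<in> labs 1 y \<union> labs (-1) y. kap i * res y i c * c powi n)" if "valid y" "i \<in> nodes N" for y i n
    using res(3)[OF that(1), of i n] that(2) labs_poles[OF that(1), of i] unfolding nodes_nd
    by (simp add: sum_distrib_left mult.assoc)
  have shift: "gext ty N q (mon (move 1 y (j, c))) e i n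
      - q powi - symcartan ty N i j * c * gext ty N q (mon (move 1 y (j, c))) e i (n - 1)
    = q powi - symcartan ty N i j * gext ty N q (mon y) e i n - c * gext ty N q (mon y) e i (n - 1)"
    if s: "valid y" "(j, c) \<in> labs 1 y" "i \<in> nodes N" for y i j c e n
  proof -
    obtain z where z: "(j, c) = enc z" "mov 1 y z" using s(2) unfolding labs_def by blast
    obtain h where h: "z = (j, h)" "c = lev (lam * h)" using z(1) unfolding enc_def by (cases z) auto
    have "move 1 y (j, c) = Mv 1 y (j, h)" unfolding z(1) move_def dec_enc h(1) ..
    then show ?thesis using gext_Mv[OF s(1) z(2)[unfolded h(1)], of i e n] s(3) h(2) by (simp add: nodes_nd)
  qed
  have disj: "labs 1 y \<inter> labs (-1) y = {}" if "valid y" for y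
  proof -
    have False if l: "x \<in> labs 1 y" "x \<in> labs (-1) y" for x
    proof -
      obtain z z' where "x = enc z" "mov 1 y z" "x = enc z'" "mov (-1) y z'" using l unfolding labs_def by blast
      then have "z' = z" using enc_inj by (auto dest: injD)
      then show False using mov_disjoint[OF \<open>valid y\<close>] \<open>mov 1 y z\<close> \<open>mov (-1) y z'\<close> by (cases z) auto
    qed
    then show ?thesis by blast
  qed
  have top: "y = y0" if "valid y" "labs (-1) y = {}" for y
    using that no by (intro extremal_unique[OF that(1) y0(1), of "-1"]) (auto simp: labs_def)
  have "crystal_module scl (nodes N) (symcartan ty N) q kap X K H F D (q powi - dexp)
    {y. valid y} y0 (\<lambda>y. nat ((total y - total y0) div 2)) (labs 1) (labs (-1)) (move 1) (move (-1))
    (\<lambda>y. gext ty N q (mon y)) (\<lambda>y x. kap (fst x) * res y (fst x) (snd x)) v0 d0"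
  proof (intro crystal_module.intro crystal_module_axioms.intro loop_module)
    show "finite {y. valid y}" by (rule finite_valid)
    show "y0 \<in> {y. valid y}" using y0 by simp
    show "nat ((total y0 - total y0) div 2) = 0" by simp
    show "finite (labs 1 y)" "finite (labs (-1) y)" if "y \<in> {y. valid y}" for y
      using finite_labs[of y] that by auto
    show "labs 1 y \<union> labs (-1) y \<subseteq> nodes N \<times> (UNIV - {0})" if "y \<in> {y. valid y}" for y
    proof
      fix x assume "x \<in> labs 1 y \<union> labs (-1) y"
      then show "x \<in> nodes N \<times> (UNIV - {0})"
        using labs_nd[of "fst x" "snd x"] unfolding nodes_nd by (cases x) auto
    qed
    show "x' \<in> labs 1 (move 1 y x) \<and> move 1 (move 1 y x) x' = move 1 (move 1 y x') x"
      if "y \<in> {y. valid y}" "x \<in> labs 1 y" "x' \<in> labs 1 y" "x \<noteq> x'" for y x x'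
      using move_diamond[OF _ that(2-4)] that(1) by simp
    show "x' \<in> labs (-1) (move (-1) y x) \<and> move (-1) (move (-1) y x) x' = move (-1) (move (-1) y x') x"
      if "y \<in> {y. valid y}" "x \<in> labs (-1) y" "x' \<in> labs (-1) y" "x \<noteq> x'" for y x x'
      using move_diamond[OF _ that(2-4)] that(1) by simp
    show "kap (fst x) * res y (fst x) (snd x) \<noteq> 0" if "y \<in> {y. valid y}" "x \<in> labs 1 y \<union> labs (-1) y" for y x
    proof -
      obtain i c where x: "x = (i, c)" by (cases x)
      then have "i \<in> nd" using that labs_nd by blast
      then show ?thesis using that res(2)[of y i c] labs_poles[of y i c] x loop_module.kap0[OF loop_module, of i]
        by (simp add: nodes_nd)
    qed
    show "gext ty N q (mon y) e i n = 0" if "y \<in> {y. valid y}" "i \<in> nodes N" "sg e * n < 0" for y e i n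
      using that by (simp add: gext_def)
    show "q powi l \<noteq> 1" if "l \<noteq> 0" for l using that by (rule qpow_neq_1)
    show "symcartan ty N i i \<noteq> 0" if "i \<in> nodes N" for i by (simp add: symcartan_def cartan_def rlen_def)
    show "\<exists>\<eta>. K Plus i v0 = scl \<eta> v0" if "i \<in> nodes N" for i
      by (rule F_eigen_imp_KH_eigen(1)[OF that Fv0[OF that]])
    show "\<exists>\<eta>. H i n v0 = scl \<eta> v0" if "i \<in> nodes N" "n \<noteq> 0" for i n
      by (rule F_eigen_imp_KH_eigen(2)[OF that(1) Fv0[OF that(1)] that(2)])
  qed (use lower raise poles shift disj top v0 d0 Fv0 in \<open>simp_all only: mem_Collect_eq fst_conv snd_conv not_False_eq_True\<close>)
  then show ?thesis by blast
qed

lemma mon_inj: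
  assumes "valid y" "valid y'" "mon y = mon y'" shows "y = y'"
  using assms(3) ordm_mon(1)[OF assms(1)] ordm_mon(1)[OF assms(2)] by (intro ordc_inj[OF assms(1,2)]) metis

lemma gamma_mon_inj:
  assumes "m \<in> monomials N" "m' \<in> monomials N" "\<And>e i r. i \<in> nodes N \<Longrightarrow> gamma ty N q m e i r = gamma ty N q m' e i r"
  shows "m = m'"
  by (rule gamma_inj[where ty = ty, OF q0 qroot assms(1,2)]) (simp_all add: gext_def assms(3))

text \<open>The vectors of the states form a basis of joint eigenvectors of all \<open>phi\<close>
  with pairwise different l-weights. A generalized eigenvector therefore involves only basis vectors
  of exactly its own l-weight, so every l-weight space is zero or a line, also for l-weights that do
  not come from a monomial.\<close>

theorem strand_character:
  assumes y0: "valid y0" "dominant (mon y0)" and hw: "highest_lweight ty N q act (gamma ty N q (mon y0))"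
  shows "qchar ty N q act = (\<Sum>y | valid y. ymono (mon y))"
    and "thin ty N q act" "special ty N q act" "antispecial ty N q act"
proof -
  obtain v0 d0 where cm: "crystal_module scl (nodes N) (symcartan ty N) q kap X K H F D (q powi - dexp)
    {y. valid y} y0 (\<lambda>y. nat ((total y - total y0) div 2)) (labs 1) (labs (-1)) (move 1) (move (-1))
    (\<lambda>y. gext ty N q (mon y)) (\<lambda>y x. kap (fst x) * res y (fst x) (snd x)) v0 d0"
    using crystal[OF assms] by blast
  define w where "w = crystal_module.vec scl X {y. valid y} (\<lambda>y. nat ((total y - total y0) div 2)) (labs 1) (labs (-1)) (move (-1)) v0"
  have w0: "w y \<noteq> 0" if "valid y" for y
    using crystal_module.vec_nz[OF cm] that unfolding w_def by simp
  have wF: "T (phi q e i n) (w y) = scl (gamma ty N q (mon y) e i n) (w y)" if "valid y" "i \<in> nodes N" for e i n y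
  proof -
    have "F e i (sg e * int n) (w y) = scl (gext ty N q (mon y) e i (sg e * int n)) (w y)"
      using crystal_module.vec_F[OF cm] that unfolding w_def by simp
    moreover have "sg e * (sg e * int n) = int n" by (cases e) simp_all
    ultimately show ?thesis by (simp add: F_def phi_int_def gext_def)
  qed
  have span: "span (w ` {y. valid y}) = UNIV"
    using crystal_module.span_vec[OF cm] unfolding w_def .
  have sep: "\<exists>x\<in>UNIV \<times> nodes N \<times> UNIV. gamma ty N q (mon y) (fst x) (fst (snd x)) (snd (snd x))
      \<noteq> gamma ty N q (mon y') (fst x) (fst (snd x)) (snd (snd x))" if "valid y" "valid y'" "y \<noteq> y'" for y y'
  proof (rule ccontr)
    assume n: "\<not> ?thesis"
    have "gamma ty N q (mon y) e i r = gamma ty N q (mon y') e i r" if "i \<in> nodes N" for e i r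
      using n that by (force dest: bspec[of _ _ "(e, i, r)"])
    then have "mon y = mon y'" by (intro gamma_mon_inj mon_monomials)
    then show False using mon_inj that by blast
  qed
  have indep: "a y = 0" if "(\<Sum>y | valid y. scl (a y) (w y)) = 0" "valid y" for a y
    by (rule eigenvectors_independent[OF finite_valid, of w "UNIV \<times> nodes N \<times> UNIV"
          "\<lambda>x. T (phi q (fst x) (fst (snd x)) (snd (snd x)))"
          "\<lambda>y x. gamma ty N q (mon y) (fst x) (fst (snd x)) (snd (snd x))"])
       (use w0 wF sep that in \<open>auto intro!: lin_T alg_phi\<close>)
  have expand: "\<exists>a. v = (\<Sum>y | valid y. scl (a y) (w y))" for v
  proof -
    have "v \<in> span (w ` {y. valid y})" using span by simp
    then obtain b where b: "v = (\<Sum>u\<in>w ` {y. valid y}. scl (b u) u)"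
      using span_finite[OF finite_imageI[OF finite_valid], of w] by auto
    have "inj_on w {y. valid y}"
    proof (rule inj_onI, rule ccontr)
      fix y y' assume y: "y \<in> {y. valid y}" "y' \<in> {y. valid y}" "w y = w y'" "y \<noteq> y'"
      obtain e i r where i: "i \<in> nodes N" "gamma ty N q (mon y) e i r \<noteq> gamma ty N q (mon y') e i r"
        using sep[of y y'] y by force
      have "scl (gamma ty N q (mon y) e i r) (w y) = scl (gamma ty N q (mon y') e i r) (w y)"
      proof -
        have "scl (gamma ty N q (mon y) e i r) (w y) = T (phi q e i r) (w y')"
          using wF[of y i e r] y i(1) by simp
        also have "\<dots> = scl (gamma ty N q (mon y') e i r) (w y)"
          using wF[of y' i e r] y i(1) by simp
        finally show ?thesis .
      qed
      then show False using i(2) w0[of y] y by (simp add: scale_cancel_right)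
    qed
    then show ?thesis using b by (intro exI[of _ "\<lambda>y. b (w y)"]) (simp add: sum.reindex)
  qed
  define LW where "LW \<gamma> = lweight_space ty N q act \<gamma>" for \<gamma>
  have LW: "LW \<gamma> = {v. \<exists>p. \<forall>e. \<forall>i \<in> nodes N. \<forall>r. ((\<lambda>w. T (phi q e i r) w - scl (\<gamma> e i r) w) ^^ p) v = 0}" for \<gamma>
    unfolding LW_def lweight_space_def scl_scal T_def ..
  have mem: "w y \<in> LW (gamma ty N q (mon y))" if "valid y" for y
    unfolding LW using wF[OF that] by (intro CollectI exI[of _ 1]) simp
  \<comment> \<open>The operator is diagonal in this basis, so it is nilpotent on a vector only if
    every component present has eigenvalue \<open>c\<close>.\<close>
  have pow: "((\<lambda>u. T (phi q e i r) u - scl c u) ^^ p) (\<Sum>y | valid y. scl (a y) (w y))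
      = (\<Sum>y | valid y. scl (a y * (gamma ty N q (mon y) e i r - c) ^ p) (w y))" if i: "i \<in> nodes N" for e i r c p a
  proof (induction p)
    case (Suc p)
    have l: "lin (T (phi q e i r))" by (intro lin_T alg_phi i)
    show ?case
      by (simp add: Suc lin_cong_sum[OF l] scale_sum_right sum_subtractf[symmetric])
         (intro sum.cong refl, simp add: wF i algebra_simps)
  qed simp
  have coeff: "gamma ty N q (mon y) e i r = \<gamma> e i r"
    if h: "(\<Sum>y | valid y. scl (a y) (w y)) \<in> LW \<gamma>" "valid y" "a y \<noteq> 0" "i \<in> nodes N" for a y e i r \<gamma>
  proof -
    obtain p where "((\<lambda>w. T (phi q e i r) w - scl (\<gamma> e i r) w) ^^ p) (\<Sum>y | valid y. scl (a y) (w y)) = 0"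
      using h(1,4) unfolding LW by blast
    then have "a y * (gamma ty N q (mon y) e i r - \<gamma> e i r) ^ p = 0"
      unfolding pow[OF h(4)] by (rule indep[where a = "\<lambda>y. a y * (gamma ty N q (mon y) e i r - \<gamma> e i r) ^ p", OF _ h(2)])
    then show ?thesis using h(3) by simp
  qed
  have LW_sub: "\<exists>A. card A \<le> 1 \<and> finite A \<and> LW \<gamma> \<subseteq> span A" for \<gamma>
  proof (cases "\<exists>y. valid y \<and> (\<forall>e. \<forall>i\<in>nodes N. \<forall>r. gamma ty N q (mon y) e i r = \<gamma> e i r)")
    case True
    then obtain y where y: "valid y" "\<And>e i r. i \<in> nodes N \<Longrightarrow> gamma ty N q (mon y) e i r = \<gamma> e i r" by blast
    have "v \<in> span {w y}" if v: "v \<in> LW \<gamma>" for v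
    proof -
      obtain a where a: "v = (\<Sum>y | valid y. scl (a y) (w y))" using expand by blast
      have "a y' = 0" if y': "valid y'" "y' \<noteq> y" for y'
      proof (rule ccontr)
        assume "a y' \<noteq> 0"
        then have "gamma ty N q (mon y') e i r = gamma ty N q (mon y) e i r" if "i \<in> nodes N" for e i r
          using coeff[of a \<gamma> y' i e r] v y(2)[OF that] y'(1) that unfolding a by simp
        then have "mon y' = mon y" by (intro gamma_mon_inj mon_monomials)
        then show False using mon_inj y y' by blast
      qed
      then have "v = (\<Sum>y' | valid y'. if y' = y then scl (a y) (w y) else 0)"
        unfolding a by (intro sum.cong) auto
      then have "v = scl (a y) (w y)" using y(1) finite_valid by (simp add: sum.delta)
      then show ?thesis by (simp add: span_scale span_base)
    qed
    then show ?thesis by (intro exI[of _ "{w y}"]) auto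
  next
    case False
    have "v = 0" if v: "v \<in> LW \<gamma>" for v
    proof -
      obtain a where a: "v = (\<Sum>y | valid y. scl (a y) (w y))" using expand by blast
      have "a y = 0" if "valid y" for y
      proof (rule ccontr)
        assume "a y \<noteq> 0"
        then have "gamma ty N q (mon y) e i r = \<gamma> e i r" if "i \<in> nodes N" for e i r
          using coeff[of a \<gamma> y i e r] v \<open>valid y\<close> that unfolding a by simp
        then show False using False \<open>valid y\<close> by blast
      qed
      then show ?thesis unfolding a by (intro sum.neutral) simp
    qed
    then show ?thesis by (intro exI[of _ "{}"]) auto
  qed
  show thin: "thin ty N q act"
    unfolding thin_def scl_scal[symmetric] LW_def[symmetric]
  proof
    fix \<gamma>
    obtain A where "card A \<le> 1" "finite A" "LW \<gamma> \<subseteq> span A" using LW_sub by blast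
    then show "dim (LW \<gamma>) \<le> 1" using dim_le_card[of "LW \<gamma>" A] by linarith
  qed
  have dim1: "dim (LW (gamma ty N q (mon y))) = 1" if y: "valid y" for y
  proof -
    let ?W = "LW (gamma ty N q (mon y))"
    obtain A where A: "card A \<le> 1" "finite A" "?W \<subseteq> span A" using LW_sub by blast
    have "dim ?W \<le> 1" using dim_le_card[OF A(3,2)] A(1) by linarith
    moreover have "dim ?W \<noteq> 0"
    proof
      assume d: "dim ?W = 0"
      obtain B where B: "B \<subseteq> ?W" "independent B" "?W \<subseteq> span B" "card B = dim ?W" using basis_exists by blast
      have "finite B" using independent_span_bound[OF A(2) B(2)] B(1) A(3) by blast
      then have "B = {}" using B(4) d by simp
      then show False using B(3) mem[OF y] w0[OF y] by auto
    qed
    ultimately show ?thesis by linarith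
  qed
  have set: "{m. m \<in> monomials N \<and> LW (gamma ty N q m) \<noteq> {0}} = mon ` {y. valid y}"
  proof (intro equalityI subsetI)
    fix m assume m: "m \<in> {m. m \<in> monomials N \<and> LW (gamma ty N q m) \<noteq> {0}}"
    have "0 \<in> LW (gamma ty N q m)" unfolding LW by (auto intro!: exI[of _ 0])
    then obtain v where v: "v \<in> LW (gamma ty N q m)" "v \<noteq> 0" using m by blast
    obtain a where a: "v = (\<Sum>y | valid y. scl (a y) (w y))" using expand by blast
    obtain y where y: "valid y" "a y \<noteq> 0"
    proof (rule ccontr)
      assume "\<not> thesis"
      then have "v = 0" unfolding a using that by (intro sum.neutral) auto
      then show False using v(2) by contradiction
    qed
    have "gamma ty N q (mon y) e i r = gamma ty N q m e i r" if "i \<in> nodes N" for e i r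
      using coeff[OF v(1)[unfolded a] y that] .
    then have "mon y = m" using m by (intro gamma_mon_inj mon_monomials) auto
    then show "m \<in> mon ` {y. valid y}" using y by blast
  next
    fix m assume "m \<in> mon ` {y. valid y}"
    then show "m \<in> {m. m \<in> monomials N \<and> LW (gamma ty N q m) \<noteq> {0}}"
      using mon_monomials mem w0 by blast
  qed
  have inj: "inj_on mon {y. valid y}" using mon_inj by (auto intro: inj_onI)
  have "qchar ty N q act = (\<Sum>m\<in>mon ` {y. valid y}. of_nat (dim (LW (gamma ty N q m))) * ymono m)"
    unfolding qchar_def scl_scal[symmetric] LW_def[symmetric] set ..
  also have "\<dots> = (\<Sum>y | valid y. ymono (mon y))"
    using dim1 by (simp add: sum.reindex[OF inj])
  finally show qc: "qchar ty N q act = (\<Sum>y | valid y. ymono (mon y))" .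
  have keys: "m \<in> Poly_Mapping.keys (qchar ty N q act) \<longleftrightarrow> m \<in> mon ` {y. valid y}" for m
  proof -
    have "Poly_Mapping.lookup (qchar ty N q act) m = (\<Sum>m'\<in>mon ` {y. valid y}. if m = m' then 1 else 0)"
      unfolding qc by (simp add: sum.reindex[OF inj] lookup_sum ymono_def lookup_single when_def eq_commute)
    then show ?thesis using finite_valid by (simp add: in_keys_iff)
  qed
  show "special ty N q act"
    unfolding special_def keys
  proof (rule ex1I[of _ "mon y0"])
    show "mon y0 \<in> mon ` {y. valid y} \<and> dominant (mon y0)" using y0 by blast
    fix m assume "m \<in> mon ` {y. valid y} \<and> dominant m"
    then obtain y where y: "m = mon y" "valid y" "dominant (mon y)" by blast
    then show "m = mon y0"
      using extremal_unique[OF y(2) y0(1), of "-1"] dominant_no_raise[OF y(2,3)] dominant_no_raise[OF y0] by simp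
  qed
  obtain z where z: "valid z" "\<And>x. \<not> mov 1 z x" using bottom_exists[OF y0(1)] by blast
  show "antispecial ty N q act"
    unfolding antispecial_def keys
  proof (rule ex1I[of _ "mon z"])
    show "mon z \<in> mon ` {y. valid y} \<and> antidominant (mon z)" using z antidominant_iff[OF z(1)] by blast
    fix m assume "m \<in> mon ` {y. valid y} \<and> antidominant m"
    then obtain y where y: "m = mon y" "valid y" "antidominant (mon y)" by blast
    then have "\<And>x. \<not> mov 1 y x" using antidominant_iff by blast
    then show "m = mon z" using extremal_unique[OF y(2) z(1), of 1] z(2) y(1) by simp
  qed
qed

text \<open>The common interface to the two types: a bijection \<open>\<Phi>\<close> from states to
  tuples of paths that respects monomials. Dominance of the top state comes for free, as its
  monomial is a product of variables.\<close>

lemma path_character: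
  assumes y0: "valid y0" "mon y0 = (\<Sum>z\<leftarrow>zs. Yvar q a z)"
    and hw: "highest_lweight ty N q act (gamma ty N q (\<Sum>z\<leftarrow>zs. Yvar q a z))"
    and mem: "\<And>y. valid y \<Longrightarrow> \<Phi> y \<in> PS" and inj: "\<And>y y'. valid y \<Longrightarrow> valid y' \<Longrightarrow> \<Phi> y = \<Phi> y' \<Longrightarrow> y = y'"
    and surj: "\<And>ps. ps \<in> PS \<Longrightarrow> \<exists>y. valid y \<and> \<Phi> y = ps"
    and mono: "\<And>y. valid y \<Longrightarrow> (\<Sum>p\<leftarrow>\<Phi> y. pm p) = mon y"
  shows "qchar ty N q act = (\<Sum>ps\<in>PS. \<Prod>p\<leftarrow>ps. ymono (pm p))
    \<and> thin ty N q act \<and> special ty N q act \<and> antispecial ty N q act"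
proof -
  have "Poly_Mapping.lookup (\<Sum>z\<leftarrow>zs. Yvar q a z) x \<ge> 0" for x
    by (induction zs) (auto simp: Yvar_def lookup_add lookup_single when_def)
  then have dom: "dominant (mon y0)" unfolding y0(2) dominant_def by blast
  have bij: "bij_betw \<Phi> {y. valid y} PS"
    unfolding bij_betw_def
  proof (intro conjI equalityI subsetI)
    show "inj_on \<Phi> {y. valid y}" using inj by (simp add: inj_on_def)
    show "ps \<in> PS" if "ps \<in> \<Phi> ` {y. valid y}" for ps using that mem by blast
    show "ps \<in> \<Phi> ` {y. valid y}" if "ps \<in> PS" for ps using surj[OF that] by blast
  qed
  have "ymono (m + m') = ymono m * ymono m'" "ymono 0 = 1" for m m'
    by (simp_all add: ymono_def mult_single)
  then have p: "(\<Prod>p\<leftarrow>ps. ymono (pm p)) = ymono (\<Sum>p\<leftarrow>ps. pm p)" for ps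
    by (induction ps) simp_all
  have "(\<Sum>ps\<in>PS. \<Prod>p\<leftarrow>ps. ymono (pm p)) = (\<Sum>y | valid y. ymono (mon y))"
    unfolding sum.reindex_bij_betw[OF bij, symmetric] p by (intro sum.cong refl) (simp add: mono)
  then show ?thesis using strand_character[OF y0(1) dom hw[folded y0(2)]] by simp
qed

lemma csgn_cases:
  assumes "strand \<sigma> z" "i \<in> nd"
  shows "csgn z i = 1 \<or> csgn z i = -1 \<or> csgn z i = 0"
    and "i < M \<Longrightarrow> csgn z i = 1 \<longleftrightarrow> z (i - 1) = z i + 1 \<and> z (Suc i) = z i + 1"
    and "i < M \<Longrightarrow> csgn z i = -1 \<longleftrightarrow> z (i - 1) = z i - 1 \<and> z (Suc i) = z i - 1"
    and "\<not> i < M \<Longrightarrow> csgn z i = 1 \<or> csgn z i = -1"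
proof -
  show a: "i < M \<Longrightarrow> csgn z i = 1 \<longleftrightarrow> z (i - 1) = z i + 1 \<and> z (Suc i) = z i + 1"
    "i < M \<Longrightarrow> csgn z i = -1 \<longleftrightarrow> z (i - 1) = z i - 1 \<and> z (Suc i) = z i - 1"
    using strand_csgn(1,4)[OF assms] by auto
  show b: "\<not> i < M \<Longrightarrow> csgn z i = 1 \<or> csgn z i = -1"
    using strand_csgn(2,3)[OF assms] by auto
  show "csgn z i = 1 \<or> csgn z i = -1 \<or> csgn z i = 0"
    using b strand_csgn(1,4)[OF assms] by (cases "i < M") auto
qed

definition corner_set :: "pm \<Rightarrow> (nat \<Rightarrow> int) \<Rightarrow> nat set \<Rightarrow> (nat \<times> int) set" where
  "corner_set e z A = (\<lambda>i. (i, cpos z i)) ` {i\<in>A. csgn z i = sg e}"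

lemma Yvar_lev: "Yvar q a (i, k) = Poly_Mapping.single (i, lev k) 1"
  by (simp add: Yvar_def lev_def)

lemma sum_corner_set:
  assumes "strand \<sigma> z" "A \<subseteq> nd"
  shows "(\<Sum>x\<in>corner_set Plus z A. Yvar q a x) - (\<Sum>x\<in>corner_set Minus z A. Yvar q a x)
    = (\<Sum>i\<in>A. Poly_Mapping.single (i, lev (cpos z i)) (csgn z i))"
proof -
  have fin: "finite A" using assms(2) fin_nd finite_subset by blast
  have s: "(\<Sum>x\<in>corner_set e z A. Yvar q a x)
      = (\<Sum>i\<in>A. if csgn z i = sg e then Poly_Mapping.single (i, lev (cpos z i)) 1 else 0)" for e
    unfolding corner_set_def sum.inter_filter[OF fin, symmetric]
    by (subst sum.reindex) (simp_all add: inj_on_def Yvar_lev)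
  show ?thesis
    unfolding s sum_subtractf[symmetric]
  proof (intro sum.cong refl)
    fix i assume "i \<in> A"
    then have "csgn z i = 1 \<or> csgn z i = -1 \<or> csgn z i = 0" using csgn_cases(1)[OF assms(1)] assms(2) by blast
    then show "(if csgn z i = sg Plus then Poly_Mapping.single (i, lev (cpos z i)) 1 else 0)
        - (if csgn z i = sg Minus then Poly_Mapping.single (i, lev (cpos z i)) 1 else 0)
        = Poly_Mapping.single (i, lev (cpos z i)) (csgn z i)"
      by (elim disjE) (simp_all add: single_uminus)
  qed
qed

end

section \<open>Paths in type A\<close>

definition path_A :: "nat \<Rightarrow> (nat \<Rightarrow> int) \<Rightarrow> path" where
  "path_A N z = map (\<lambda>c. (real c, real_of_int (z c))) [0..<N + 2]"

lemma path_A_nth: "c \<le> N + 1 \<Longrightarrow> path_A N z ! c = (real c, real_of_int (z c))"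
  using nth_map_upt[of c "N + 2" 0] by (simp add: path_A_def del: upt_Suc)

lemma set_path_A: "set (path_A N z) = (\<lambda>c. (real c, real_of_int (z c))) ` {..N + 1}"
  by (auto simp: path_A_def simp del: upt_Suc)

text \<open>Triangle inequality along the snake.\<close>

lemma snake_A_pairs:
  assumes "snake TypeA N zs" "t < u" "u < length zs"
  shows "\<bar>int (fst (zs ! u)) - int (fst (zs ! t))\<bar> + 2 \<le> snd (zs ! u) - snd (zs ! t)"
  using assms(2,3)
proof (induction u rule: less_induct)
  case (less u)
  then obtain v where v: "u = Suc v" by (cases u) auto
  have st: "snd (zs ! u) - snd (zs ! v) \<ge> \<bar>int (fst (zs ! u)) - int (fst (zs ! v))\<bar> + 2"
    using assms(1) less.prems unfolding snake_def v by (cases "zs ! Suc v"; cases "zs ! v") auto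
  show ?case
  proof (cases "t = v")
    case True
    then show ?thesis using st by simp
  next
    case False
    then have "\<bar>int (fst (zs ! v)) - int (fst (zs ! t))\<bar> + 2 \<le> snd (zs ! v) - snd (zs ! t)"
      using less v by simp
    then show ?thesis using st by linarith
  qed
qed

theorem character_A:
  fixes act :: "'v::ab_group_add uq_action"
  assumes um: "uq_mod TypeA N q act" and a: "a \<noteq> 0" and sn: "snake TypeA N zs"
    and hw: "highest_lweight TypeA N q act (gamma TypeA N q (\<Sum>z\<leftarrow>zs. Yvar q a z))"
  shows "qchar TypeA N q act =
      (\<Sum>ps \<in> nonoverlapping_paths TypeA N \<epsilon> zs. \<Prod>p\<leftarrow>ps. ymono (path_monomial TypeA N \<epsilon> q a p))
    \<and> thin TypeA N q act \<and> special TypeA N q act \<and> antispecial TypeA N q act"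
proof -
  let ?T = "length zs"
  \<comment> \<open>The prescribed heights at both ends of a path. On the index set every
    \<open>st t\<close> is odd, so all strands have the same parity and are compared in all
    columns.\<close>
  define st where "st t = int (fst (zs ! t)) + snd (zs ! t)" for t
  define en where "en t = int N + 1 - int (fst (zs ! t)) + snd (zs ! t)" for t
  have ix: "1 \<le> fst (zs ! t)" "fst (zs ! t) \<le> N" "odd (st t)" if "t < ?T" for t
  proof -
    have "zs ! t \<in> index_set TypeA N" using sn nth_mem[OF that] unfolding snake_def by blast
    then have "fst (zs ! t) \<in> nodes N" "(int (fst (zs ! t)) - snd (zs ! t)) mod 2 = 1"
      by (cases "zs ! t"; simp)+
    then show "1 \<le> fst (zs ! t)" "fst (zs ! t) \<le> N" "odd (st t)"
      unfolding nodes_def st_def by (simp_all, presburger)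
  qed
  interpret uq_mod TypeA N q act by fact
  interpret strand_module TypeA N q act "{..<?T}" "N + 1" st en False a
    by unfold_locales (use a in auto)
  have lam: "lam = 1" by (simp add: lam_def)
  have nd': "nd = {1..N}" unfolding nd_def by simp
  \<comment> \<open>The V-shaped path, whose only corner is the upper one at the snake entry
    itself.\<close>
  define y0 where "y0 t c = (if t < ?T \<and> c \<le> N + 1 then snd (zs ! t) + \<bar>int c - int (fst (zs ! t))\<bar> else 0)" for t c
  have y0s: "strand t (y0 t)" if "t < ?T" for t
    unfolding strand_def using ix(1,2)[OF that] that by (auto simp: y0_def st_def en_def)
  have y0v: "valid y0"
    unfolding valid_def ordered_def
  proof (intro conjI ballI allI impI)
    fix \<sigma> \<tau> c assume h: "\<sigma> \<in> {..<?T}" "\<tau> \<in> {..<?T}" "\<sigma> < \<tau>" "c \<le> N + 1"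
    then show "y0 \<sigma> c < y0 \<tau> c"
      using snake_A_pairs[OF sn h(3)] by (simp add: y0_def)
  qed (use y0s in \<open>auto simp: y0_def\<close>)
  have y0m: "mon y0 = (\<Sum>z\<leftarrow>zs. Yvar q a z)"
  proof -
    have "(\<Sum>i\<in>nd. Poly_Mapping.single (i, lev (cpos (y0 t) i)) (csgn (y0 t) i)) = Yvar q a (zs ! t)" if t: "t < ?T" for t
    proof -
      have "Poly_Mapping.single (i, lev (cpos (y0 t) i)) (csgn (y0 t) i)
          = (if i = fst (zs ! t) then Yvar q a (zs ! t) else 0)" if i: "i \<in> nd" for i
      proof -
        have i': "1 \<le> i" "i \<le> N" using i nd' by auto
        have "csgn (y0 t) i = (if i = fst (zs ! t) then 1 else 0)"
          unfolding csgn_def y0_def using i' t by (auto simp: of_nat_diff abs_if)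
        moreover have "i = fst (zs ! t) \<Longrightarrow> cpos (y0 t) i = snd (zs ! t)"
          unfolding cpos_def y0_def lam using i' t by simp
        ultimately show ?thesis by (cases "zs ! t") (auto simp: Yvar_lev)
      qed
      then have "(\<Sum>i\<in>nd. Poly_Mapping.single (i, lev (cpos (y0 t) i)) (csgn (y0 t) i))
          = (\<Sum>i\<in>nd. if i = fst (zs ! t) then Yvar q a (zs ! t) else 0)" by (rule sum.cong[OF refl])
      also have "\<dots> = Yvar q a (zs ! t)" unfolding nd' using ix(1,2)[OF t] by (simp add: sum.delta)
      finally show ?thesis .
    qed
    then have "mon y0 = (\<Sum>t<?T. Yvar q a (zs ! t))" unfolding mon_def by (intro sum.cong) auto
    then show ?thesis by (simp add: sum_list_sum_nth atLeast0LessThan)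
  qed
  define \<Phi> where "\<Phi> y = map (\<lambda>t. path_A N (y t)) [0..<?T]" for y
  have \<Phi>_nth: "\<Phi> y ! t = path_A N (y t)" if "t < ?T" for y t using that by (simp add: \<Phi>_def)
  have above: "strictly_above (path_A N z) (path_A N z') \<longleftrightarrow> (\<forall>c\<le>N + 1. z c < z' c)" for z z'
  proof
    assume h: "strictly_above (path_A N z) (path_A N z')"
    show "\<forall>c\<le>N + 1. z c < z' c"
    proof (intro allI impI)
      fix c assume "c \<le> N + 1"
      then have "(real c, real_of_int (z c)) \<in> set (path_A N z)" "(real c, real_of_int (z' c)) \<in> set (path_A N z')"
        unfolding set_path_A by blast+
      then show "z c < z' c" using h unfolding strictly_above_def by fastforce
    qed
  qed (auto simp: strictly_above_def set_path_A)
  have pmem: "path_A N z \<in> pathsA N (zs ! t)" if t: "t < ?T" and z: "strand t z" for z t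
  proof -
    obtain i k where ik: "zs ! t = (i, k)" by (cases "zs ! t")
    have "z (Suc c) - z c = 1 \<or> z (Suc c) - z c = -1" if "c \<le> N" for c
      using step[OF z, of c] that by auto
    then have "real_of_int (z (Suc c)) - real_of_int (z c) \<in> {1, -1}" if "c \<le> N" for c
      using that by (simp flip: of_int_diff) (metis of_int_1 of_int_minus)
    then show ?thesis
      using z unfolding ik pathsA_def strand_def by (simp add: path_A_nth st_def en_def ik) (simp add: path_A_def)
  qed
  have surj1: "\<exists>z. strand t z \<and> (\<forall>c>N + 1. z c = 0) \<and> path_A N z = p" if t: "t < ?T" and p: "p \<in> pathsA N (zs ! t)" for p t
  proof -
    obtain i k where ik: "zs ! t = (i, k)" by (cases "zs ! t")
    have p': "length p = N + 2" "\<And>r. r \<le> N + 1 \<Longrightarrow> fst (p ! r) = real r"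
      "snd (p ! 0) = real i + of_int k" "snd (p ! (N + 1)) = real N + 1 - real i + of_int k"
      "\<And>r. r \<le> N \<Longrightarrow> snd (p ! Suc r) - snd (p ! r) \<in> {1, -1}"
      using p unfolding ik pathsA_def by auto
    \<comment> \<open>The floor is exact, since the first ordinate is an integer and the steps are 1
      or -1.\<close>
    define z where "z c = (if c \<le> N + 1 then \<lfloor>snd (p ! c)\<rfloor> else 0)" for c
    have zi: "real_of_int (z c) = snd (p ! c)" if "c \<le> N + 1" for c
      using that
    proof (induction c)
      case 0
      have "snd (p ! 0) = of_int (int i + k)" using p'(3) by simp
      then show ?case by (simp add: z_def)
    next
      case (Suc c)
      have "snd (p ! Suc c) = of_int (z c + 1) \<or> snd (p ! Suc c) = of_int (z c - 1)"
        using Suc p'(5)[of c] by auto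
      moreover have "z (Suc c) = \<lfloor>snd (p ! Suc c)\<rfloor>" using Suc.prems by (simp add: z_def)
      ultimately show ?case by (elim disjE) (simp_all only: floor_of_int)
    qed
    have "strand t z"
      unfolding strand_def
    proof (intro conjI allI impI)
      have "real_of_int (z 0) = of_int (st t)" using zi[of 0] p'(3) by (simp add: st_def ik)
      then show "z 0 = st t" by linarith
      have "real_of_int (z (N + 1)) = of_int (en t)" using zi[of "N + 1"] p'(4) by (simp add: en_def ik)
      then show "False \<or> z (N + 1) = en t" by linarith
      fix c assume "c < N + 1"
      then have "real_of_int (z (Suc c)) - real_of_int (z c) \<in> {1, -1}" using zi[of c] zi[of "Suc c"] p'(5)[of c] by simp
      then have "real_of_int (z (Suc c) - z c) = of_int 1 \<or> real_of_int (z (Suc c) - z c) = of_int (-1)" by auto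
      then show "\<bar>z (Suc c) - z c\<bar> = 1" unfolding of_int_eq_iff by auto
    qed
    moreover have "path_A N z = p"
    proof (rule nth_equalityI)
      show "length (path_A N z) = length p" by (simp add: path_A_def p')
      fix c assume "c < length (path_A N z)"
      then have c: "c \<le> N + 1" by (simp add: path_A_def)
      then show "path_A N z ! c = p ! c" using zi p'(2) by (simp add: path_A_nth prod_eq_iff)
    qed
    ultimately show ?thesis by (intro exI[of _ z]) (simp add: z_def)
  qed
  show ?thesis
  proof (rule path_character[OF y0v y0m hw, of \<Phi>])
    fix y assume y: "valid y"
    have sy: "strand t (y t)" if "t < ?T" for t using strandD[OF y] that by simp
    show "\<Phi> y \<in> nonoverlapping_paths TypeA N \<epsilon> zs"
      unfolding nonoverlapping_paths_def
    proof (rule CollectI, intro conjI allI impI)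
      show "length (\<Phi> y) = ?T" by (simp add: \<Phi>_def)
      show "\<Phi> y ! t \<in> paths TypeA N \<epsilon> (zs ! t)" if "t < ?T" for t
        using pmem[OF that sy[OF that]] that by (simp add: \<Phi>_nth)
      show "strictly_above (\<Phi> y ! u) (\<Phi> y ! t)" if "t < ?T" "u < t" for t u
      proof -
        have u: "u < ?T" using that by simp
        have "y u c < y t c" if c: "c \<le> N + 1" for c
          using orderedD[OF y, of u t c] u \<open>t < ?T\<close> \<open>u < t\<close> c ix(3)[of u] ix(3)[of t] by simp
        then show ?thesis using u that by (simp add: \<Phi>_nth above)
      qed
    qed
    have "path_monomial TypeA N \<epsilon> q a (path_A N (y t))
        = (\<Sum>i\<in>nd. Poly_Mapping.single (i, lev (cpos (y t) i)) (csgn (y t) i))" if t: "t < ?T" for t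
    proof -
      note S = sy[OF t]
      have sge: "sg e = 1 \<or> sg e = -1" for e by (cases e) auto
      have "cornersA N e (path_A N (y t)) = corner_set e (y t) nd" for e
      proof (intro equalityI subsetI)
        fix x assume x: "x \<in> cornersA N e (path_A N (y t))"
        obtain i k where ik: "x = (i, k)" by (cases x)
        have i: "1 \<le> i" "i \<le> N" and e: "path_A N (y t) ! i = (real i, of_int k)"
          "snd (path_A N (y t) ! (i - 1)) = of_int (k + sg e)" "snd (path_A N (y t) ! (i + 1)) = of_int (k + sg e)"
          using x unfolding ik cornersA_def by (auto simp: nodes_def)
        have "k = y t i" "y t (i - 1) = k + sg e" "y t (Suc i) = k + sg e"
          using e i by (simp_all add: path_A_nth flip: of_int_add)
        moreover have "i \<in> nd" unfolding nd' using i by simp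
        ultimately have "csgn (y t) i = sg e" using csgn_cases(2,3)[OF S, of i] sge[of e] i by auto
        then show "x \<in> corner_set e (y t) nd"
          unfolding corner_set_def ik cpos_def lam nd' using i \<open>k = y t i\<close> \<open>csgn (y t) i = sg e\<close> by auto
      next
        fix x assume "x \<in> corner_set e (y t) nd"
        then obtain i where i: "i \<in> nd" "csgn (y t) i = sg e" "x = (i, y t i)"
          unfolding corner_set_def cpos_def lam nd' by auto
        have i': "1 \<le> i" "i \<le> N" using i nd' by auto
        have "y t (i - 1) = y t i + sg e" "y t (Suc i) = y t i + sg e"
          using csgn_cases(2,3)[OF S i(1)] i(2) sge[of e] i' by auto
        moreover have "(int i - y t i) mod 2 = 1" using parity[OF S, of i] ix(3)[OF t] i' by presburger
        ultimately show "x \<in> cornersA N e (path_A N (y t))"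
          unfolding i(3) cornersA_def using i' by (simp add: path_A_nth nodes_def)
      qed
      then show ?thesis
        unfolding path_monomial_def using sum_corner_set[OF S order.refl] by simp
    qed
    then show "(\<Sum>p\<leftarrow>\<Phi> y. path_monomial TypeA N \<epsilon> q a p) = mon y"
      unfolding mon_def \<Phi>_def by (simp add: sum_list_sum_nth atLeast0LessThan)
  next
    fix y y' assume y: "valid y" "valid y'" and eq: "\<Phi> y = \<Phi> y'"
    show "y = y'"
    proof (intro ext)
      fix t c
      show "y t c = y' t c"
      proof (cases "t < ?T \<and> c \<le> N + 1")
        case True
        then have "path_A N (y t) ! c = path_A N (y' t) ! c" using eq \<Phi>_nth[of t] by metis
        then show ?thesis using True by (simp add: path_A_nth)
      next
        case False
        then show ?thesis using valid_outside[OF y(1), of t c] valid_outside[OF y(2), of t c] by auto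
      qed
    qed
  next
    fix ps assume ps: "ps \<in> nonoverlapping_paths TypeA N \<epsilon> zs"
    then have len: "length ps = ?T" and pt: "\<And>t. t < ?T \<Longrightarrow> ps ! t \<in> pathsA N (zs ! t)"
      and ab: "\<And>t u. t < ?T \<Longrightarrow> u < t \<Longrightarrow> strictly_above (ps ! u) (ps ! t)"
      unfolding nonoverlapping_paths_def by auto
    have "\<forall>t. \<exists>z. t < ?T \<longrightarrow> strand t z \<and> (\<forall>c>N + 1. z c = 0) \<and> path_A N z = ps ! t"
      using surj1 pt by blast
    from choice[OF this] obtain Z where Z: "\<And>t. t < ?T \<Longrightarrow> strand t (Z t) \<and> (\<forall>c>N + 1. Z t c = 0) \<and> path_A N (Z t) = ps ! t"
      by blast
    define y where "y t = (if t < ?T then Z t else (\<lambda>c. 0))" for t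
    have "y \<sigma> c < y \<tau> c" if "\<sigma> < ?T" "\<tau> < ?T" "\<sigma> < \<tau>" "c \<le> N + 1" for \<sigma> \<tau> c
      using ab[OF that(2,3)] Z[OF that(1)] Z[OF that(2)] above[of "Z \<sigma>" "Z \<tau>"] that by (auto simp: y_def)
    then have "valid y" unfolding valid_def ordered_def using Z by (auto simp: y_def)
    moreover have "\<Phi> y = ps"
      by (rule nth_equalityI) (use len Z in \<open>auto simp: \<Phi>_def y_def\<close>)
    ultimately show "\<exists>y. valid y \<and> \<Phi> y = ps" by blast
  qed
qed

section \<open>Paths in type B\<close>

text \<open>What the snake condition for neighbours implies for two arbitrary entries of a snake; the last
  alternative arises when a vertex of the node \<open>N\<close> lies between them.\<close>

definition apart_B :: "int \<Rightarrow> int \<Rightarrow> int \<Rightarrow> int \<Rightarrow> bool" where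
  "apart_B n i i' d \<longleftrightarrow>
     (if i = n \<and> i' = n then d \<ge> 2
      else if i = n \<or> i' = n then d \<ge> 2 * \<bar>i' - i\<bar> + 3
      else (d - 2 * (i' - i)) mod 4 = 0 \<and> d \<ge> 2 * \<bar>i' - i\<bar> + 4
        \<or> (d - 2 * (i' - i)) mod 4 = 2 \<and> d \<ge> 2 * (2 * n - i - i') + 2)"

lemma mod4_witness: "(x::int) mod 4 = y mod 4 \<Longrightarrow> \<exists>m. x = y + 4 * m"
  by presburger

lemma mod4_abs: "((d::int) - 2 * \<bar>x\<bar>) mod 4 = (d - 2 * x) mod 4"
  by (cases "x \<ge> 0") (simp, presburger)

lemma snake_position_apart_B:
  assumes "snake_position TypeB N (i', k') (i, k)"
  shows "apart_B (int N) (int i) (int i') (k' - k)"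
proof (cases "i = N \<or> i' = N")
  case False
  then have d: "k' - k \<ge> 2 * \<bar>int i' - int i\<bar> + 4" "(k' - k) mod 4 = (2 * \<bar>int i' - int i\<bar>) mod 4"
    using assms by auto
  then have "((k' - k) - 2 * \<bar>int i' - int i\<bar>) mod 4 = 0" by (metis mod_0 mod_diff_cong cancel_comm_monoid_add_class.diff_cancel)
  then show ?thesis using d False unfolding apart_B_def mod4_abs by auto
qed (use assms in \<open>auto simp: apart_B_def split: if_splits\<close>)

text \<open>Steps between nodes other than \<open>n\<close> preserve the alternative that holds.
  After passing node \<open>n\<close> only parity is known, so either congruence may occur; but the
  bounds \<open>2 * (n - i) + 3\<close> and \<open>2 * (n - k) + 3\<close> add up to more than
  either alternative asks for.\<close>

lemma apart_B_trans:
  assumes "apart_B n i j d" "apart_B n j k e"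
    and "i \<le> n" "j \<le> n" "k \<le> n"
    and "j \<noteq> n \<Longrightarrow> k \<noteq> n \<Longrightarrow> (e - 2 * (k - j)) mod 4 = 0 \<and> e \<ge> 2 * \<bar>k - j\<bar> + 4"
    and "i \<noteq> n \<Longrightarrow> k \<noteq> n \<Longrightarrow> even (d + e)"
  shows "apart_B n i k (d + e)"
proof -
  consider "i \<noteq> n" "j \<noteq> n" "k \<noteq> n" | "i \<noteq> n" "k \<noteq> n" "j = n" | "i = n \<or> k = n" by blast
  then show ?thesis
  proof cases
    case 1
    have e: "(e - 2 * (k - j)) mod 4 = 0" "e \<ge> 2 * \<bar>k - j\<bar> + 4" using assms(6)[OF 1(2,3)] by auto
    from assms(1) 1 consider "(d - 2 * (j - i)) mod 4 = 0" "d \<ge> 2 * \<bar>j - i\<bar> + 4"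
      | "(d - 2 * (j - i)) mod 4 = 2" "d \<ge> 2 * (2 * n - i - j) + 2" by (auto simp: apart_B_def)
    then show ?thesis
    proof cases
      case A: 1
      have "(d + e - 2 * (k - i)) mod 4 = 0" using A(1) e(1) by presburger
      moreover have "d + e \<ge> 2 * \<bar>k - i\<bar> + 4" using A(2) e(2) abs_triangle_ineq[of "k - j" "j - i"] by simp
      ultimately show ?thesis using 1 by (simp add: apart_B_def)
    next
      case B: 2
      have "(d + e - 2 * (k - i)) mod 4 = 2" using B(1) e(1) by presburger
      moreover have "d + e \<ge> 2 * (2 * n - i - k) + 2" using B(2) e(2) abs_ge_minus_self[of "k - j"] by (simp add: algebra_simps)
      ultimately show ?thesis using 1 by (simp add: apart_B_def)
    qed
  next
    case 2
    then have "d \<ge> 2 * (n - i) + 3" "e \<ge> 2 * (n - k) + 3" using assms(1-5) by (auto simp: apart_B_def)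
    moreover have "(d + e - 2 * (k - i)) mod 4 = 0 \<or> (d + e - 2 * (k - i)) mod 4 = 2"
      using assms(7)[OF 2(1,2)] by presburger
    moreover from calculation(1,2) have "d + e \<ge> 2 * \<bar>k - i\<bar> + 4" using assms(3,5) by (cases "k \<ge> i") auto
    moreover from calculation(1,2) have "d + e \<ge> 2 * (2 * n - i - k) + 2" by auto
    ultimately show ?thesis using 2 unfolding apart_B_def by auto
  next
    case 3
    then show ?thesis using assms abs_ge_self[of "j - i"] abs_ge_minus_self[of "k - j"] abs_ge_self[of "k - j"] abs_ge_minus_self[of "j - i"]
      unfolding apart_B_def by (auto split: if_splits)
  qed
qed

locale snake_B = uq_mod TypeB N q act
  for N :: nat and q :: complex and act :: "'v::ab_group_add uq_action" +
  fixes zs :: "(nat \<times> int) list" and \<epsilon> :: real and a :: complex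
  assumes a_nz: "a \<noteq> 0" and sn: "snake TypeB N zs" and eps: "0 < \<epsilon>" "\<epsilon> < 1 / 2"
begin

section \<open>The strands of a snake and the top state\<close>

abbreviation "node t \<equiv> fst (zs ! t)"
abbreviation "pos t \<equiv> snd (zs ! t)"
abbreviation "len \<equiv> length zs"

lemma N2: "N \<ge> 2"
  using rank by simp

lemma index:
  assumes "t < len"
  shows "1 \<le> node t" "node t \<le> N" "odd (pos t) \<longleftrightarrow> node t = N"
proof -
  have "zs ! t \<in> index_set TypeB N" using sn nth_mem[OF assms] unfolding snake_def by blast
  then show "1 \<le> node t" "node t \<le> N" "odd (pos t) \<longleftrightarrow> node t = N"
    using N2 by (cases "zs ! t"; auto simp: nodes_def)+
qed

lemma position: "Suc t < len \<Longrightarrow> snake_position TypeB N (node (Suc t), pos (Suc t)) (node t, pos t)"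
  using sn unfolding snake_def by simp

lemma apart:
  assumes "t < u" "u < len"
  shows "apart_B (int N) (int (node t)) (int (node u)) (pos u - pos t)"
  using assms
proof (induction u rule: less_induct)
  case (less u)
  then obtain v where v: "u = Suc v" by (cases u) auto
  have p: "snake_position TypeB N (node u, pos u) (node v, pos v)" using position less.prems v by blast
  note st = snake_position_apart_B[OF p]
  show ?case
  proof (cases "t = v")
    case True
    then show ?thesis using st by simp
  next
    case False
    then have tv: "t < v" "v < len" "t < len" using less.prems v by auto
    have "apart_B (int N) (int (node t)) (int (node v)) (pos v - pos t)" using less.IH tv v by simp
    then have "apart_B (int N) (int (node t)) (int (node u)) ((pos v - pos t) + (pos u - pos v))"
    proof (rule apart_B_trans[OF _ st])
      assume n: "int (node v) \<noteq> int N" "int (node u) \<noteq> int N"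
      then have d: "pos u - pos v \<ge> 2 * \<bar>int (node u) - int (node v)\<bar> + 4"
        "(pos u - pos v) mod 4 = (2 * \<bar>int (node u) - int (node v)\<bar>) mod 4" using p[unfolded snake_position.simps] by auto
      then have "((pos u - pos v) - 2 * \<bar>int (node u) - int (node v)\<bar>) mod 4 = 0" by (metis mod_0 mod_diff_cong cancel_comm_monoid_add_class.diff_cancel)
      then show "(pos u - pos v - 2 * (int (node u) - int (node v))) mod 4 = 0 \<and>
          2 * \<bar>int (node u) - int (node v)\<bar> + 4 \<le> pos u - pos v"
        using d unfolding mod4_abs by simp
    qed (use index[OF tv(2)] index[OF tv(3)] index[OF less.prems(2)] in auto)
    then show ?thesis by simp
  qed
qed

text \<open>A path of a node \<open>i < N\<close> consists of two half paths: the strand \<open>2 * t\<close> is the second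
  half, whose end in the middle column has the smaller second coordinate, and \<open>2 * t + 1\<close> the first.
  The heights of the strands are half of those of the paths, up to a perturbation in the middle
  column.\<close>

definition J :: "nat set" where
  "J = {\<sigma>. \<sigma> div 2 < len \<and> (even \<sigma> \<or> node (\<sigma> div 2) \<noteq> N)}"

definition st :: "nat \<Rightarrow> int" where
  "st \<sigma> = (if node (\<sigma> div 2) = N then (pos (\<sigma> div 2) - 1) div 2 + int N
     else if even \<sigma> then pos (\<sigma> div 2) div 2 + 2 * int N - 1 - int (node (\<sigma> div 2))
     else pos (\<sigma> div 2) div 2 + int (node (\<sigma> div 2)))"

lemma st2: "\<sigma> \<in> J \<Longrightarrow> 2 * st \<sigma> = (if node (\<sigma> div 2) = N then pos (\<sigma> div 2) + 2 * int N - 1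
     else if even \<sigma> then pos (\<sigma> div 2) + 4 * int N - 2 - 2 * int (node (\<sigma> div 2))
     else pos (\<sigma> div 2) + 2 * int (node (\<sigma> div 2)))"
  using index(3)[of "\<sigma> div 2"] unfolding st_def J_def by (auto elim!: evenE oddE)

lemma J_cases:
  assumes "\<sigma> \<in> J"
  obtains t where "t < len" "\<sigma> = 2 * t" "2 * st \<sigma> = (if node t = N then pos t + 2 * int N - 1 else pos t + 4 * int N - 2 - 2 * int (node t))"
  | t where "t < len" "\<sigma> = 2 * t + 1" "node t \<noteq> N" "2 * st \<sigma> = pos t + 2 * int (node t)"
  using assms st2[OF assms] by (cases "even \<sigma>") (auto simp: J_def elim!: evenE oddE)

lemma J_even: "t < len \<Longrightarrow> 2 * t \<in> J" and J_odd: "t < len \<Longrightarrow> node t \<noteq> N \<Longrightarrow> 2 * t + 1 \<in> J"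
  by (simp_all add: J_def)

text \<open>The last strand of an entry and the first strand of the next one have opposite parity.
  This is the content of the congruences modulo 4 in the snake condition; doubling removes the
  divisions in \<open>st\<close>.\<close>

lemma next_type:
  assumes "Suc t < len"
  shows "odd (st (if node t = N then 2 * t else 2 * t + 1) - st (2 * Suc t))"
proof -
  let ?\<sigma> = "if node t = N then 2 * t else 2 * t + 1"
  have t: "t < len" using assms by simp
  have 1: "2 * st (2 * Suc t) = (if node (Suc t) = N then pos (Suc t) + 2 * int N - 1
      else pos (Suc t) + 4 * int N - 2 - 2 * int (node (Suc t)))"
    using st2[OF J_even[OF assms]] by simp
  have 2: "2 * st ?\<sigma> = (if node t = N then pos t + 2 * int N - 1 else pos t + 2 * int (node t))"
    using st2[OF J_even[OF t]] st2[OF J_odd[OF t]] by auto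
  let ?D = "int (node (Suc t)) - int (node t)"
  have p: "snake_position TypeB N (node (Suc t), pos (Suc t)) (node t, pos t)" by (rule position[OF assms])
  consider "node t = N" "node (Suc t) = N" | "node t = N" "node (Suc t) \<noteq> N" | "node t \<noteq> N" "node (Suc t) = N"
    | "node t \<noteq> N" "node (Suc t) \<noteq> N" by blast
  then show ?thesis
  proof cases
    case s: 1
    then have "(pos (Suc t) - pos t) mod 4 = 2 mod 4" using p[unfolded snake_position.simps] by simp
    from mod4_witness[OF this] obtain m where "pos (Suc t) - pos t = 2 + 4 * m" ..
    then have "st ?\<sigma> - st (2 * Suc t) = 2 * (- m - 1) + 1" using 1 2 s by simp
    then show ?thesis by presburger
  next
    case s: 2
    then have "(pos (Suc t) - pos t) mod 4 = (2 * (int N - int (node (Suc t))) - 1) mod 4"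
      using p[unfolded snake_position.simps] index(2)[OF assms] by simp
    from mod4_witness[OF this] obtain m where "pos (Suc t) - pos t = 2 * (int N - int (node (Suc t))) - 1 + 4 * m" ..
    then have "st ?\<sigma> - st (2 * Suc t) = 2 * (int (node (Suc t)) - int N - m) + 1" using 1 2 s by simp
    then show ?thesis by presburger
  next
    case s: 3
    then have "(pos (Suc t) - pos t) mod 4 = (2 * (int N - int (node t)) - 1) mod 4"
      using p[unfolded snake_position.simps] index(2)[OF t] by simp
    from mod4_witness[OF this] obtain m where "pos (Suc t) - pos t = 2 * (int N - int (node t)) - 1 + 4 * m" ..
    then have "st ?\<sigma> - st (2 * Suc t) = 2 * (int (node t) - int N - m) + 1" using 1 2 s by simp
    then show ?thesis by presburger
  next
    case s: 4
    then have "(pos (Suc t) - pos t) mod 4 = (2 * \<bar>?D\<bar>) mod 4" using p[unfolded snake_position.simps] by simp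
    from mod4_witness[OF this] obtain m where "pos (Suc t) - pos t = 2 * \<bar>?D\<bar> + 4 * m" ..
    moreover have "\<bar>?D\<bar> = ?D - 2 * min 0 ?D" by (simp add: min_def)
    ultimately have "st ?\<sigma> - st (2 * Suc t) = 2 * (int (node t) - int N - m + min 0 ?D) + 1" using 1 2 s by simp
    then show ?thesis by presburger
  qed
qed

lemma twin_type: "t < len \<Longrightarrow> node t \<noteq> N \<Longrightarrow> odd (st (2 * t) - st (2 * t + 1))"
  using st2[OF J_even, of t] st2[OF J_odd, of t] by simp presburger

text \<open>Consecutive strands have opposite parity, within an entry by \<open>twin_type\<close>
  and between entries by \<open>next_type\<close>. Two strands of equal parity thus always have one
  of the other parity in between, as \<open>alternate\<close> requires.\<close>

lemma J_next:
  assumes \<sigma>: "\<sigma> \<in> J" and \<tau>: "\<tau> \<in> J" "\<sigma> < \<tau>"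
  shows "\<exists>\<upsilon>\<in>J. \<sigma> < \<upsilon> \<and> \<upsilon> \<le> \<tau> \<and> odd (st \<sigma> - st \<upsilon>)"
proof -
  define t where "t = \<sigma> div 2"
  have t: "t < len" using \<sigma> by (simp add: J_def t_def)
  show ?thesis
  proof (cases "even \<sigma> \<and> node t \<noteq> N")
    case True
    then have "\<sigma> = 2 * t" by (simp add: t_def)
    then show ?thesis using True t twin_type[OF t] J_odd[OF t] \<tau>(2) by (intro bexI[of _ "2 * t + 1"]) auto
  next
    case False
    then have s: "\<sigma> = (if node t = N then 2 * t else 2 * t + 1)" using \<sigma> by (auto simp: J_def t_def)
    have "\<tau> \<noteq> Suc (2 * t) \<or> node t \<noteq> N" using \<tau> by (auto simp: J_def)
    then have u: "2 * Suc t \<le> \<tau>" using s \<tau>(2) by (auto split: if_splits)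
    then have "Suc t < len" using \<tau>(1) by (auto simp: J_def)
    then show ?thesis using next_type[of t] J_even[of "Suc t"] u s by (intro bexI[of _ "2 * Suc t"]) auto
  qed
qed

sublocale strand_module TypeB N q act J N st "\<lambda>_. 0" True a
proof unfold_locales
  have "J \<subseteq> {..< 2 * len}" by (auto simp: J_def)
  then show "finite J" using finite_subset by blast
  show "\<exists>\<upsilon>\<in>J. \<sigma> < \<upsilon> \<and> \<upsilon> < \<tau> \<and> odd (st \<sigma> - st \<upsilon>)"
    if h: "\<sigma> \<in> J" "\<tau> \<in> J" "\<sigma> < \<tau>" "even (st \<sigma> - st \<tau>)" for \<sigma> \<tau>
  proof -
    obtain \<upsilon> where "\<upsilon> \<in> J" "\<sigma> < \<upsilon>" "\<upsilon> \<le> \<tau>" "odd (st \<sigma> - st \<upsilon>)" using J_next[OF h(1-3)] by blast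
    moreover from this have "\<upsilon> \<noteq> \<tau>" using h(4) by blast
    ultimately show ?thesis by force
  qed
qed (use N2 a_nz in auto)

text \<open>The state of the highest \<open>l\<close>-weight: the strands descend straight, except that the first half of a
  path of a node \<open>i < N\<close> turns in the column of \<open>i\<close>.\<close>

definition top :: "nat \<Rightarrow> nat \<Rightarrow> int" where
  "top \<sigma> c = (if \<sigma> \<in> J \<and> c \<le> N then
     if even \<sigma> then st \<sigma> - int c else pos (\<sigma> div 2) div 2 + \<bar>int c - int (node (\<sigma> div 2))\<bar> else 0)"

lemma top2:
  assumes "\<sigma> \<in> J" "c \<le> N"
  shows "2 * top \<sigma> c = (if node (\<sigma> div 2) = N then pos (\<sigma> div 2) + 2 * int N - 1 - 2 * int c
     else if even \<sigma> then pos (\<sigma> div 2) + 4 * int N - 2 - 2 * int (node (\<sigma> div 2)) - 2 * int c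
     else pos (\<sigma> div 2) + 2 * \<bar>int c - int (node (\<sigma> div 2))\<bar>)"
  using assms st2[OF assms(1)] index(3)[of "\<sigma> div 2"] unfolding top_def
  by (auto simp: J_def elim!: evenE)

lemma top_strand: "\<sigma> \<in> J \<Longrightarrow> strand \<sigma> (top \<sigma>)"
proof -
  assume \<sigma>: "\<sigma> \<in> J"
  have "top \<sigma> 0 = st \<sigma>" using \<sigma> by (auto simp: top_def st_def J_def)
  then show ?thesis using \<sigma> unfolding strand_def by (auto simp: top_def abs_if)
qed

text \<open>The congruence in \<open>apart_B\<close> decides which columns have to be compared. In
  its first alternative strands of unlike halves have opposite parity and meet only in the last
  column; in the second one this holds for like halves, and the reflected bound is what unlike
  halves need in all columns.\<close>

lemma top_valid: "valid top"
  unfolding valid_def ordered_def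
proof (intro conjI ballI allI impI)
  fix \<sigma> \<tau> c assume h: "\<sigma> \<in> J" "\<tau> \<in> J" "\<sigma> < \<tau>" "c \<le> N" "even (st \<sigma> - st \<tau>) \<or> c = N"
  define t u where tu: "t = \<sigma> div 2" "u = \<tau> div 2"
  have l: "t < len" "u < len" using h by (auto simp: J_def tu)
  note i = index(1,2)[OF l(1)] index(1,2)[OF l(2)]
  have "2 * top \<sigma> c < 2 * top \<tau> c"
  proof (cases "t = u")
    case True
    then have e: "even \<sigma>" "odd \<tau>" using h(3) tu by presburger+
    then have "\<sigma> = 2 * t" "\<tau> = 2 * t + 1" "node t \<noteq> N" using h(2) tu True by (auto simp: J_def elim!: evenE oddE)
    moreover from this have "c = N" using h(5) twin_type[OF l(1)] by auto
    ultimately show ?thesis using top2[OF h(1,4)] top2[OF h(2,4)] i by simp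
  next
    case False
    then have "t < u" using h(3) tu by presburger
    note A = apart[OF this l(2), unfolded apart_B_def]
    show ?thesis
    proof (cases "node t = N \<or> node u = N")
      case True
      then show ?thesis using top2[OF h(1,4)] top2[OF h(2,4)] A i h(4) unfolding tu[symmetric]
        by (auto simp: abs_if split: if_splits)
    next
      case f: False
      let ?\<Delta> = "int (node u) - int (node t)"
      have A': "(pos u - pos t - 2 * ?\<Delta>) mod 4 = 0 \<and> pos u - pos t \<ge> 2 * \<bar>?\<Delta>\<bar> + 4
          \<or> (pos u - pos t - 2 * ?\<Delta>) mod 4 = 2 \<and> pos u - pos t \<ge> 2 * (2 * int N - int (node t) - int (node u)) + 2"
        using A f by simp
      have w: "x mod 4 = r \<Longrightarrow> \<exists>m. x = r + 4 * m" for x r :: int by presburger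
      from A' consider (same) m where "pos u - pos t - 2 * ?\<Delta> = 0 + 4 * m" "pos u - pos t \<ge> 2 * \<bar>?\<Delta>\<bar> + 4"
        | (diff) m where "pos u - pos t - 2 * ?\<Delta> = 2 + 4 * m"
          "pos u - pos t \<ge> 2 * (2 * int N - int (node t) - int (node u)) + 2" by (elim disjE conjE) (drule w, blast)+
      then show ?thesis
      proof cases
        case same
        have "c = N" if ne: "even \<sigma> \<noteq> even \<tau>"
        proof -
          have "st \<sigma> - st \<tau> = 2 * (if even \<sigma> then int N - int (node u) - m - 1 else int (node t) - int N - m) + 1"
            using same(1) st2[OF h(1)] st2[OF h(2)] ne f unfolding tu[symmetric] by (cases "even \<sigma>") simp_all
          then have "odd (st \<sigma> - st \<tau>)" by presburger
          then show ?thesis using h(5) by blast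
        qed
        then show ?thesis using top2[OF h(1,4)] top2[OF h(2,4)] same(2) f i h(4) unfolding tu[symmetric]
          by (auto simp: abs_if split: if_splits)
      next
        case diff
        have "c = N" if eq: "even \<sigma> = even \<tau>"
        proof -
          have "st \<sigma> - st \<tau> = 2 * (if even \<sigma> then - m - 1 else - m - 1 - ?\<Delta>) + 1"
            using diff(1) st2[OF h(1)] st2[OF h(2)] eq f unfolding tu[symmetric] by (cases "even \<sigma>") simp_all
          then have "odd (st \<sigma> - st \<tau>)" by presburger
          then show ?thesis using h(5) by blast
        qed
        then show ?thesis using top2[OF h(1,4)] top2[OF h(2,4)] diff(2) f i h(4) unfolding tu[symmetric]
          by (auto simp: abs_if split: if_splits)
      qed
    qed
  qed
  then show "top \<sigma> c < top \<tau> c" by simp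
qed (auto simp: top_strand top_def)

section \<open>The monomial of the top state\<close>

definition tm :: "(nat \<Rightarrow> int) \<Rightarrow> monomial" where
  "tm z = (\<Sum>i\<in>nd. Poly_Mapping.single (i, lev (cpos z i)) (csgn z i))"

lemma nd_eq: "nd = {1..N}"
  by (simp add: nd_def)

lemma lam2: "lam = 2"
  by (simp add: lam_def)

lemma csgn_inner: "i < N \<Longrightarrow> csgn z i = (z (i - 1) + z (Suc i) - 2 * z i) div 2"
  and csgn_last: "csgn z N = z (N - 1) - z N"
  and cpos_inner: "i < N \<Longrightarrow> cpos z i = 2 * z i" and cpos_last: "cpos z N = z (N - 1) + z N"
  by (simp_all add: csgn_def cpos_def lam2)

lemma sum_J: "(\<Sum>\<sigma>\<in>J. f \<sigma>) = (\<Sum>t<len. f (2 * t) + (if node t = N then 0 else f (2 * t + 1)))"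
  for f :: "nat \<Rightarrow> 'b::comm_monoid_add"
proof -
  have J: "J = (\<lambda>t. 2 * t) ` {..<len} \<union> (\<lambda>t. 2 * t + 1) ` {t\<in>{..<len}. node t \<noteq> N}"
  proof (rule Set.set_eqI)
    fix \<sigma> :: nat
    consider t where "\<sigma> = 2 * t" | t where "\<sigma> = 2 * t + 1" by (cases "even \<sigma>") (auto elim!: evenE oddE)
    then show "\<sigma> \<in> J \<longleftrightarrow> \<sigma> \<in> (\<lambda>t. 2 * t) ` {..<len} \<union> (\<lambda>t. 2 * t + 1) ` {t\<in>{..<len}. node t \<noteq> N}"
    proof cases
      case 1
      then have "\<sigma> \<notin> (\<lambda>t. 2 * t + 1) ` {t\<in>{..<len}. node t \<noteq> N}" by (auto, presburger)
      then show ?thesis using 1 by (auto simp: J_def)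
    next
      case 2
      then have "\<sigma> \<notin> (\<lambda>t. 2 * t) ` {..<len}" by (auto, presburger)
      then show ?thesis using 2 by (auto simp: J_def)
    qed
  qed
  have "(\<Sum>\<sigma>\<in>J. f \<sigma>) = (\<Sum>\<sigma>\<in>(\<lambda>t. 2 * t) ` {..<len}. f \<sigma>) + (\<Sum>\<sigma>\<in>(\<lambda>t. 2 * t + 1) ` {t\<in>{..<len}. node t \<noteq> N}. f \<sigma>)"
    unfolding J by (rule sum.union_disjoint) (auto, presburger)
  also have "\<dots> = (\<Sum>t<len. f (2 * t)) + (\<Sum>t\<in>{t\<in>{..<len}. node t \<noteq> N}. f (2 * t + 1))"
    by (subst (1 2) sum.reindex) (auto simp: inj_on_def)
  also have "(\<Sum>t\<in>{t\<in>{..<len}. node t \<noteq> N}. f (2 * t + 1)) = (\<Sum>t<len. if node t = N then 0 else f (2 * t + 1))"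
    by (subst sum.inter_filter) (auto intro!: sum.cong)
  finally show ?thesis by (simp only: sum.distrib)
qed

lemma mon_sum_J: "mon y = (\<Sum>t<len. tm (y (2 * t)) + (if node t = N then 0 else tm (y (2 * t + 1))))"
  unfolding mon_def sum_J tm_def ..

lemma tm_single_corners:
  assumes "\<And>i. i \<in> nd \<Longrightarrow> i \<noteq> j \<Longrightarrow> i \<noteq> N \<Longrightarrow> csgn z i = 0" "j \<in> nd" "j \<noteq> N"
  shows "tm z = Poly_Mapping.single (j, lev (cpos z j)) (csgn z j) + Poly_Mapping.single (N, lev (cpos z N)) (csgn z N)"
proof -
  have "tm z = (\<Sum>i\<in>{j, N}. Poly_Mapping.single (i, lev (cpos z i)) (csgn z i))"
    unfolding tm_def using assms N2 by (intro sum.mono_neutral_right) (auto simp: nd_eq)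
  then show ?thesis using assms(3) by simp
qed

lemma tm_straight:
  assumes "\<And>c. c \<le> N \<Longrightarrow> z c = x - int c"
  shows "tm z = Poly_Mapping.single (N, lev (2 * x - 2 * int N + 1)) 1"
proof -
  have "csgn z i = 0" if "i \<in> nd" "i \<noteq> 1" "i \<noteq> N" for i
    using that by (auto simp: nd_eq csgn_inner assms)
  moreover have "csgn z 1 = 0" using N2 by (simp add: csgn_inner assms)
  moreover have "csgn z N = 1" "cpos z N = 2 * x - 2 * int N + 1" using N2 by (simp_all add: csgn_last cpos_last assms of_nat_diff)
  ultimately show ?thesis using N2 by (subst tm_single_corners[of 1]) (auto simp: nd_eq)
qed

lemma tm_bent:
  assumes z: "\<And>c. c \<le> N \<Longrightarrow> z c = x + \<bar>int c - int j\<bar>" and j: "1 \<le> j" "j < N"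
  shows "tm z = Poly_Mapping.single (j, lev (2 * x)) 1 + Poly_Mapping.single (N, lev (2 * x + 2 * int N - 2 * int j - 1)) (-1)"
proof -
  have "csgn z i = 0" if "i \<in> nd" "i \<noteq> j" "i \<noteq> N" for i
  proof (cases "i < j")
    case True
    then show ?thesis using that j by (auto simp: nd_eq csgn_inner z of_nat_diff)
  next
    case False
    then show ?thesis using that j by (auto simp: nd_eq csgn_inner z of_nat_diff)
  qed
  moreover have "csgn z j = 1" "cpos z j = 2 * x" using j by (simp_all add: csgn_inner cpos_inner z of_nat_diff)
  moreover have "csgn z N = -1" "cpos z N = 2 * x + 2 * int N - 2 * int j - 1"
    using j by (simp_all add: csgn_last cpos_last z of_nat_diff)
  ultimately show ?thesis using j by (subst tm_single_corners[of j]) (auto simp: nd_eq)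
qed

text \<open>For a node below \<open>N\<close> the straight strand gives a variable of node
  \<open>N\<close>, the bent one gives the variable of the entry and an inverse variable of node
  \<open>N\<close>; the two of node \<open>N\<close> have the same level and cancel.\<close>

lemma top_mon: "mon top = (\<Sum>z\<leftarrow>zs. Yvar q a z)"
proof -
  have "tm (top (2 * t)) + (if node t = N then 0 else tm (top (2 * t + 1))) = Yvar q a (zs ! t)" if t: "t < len" for t
  proof -
    have e: "tm (top (2 * t)) = Poly_Mapping.single (N, lev (2 * st (2 * t) - 2 * int N + 1)) 1"
      by (rule tm_straight) (simp add: top_def J_even[OF t])
    have Y: "Yvar q a (zs ! t) = Poly_Mapping.single (node t, lev (pos t)) 1"
      using Yvar_lev[of "node t" "pos t"] by simp
    show ?thesis
    proof (cases "node t = N")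
      case True
      then show ?thesis using e Y st2[OF J_even[OF t]] by simp
    next
      case False
      have p: "2 * (pos t div 2) = pos t" using index(3)[OF t] False by auto
      have "tm (top (2 * t + 1)) = Poly_Mapping.single (node t, lev (2 * (pos t div 2))) 1
          + Poly_Mapping.single (N, lev (2 * (pos t div 2) + 2 * int N - 2 * int (node t) - 1)) (-1)"
        using index(1,2)[OF t] False by (intro tm_bent) (simp_all add: top_def J_odd[OF t False, simplified])
      moreover have eq: "2 * st (2 * t) - 2 * int N + 1 = 2 * (pos t div 2) + 2 * int N - 2 * int (node t) - 1"
        using st2[OF J_even[OF t]] False p by simp
      ultimately show ?thesis using e[unfolded eq] Y False p by (simp add: single_uminus)
    qed
  qed
  then have "mon top = (\<Sum>t<len. Yvar q a (zs ! t))" unfolding mon_sum_J by (intro sum.cong) auto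
  then show ?thesis by (simp add: sum_list_sum_nth atLeast0LessThan)
qed

section \<open>Half paths as strands\<close>

definition ll :: "nat \<Rightarrow> int" where
  "ll \<sigma> = 2 * st \<sigma> - 2 * int N + 1"

lemma ll_mod: "ll \<sigma> mod 4 = 3 \<longleftrightarrow> odd (st \<sigma> - int N)"
  unfolding ll_def by presburger

lemma ll_eq:
  assumes "t < len"
  shows "node t = N \<Longrightarrow> ll (2 * t) = pos t"
    and "node t \<noteq> N \<Longrightarrow> ll (2 * t) = pos t + (2 * int N - 2 * int (node t) - 1)"
    and "node t \<noteq> N \<Longrightarrow> ll (2 * t + 1) = pos t - (2 * int N - 2 * int (node t) - 1)"
  using st2[OF J_even[OF assms]] st2[OF J_odd[OF assms]] by (simp_all add: ll_def)

text \<open>The horizontal coordinate: strands of one parity run towards the middle column from the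
  left, those of the other from the right, and by \<open>ll_mod\<close> the residue of
  \<open>ll\<close> modulo 4 is this parity.\<close>

definition col :: "nat \<Rightarrow> nat \<Rightarrow> real" where
  "col \<sigma> c = (if c < N then (if ll \<sigma> mod 4 = 3 then 2 * real c else 4 * real N - 2 - 2 * real c) else 2 * real N - 1)"

text \<open>At the end \<open>cpos\<close> is the odd level of the corner of node \<open>N\<close>,
  and the perturbation has the sign that \<open>cornersB\<close> uses to tell upper corners from
  lower ones.\<close>

definition ht :: "(nat \<Rightarrow> int) \<Rightarrow> nat \<Rightarrow> real" where
  "ht z c = (if c < N then 2 * of_int (z c) else of_int (cpos z N) - of_int (csgn z N) * \<epsilon>)"

definition hp :: "nat \<Rightarrow> (nat \<Rightarrow> int) \<Rightarrow> path" where
  "hp \<sigma> z = map (\<lambda>c. (col \<sigma> c, ht z c)) [0..<Suc N]"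

lemma length_hp: "length (hp \<sigma> z) = N + 1"
  by (simp add: hp_def)

lemma hp_nth: "c \<le> N \<Longrightarrow> hp \<sigma> z ! c = (col \<sigma> c, ht z c)"
  unfolding hp_def by (subst nth_map) (simp_all del: upt_Suc)

lemma set_hp: "set (hp \<sigma> z) = (\<lambda>c. (col \<sigma> c, ht z c)) ` {..N}"
  by (auto simp: hp_def simp del: upt_Suc)

lemma last_step:
  assumes "strand \<sigma> z"
  shows "z N = z (N - 1) + 1 \<and> csgn z N = -1 \<and> ht z N = 2 * of_int (z (N - 1)) + (1 + \<epsilon>)
    \<or> z N = z (N - 1) - 1 \<and> csgn z N = 1 \<and> ht z N = 2 * of_int (z (N - 1)) - (1 + \<epsilon>)"
  using step_left[OF assms, of N] N2 by (auto simp: ht_def csgn_last cpos_last)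

lemma ht_less:
  assumes z: "strand \<sigma> z" and c: "c < N"
  shows "ht z c < ht z (Suc c) \<longleftrightarrow> z c < z (Suc c)" and "ht z (Suc c) < ht z c \<longleftrightarrow> z (Suc c) < z c"
  using last_step[OF z] eps c by (cases "Suc c = N"; auto simp: ht_def)+

text \<open>\<open>ht z N\<close> differs from \<open>2 * z N\<close> by
  \<open>1 - \<epsilon>\<close> in absolute value, so a gap of 2 between doubled heights survives
  both perturbations.\<close>

lemma mid_less:
  assumes "strand \<sigma> z" "strand \<tau> z'" "z N < z' N"
  shows "ht z N < ht z' N"
proof -
  have "2 * real_of_int (z' N) \<ge> 2 * real_of_int (z N) + 2" using assms(3) by simp
  then show ?thesis using last_step[OF assms(1)] last_step[OF assms(2)] eps by auto
qed

text \<open>Apart from the middle column, columns of opposite orientation lie on different sides of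
  it.\<close>

lemma col_eq:
  assumes "c \<le> N" "c' \<le> N"
  shows "col \<sigma> c = col \<tau> c' \<longleftrightarrow> c = c' \<and> (even (st \<sigma> - st \<tau>) \<or> c = N)"
proof -
  have e: "(ll \<sigma> mod 4 = 3) = (ll \<tau> mod 4 = 3) \<longleftrightarrow> even (st \<sigma> - st \<tau>)" unfolding ll_mod by simp blast
  have r: "2 * real c \<noteq> 2 * real N - 1" "4 * real N - 2 - 2 * real c \<noteq> 2 * real N - 1" for c
  proof -
    have "2 * int c \<noteq> 2 * int N - 1" "4 * int N - 2 - 2 * int c \<noteq> 2 * int N - 1" by presburger+
    then show "2 * real c \<noteq> 2 * real N - 1" "4 * real N - 2 - 2 * real c \<noteq> 2 * real N - 1" by linarith+
  qed
  have s: "2 * real c \<noteq> 4 * real N - 2 - 2 * real c'" if "c < N" "c' < N" for c c'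
    using that by linarith
  show ?thesis
    using assms r[of c] r[of c'] s[of c c'] s[of c' c] e unfolding col_def
    by (cases "c < N"; cases "c' < N"; cases "ll \<sigma> mod 4 = 3"; cases "ll \<tau> mod 4 = 3") auto
qed

lemma above_hp: "strictly_above (hp \<sigma> z) (hp \<tau> z') \<longleftrightarrow>
    ht z N < ht z' N \<and> (even (st \<sigma> - st \<tau>) \<longrightarrow> (\<forall>c<N. z c < z' c))"
proof -
  have "strictly_above (hp \<sigma> z) (hp \<tau> z') \<longleftrightarrow> (\<forall>c\<le>N. \<forall>c'\<le>N. col \<sigma> c = col \<tau> c' \<longrightarrow> ht z c < ht z' c')"
    unfolding strictly_above_def set_hp by (auto simp: image_iff)
  also have "\<dots> \<longleftrightarrow> (\<forall>c\<le>N. even (st \<sigma> - st \<tau>) \<or> c = N \<longrightarrow> ht z c < ht z' c)"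
    using col_eq by auto
  also have "\<dots> \<longleftrightarrow> ht z N < ht z' N \<and> (even (st \<sigma> - st \<tau>) \<longrightarrow> (\<forall>c<N. ht z c < ht z' c))"
    by (auto simp: le_less)
  also have "(\<forall>c<N. ht z c < ht z' c) \<longleftrightarrow> (\<forall>c<N. z c < z' c)" by (simp add: ht_def)
  finally show ?thesis .
qed

text \<open>The converse of \<open>mid_less\<close> fails when the heights \<open>z N\<close> are
  equal. Strands of opposite parity never have equal heights, and for equal parity the comparison
  goes through the strand in between supplied by \<open>alternate\<close>.\<close>

lemma ordered_above:
  assumes y: "\<And>\<sigma>. \<sigma> \<in> J \<Longrightarrow> strand \<sigma> (y \<sigma>)"
  shows "ordered y \<longleftrightarrow> (\<forall>\<sigma>\<in>J. \<forall>\<tau>\<in>J. \<sigma> < \<tau> \<longrightarrow> strictly_above (hp \<sigma> (y \<sigma>)) (hp \<tau> (y \<tau>)))"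
proof
  assume o: "ordered y"
  show "\<forall>\<sigma>\<in>J. \<forall>\<tau>\<in>J. \<sigma> < \<tau> \<longrightarrow> strictly_above (hp \<sigma> (y \<sigma>)) (hp \<tau> (y \<tau>))"
    unfolding above_hp
  proof (intro ballI impI conjI allI)
    fix \<sigma> \<tau> assume h: "\<sigma> \<in> J" "\<tau> \<in> J" "\<sigma> < \<tau>"
    then have "y \<sigma> N < y \<tau> N" using o unfolding ordered_def by blast
    then show "ht (y \<sigma>) N < ht (y \<tau>) N" by (rule mid_less[OF y[OF h(1)] y[OF h(2)]])
    show "y \<sigma> c < y \<tau> c" if "even (st \<sigma> - st \<tau>)" "c < N" for c
      using o h that less_imp_le[OF that(2)] unfolding ordered_def by blast
  qed
next
  assume ab: "\<forall>\<sigma>\<in>J. \<forall>\<tau>\<in>J. \<sigma> < \<tau> \<longrightarrow> strictly_above (hp \<sigma> (y \<sigma>)) (hp \<tau> (y \<tau>))"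
  have diff: "y \<sigma> N < y \<tau> N" if h: "\<sigma> \<in> J" "\<tau> \<in> J" "\<sigma> < \<tau>" "odd (st \<sigma> - st \<tau>)" for \<sigma> \<tau>
  proof -
    have "ht (y \<sigma>) N < ht (y \<tau>) N" using ab h(1-3) above_hp by blast
    then have "\<not> y \<tau> N < y \<sigma> N" using mid_less[OF y[OF h(2)] y[OF h(1)]] by auto
    moreover have "even (y \<sigma> N - st \<sigma> - int N)" "even (y \<tau> N - st \<tau> - int N)"
      using parity[OF y[OF h(1)], of N] parity[OF y[OF h(2)], of N] by simp_all
    then have "y \<sigma> N \<noteq> y \<tau> N" using h(4) by presburger
    ultimately show ?thesis by simp
  qed
  show "ordered y"
    unfolding ordered_def
  proof (intro ballI impI allI)
    fix \<sigma> \<tau> c assume h: "\<sigma> \<in> J" "\<tau> \<in> J" "\<sigma> < \<tau>" "c \<le> N" "even (st \<sigma> - st \<tau>) \<or> c = N"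
    show "y \<sigma> c < y \<tau> c"
    proof (cases "c = N")
      case True
      show ?thesis
      proof (cases "even (st \<sigma> - st \<tau>)")
        case e: True
        then obtain \<upsilon> where u: "\<upsilon> \<in> J" "\<sigma> < \<upsilon>" "\<upsilon> < \<tau>" "odd (st \<sigma> - st \<upsilon>)" using alternate[OF TrueI h(1-3)] by blast
        then have "odd (st \<upsilon> - st \<tau>)" using e by presburger
        then show ?thesis using diff[OF h(1) u(1,2,4)] diff[OF u(1) h(2) u(3)] True by simp
      next
        case False
        then show ?thesis using diff[OF h(1-3)] True by simp
      qed
    next
      case False
      then show ?thesis using ab h above_hp[of \<sigma> "y \<sigma>" \<tau> "y \<tau>"] by auto
    qed
  qed
qed

lemma hp_mem:
  assumes z: "strand \<sigma> z"
  shows "hp \<sigma> z \<in> half_pathsB N \<epsilon> (ll \<sigma>)"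
proof -
  have 0: "ht z 0 = of_int (ll \<sigma>) + 2 * real N - 1" using z N2 by (simp add: ht_def ll_def strand_def)
  have 1: "ht z (Suc r) - ht z r \<in> {2, -2}" if "r + 2 \<le> N" for r
    using step[OF z, of r] that by (auto simp: ht_def)
  have "ht z (N - 1) = 2 * of_int (z (N - 1))" using N2 by (simp add: ht_def)
  then have 2: "ht z N - ht z (N - 1) \<in> {1 + \<epsilon>, - 1 - \<epsilon>}" using last_step[OF z] by auto
  show ?thesis
    unfolding half_pathsB_def using 0 1 2 N2 by (simp add: length_hp hp_nth col_def)
qed

text \<open>Up to the last step the ordinates are even integers. In the middle column they carry the
  perturbation, so the last height is read off from the direction of the last step.\<close>

lemma hp_surj:
  assumes p: "p \<in> half_pathsB N \<epsilon> (ll \<sigma>)"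
  shows "\<exists>z. strand \<sigma> z \<and> (\<forall>c>N. z c = 0) \<and> hp \<sigma> z = p"
proof -
  have p': "length p = N + 1" "fst (p ! N) = 2 * real N - 1"
    "\<And>r. r < N \<Longrightarrow> fst (p ! r) = (if ll \<sigma> mod 4 = 3 then 2 * real r else 4 * real N - 2 - 2 * real r)"
    "snd (p ! 0) = of_int (ll \<sigma>) + 2 * real N - 1"
    "\<And>r. r + 2 \<le> N \<Longrightarrow> snd (p ! Suc r) - snd (p ! r) \<in> {2, -2}"
    "snd (p ! N) - snd (p ! (N - 1)) \<in> {1 + \<epsilon>, - 1 - \<epsilon>}"
    using p unfolding half_pathsB_def by auto
  define x where "x c = \<lfloor>snd (p ! c) / 2\<rfloor>" for c
  define z where "z c = (if c < N then x c else if c = N then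
      (if snd (p ! N) > snd (p ! (N - 1)) then x (N - 1) + 1 else x (N - 1) - 1) else 0)" for c
  have zi: "2 * real_of_int (z c) = snd (p ! c)" if "c < N" for c
    using that
  proof (induction c)
    case 0
    have "snd (p ! 0) / 2 = of_int (st \<sigma>)" using p'(4) by (simp add: ll_def)
    then have "x 0 = st \<sigma>" unfolding x_def by (simp only: floor_of_int)
    then show ?case using p'(4) N2 by (simp add: z_def ll_def)
  next
    case (Suc c)
    then have "snd (p ! Suc c) / 2 = of_int (z c + 1) \<or> snd (p ! Suc c) / 2 = of_int (z c - 1)"
      using p'(5)[of c] by auto
    moreover have "z (Suc c) = \<lfloor>snd (p ! Suc c) / 2\<rfloor>" using Suc.prems by (simp add: z_def x_def)
    ultimately have "real_of_int (z (Suc c)) = snd (p ! Suc c) / 2" by (elim disjE) (simp_all only: floor_of_int)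
    then show ?case by simp
  qed
  have zN: "z N = z (N - 1) + 1 \<and> snd (p ! N) = 2 * of_int (z (N - 1)) + (1 + \<epsilon>)
      \<or> z N = z (N - 1) - 1 \<and> snd (p ! N) = 2 * of_int (z (N - 1)) - (1 + \<epsilon>)"
    using p'(6) zi[of "N - 1"] N2 eps by (auto simp: z_def)
  have s: "strand \<sigma> z"
    unfolding strand_def
  proof (intro conjI allI impI)
    have "real_of_int (z 0) = of_int (st \<sigma>)" using zi[of 0] p'(4) N2 by (simp add: ll_def)
    then show "z 0 = st \<sigma>" by linarith
    show "\<bar>z (Suc c) - z c\<bar> = 1" if c: "c < N" for c
    proof (cases "Suc c = N")
      case True
      then show ?thesis using zN by auto
    next
      case False
      then have "2 * real_of_int (z (Suc c)) - 2 * real_of_int (z c) \<in> {2, -2}"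
        using zi[of c] zi[of "Suc c"] p'(5)[of c] c by simp
      then have "real_of_int (z (Suc c) - z c) = of_int 1 \<or> real_of_int (z (Suc c) - z c) = of_int (-1)" by auto
      then show ?thesis unfolding of_int_eq_iff by auto
    qed
  qed simp
  moreover have "hp \<sigma> z = p"
  proof (rule nth_equalityI)
    show "length (hp \<sigma> z) = length p" by (simp add: length_hp p')
    fix c assume "c < length (hp \<sigma> z)"
    then have c: "c \<le> N" by (simp add: length_hp)
    have "ht z c = snd (p ! c)"
    proof (cases "c = N")
      case True
      then show ?thesis using zN last_step[OF s] by auto
    next
      case False
      then show ?thesis using zi[of c] c by (simp add: ht_def)
    qed
    moreover have "col \<sigma> c = fst (p ! c)" using c p'(2,3) by (cases "c = N") (simp_all add: col_def)
    ultimately show "hp \<sigma> z ! c = p ! c" by (simp add: hp_nth[OF c] prod_eq_iff)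
  qed
  ultimately show ?thesis by (intro exI[of _ z]) (simp add: z_def)
qed

end

section \<open>Corners of half paths and of their concatenations\<close>

lemma turnsB_rev: "turnsB N e (rev p) = turnsB N e p"
proof -
  have "turnsB N e (rev p) \<subseteq> turnsB N e p" for p
  proof
    fix x assume "x \<in> turnsB N e (rev p)"
    then obtain r where r: "x = rev p ! r" "0 < r" "Suc r < length p"
      "fst (rev p ! r) \<notin> {0, 2 * real N - 1, 4 * real N - 2}"
      "of_int (sg e) * snd (rev p ! (r - 1)) > of_int (sg e) * snd (rev p ! r)"
      "of_int (sg e) * snd (rev p ! Suc r) > of_int (sg e) * snd (rev p ! r)"
      unfolding turnsB_def by auto
    define s where "s = length p - Suc r"
    have "rev p ! r = p ! s" "rev p ! (r - 1) = p ! Suc s" "rev p ! Suc r = p ! (s - 1)" "0 < s" "Suc s < length p"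
      using r(2,3) by (simp_all add: rev_nth s_def Suc_diff_Suc)
    then show "x \<in> turnsB N e p" using r unfolding turnsB_def by auto
  qed
  from this[of p] this[of "rev p"] show ?thesis by auto
qed

text \<open>Both points at the junction lie in the middle column, which \<open>turnsB\<close>
  excludes, so joining neither creates nor destroys a turn.\<close>

lemma turnsB_append:
  assumes "xs \<noteq> []" "ys \<noteq> []" "fst (last xs) = 2 * real N - 1" "fst (hd ys) = 2 * real N - 1"
  shows "turnsB N e (xs @ ys) = turnsB N e xs \<union> turnsB N e ys"
proof (intro equalityI subsetI)
  let ?p = "xs @ ys" and ?n = "length xs"
  let ?P = "\<lambda>p r. fst (p ! r) \<notin> {0, 2 * real N - 1, 4 * real N - 2} \<and>
     of_int (sg e) * snd (p ! (r - 1)) > of_int (sg e) * snd (p ! r) \<and>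
     of_int (sg e) * snd (p ! Suc r) > of_int (sg e) * snd (p ! r)"
  have T: "x \<in> turnsB N e p \<longleftrightarrow> (\<exists>r. x = p ! r \<and> 0 < r \<and> Suc r < length p \<and> ?P p r)" for x p
    unfolding turnsB_def by blast
  fix x
  {
    assume "x \<in> turnsB N e ?p"
    then obtain r where r: "x = ?p ! r" "0 < r" "Suc r < length ?p" "?P ?p r" unfolding T by blast
    have "?p ! (?n - 1) = last xs" "?p ! ?n = hd ys" using assms(1,2) by (simp_all add: nth_append last_conv_nth hd_conv_nth)
    then have "r \<noteq> ?n - 1" "r \<noteq> ?n" using r(4) assms(3,4) by auto
    then consider "Suc r < ?n" | "?n < r" by linarith
    then show "x \<in> turnsB N e xs \<union> turnsB N e ys"
    proof cases
      case 1
      then have "?p ! r = xs ! r" "?p ! (r - 1) = xs ! (r - 1)" "?p ! Suc r = xs ! Suc r" by (simp_all add: nth_append less_imp_diff_less)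
      then have "x \<in> turnsB N e xs" unfolding T using r 1 by auto
      then show ?thesis by blast
    next
      case 2
      then obtain s where s: "r = ?n + s" "0 < s" using less_imp_add_positive by blast
      have "?p ! r = ys ! s" "?p ! (r - 1) = ys ! (s - 1)" "?p ! Suc r = ys ! Suc s"
        using s by (cases s; simp add: nth_append)+
      then have "x \<in> turnsB N e ys" unfolding T using r s by (intro exI[of _ s]) simp
      then show ?thesis by blast
    qed
  }
  assume "x \<in> turnsB N e xs \<union> turnsB N e ys"
  then show "x \<in> turnsB N e ?p"
  proof
    assume "x \<in> turnsB N e xs"
    then obtain r where r: "x = xs ! r" "0 < r" "Suc r < ?n" "?P xs r" unfolding T by blast
    then have "?p ! r = xs ! r" "?p ! (r - 1) = xs ! (r - 1)" "?p ! Suc r = xs ! Suc r" by (simp_all add: nth_append less_imp_diff_less)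
    then show ?thesis unfolding T using r by (intro exI[of _ r]) simp
  next
    assume "x \<in> turnsB N e ys"
    then obtain s where s: "x = ys ! s" "0 < s" "Suc s < length ys" "?P ys s" unfolding T by blast
    then have "?p ! (?n + s) = ys ! s" "?p ! (?n + s - 1) = ys ! (s - 1)" "?p ! Suc (?n + s) = ys ! Suc s"
      by (cases s; simp add: nth_append)+
    then show ?thesis unfolding T using s by (intro exI[of _ "?n + s"]) simp
  qed
qed

context snake_B
begin

lemma col_inner:
  assumes "0 < r" "r < N" shows "col \<sigma> r \<notin> {0, 2 * real N - 1, 4 * real N - 2}"
proof -
  have "2 * int r \<noteq> 2 * int N - 1" "4 * int N - 2 - 2 * int r \<noteq> 2 * int N - 1" by presburger+
  then have "2 * real r \<noteq> 2 * real N - 1" "4 * real N - 2 - 2 * real r \<noteq> 2 * real N - 1" by linarith+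
  then show ?thesis using assms by (auto simp: col_def)
qed

lemma turns_hp:
  assumes z: "strand \<sigma> z"
  shows "turnsB N e (hp \<sigma> z) = {(col \<sigma> r, 2 * real_of_int (z r)) | r. 0 < r \<and> r < N \<and> csgn z r = sg e}"
proof -
  have sge: "sg e = 1 \<or> sg e = -1" by (cases e) auto
  have eq: "hp \<sigma> z ! r = (col \<sigma> r, 2 * real_of_int (z r)) \<and>
      (fst (hp \<sigma> z ! r) \<notin> {0, 2 * real N - 1, 4 * real N - 2} \<and>
       of_int (sg e) * snd (hp \<sigma> z ! (r - 1)) > of_int (sg e) * snd (hp \<sigma> z ! r) \<and>
       of_int (sg e) * snd (hp \<sigma> z ! Suc r) > of_int (sg e) * snd (hp \<sigma> z ! r) \<longleftrightarrow> csgn z r = sg e)"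
    if r: "0 < r" "r < N" for r
  proof -
    have n: "hp \<sigma> z ! r = (col \<sigma> r, ht z r)" "hp \<sigma> z ! (r - 1) = (col \<sigma> (r - 1), ht z (r - 1))"
      "hp \<sigma> z ! Suc r = (col \<sigma> (Suc r), ht z (Suc r))" "ht z r = 2 * of_int (z r)"
      using r by (simp_all add: hp_nth ht_def)
    have i: "r \<in> nd" using r by (simp add: nd_eq)
    have 1: "ht z (r - 1) < ht z r \<longleftrightarrow> z (r - 1) < z r" "ht z r < ht z (r - 1) \<longleftrightarrow> z r < z (r - 1)"
      using ht_less[OF z, of "r - 1"] r by simp_all
    have up: "csgn z r = 1 \<longleftrightarrow> ht z r < ht z (r - 1) \<and> ht z r < ht z (Suc r)"
      unfolding 1 ht_less[OF z r(2)] csgn_cases(2)[OF z i r(2)] using strand_csgn(4)[OF z i r(2)] by linarith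
    have dn: "csgn z r = -1 \<longleftrightarrow> ht z (r - 1) < ht z r \<and> ht z (Suc r) < ht z r"
      unfolding 1 ht_less[OF z r(2)] csgn_cases(3)[OF z i r(2)] using strand_csgn(4)[OF z i r(2)] by linarith
    have "of_int (sg e) * ht z (r - 1) > of_int (sg e) * ht z r \<and> of_int (sg e) * ht z (Suc r) > of_int (sg e) * ht z r
      \<longleftrightarrow> csgn z r = sg e"
      using sge
    proof
      assume "sg e = 1"
      then show ?thesis using up by simp
    next
      assume "sg e = -1"
      then show ?thesis using dn by simp
    qed
    then show ?thesis unfolding n(1-3) fst_conv snd_conv using n(4) col_inner[OF r, of \<sigma>] by blast
  qed
  show ?thesis
  proof (intro equalityI subsetI)
    fix x assume "x \<in> turnsB N e (hp \<sigma> z)"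
    then obtain r where r: "0 < r" "r < N" "x = hp \<sigma> z ! r" and h: "fst (hp \<sigma> z ! r) \<notin> {0, 2 * real N - 1, 4 * real N - 2}"
       "of_int (sg e) * snd (hp \<sigma> z ! (r - 1)) > of_int (sg e) * snd (hp \<sigma> z ! r)"
       "of_int (sg e) * snd (hp \<sigma> z ! Suc r) > of_int (sg e) * snd (hp \<sigma> z ! r)"
      unfolding turnsB_def length_hp by auto
    then have "csgn z r = sg e" "x = (col \<sigma> r, 2 * real_of_int (z r))" using eq[OF r(1,2)] by blast+
    then show "x \<in> {(col \<sigma> r, 2 * real_of_int (z r)) | r. 0 < r \<and> r < N \<and> csgn z r = sg e}" using r by blast
  next
    fix x assume "x \<in> {(col \<sigma> r, 2 * real_of_int (z r)) | r. 0 < r \<and> r < N \<and> csgn z r = sg e}"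
    then obtain r where r: "0 < r" "r < N" "x = (col \<sigma> r, 2 * real_of_int (z r))" "csgn z r = sg e" by blast
    have "Suc r < N + 1" using r(2) by simp
    then show "x \<in> turnsB N e (hp \<sigma> z)" 
      unfolding turnsB_def length_hp
      by (intro CollectI exI[of _ r]) (use eq[OF r(1,2)] r in metis)
  qed
qed

text \<open>\<open>iotaB\<close> selects a column by the residue of \<open>2 * N + k - 2 * i\<close>
  modulo 4. At a point of the strand, where \<open>k = 2 * z r\<close>, parity makes this residue
  depend on \<open>ll \<sigma>\<close> alone, so the selected column is the one on the side of the
  half path.\<close>

lemma iota_turn:
  assumes z: "strand \<sigma> z"
  shows "{x \<in> index_set TypeB N. map_prod of_int of_int (iotaB N x) \<in> turnsB N e (hp \<sigma> z)} = corner_set e z {1..<N}"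
proof -
  have k: "(2 * int N + 2 * z r - 2 * int r) mod 4 = (ll \<sigma> - 1) mod 4" if "r < N" for r
  proof -
    have "even (z r - st \<sigma> - int r)" by (rule parity[OF z less_imp_le[OF that]])
    then obtain m where "z r - st \<sigma> - int r = 2 * m" by (rule evenE)
    then have "2 * int N + 2 * z r - 2 * int r = (ll \<sigma> - 1) + 4 * (m + int N)" by (simp add: ll_def)
    then show ?thesis by (simp only: mod_mult_self2)
  qed
  have l: "ll \<sigma> mod 4 = 3 \<longleftrightarrow> (ll \<sigma> - 1) mod 4 = 2" unfolding ll_def by presburger
  have iota: "iotaB N (r, 2 * z r) = ((if ll \<sigma> mod 4 = 3 then 2 * int r else 4 * int N - 2 - 2 * int r), 2 * z r)" if "r < N" for r
    using that k[OF that] l by (simp add: iotaB_def)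
  have colr: "col \<sigma> r = of_int (if ll \<sigma> mod 4 = 3 then 2 * int r else 4 * int N - 2 - 2 * int r)" if "r < N" for r
    using that by (simp add: col_def)
  have cs: "corner_set e z {1..<N} = {(r, 2 * z r) | r. 0 < r \<and> r < N \<and> csgn z r = sg e}"
    unfolding corner_set_def by (auto simp: cpos_inner)
  have mem: "map_prod real_of_int real_of_int (iotaB N x) = (col \<sigma> r, 2 * real_of_int (z r)) \<longleftrightarrow> x = (r, 2 * z r)"
    if x: "x \<in> index_set TypeB N" and r: "0 < r" "r < N" for x r
  proof
    assume "x = (r, 2 * z r)"
    then show "map_prod real_of_int real_of_int (iotaB N x) = (col \<sigma> r, 2 * real_of_int (z r))"
      using iota[OF r(2)] colr[OF r(2)] by simp
  next
    obtain i k where ik: "x = (i, k)" by (cases x)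
    assume "map_prod real_of_int real_of_int (iotaB N x) = (col \<sigma> r, 2 * real_of_int (z r))"
    then have "real_of_int (fst (iotaB N x)) = of_int (if ll \<sigma> mod 4 = 3 then 2 * int r else 4 * int N - 2 - 2 * int r)"
      and s: "real_of_int (snd (iotaB N x)) = of_int (2 * z r)"
      unfolding colr[OF r(2)] by (simp_all add: prod_eq_iff)
    then have f: "fst (iotaB N x) = (if ll \<sigma> mod 4 = 3 then 2 * int r else 4 * int N - 2 - 2 * int r)"
      unfolding of_int_eq_iff by blast
    have "k = 2 * z r" using s unfolding of_int_eq_iff ik by (simp add: iotaB_def split: if_splits)
    moreover have "i = r"
    proof (cases "i = N")
      case True
      then have "2 * int N - 1 = (if ll \<sigma> mod 4 = 3 then 2 * int r else 4 * int N - 2 - 2 * int r)"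
        using f by (simp add: ik iotaB_def)
      then show ?thesis by (cases "ll \<sigma> mod 4 = 3") (simp_all, presburger+)
    next
      case False
      then have "i < N" using x by (auto simp: ik nodes_def)
      then show ?thesis using f r False unfolding ik iotaB_def by (auto split: if_splits)
    qed
    ultimately show "x = (r, 2 * z r)" by (simp add: ik)
  qed
  have ix: "(r, 2 * z r) \<in> index_set TypeB N" if "0 < r" "r < N" for r
    using that by (simp add: nodes_def)
  show ?thesis
    unfolding turns_hp[OF z] cs
  proof (intro equalityI subsetI)
    fix x assume "x \<in> {x \<in> index_set TypeB N. map_prod real_of_int real_of_int (iotaB N x)
      \<in> {(col \<sigma> r, 2 * real_of_int (z r)) | r. 0 < r \<and> r < N \<and> csgn z r = sg e}}"
    then obtain r where "x \<in> index_set TypeB N" "0 < r" "r < N" "csgn z r = sg e"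
      "map_prod real_of_int real_of_int (iotaB N x) = (col \<sigma> r, 2 * real_of_int (z r))" by blast
    then show "x \<in> {(r, 2 * z r) | r. 0 < r \<and> r < N \<and> csgn z r = sg e}" using mem by blast
  next
    fix x assume "x \<in> {(r, 2 * z r) | r. 0 < r \<and> r < N \<and> csgn z r = sg e}"
    then obtain r where r: "0 < r" "r < N" "csgn z r = sg e" "x = (r, 2 * z r)" by blast
    then show "x \<in> {x \<in> index_set TypeB N. map_prod real_of_int real_of_int (iotaB N x)
      \<in> {(col \<sigma> r, 2 * real_of_int (z r)) | r. 0 < r \<and> r < N \<and> csgn z r = sg e}}"
      using mem[OF ix[OF r(1,2)] r(1,2)] ix[OF r(1,2)] by blast
  qed
qed

definition midset :: "pm \<Rightarrow> path \<Rightarrow> (nat \<times> int) set" where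
  "midset e p = {(i, l) \<in> index_set TypeB N. i = N \<and>
        (2 * real N - 1, of_int l - of_int (sg e) * \<epsilon>) \<in> set p \<and>
        (2 * real N - 1, of_int l + of_int (sg e) * \<epsilon>) \<notin> set p}"

text \<open>The points \<open>l - \<epsilon>\<close> and \<open>l + \<epsilon>\<close> with integral
  \<open>l\<close> are all distinct because \<open>2 * \<epsilon> < 1\<close>.\<close>

lemma mid_mem:
  assumes z: "strand \<sigma> z" and f: "f = 1 \<or> f = -1"
  shows "(2 * real N - 1, of_int l - of_int f * \<epsilon>) \<in> set (hp \<sigma> z) \<longleftrightarrow> l = cpos z N \<and> f = csgn z N"
proof -
  have "(2 * real N - 1, y) \<in> set (hp \<sigma> z) \<longleftrightarrow> y = ht z N" for y
  proof -
    have "col \<sigma> c = 2 * real N - 1 \<longleftrightarrow> c = N" if "c \<le> N" for c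
      using col_eq[OF that order.refl, of \<sigma> \<sigma>] by (simp add: col_def)
    then show ?thesis unfolding set_hp by force
  qed
  moreover have "of_int l - of_int f * \<epsilon> = of_int w - of_int g * \<epsilon> \<longleftrightarrow> l = w \<and> f = g" if g: "g = 1 \<or> g = -1" for w g :: int
  proof
    assume h: "of_int l - of_int f * \<epsilon> = of_int w - of_int g * \<epsilon>"
    show "l = w \<and> f = g"
    proof (cases "f = g")
      case True
      then show ?thesis using h by simp
    next
      case False
      then have "real_of_int (l - w) = 2 * \<epsilon> \<or> real_of_int (w - l) = 2 * \<epsilon>" using f g h by auto
      then have "of_int 0 < real_of_int (l - w) \<and> real_of_int (l - w) < of_int 1
          \<or> of_int 0 < real_of_int (w - l) \<and> real_of_int (w - l) < of_int 1" using eps by auto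
      then show ?thesis unfolding of_int_less_iff by linarith
    qed
  qed auto
  moreover have "csgn z N = 1 \<or> csgn z N = -1" using last_step[OF z] by auto
  ultimately show ?thesis by (simp add: ht_def)
qed

lemma cpos_odd: "strand \<sigma> z \<Longrightarrow> (N, cpos z N) \<in> index_set TypeB N"
  using last_step[of \<sigma> z] by (auto simp: cpos_last)

lemma path_monomial_split:
  assumes "finite (A Plus)" "finite (A Minus)" "finite (midset Plus p)" "finite (midset Minus p)"
    and "\<And>e. {x \<in> index_set TypeB N. map_prod of_int of_int (iotaB N x) \<in> turnsB N e p} = A e"
    and "\<And>e x. x \<in> A e \<Longrightarrow> fst x \<noteq> N"
  shows "path_monomial TypeB N \<epsilon> q a p = ((\<Sum>x\<in>A Plus. Yvar q a x) - (\<Sum>x\<in>A Minus. Yvar q a x))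
    + ((\<Sum>x\<in>midset Plus p. Yvar q a x) - (\<Sum>x\<in>midset Minus p. Yvar q a x))"
proof -
  have "corners TypeB N \<epsilon> e p = A e \<union> midset e p" for e
    unfolding corners.simps cornersB_def assms(5) midset_def ..
  moreover have "A e \<inter> midset e p = {}" for e using assms(6)[of _ e] unfolding midset_def by force
  ultimately show ?thesis unfolding path_monomial_def using assms(1-4) by (simp add: sum.union_disjoint)
qed

lemma fin_corner_set: "finite A \<Longrightarrow> finite (corner_set e z A)"
  by (simp add: corner_set_def)

lemma tm_split:
  assumes "strand \<sigma> z"
  shows "tm z = ((\<Sum>x\<in>corner_set Plus z {1..<N}. Yvar q a x) - (\<Sum>x\<in>corner_set Minus z {1..<N}. Yvar q a x))
    + ((\<Sum>x\<in>corner_set Plus z {N}. Yvar q a x) - (\<Sum>x\<in>corner_set Minus z {N}. Yvar q a x))"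
proof -
  have "nd = {1..<N} \<union> {N}" using N2 by (auto simp: nd_eq)
  then have "tm z = (\<Sum>i\<in>{1..<N}. Poly_Mapping.single (i, lev (cpos z i)) (csgn z i))
      + (\<Sum>i\<in>{N}. Poly_Mapping.single (i, lev (cpos z i)) (csgn z i))"
    unfolding tm_def by (simp add: sum.union_disjoint)
  moreover have "{1..<N} \<subseteq> nd" "{N} \<subseteq> nd" using N2 by (auto simp: nd_eq)
  ultimately show ?thesis using sum_corner_set[OF assms] by (simp only:)
qed

lemma corner_set_last: "corner_set e z {N} = (if csgn z N = sg e then {(N, cpos z N)} else {})"
  by (auto simp: corner_set_def)

lemma corner_set_inner: "x \<in> corner_set e z {1..<N} \<Longrightarrow> fst x \<noteq> N"
  by (auto simp: corner_set_def)

lemma monomial_single: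
  assumes z: "strand \<sigma> z"
  shows "path_monomial TypeB N \<epsilon> q a (hp \<sigma> z) = tm z"
proof -
  have mid: "midset e (hp \<sigma> z) = corner_set e z {N}" for e
  proof -
    have sge: "sg e = 1 \<or> sg e = -1" "- sg e = 1 \<or> - sg e = -1" by (cases e; simp)+
    show ?thesis
      unfolding midset_def corner_set_last using mid_mem[OF z sge(1)] mid_mem[OF z sge(2)] cpos_odd[OF z] sge
      by (auto simp del: index_set.simps)
  qed
  have "path_monomial TypeB N \<epsilon> q a (hp \<sigma> z) =
      ((\<Sum>x\<in>corner_set Plus z {1..<N}. Yvar q a x) - (\<Sum>x\<in>corner_set Minus z {1..<N}. Yvar q a x))
      + ((\<Sum>x\<in>midset Plus (hp \<sigma> z). Yvar q a x) - (\<Sum>x\<in>midset Minus (hp \<sigma> z). Yvar q a x))"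
    by (rule path_monomial_split[OF _ _ _ _ iota_turn[OF z] corner_set_inner]) (simp_all add: mid fin_corner_set)
  then show ?thesis unfolding mid tm_split[OF z] .
qed

text \<open>Corners of the two halves in inner columns differ by the parity of their heights. In the
  middle column an upper corner of one half and a lower corner of the other may have the same level;
  the path then contains both perturbed points and \<open>cornersB\<close> counts neither, which
  matches the cancellation in \<open>tm z + tm z'\<close>.\<close>

lemma monomial_double:
  assumes z: "strand \<sigma> z" "strand \<tau> z'" and odd: "odd (st \<sigma> - st \<tau>)"
  shows "path_monomial TypeB N \<epsilon> q a (hp \<tau> z' @ rev (hp \<sigma> z)) = tm z + tm z'"
proof -
  let ?p = "hp \<tau> z' @ rev (hp \<sigma> z)"
  have ne: "hp \<sigma> z \<noteq> []" for \<sigma> z using length_hp[of \<sigma> z] by auto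
  have "fst (last (hp \<sigma> z)) = 2 * real N - 1" for \<sigma> z
    using last_conv_nth[OF ne, of \<sigma> z] by (simp add: length_hp hp_nth col_def)
  then have t: "turnsB N e ?p = turnsB N e (hp \<sigma> z) \<union> turnsB N e (hp \<tau> z')" for e
    using turnsB_append[of "hp \<tau> z'" "rev (hp \<sigma> z)"] ne by (simp add: turnsB_rev hd_rev Un_commute)
  have neq: "z c \<noteq> z' c" if "c \<le> N" for c
    using parity[OF z(1) that] parity[OF z(2) that] odd by presburger
  have dA: "corner_set e z {1..<N} \<inter> corner_set f z' {1..<N} = {}" for e f
    using neq by (auto simp: corner_set_def cpos_inner)
  have A: "{x \<in> index_set TypeB N. map_prod of_int of_int (iotaB N x) \<in> turnsB N e ?p}
      = corner_set e z {1..<N} \<union> corner_set e z' {1..<N}" for e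
    unfolding iota_turn[OF z(1), symmetric] iota_turn[OF z(2), symmetric] t by blast
  have c1: "csgn z N = 1 \<or> csgn z N = -1" "csgn z' N = 1 \<or> csgn z' N = -1" using last_step z by blast+
  have c2: "csgn z N \<noteq> csgn z' N" if "cpos z N = cpos z' N"
    using that neq[of N] by (auto simp: cpos_last csgn_last)
  have mid: "midset e ?p = {x. (x = (N, cpos z N) \<and> csgn z N = sg e \<or> x = (N, cpos z' N) \<and> csgn z' N = sg e)
      \<and> \<not> (x = (N, cpos z N) \<and> csgn z N = - sg e \<or> x = (N, cpos z' N) \<and> csgn z' N = - sg e)}" for e
  proof -
    have sge: "sg e = 1 \<or> sg e = -1" "- sg e = 1 \<or> - sg e = -1" by (cases e; simp)+
    have m: "(2 * real N - 1, of_int l - of_int f * \<epsilon>) \<in> set ?p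
        \<longleftrightarrow> l = cpos z N \<and> csgn z N = f \<or> l = cpos z' N \<and> csgn z' N = f" if "f = 1 \<or> f = -1" for f l
      using mid_mem[OF z(1) that] mid_mem[OF z(2) that] by auto
    have m2: "(2 * real N - 1, of_int l + of_int (sg e) * \<epsilon>) \<in> set ?p
        \<longleftrightarrow> l = cpos z N \<and> csgn z N = - sg e \<or> l = cpos z' N \<and> csgn z' N = - sg e" for l
      using m[OF sge(2), of l] by simp
    have mm: "(i, l) \<in> midset e ?p \<longleftrightarrow> (i, l) \<in> index_set TypeB N \<and> i = N
        \<and> (l = cpos z N \<and> csgn z N = sg e \<or> l = cpos z' N \<and> csgn z' N = sg e)
        \<and> \<not> (l = cpos z N \<and> csgn z N = - sg e \<or> l = cpos z' N \<and> csgn z' N = - sg e)" for i l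
      unfolding midset_def m[OF sge(1)] m2 by (simp del: index_set.simps)
    show ?thesis
    proof (rule Set.set_eqI)
      fix x :: "nat \<times> int"
      obtain i l where x: "x = (i, l)" by (cases x)
      show "x \<in> midset e ?p \<longleftrightarrow> x \<in> {x. (x = (N, cpos z N) \<and> csgn z N = sg e \<or> x = (N, cpos z' N) \<and> csgn z' N = sg e)
          \<and> \<not> (x = (N, cpos z N) \<and> csgn z N = - sg e \<or> x = (N, cpos z' N) \<and> csgn z' N = - sg e)}"
        unfolding x mm mem_Collect_eq prod.inject using cpos_odd[OF z(1)] cpos_odd[OF z(2)] by blast
    qed
  qed
  have "(\<Sum>x\<in>midset Plus ?p. Yvar q a x) - (\<Sum>x\<in>midset Minus ?p. Yvar q a x)
      = ((\<Sum>x\<in>corner_set Plus z {N}. Yvar q a x) - (\<Sum>x\<in>corner_set Minus z {N}. Yvar q a x))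
        + ((\<Sum>x\<in>corner_set Plus z' {N}. Yvar q a x) - (\<Sum>x\<in>corner_set Minus z' {N}. Yvar q a x))"
  proof (cases "cpos z N = cpos z' N")
    case True
    have "midset e ?p = {}" for e
      unfolding mid using True c2[OF True] c1 by (cases e) auto
    then show ?thesis using True c2[OF True] c1 by (auto simp: corner_set_last)
  next
    case False
    have "midset e ?p = corner_set e z {N} \<union> corner_set e z' {N}" for e
      unfolding mid corner_set_last using False c1 by (cases e) auto
    moreover have "corner_set e z {N} \<inter> corner_set e z' {N} = {}" for e
      using False by (simp add: corner_set_last)
    ultimately show ?thesis by (simp add: sum.union_disjoint fin_corner_set)
  qed
  moreover have "finite (midset e ?p)" for e
  proof -
    have "midset e ?p \<subseteq> {(N, cpos z N), (N, cpos z' N)}" unfolding mid by blast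
    then show ?thesis using finite_subset by blast
  qed
  moreover have "(\<Sum>x\<in>corner_set e z {1..<N} \<union> corner_set e z' {1..<N}. Yvar q a x)
      = (\<Sum>x\<in>corner_set e z {1..<N}. Yvar q a x) + (\<Sum>x\<in>corner_set e z' {1..<N}. Yvar q a x)" for e
    by (rule sum.union_disjoint[OF fin_corner_set fin_corner_set dA]) simp_all
  moreover have "fst x \<noteq> N" if "x \<in> corner_set e z {1..<N} \<union> corner_set e z' {1..<N}" for x e
    using that corner_set_inner by blast
  ultimately show ?thesis
    by (subst path_monomial_split[OF _ _ _ _ A]) (simp_all add: tm_split[OF z(1)] tm_split[OF z(2)] fin_corner_set)
qed

section \<open>Tuples of paths and states\<close>

definition path_B :: "(nat \<Rightarrow> nat \<Rightarrow> int) \<Rightarrow> nat \<Rightarrow> path" where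
  "path_B y t = (if node t = N then hp (2 * t) (y (2 * t))
     else hp (2 * t + 1) (y (2 * t + 1)) @ rev (hp (2 * t) (y (2 * t))))"

lemma set_path_B: "t < len \<Longrightarrow> set (path_B y t) = (\<Union>\<sigma>\<in>{\<sigma>\<in>J. \<sigma> div 2 = t}. set (hp \<sigma> (y \<sigma>)))"
proof -
  assume t: "t < len"
  have "{\<sigma>\<in>J. \<sigma> div 2 = t} = (if node t = N then {2 * t} else {2 * t, 2 * t + 1})"
    using t by (auto simp: J_def elim!: oddE; arith)
  then show ?thesis by (simp add: path_B_def Un_commute)
qed

lemma above_path_B:
  assumes "t < len" "u < len"
  shows "strictly_above (path_B y t) (path_B y u) \<longleftrightarrow>
    (\<forall>\<sigma>\<in>J. \<forall>\<tau>\<in>J. \<sigma> div 2 = t \<longrightarrow> \<tau> div 2 = u \<longrightarrow> strictly_above (hp \<sigma> (y \<sigma>)) (hp \<tau> (y \<tau>)))"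
  unfolding strictly_above_def set_path_B[OF assms(1)] set_path_B[OF assms(2)] by blast

text \<open>Strands of different entries are ordered because their paths do not overlap. For the two
  halves of one path the order is the condition in \<open>pathsB\<close> on their ends; having
  opposite parity, they share only the middle column.\<close>

lemma ordered_paths:
  assumes y: "\<And>\<sigma>. \<sigma> \<in> J \<Longrightarrow> strand \<sigma> (y \<sigma>)"
  shows "ordered y \<longleftrightarrow> (\<forall>t<len. \<forall>u<t. strictly_above (path_B y u) (path_B y t))
    \<and> (\<forall>t<len. node t \<noteq> N \<longrightarrow> ht (y (2 * t)) N < ht (y (2 * t + 1)) N)"
proof -
  have twin: "strictly_above (hp (2 * t) (y (2 * t))) (hp (2 * t + 1) (y (2 * t + 1))) \<longleftrightarrow> ht (y (2 * t)) N < ht (y (2 * t + 1)) N"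
    if "t < len" "node t \<noteq> N" for t
    using twin_type[OF that] above_hp by blast
  have oa: "ordered y \<longleftrightarrow> (\<forall>\<sigma>\<in>J. \<forall>\<tau>\<in>J. \<sigma> < \<tau> \<longrightarrow> strictly_above (hp \<sigma> (y \<sigma>)) (hp \<tau> (y \<tau>)))"
    by (rule ordered_above) (rule y)
  show ?thesis
    unfolding oa
  proof (rule iffI)
    assume h: "\<forall>\<sigma>\<in>J. \<forall>\<tau>\<in>J. \<sigma> < \<tau> \<longrightarrow> strictly_above (hp \<sigma> (y \<sigma>)) (hp \<tau> (y \<tau>))"
    have "strictly_above (path_B y u) (path_B y t)" if tu: "t < len" "u < t" for t u
    proof -
      have u: "u < len" using tu by simp
      have "\<sigma> < \<tau>" if "\<sigma> div 2 = u" "\<tau> div 2 = t" for \<sigma> \<tau> using that tu(2) by presburger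
      then show ?thesis unfolding above_path_B[OF u tu(1)] using h by blast
    qed
    moreover have "ht (y (2 * t)) N < ht (y (2 * t + 1)) N" if t: "t < len" "node t \<noteq> N" for t
      using h J_even[OF t(1)] J_odd[OF t] unfolding twin[OF t, symmetric] by simp
    ultimately show "(\<forall>t<len. \<forall>u<t. strictly_above (path_B y u) (path_B y t))
      \<and> (\<forall>t<len. node t \<noteq> N \<longrightarrow> ht (y (2 * t)) N < ht (y (2 * t + 1)) N)" by blast
  next
    assume h: "(\<forall>t<len. \<forall>u<t. strictly_above (path_B y u) (path_B y t))
      \<and> (\<forall>t<len. node t \<noteq> N \<longrightarrow> ht (y (2 * t)) N < ht (y (2 * t + 1)) N)"
    have "strictly_above (hp \<sigma> (y \<sigma>)) (hp \<tau> (y \<tau>))" if s: "\<sigma> \<in> J" "\<tau> \<in> J" "\<sigma> < \<tau>" for \<sigma> \<tau>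
    proof -
    have l: "\<sigma> div 2 < len" "\<tau> div 2 < len" using s by (auto simp: J_def)
    show ?thesis
    proof (cases "\<sigma> div 2 = \<tau> div 2")
      case True
      define t where "t = \<sigma> div 2"
      have e: "\<sigma> = 2 * t" "\<tau> = 2 * t + 1" using s(3) True unfolding t_def by presburger+
      have t: "t < len" using l(1) by (simp add: t_def)
      have n: "node t \<noteq> N" using s(2) unfolding e J_def by simp
      show ?thesis unfolding e twin[OF t n] using h t n by blast
    next
      case False
      then have "\<sigma> div 2 < \<tau> div 2" using s(3) by presburger
      then show ?thesis using h l s(1,2) above_path_B[OF l] by blast
    qed
    qed
    then show "\<forall>\<sigma>\<in>J. \<forall>\<tau>\<in>J. \<sigma> < \<tau> \<longrightarrow> strictly_above (hp \<sigma> (y \<sigma>)) (hp \<tau> (y \<tau>))" by blast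
  qed
qed

lemma path_B_mem:
  assumes t: "t < len" and y: "\<And>\<sigma>. \<sigma> \<in> J \<Longrightarrow> strand \<sigma> (y \<sigma>)"
    and o: "node t \<noteq> N \<Longrightarrow> ht (y (2 * t)) N < ht (y (2 * t + 1)) N"
  shows "path_B y t \<in> pathsB N \<epsilon> (zs ! t)"
proof (cases "node t = N")
  case True
  then show ?thesis using hp_mem[OF y[OF J_even[OF t]]] ll_eq(1)[OF t True]
    by (cases "zs ! t") (simp add: path_B_def pathsB_def)
next
  case False
  have "hp (2 * t) (y (2 * t)) \<in> half_pathsB N \<epsilon> (pos t + (2 * int N - 2 * int (node t) - 1))"
    using hp_mem[OF y[OF J_even[OF t]]] unfolding ll_eq(2)[OF t False] .
  moreover have "hp (2 * t + 1) (y (2 * t + 1)) \<in> half_pathsB N \<epsilon> (pos t - (2 * int N - 2 * int (node t) - 1))"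
    using hp_mem[OF y[OF J_odd[OF t False]]] unfolding ll_eq(3)[OF t False] .
  moreover have "fst (hp (2 * t + 1) (y (2 * t + 1)) ! N) = fst (hp (2 * t) (y (2 * t)) ! N)"
    "snd (hp (2 * t + 1) (y (2 * t + 1)) ! N) - snd (hp (2 * t) (y (2 * t)) ! N) > 0"
    using o[OF False] by (simp_all add: hp_nth col_def)
  ultimately show ?thesis using False unfolding pathsB_def path_B_def by (cases "zs ! t") auto
qed

lemma path_B_surj:
  assumes t: "t < len" and p: "p \<in> pathsB N \<epsilon> (zs ! t)"
  shows "\<exists>z z'. (\<forall>c>N. z c = 0 \<and> z' c = 0) \<and> strand (2 * t) z \<and> (node t \<noteq> N \<longrightarrow> strand (2 * t + 1) z' \<and> ht z N < ht z' N)
    \<and> p = (if node t = N then hp (2 * t) z else hp (2 * t + 1) z' @ rev (hp (2 * t) z))"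
proof (cases "node t = N")
  case True
  then have "p \<in> half_pathsB N \<epsilon> (ll (2 * t))" using p ll_eq(1)[OF t True] by (cases "zs ! t") (simp add: pathsB_def)
  from hp_surj[OF this] obtain z where z: "strand (2 * t) z" "\<forall>c>N. z c = 0" "hp (2 * t) z = p" by blast
  show ?thesis by (rule exI[of _ z], rule exI[of _ "\<lambda>_. 0"]) (use z True in simp)
next
  case False
  then obtain u v where uv: "p = u @ rev v" "u \<in> half_pathsB N \<epsilon> (ll (2 * t + 1))" "v \<in> half_pathsB N \<epsilon> (ll (2 * t))"
    "snd (u ! N) - snd (v ! N) > 0"
    using p unfolding ll_eq(2)[OF t False] ll_eq(3)[OF t False] by (cases "zs ! t") (auto simp: pathsB_def)
  from hp_surj[OF uv(3)] obtain z where z: "strand (2 * t) z" "\<forall>c>N. z c = 0" "hp (2 * t) z = v" by blast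
  from hp_surj[OF uv(2)] obtain z' where z': "strand (2 * t + 1) z'" "\<forall>c>N. z' c = 0" "hp (2 * t + 1) z' = u" by blast
  have "ht z N < ht z' N" using uv(4) unfolding z(3)[symmetric] z'(3)[symmetric] by (simp add: hp_nth)
  then show ?thesis using z z' uv(1) False by (intro exI[of _ z] exI[of _ z']) simp
qed

lemma hp_inj:
  assumes "strand \<sigma> z" "strand \<sigma> z'" "hp \<sigma> z = hp \<sigma> z'" "c \<le> N"
  shows "z c = z' c"
proof -
  have ht: "ht z c = ht z' c" if "c \<le> N" for c using assms(3) hp_nth[OF that, of \<sigma>] by (metis prod.inject)
  have lt: "z c = z' c" if "c < N" for c using ht[of c] that by (simp add: ht_def)
  have "z N = z' N" using ht[of N] lt[of "N - 1"] N2 last_step[OF assms(1)] last_step[OF assms(2)] eps by auto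
  then show ?thesis using lt[of c] assms(4) by (cases "c = N") auto
qed

theorem character_B:
  assumes hw: "highest_lweight TypeB N q act (gamma TypeB N q (\<Sum>z\<leftarrow>zs. Yvar q a z))"
  shows "qchar TypeB N q act =
      (\<Sum>ps \<in> nonoverlapping_paths TypeB N \<epsilon> zs. \<Prod>p\<leftarrow>ps. ymono (path_monomial TypeB N \<epsilon> q a p))
    \<and> thin TypeB N q act \<and> special TypeB N q act \<and> antispecial TypeB N q act"
proof (rule path_character[OF top_valid top_mon hw, of "\<lambda>y. map (path_B y) [0..<len]"])
  fix y assume y: "valid y"
  have ys: "strand \<sigma> (y \<sigma>)" if "\<sigma> \<in> J" for \<sigma> using strandD[OF y that] .
  have "ordered y" using y by (simp add: valid_def)
  moreover have "ordered y \<longleftrightarrow> (\<forall>t<len. \<forall>u<t. strictly_above (path_B y u) (path_B y t))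
      \<and> (\<forall>t<len. node t \<noteq> N \<longrightarrow> ht (y (2 * t)) N < ht (y (2 * t + 1)) N)"
    by (rule ordered_paths) (rule ys)
  ultimately have o: "\<And>t u. t < len \<Longrightarrow> u < t \<Longrightarrow> strictly_above (path_B y u) (path_B y t)"
    "\<And>t. t < len \<Longrightarrow> node t \<noteq> N \<Longrightarrow> ht (y (2 * t)) N < ht (y (2 * t + 1)) N" by blast+
  show "map (path_B y) [0..<len] \<in> nonoverlapping_paths TypeB N \<epsilon> zs"
    unfolding nonoverlapping_paths_def using o(1) path_B_mem[OF _ ys o(2)] by simp
  have "path_monomial TypeB N \<epsilon> q a (path_B y t) = tm (y (2 * t)) + (if node t = N then 0 else tm (y (2 * t + 1)))"
    if t: "t < len" for t
  proof (cases "node t = N")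
    case True
    then show ?thesis using monomial_single[OF ys[OF J_even[OF t]]] by (simp add: path_B_def)
  next
    case False
    then show ?thesis
      using monomial_double[OF ys[OF J_even[OF t]] ys[OF J_odd[OF t False]] twin_type[OF t False]] by (simp add: path_B_def)
  qed
  then show "(\<Sum>p\<leftarrow>map (path_B y) [0..<len]. path_monomial TypeB N \<epsilon> q a p) = mon y"
    unfolding mon_sum_J by (simp add: sum_list_sum_nth atLeast0LessThan)
next
  fix y y' assume y: "valid y" "valid y'" and eq: "map (path_B y) [0..<len] = map (path_B y') [0..<len]"
  have p: "path_B y t = path_B y' t" if "t < len" for t using arg_cong[OF eq, of "\<lambda>ps. ps ! t"] that by simp
  have "hp \<sigma> (y \<sigma>) = hp \<sigma> (y' \<sigma>)" if \<sigma>: "\<sigma> \<in> J" for \<sigma>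
  proof -
    define t where "t = \<sigma> div 2"
    have t: "t < len" using \<sigma> by (simp add: J_def t_def)
    have "\<sigma> = 2 * t \<or> \<sigma> = 2 * t + 1 \<and> node t \<noteq> N" using \<sigma> by (auto simp: J_def t_def)
    then show ?thesis using p[OF t] unfolding path_B_def by (auto simp: length_hp split: if_splits)
  qed
  then have in_J: "y \<sigma> c = y' \<sigma> c" if "\<sigma> \<in> J" "c \<le> N" for \<sigma> c
    using hp_inj[OF strandD[OF y(1)] strandD[OF y(2)]] that by blast
  show "y = y'"
  proof (intro ext)
    fix \<sigma> c show "y \<sigma> c = y' \<sigma> c"
      using in_J[of \<sigma> c] valid_outside[OF y(1), of \<sigma> c] valid_outside[OF y(2), of \<sigma> c]
      by (cases "\<sigma> \<in> J \<and> c \<le> N") auto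
  qed
next
  fix ps assume "ps \<in> nonoverlapping_paths TypeB N \<epsilon> zs"
  then have ps: "length ps = len" "\<And>t. t < len \<Longrightarrow> ps ! t \<in> pathsB N \<epsilon> (zs ! t)"
    "\<And>t u. t < len \<Longrightarrow> u < t \<Longrightarrow> strictly_above (ps ! u) (ps ! t)"
    unfolding nonoverlapping_paths_def by auto
  let ?Q = "\<lambda>t z z'. (\<forall>c>N. z c = 0 \<and> z' c = 0) \<and> strand (2 * t) z \<and> (node t \<noteq> N \<longrightarrow> strand (2 * t + 1) z' \<and> ht z N < ht z' N)
    \<and> ps ! t = (if node t = N then hp (2 * t) z else hp (2 * t + 1) z' @ rev (hp (2 * t) z))"
  have "\<forall>t. \<exists>w. t < len \<longrightarrow> ?Q t (fst w) (snd w)"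
  proof
    fix t
    show "\<exists>w. t < len \<longrightarrow> ?Q t (fst w) (snd w)"
    proof (cases "t < len")
      case True
      from path_B_surj[OF True ps(2)[OF True]] obtain z z' where "?Q t z z'" by blast
      then have "?Q t (fst (z, z')) (snd (z, z'))" unfolding fst_conv snd_conv .
      then show ?thesis by blast
    qed simp
  qed
  from choice[OF this] obtain w where w: "\<And>t. t < len \<Longrightarrow> ?Q t (fst (w t)) (snd (w t))" by blast
  define y where "y \<sigma> = (if \<sigma> \<in> J then if even \<sigma> then fst (w (\<sigma> div 2)) else snd (w (\<sigma> div 2)) else (\<lambda>_. 0))" for \<sigma>
  have ye: "y (2 * t) = fst (w t)" if "t < len" for t using J_even[OF that] by (simp add: y_def)
  have yo: "y (2 * t + 1) = snd (w t)" if "t < len" "node t \<noteq> N" for t using J_odd[OF that] by (simp add: y_def)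
  have ys: "strand \<sigma> (y \<sigma>)" if "\<sigma> \<in> J" for \<sigma>
    using that
  proof (cases rule: J_cases)
    case (1 t)
    then show ?thesis using w[of t] ye[of t] by simp
  next
    case (2 t)
    then show ?thesis using w[of t] yo[of t] by simp
  qed
  have pt: "path_B y t = ps ! t" if t: "t < len" for t
    unfolding path_B_def ye[OF t] using yo[OF t] w[OF t] by simp
  have "ordered y"
  proof (rule ordered_paths[THEN iffD2, OF ys], assumption, intro conjI allI impI)
    show "strictly_above (path_B y u) (path_B y t)" if "t < len" "u < t" for t u
      using ps(3)[OF that] that by (simp add: pt)
    show "ht (y (2 * t)) N < ht (y (2 * t + 1)) N" if "t < len" "node t \<noteq> N" for t
      unfolding ye[OF that(1)] yo[OF that] using w[OF that(1)] that(2) by blast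
  qed
  moreover have "y \<sigma> c = 0" if "\<sigma> \<notin> J \<or> c > N" for \<sigma> c
    using that w[of "\<sigma> div 2"] by (auto simp: y_def J_def)
  ultimately have "valid y" unfolding valid_def using ys by blast
  moreover have "map (path_B y) [0..<len] = ps"
    by (rule nth_equalityI) (simp_all add: ps(1) pt)
  ultimately show "\<exists>y. valid y \<and> map (path_B y) [0..<len] = ps" by blast
qed

end

theorem theorem6p1:
  fixes ty :: cartan_type and N :: nat and q a :: complex and \<epsilon> :: real
    and s :: "(nat \<times> int) list" and act :: "'v::ab_group_add uq_action"
  assumes "valid_rank ty N"
    and "q \<noteq> 0" and "\<And>n::nat. n > 0 \<Longrightarrow> q ^ n \<noteq> 1"
    and "a \<noteq> 0"
    and "0 < \<epsilon>" and "\<epsilon> < 1 / 2"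
    and "snake ty N s" and "length s \<ge> 1"
    and "is_L ty N q (\<Sum>z\<leftarrow>s. Yvar q a z) act"
  shows "qchar ty N q act =
           (\<Sum>ps \<in> nonoverlapping_paths ty N \<epsilon> s. \<Prod>p\<leftarrow>ps. ymono (path_monomial ty N \<epsilon> q a p))
         \<and> thin ty N q act \<and> special ty N q act \<and> antispecial ty N q act"
proof -
  have um: "uq_mod ty N q act"
    using assms(1-3,9) unfolding is_L_def uq_module_def type1_def by unfold_locales blast+
  have hw: "highest_lweight ty N q act (gamma ty N q (\<Sum>z\<leftarrow>s. Yvar q a z))"
    using assms(9) unfolding is_L_def by blast
  show ?thesis
  proof (cases ty)
    case TypeA
    show ?thesis
      using character_A[OF um[unfolded TypeA] assms(4) assms(7)[unfolded TypeA] hw[unfolded TypeA]] unfolding TypeA .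
  next
    case TypeB
    interpret snake_B N q act s \<epsilon> a
      using um assms(4-7) unfolding TypeB snake_B_def snake_B_axioms_def by blast
    show ?thesis using character_B[OF hw[unfolded TypeB]] unfolding TypeB .
  qed
qed

end
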